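(* Let $\Omega$, $p_i$, $q_i$, $f_i$ ($i=1,2$) and $X$ be as in the context. Assume the following two conditions. (i) There exist $r_i,s_i\in\,]1,p_i^*[$, $D_i>0$ and $\sigma_i\in L^{s_i'}(\Omega)$, $i=1,2$, such that $$|f_1(x,s,t,\xi,\nu)|\le D_1\left[|s|^{\frac{p_1^*}{r_1'}}+|t|^{\frac{p_2^*}{r_1'}}+|\xi|^{\frac{p_1}{r_1'}}+|\nu|^{\frac{p_2}{r_1'}}\right]+\sigma_1(x),$$ $$|f_2(x,s,t,\xi,\nu)|\le D_2\left[|s|^{\frac{p_1^*}{r_2'}}+|t|^{\frac{p_2^*}{r_2'}}+|\xi|^{\frac{p_1}{r_2'}}+|\nu|^{\frac{p_2}{r_2'}}\right]+\sigma_2(x)$$ for a.e. $x\in\Omega$ and all $s,t\in\mathbb{R}$, $\xi,\nu\in\mathbb{R}^N$. (ii) There are constants $c_i,d_i>0$, $i=1,2$, with $$c_1+c_2+(d_1+d_2)\frac{1}{\min\{\lambda_{1,p_1},\lambda_{1,p_2}\}}<1,$$ and functions $\gamma_i\in L^1(\Omega)$, $i=1,2$, satisfying $$f_1(x,s,t,\xi,\nu)\,s\le c_1\left(|\xi|^{p_1}+|\nu|^{p_2}\right)+d_1\left(|s|^{p_1}+|t|^{p_2}\right)+\gamma_1(x),$$ $$f_2(x,s,t,\xi,\nu)\,t\le c_2\left(|\xi|^{p_1}+|\nu|^{p_2}\right)+d_2\left(|s|^{p_1}+|t|^{p_2}\right)+\gamma_2(x)$$ for a.e. $x\in\Omega$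 and all $s,t\in\mathbb{R}$, $\xi,\nu\in\mathbb{R}^N$. Let $(\mu_1,\mu_2)\in\mathbb{R}^2$. Then the Dirichlet system $$-\Delta_{p_1}u+\mu_1\Delta_{q_1}u=f_1(x,u,v,\nabla u,\nabla v)\ \text{in }\Omega,\qquad -\Delta_{p_2}v+\mu_2\Delta_{q_2}v=f_2(x,u,v,\nabla u,\nabla v)\ \text{in }\Omega,\qquad u=v=0\ \text{on }\partial\Omega$$ admits a strong generalized solution $(u,v)\in X$. Moreover, $(u,v)$ is a weak solution if $\max\{\mu_1,\mu_2\}<0$.
   Context: Standing assumptions: $\Omega\subseteq\mathbb{R}^N$, $N\ge 2$, is a bounded domain with Lipschitz boundary; $1<q_i<p_i<N$ for $i=1,2$; $f_i:\Omega\times\mathbb{R}^2\times\mathbb{R}^{2N}\to\mathbb{R}$, $i=1,2$, written $f_i(x,s,t,\xi,\nu)$ with $s,t\in\mathbb{R}$, $\xi,\nu\in\mathbb{R}^N$, are Carathéodory functions (measurable in $x$, continuous in $(s,t,\xi,\nu)$ for a.e. $x$). Notation: for $1<r<\infty$, $r':=r/(r-1)$, and for $r<N$, $r^*:=Nr/(N-r)$. $\Delta_r u:=\mathrm{div}(|\nabla u|^{r-2}\nabla u)$. $W^{1,r}_0(\Omega)$ has norm $\|u\|_{1,r}:=\|\nabla u\|_{L^r(\Omega)}$. $\lambda_{1,r}:=\inf_{u\in W_0^{1,r}(\Omega)\setminus\{0\}}\|u\|_{1,r}^r/\|u\|_{L^r(\Omega)}^r>0$ is the first eigenvalue of $-\Delta_r$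 in $W^{1,r}_0(\Omega)$. $X:=W^{1,p_1}_0(\Omega)\times W^{1,p_2}_0(\Omega)$ with norm $\|(u,v)\|:=\|u\|_{1,p_1}+\|v\|_{1,p_2}$, and $X^*$ is its dual. Define $A_{\mu_1,\mu_2}:X\to X^*$ by $$\langle A_{\mu_1,\mu_2}(u,v),(\varphi,\psi)\rangle=\int_\Omega\big(|\nabla u|^{p_1-2}\nabla u-\mu_1|\nabla u|^{q_1-2}\nabla u\big)\cdot\nabla\varphi\,dx+\int_\Omega\big(|\nabla v|^{p_2-2}\nabla v-\mu_2|\nabla v|^{q_2-2}\nabla v\big)\cdot\nabla\psi\,dx$$ and $\mathcal{A}_{\mu_1,\mu_2}:X\to X^*$ by $$\langle\mathcal{A}_{\mu_1,\mu_2}(u,v),(\varphi,\psi)\rangle=\langle A_{\mu_1,\mu_2}(u,v),(\varphi,\psi)\rangle-\int_\Omega f_1(x,u,v,\nabla u,\nabla v)\varphi\,dx-\int_\Omega f_2(x,u,v,\nabla u,\nabla v)\psi\,dx$$ for all $(u,v),(\varphi,\psi)\in X$ (well defined under condition (i) of the claim). A pair $(u,v)\in X$ is a strong generalized solution of the system if there exists a sequence $\{(u_n,v_n)\}\subseteq X$ such that (a) $(u_n,v_n)\rightharpoonup(u,v)$ weakly in $X$; (b) $\mathcal{A}_{\mu_1,\mu_2}(u_n,v_n)\rightharpoonup 0$ weakly in $X^*$; (c') $\lim_{n\to\infty}\langle A_{\mu_1,\mu_2}(u_n,v_n),(u_n-u,v_n-v)\rangle=0$. A pair $(u,v)\in X$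 is a weak solution of the system if $\mathcal{A}_{\mu_1,\mu_2}(u,v)=0$ in $X^*$. *)

theory Defs
  imports "HOL-Analysis.Analysis" "HOL-Library.Function_Algebras"
begin

instantiation "fun" :: (type, real_vector) real_vector
begin

definition scaleR_fun :: "real \<Rightarrow> ('a \<Rightarrow> 'b) \<Rightarrow> 'a \<Rightarrow> 'b" where
  "scaleR_fun c f = (\<lambda>x. c *\<^sub>R f x)"

instance
  by standard (simp_all add: scaleR_fun_def fun_eq_iff scaleR_add_right scaleR_add_left)

end

text \<open>
  A space is a linear subspace \<open>V\<close> of some real vector space together with a seminorm \<open>nrm\<close>
  on \<open>V\<close>. Function spaces are represented by actual functions rather than by classes modulo
  equality almost everywhere, and functionals by functions whose values outside \<open>V\<close> are
  irrelevant. In both cases the (semi)norm does not see the choice of the representative, and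
  hence neither does any functional that is bounded in the sense below.
\<close>

definition dual_space :: "'v::real_vector set \<Rightarrow> ('v \<Rightarrow> real) \<Rightarrow> ('v \<Rightarrow> real) set" where
  "dual_space V nrm =
     {F. (\<forall>x\<in>V. \<forall>y\<in>V. F (x + y) = F x + F y) \<and>
         (\<forall>c. \<forall>x\<in>V. F (c *\<^sub>R x) = c * F x) \<and>
         (\<exists>C. \<forall>x\<in>V. \<bar>F x\<bar> \<le> C * nrm x)}"

definition dual_norm :: "'v::real_vector set \<Rightarrow> ('v \<Rightarrow> real) \<Rightarrow> ('v \<Rightarrow> real) \<Rightarrow> real" where
  "dual_norm V nrm F = (SUP x\<in>{x \<in> V. nrm x \<le> 1}. \<bar>F x\<bar>)"

definition weakly_converges ::
    "'v::real_vector set \<Rightarrow> ('v \<Rightarrow> real) \<Rightarrow> (nat \<Rightarrow> 'v) \<Rightarrow> 'v \<Rightarrow> bool" where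
  "weakly_converges V nrm w l \<longleftrightarrow>
     (\<forall>n. w n \<in> V) \<and> l \<in> V \<and> (\<forall>F\<in>dual_space V nrm. (\<lambda>n. F (w n)) \<longlonglongrightarrow> F l)"

text \<open>
  Near each boundary point the set is the strict supergraph, in the direction of some unit vector
  \<open>e\<close>, of a Lipschitz function on the hyperplane orthogonal to \<open>e\<close>.
\<close>

definition lipschitz_boundary :: "'a::euclidean_space set \<Rightarrow> bool" where
  "lipschitz_boundary \<Omega> \<longleftrightarrow>
     (\<forall>z\<in>frontier \<Omega>. \<exists>e \<gamma> L r. norm e = 1 \<and> L-lipschitz_on {y. y \<bullet> e = 0} \<gamma> \<and> 0 < r \<and>
        \<Omega> \<inter> ball z r = {x \<in> ball z r. \<gamma> (x - (x \<bullet> e) *\<^sub>R e) < x \<bullet> e})"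

definition bounded_lipschitz_domain :: "'a::euclidean_space set \<Rightarrow> bool" where
  "bounded_lipschitz_domain \<Omega> \<longleftrightarrow>
     open \<Omega> \<and> connected \<Omega> \<and> \<Omega> \<noteq> {} \<and> bounded \<Omega> \<and> lipschitz_boundary \<Omega>"

definition conj_exp :: "real \<Rightarrow> real" where
  "conj_exp r = r / (r - 1)"

definition sobolev_exp :: "nat \<Rightarrow> real \<Rightarrow> real" where
  "sobolev_exp N r = real N * r / (real N - r)"

definition Lp_space :: "real \<Rightarrow> 'a::euclidean_space set \<Rightarrow> ('a \<Rightarrow> 'b::euclidean_space) set" where
  "Lp_space r \<Omega> = {g \<in> borel_measurable (lebesgue_on \<Omega>).
     integrable (lebesgue_on \<Omega>) (\<lambda>x. norm (g x) powr r)}"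

definition Lp_norm :: "real \<Rightarrow> 'a::euclidean_space set \<Rightarrow> ('a \<Rightarrow> 'b::euclidean_space) \<Rightarrow> real" where
  "Lp_norm r \<Omega> g = (LINT x|lebesgue_on \<Omega>. norm (g x) powr r) powr (1 / r)"

definition locally_integrable :: "'a::euclidean_space set \<Rightarrow> ('a \<Rightarrow> 'b::euclidean_space) \<Rightarrow> bool" where
  "locally_integrable \<Omega> g \<longleftrightarrow> (\<forall>K. compact K \<and> K \<subseteq> \<Omega> \<longrightarrow> integrable (lebesgue_on K) g)"

primrec Ck_function :: "nat \<Rightarrow> ('a::euclidean_space \<Rightarrow> real) \<Rightarrow> bool" where
  "Ck_function 0 f \<longleftrightarrow> continuous_on UNIV f"
| "Ck_function (Suc k) f \<longleftrightarrow> (\<forall>x. f differentiable (at x)) \<and>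
     (\<forall>b\<in>Basis. Ck_function k (\<lambda>x. frechet_derivative f (at x) b))"

definition test_function :: "'a::euclidean_space set \<Rightarrow> ('a \<Rightarrow> real) \<Rightarrow> bool" where
  "test_function \<Omega> \<phi> \<longleftrightarrow> (\<forall>k. Ck_function k \<phi>) \<and>
     compact (closure {x. \<phi> x \<noteq> 0}) \<and> closure {x. \<phi> x \<noteq> 0} \<subseteq> \<Omega>"

definition has_weak_gradient ::
    "'a::euclidean_space set \<Rightarrow> ('a \<Rightarrow> real) \<Rightarrow> ('a \<Rightarrow> 'a) \<Rightarrow> bool" where
  "has_weak_gradient \<Omega> u g \<longleftrightarrow> locally_integrable \<Omega> u \<and> locally_integrable \<Omega> g \<and>
     (\<forall>\<phi>. test_function \<Omega> \<phi> \<longrightarrow> (\<forall>b\<in>Basis.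
        (LINT x|lebesgue_on \<Omega>. u x * frechet_derivative \<phi> (at x) b) =
        - (LINT x|lebesgue_on \<Omega>. (g x \<bullet> b) * \<phi> x)))"

text \<open>The weak gradient is determined only up to equality almost everywhere in \<open>\<Omega>\<close>.\<close>

definition weak_gradient :: "'a::euclidean_space set \<Rightarrow> ('a \<Rightarrow> real) \<Rightarrow> 'a \<Rightarrow> 'a" where
  "weak_gradient \<Omega> u = (SOME g. has_weak_gradient \<Omega> u g)"

definition W1 :: "real \<Rightarrow> 'a::euclidean_space set \<Rightarrow> ('a \<Rightarrow> real) set" where
  "W1 r \<Omega> = {u \<in> Lp_space r \<Omega>. \<exists>g\<in>Lp_space r \<Omega>. has_weak_gradient \<Omega> u g}"

definition W10 :: "real \<Rightarrow> 'a::euclidean_space set \<Rightarrow> ('a \<Rightarrow> real) set" where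
  "W10 r \<Omega> = {u \<in> W1 r \<Omega>. \<exists>\<phi>. (\<forall>n::nat. test_function \<Omega> (\<phi> n)) \<and>
     (\<lambda>n. Lp_norm r \<Omega> (\<phi> n - u)) \<longlonglongrightarrow> 0 \<and>
     (\<lambda>n. Lp_norm r \<Omega> (weak_gradient \<Omega> (\<phi> n - u))) \<longlonglongrightarrow> 0}"

definition W10_norm :: "real \<Rightarrow> 'a::euclidean_space set \<Rightarrow> ('a \<Rightarrow> real) \<Rightarrow> real" where
  "W10_norm r \<Omega> u = Lp_norm r \<Omega> (weak_gradient \<Omega> u)"

definition first_eigenvalue :: "real \<Rightarrow> 'a::euclidean_space set \<Rightarrow> real" where
  "first_eigenvalue r \<Omega> =
     (INF u\<in>{u \<in> W10 r \<Omega>. \<not> (AE x in lebesgue_on \<Omega>. u x = 0)}.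
        W10_norm r \<Omega> u powr r / Lp_norm r \<Omega> u powr r)"

type_synonym 'a nonlinearity = "'a \<Rightarrow> real \<Rightarrow> real \<Rightarrow> 'a \<Rightarrow> 'a \<Rightarrow> real"

definition caratheodory :: "'a::euclidean_space set \<Rightarrow> 'a nonlinearity \<Rightarrow> bool" where
  "caratheodory \<Omega> f \<longleftrightarrow>
     (\<forall>s t \<xi> \<nu>. (\<lambda>x. f x s t \<xi> \<nu>) \<in> borel_measurable (lebesgue_on \<Omega>)) \<and>
     (AE x in lebesgue_on \<Omega>. continuous_on UNIV (\<lambda>(s, t, \<xi>, \<nu>). f x s t \<xi> \<nu>))"

definition X_space ::
    "'a::euclidean_space set \<Rightarrow> real \<Rightarrow> real \<Rightarrow> (('a \<Rightarrow> real) \<times> ('a \<Rightarrow> real)) set" where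
  "X_space \<Omega> p1 p2 = W10 p1 \<Omega> \<times> W10 p2 \<Omega>"

definition X_norm ::
    "'a::euclidean_space set \<Rightarrow> real \<Rightarrow> real \<Rightarrow> ('a \<Rightarrow> real) \<times> ('a \<Rightarrow> real) \<Rightarrow> real" where
  "X_norm \<Omega> p1 p2 = (\<lambda>(u, v). W10_norm p1 \<Omega> u + W10_norm p2 \<Omega> v)"

text \<open>
  The flux \<open>|\<xi>|\<^sup>p\<^sup>-\<^sup>2 \<xi> - \<mu> |\<xi>|\<^sup>q\<^sup>-\<^sup>2 \<xi>\<close>; it vanishes at \<open>\<xi> = 0\<close>, also for exponents below \<open>2\<close>.
\<close>

definition flux :: "real \<Rightarrow> real \<Rightarrow> real \<Rightarrow> 'a::euclidean_space \<Rightarrow> 'a" where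
  "flux p q \<mu> \<xi> = norm \<xi> powr (p - 2) *\<^sub>R \<xi> - \<mu> *\<^sub>R (norm \<xi> powr (q - 2) *\<^sub>R \<xi>)"

definition A_op ::
    "'a::euclidean_space set \<Rightarrow> real \<Rightarrow> real \<Rightarrow> real \<Rightarrow> real \<Rightarrow> real \<Rightarrow> real \<Rightarrow>
     ('a \<Rightarrow> real) \<times> ('a \<Rightarrow> real) \<Rightarrow> ('a \<Rightarrow> real) \<times> ('a \<Rightarrow> real) \<Rightarrow> real" where
  "A_op \<Omega> p1 p2 q1 q2 \<mu>1 \<mu>2 = (\<lambda>(u, v) (\<phi>, \<psi>).
     (LINT x|lebesgue_on \<Omega>. flux p1 q1 \<mu>1 (weak_gradient \<Omega> u x) \<bullet> weak_gradient \<Omega> \<phi> x) +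
     (LINT x|lebesgue_on \<Omega>. flux p2 q2 \<mu>2 (weak_gradient \<Omega> v x) \<bullet> weak_gradient \<Omega> \<psi> x))"

definition system_op ::
    "'a::euclidean_space set \<Rightarrow> real \<Rightarrow> real \<Rightarrow> real \<Rightarrow> real \<Rightarrow> real \<Rightarrow> real \<Rightarrow>
     'a nonlinearity \<Rightarrow> 'a nonlinearity \<Rightarrow>
     ('a \<Rightarrow> real) \<times> ('a \<Rightarrow> real) \<Rightarrow> ('a \<Rightarrow> real) \<times> ('a \<Rightarrow> real) \<Rightarrow> real" where
  "system_op \<Omega> p1 p2 q1 q2 \<mu>1 \<mu>2 f1 f2 = (\<lambda>(u, v) (\<phi>, \<psi>).
     A_op \<Omega> p1 p2 q1 q2 \<mu>1 \<mu>2 (u, v) (\<phi>, \<psi>) -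
     (LINT x|lebesgue_on \<Omega>. f1 x (u x) (v x) (weak_gradient \<Omega> u x) (weak_gradient \<Omega> v x) * \<phi> x) -
     (LINT x|lebesgue_on \<Omega>. f2 x (u x) (v x) (weak_gradient \<Omega> u x) (weak_gradient \<Omega> v x) * \<psi> x))"

text \<open>
  Weak convergence in the dual of \<open>X\<close> is tested against the bidual, so membership of the
  functionals \<open>system_op \<dots> (w n)\<close> in the dual of \<open>X\<close> is part of the definition.
\<close>

definition strong_generalized_solution ::
    "'a::euclidean_space set \<Rightarrow> real \<Rightarrow> real \<Rightarrow> real \<Rightarrow> real \<Rightarrow> real \<Rightarrow> real \<Rightarrow>
     'a nonlinearity \<Rightarrow> 'a nonlinearity \<Rightarrow> ('a \<Rightarrow> real) \<times> ('a \<Rightarrow> real) \<Rightarrow> bool" where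
  "strong_generalized_solution \<Omega> p1 p2 q1 q2 \<mu>1 \<mu>2 f1 f2 z \<longleftrightarrow>
     z \<in> X_space \<Omega> p1 p2 \<and>
     (\<exists>w. (\<forall>n::nat. w n \<in> X_space \<Omega> p1 p2) \<and>
        weakly_converges (X_space \<Omega> p1 p2) (X_norm \<Omega> p1 p2) w z \<and>
        weakly_converges
          (dual_space (X_space \<Omega> p1 p2) (X_norm \<Omega> p1 p2))
          (dual_norm (X_space \<Omega> p1 p2) (X_norm \<Omega> p1 p2))
          (\<lambda>n. system_op \<Omega> p1 p2 q1 q2 \<mu>1 \<mu>2 f1 f2 (w n)) 0 \<and>
        (\<lambda>n. A_op \<Omega> p1 p2 q1 q2 \<mu>1 \<mu>2 (w n) (w n - z)) \<longlonglongrightarrow> 0)"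

definition weak_solution ::
    "'a::euclidean_space set \<Rightarrow> real \<Rightarrow> real \<Rightarrow> real \<Rightarrow> real \<Rightarrow> real \<Rightarrow> real \<Rightarrow>
     'a nonlinearity \<Rightarrow> 'a nonlinearity \<Rightarrow> ('a \<Rightarrow> real) \<times> ('a \<Rightarrow> real) \<Rightarrow> bool" where
  "weak_solution \<Omega> p1 p2 q1 q2 \<mu>1 \<mu>2 f1 f2 z \<longleftrightarrow>
     z \<in> X_space \<Omega> p1 p2 \<and>
     (\<forall>h\<in>X_space \<Omega> p1 p2. system_op \<Omega> p1 p2 q1 q2 \<mu>1 \<mu>2 f1 f2 z h = 0)"

end

theory Submission
 imports Defs "HOL-Homology.Homology" "HOL-Complex_Analysis.Great_Picard"
begin

text \<open>
 The solution is the weak limit of Galerkin approximations. The growth condition bounds each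
 \<open>f\<^sub>i(\<cdot>,u,v,\<nabla>u,\<nabla>v)\<close> by a function in the Lebesgue space dual to \<open>L\<^sup>r\<close> that Sobolev's inequality controls through the
 gradients, plus \<open>\<sigma>\<^sub>i\<close>; as \<open>r\<^sub>i\<close> and \<open>s\<^sub>i\<close> are subcritical, the operator \<open>S\<close> of the system maps
 \<open>X\<close> into its dual, boundedly on bounded sets (\<open>S_bounded\<close>, \<open>S_dual\<close>). The sign condition, the
 definition of the first eigenvalues and the smallness of the constants make \<open>S\<close> coercive, whatever the
 sign of \<open>\<mu>\<^sub>i\<close>, since \<open>q\<^sub>i < p\<^sub>i\<close> (\<open>S_coercive\<close>). Restricted to a finite dimensional subspace, a coercive
 continuous operator has a zero: it points outwards on a large sphere, so Brouwer degree applies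
 (\<open>outward_field_has_zero\<close>, \<open>galerkin_step\<close>). Taking the subspaces spanned by the first \<open>n\<close> elements of a
 dense sequence yields a bounded sequence \<open>w\<^sub>n\<close> with \<open>S(w\<^sub>n)w\<^sub>n = 0\<close> and \<open>S(w\<^sub>n)h \<rightarrow> 0\<close> for all \<open>h\<close>.

 Along a subsequence, \<open>w\<^sub>n\<close> converges weakly to some \<open>z\<close> (\<open>Lp_weak_compact\<close>), and its components converge
 strongly in every subcritical \<open>L\<^sup>r\<close> (\<open>Rellich\<close>, \<open>subcritical_interpolation\<close>). Hence the lower order
 terms tested with \<open>w\<^sub>n - z\<close> tend to zero, and with them the principal part, which is the third
 requirement on a strong generalized solution. The second one is convergence against the bidual of \<open>X\<close>; it
 follows from pointwise convergence because \<open>X\<close> is reflexive (\<open>bidual_evaluation\<close>).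

 If both \<open>\<mu>\<^sub>i\<close> are negative, the principal part is monotone, and the vanishing of its pairing with
 \<open>w\<^sub>n - z\<close> forces the gradients to converge almost everywhere along a subsequence. Then every term
 of \<open>S(w\<^sub>n)h\<close> passes to the limit, and \<open>S(z)h = 0\<close> (\<open>weak_solution_limit\<close>).

 Most of the text builds the function spaces. Reflexivity, Riesz representation and separation for closed
 subspaces of \<open>L\<^sup>p\<close> all come from minimising \<open>\<parallel>h + v\<parallel>\<^sup>p/p - F(v)\<close> over \<open>v\<close> in the subspace, where uniform
 convexity makes minimising sequences converge (\<open>Lp_minimizer\<close>). Sobolev's inequality is proved by
 integrating along coordinate lines, and Rellich's theorem by comparing a function with its averages
 over small cubes. A space \<open>W\<^sub>0\<^sup>1\<^sup>,\<^sup>p\<close> enters through its closed subspace of gradients in \<open>L\<^sup>p\<close>.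
\<close>

abbreviation (input) seq_tendsto :: "(nat => 'a::topological_space) => 'a => bool" (infix "---->" 60) where
 "X ----> l == X \<longlonglongrightarrow> l"

notation scaleR (infixr "*R" 75)

section \<open>Zeros of outward pointing vector fields\<close>

lemma nsphere_top_of_set:
 "nsphere n = top_of_set {x::nat => real. (\<Sum>i\<le>n. x i ^ 2) = 1 \<and> (\<forall>i\<ge>Suc n. x i = 0)}"
 by (simp add: nsphere euclidean_product_topology Suc_le_eq)

text \<open>
 A nowhere vanishing family of vectors on the unit sphere, depending continuously on a parameter in
 \<open>{0..1}\<close>, is a homotopy of self-maps of the sphere once it is normalised.
\<close>

lemma normalized_field_continuous_map:
 fixes G :: "nat => real \<times> (nat => real) => real"
 assumes S: "S = {x::nat => real. (\<Sum>i\<le>n. x i ^ 2) = 1 \<and> (\<forall>i\<ge>Suc n. x i = 0)}"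
  and cont: "\<And>i. i <= n ==> continuous_on ({0..1} \<times> S) (G i)"
  and nz: "\<And>z. z \<in> {0..1} \<times> S ==> \<exists>i\<le>n. G i z \<noteq> 0"
 shows "continuous_map (prod_topology (top_of_set {0..1}) (nsphere n)) (nsphere n)
      (%z i. if i <= n then G i z / sqrt (\<Sum>j\<le>n. (G j z)\<^sup>2) else 0)"
proof -
 have pos: "0 < (\<Sum>j\<le>n. (G j z)\<^sup>2)" if z: "z \<in> {0..1} \<times> S" for z
 proof -
  obtain i where "i <= n" "G i z \<noteq> 0" using nz[OF z] by blast
  then show ?thesis by (intro sum_pos2[of _ i]) auto
 qed
 have "continuous_on ({0..1} \<times> S) (%z i. if i <= n then G i z / sqrt (\<Sum>j\<le>n. (G j z)\<^sup>2) else 0)"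
 proof (rule continuous_on_coordinatewise_then_product)
  fix i
  show "continuous_on ({0..1} \<times> S) (%z. if i <= n then G i z / sqrt (\<Sum>j\<le>n. (G j z)\<^sup>2) else 0)"
  proof (cases "i <= n")
   case True
   have "\<forall>z\<in>{0..1} \<times> S. sqrt (\<Sum>j\<le>n. (G j z)\<^sup>2) \<noteq> 0" using pos by force
   then show ?thesis using True
    by (auto intro!: continuous_intros cont)
  qed auto
 qed
 moreover have "(%i. if i <= n then G i z / sqrt (\<Sum>j\<le>n. (G j z)\<^sup>2) else 0) \<in> S"
  if z: "z \<in> {0..1} \<times> S" for z
 proof -
  define q where "q = (\<Sum>j\<le>n. (G j z)\<^sup>2)"
  have q: "0 < q" using pos[OF z] by (simp add: q_def)
  have "(\<Sum>i\<le>n. (G i z / sqrt q)\<^sup>2) = (\<Sum>i\<le>n. (G i z)\<^sup>2) / q"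
   using q by (simp add: power_divide sum_divide_distrib)
  also have "\<dots> = 1" using q by (simp add: q_def[symmetric])
  finally show ?thesis unfolding S q_def by (auto cong: if_cong)
 qed
 ultimately show ?thesis
  unfolding nsphere_top_of_set S[symmetric]
  by (simp add: prod_topology_subtopology_eu continuous_map_iff_continuous2 image_subset_iff)
qed

text \<open>
 If the field had no zero, its normalised restriction to the sphere of radius \<open>R\<close> would be homotopic to a
 constant map by shrinking the radius to zero, and homotopic to the identity by a straight line, along
 which no vector vanishes because the field points outwards. The degrees 0 and 1 contradict each other.
 Vectors of \<open>m\<close> entries are sequences vanishing from \<open>m\<close> on, which lets \<open>m\<close> depend on the situation.
\<close>

lemma outward_field_has_zero:
 fixes F :: "nat => (nat => real) => real"
 assumes cont: "\<And>i. i < m ==> continuous_on {c. \<forall>j\<ge>m. c j = 0} (F i)"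
  and R: "0 < R"
  and out: "\<And>c. \<forall>j\<ge>m. c j = 0 ==> (\<Sum>j<m. (c j)\<^sup>2) = R\<^sup>2 ==> 0 < (\<Sum>j<m. F j c * c j)"
 shows "\<exists>c. (\<forall>j\<ge>m. c j = 0) \<and> (\<forall>i<m. F i c = 0)"
proof (cases m)
 case 0
 then show ?thesis by (intro exI[of _ "%_. 0"]) auto
next
 case (Suc n)
 define E where "E = {c::nat => real. \<forall>j\<ge>m. c j = 0}"
 define S where "S = {x::nat => real. (\<Sum>i\<le>n. x i ^ 2) = 1 \<and> (\<forall>i\<ge>Suc n. x i = 0)}"
 define nrml where "nrml G = (%z i. if i <= n then G i z / sqrt (\<Sum>j\<le>n. (G j z)\<^sup>2) else 0)"
  for G :: "nat => real \<times> (nat => real) => real"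
 have topS: "topspace (nsphere n) = S" by (simp add: nsphere_top_of_set S_def)
 show ?thesis
 proof (rule ccontr)
  assume neg: "\<not> ?thesis"
  \<comment> \<open>\<open>G\<close> joins the identity to the field by straight lines, \<open>K\<close> shrinks the radius\<close>
  define G where "G i z = (1 - fst z) * snd z i + fst z * F i (%j. R * snd z j)" for i z
  define K where "K i z = F i (%j. fst z * (R * snd z j))" for i z
  have coord: "continuous_on A (%z::real \<times> (nat => real). snd z i)" for A i
   by (rule continuous_on_product_then_coordinatewise) (rule continuous_on_snd[OF continuous_on_id])
  have contF: "continuous_on A (%z. F i (h z))"
   if "i <= n" "continuous_on A h" "h ` A \<subseteq> E" for i A and h :: "real \<times> (nat => real) => nat => real"
   using continuous_on_compose2[OF cont that(2), of i] that Suc unfolding E_def by auto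
  have contG: "continuous_on ({0..1} \<times> S) (G i)" if "i <= n" for i
   unfolding G_def
   by (intro continuous_intros coord contF that continuous_on_coordinatewise_then_product)
    (auto simp: E_def S_def Suc)
  have contK: "continuous_on ({0..1} \<times> S) (K i)" if "i <= n" for i
   unfolding K_def
   by (intro contF that continuous_on_coordinatewise_then_product continuous_intros coord)
    (auto simp: E_def S_def Suc)
  have nzG: "\<exists>i\<le>n. G i z \<noteq> 0" if z: "z \<in> {0..1} \<times> S" for z
  proof (rule ccontr)
   assume "\<not> ?thesis"
   then have 0: "G i z = 0" if "i <= n" for i using that by blast
   obtain t x where zz: "z = (t, x)" by (cases z)
   have t: "0 <= t" "t <= 1" and x: "(\<Sum>i\<le>n. x i ^ 2) = 1" "\<forall>i\<ge>m. x i = 0"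
    using z zz Suc by (auto simp: S_def)
   define y where "y = (%j. R * x j)"
   have "(\<Sum>j<m. (y j)\<^sup>2) = R\<^sup>2"
    using x(1) by (simp add: y_def power_mult_distrib Suc lessThan_Suc_atMost flip: sum_distrib_left)
   then have "0 < (\<Sum>j<m. F j y * y j)" by (intro out) (use x(2) in \<open>auto simp: y_def\<close>)
   also have "(\<Sum>j<m. F j y * y j) = R * (\<Sum>j\<le>n. F j y * x j)"
    by (simp add: y_def Suc lessThan_Suc_atMost sum_distrib_left algebra_simps)
   finally have p: "0 < (\<Sum>j\<le>n. F j y * x j)" using R by (simp add: zero_less_mult_iff)
   have "0 = (\<Sum>i\<le>n. G i z * x i)" using 0 by simp
   also have "\<dots> = (1 - t) * (\<Sum>i\<le>n. (x i)\<^sup>2) + t * (\<Sum>j\<le>n. F j y * x j)"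
    unfolding sum_distrib_left sum.distrib[symmetric]
    by (intro sum.cong) (auto simp: G_def zz y_def algebra_simps power2_eq_square)
   also have "\<dots> > 0" using t p x by (cases "t = 0") (auto simp: add_nonneg_pos)
   finally show False by simp
  qed
  have nzK: "\<exists>i\<le>n. K i z \<noteq> 0" if z: "z \<in> {0..1} \<times> S" for z
  proof -
   have "\<forall>j\<ge>m. (%j. fst z * (R * snd z j)) j = 0" using z Suc by (auto simp: S_def)
   then have "\<exists>i<m. F i (%j. fst z * (R * snd z j)) \<noteq> 0" using neg by metis
   then show ?thesis unfolding K_def Suc less_Suc_eq_le .
  qed
  have homG: "homotopic_with (%_. True) (nsphere n) (nsphere n)
    (%x. nrml G (0, x)) (%x. nrml G (1, x))"
   unfolding homotopic_with_def
   using normalized_field_continuous_map[OF S_def, of G] contG nzG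
   by (intro exI[of _ "nrml G"]) (auto simp: nrml_def)
  have homK: "homotopic_with (%_. True) (nsphere n) (nsphere n)
    (%x. nrml K (0, x)) (%x. nrml K (1, x))"
   unfolding homotopic_with_def
   using normalized_field_continuous_map[OF S_def, of K] contK nzK
   by (intro exI[of _ "nrml K"]) (auto simp: nrml_def)
  have eq1: "(%x. nrml K (1, x)) = (%x. nrml G (1, x))"
   by (intro ext) (simp add: nrml_def K_def G_def)
  have K0: "(%x. nrml K (0, x)) = (%x. nrml K (0, (%_. 0)))"
   by (intro ext) (simp add: nrml_def K_def)
  have "Brouwer_degree2 n (%x. nrml G (1, x)) = 0"
   using Brouwer_degree2_nullhomotopic[of n "%x. nrml G (1, x)"] homK K0 eq1
   by (metis homotopic_with_sym)
  moreover have "homotopic_with (%_. True) (nsphere n) (nsphere n) id (%x. nrml G (1, x))"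
  proof (rule homotopic_with_eq[OF homG])
   fix x assume "x \<in> topspace (nsphere n)"
   then have "x \<in> S" using topS by simp
   then show "id x = nrml G (0, x)"
    by (auto simp: nrml_def G_def S_def fun_eq_iff)
  qed auto
  ultimately show False
   using Brouwer_degree2_homotopic Brouwer_degree2_id by (metis zero_neq_one)
 qed
qed

section \<open>Products of integrals along coordinate lines\<close>

lemma weighted_AM_GM:
 fixes a w :: "'i => real"
 assumes "finite J" "\<And>j. j \<in> J ==> 0 < w j" "sum w J = 1" "\<And>j. j \<in> J ==> 0 <= a j"
 shows "(\<Prod>j\<in>J. a j powr w j) <= (\<Sum>j\<in>J. w j * a j)"
proof (cases "\<exists>j\<in>J. a j = 0")
 case True
 then have "(\<Prod>j\<in>J. a j powr w j) = 0" using assms(1) by (auto intro!: prod_zero)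
 moreover have "0 <= (\<Sum>j\<in>J. w j * a j)"
  using assms by (intro sum_nonneg mult_nonneg_nonneg) (auto simp: less_imp_le)
 ultimately show ?thesis by simp
next
 case False
 then have pos: "0 < a j" if "j \<in> J" for j using assms(4)[OF that] that by fastforce
 have "J \<noteq> {}" using assms(3) by auto
 have "(\<Prod>j\<in>J. a j powr w j) = exp (\<Sum>j\<in>J. w j *R ln (a j))"
  unfolding exp_sum[OF assms(1)]
  by (intro prod.cong) (use pos in \<open>force simp: powr_def\<close>)+
 also have "\<dots> <= (\<Sum>j\<in>J. w j * exp (ln (a j)))"
  using convex_on_sum[OF assms(1) \<open>J \<noteq> {}\<close> exp_convex assms(3)] assms(2) by (simp add: less_imp_le)
 also have "\<dots> = (\<Sum>j\<in>J. w j * a j)" using pos by (intro sum.cong) auto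
 finally show ?thesis .
qed

text \<open>
 Powers with the conventions that suit weights: the zeroth power is 1 also at 0 and at infinity.
\<close>

definition epow :: "ennreal => real => ennreal" where
 "epow a r = (if r = 0 then 1 else if a = top_class.top then top_class.top else ennreal (enn2real a powr r))"

lemma epow_measurable [measurable]: "f \<in> borel_measurable M ==> (%x. epow (f x) r) \<in> borel_measurable M"
 by (cases "r = 0") (simp_all add: epow_def)

lemma epow_0 [simp]: "r \<noteq> 0 ==> epow 0 r = 0" "epow a 0 = 1" "epow a 1 = a"
 by (auto simp: epow_def less_top)

lemma epow_ennreal: "0 <= a ==> r \<noteq> 0 ==> epow (ennreal a) r = ennreal (a powr r)"
 by (simp add: epow_def)

lemma epow_add: assumes "0 <= r" "0 <= s" shows "epow a (r + s) = epow a r * epow a s"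
proof (cases "r = 0 \<or> s = 0")
 case False
 then have "0 < r" "0 < s" using assms by auto
 then show ?thesis
  by (auto simp: epow_def ennreal_mult'[symmetric] powr_add ennreal_top_mult ennreal_mult_top)
qed (auto simp: epow_def)

lemma epow_mono: assumes "0 <= r" "a <= b" shows "epow a r <= epow b r"
 using assms by (auto simp: epow_def top_unique less_top intro!: ennreal_leI powr_mono2 enn2real_mono)

lemma epow_eq_0: "epow a r = 0 ==> a = 0"
 by (auto simp: epow_def ennreal_eq_0_iff enn2real_eq_0_iff split: if_splits)

text \<open>
 After division by the integrals of the factors, the claim is the integrated weighted inequality between
 the arithmetic and the geometric mean.
\<close>

lemma nn_integral_Holder_prod_pos:
 fixes f :: "'i => 'a => ennreal"
 assumes fin: "finite J" and w: "\<And>j. j \<in> J ==> 0 < w j" and w1: "sum w J = 1"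
  and meas [measurable]: "\<And>j. j \<in> J ==> f j \<in> borel_measurable M"
 shows "(\<integral>\<^sup>+x. (\<Prod>j\<in>J. epow (f j x) (w j)) \<partial>M) <= (\<Prod>j\<in>J. epow (\<integral>\<^sup>+x. f j x \<partial>M) (w j))"
proof -
 define I where "I j = (\<integral>\<^sup>+x. f j x \<partial>M)" for j
 consider (zero) "\<exists>j\<in>J. I j = 0" | (infinite) "\<forall>j\<in>J. I j \<noteq> 0" "\<exists>j\<in>J. I j = top_class.top"
  | (fin) "\<forall>j\<in>J. I j \<noteq> 0" "\<forall>j\<in>J. I j \<noteq> top_class.top" by blast
 then show ?thesis
 proof cases
  case zero
  then obtain j where j: "j \<in> J" "I j = 0" by blast
  then have "AE x in M. f j x = 0" unfolding I_def by (subst (asm) nn_integral_0_iff_AE) auto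
  then have "AE x in M. (\<Prod>j\<in>J. epow (f j x) (w j)) = 0"
  proof eventually_elim
   case (elim x)
   then show ?case using j(1) w[OF j(1)] fin by (intro prod_zero) (auto intro!: bexI[of _ j])
  qed
  then have "(\<integral>\<^sup>+x. (\<Prod>j\<in>J. epow (f j x) (w j)) \<partial>M) = 0"
   by (subst nn_integral_0_iff_AE) auto
  then show ?thesis by simp
 next
  case infinite
  then obtain j where j: "j \<in> J" "I j = top_class.top" by blast
  have "(\<Prod>j\<in>J. epow (I j) (w j)) = epow (I j) (w j) * (\<Prod>j\<in>J - {j}. epow (I j) (w j))"
   using fin j by (simp add: prod.remove)
  also have "epow (I j) (w j) = top_class.top" using j w[OF j(1)] by (simp add: epow_def)
  also have "top_class.top * (\<Prod>j\<in>J - {j}. epow (I j) (w j)) = top_class.top"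
   using infinite fin epow_eq_0 by (subst ennreal_top_mult) (auto simp: prod_zero_iff)
  finally show ?thesis unfolding I_def by simp
 next
  case fin
  define i where "i j = enn2real (I j)" for j
  have i: "0 < i j" "I j = ennreal (i j)" if "j \<in> J" for j
   using fin that by (auto simp: i_def enn2real_positive_iff less_top[symmetric] zero_less_iff_neq_zero)
  define P where "P = (\<Prod>j\<in>J. i j powr w j)"
  have Peq: "(\<Prod>j\<in>J. epow (I j) (w j)) = ennreal P"
  proof -
   have "(\<Prod>j\<in>J. epow (I j) (w j)) = (\<Prod>j\<in>J. ennreal (i j powr w j))"
    using i w by (intro prod.cong) (auto simp: epow_ennreal less_imp_le less_imp_neq[THEN not_sym])
   then show ?thesis by (simp add: P_def prod_ennreal)
  qed
  have Ppos: "0 < P" unfolding P_def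
   by (intro prod_pos) (simp add: i(1)[THEN less_imp_neq, THEN not_sym])
  have pt: "(\<Prod>j\<in>J. epow (f j x) (w j)) <= ennreal P * (\<Sum>j\<in>J. ennreal (w j / i j) * f j x)" for x
  proof (cases "\<exists>j\<in>J. f j x = top_class.top")
   case True
   then obtain j where j: "j \<in> J" "f j x = top_class.top" by blast
   have "ennreal (w j / i j) * f j x = top_class.top"
    using w[OF j(1)] i[OF j(1)] j by (simp add: ennreal_mult_top)
   then have "(\<Sum>j\<in>J. ennreal (w j / i j) * f j x) = top_class.top"
    using \<open>finite J\<close> j(1) by auto
   then show ?thesis using Ppos by (simp add: ennreal_mult_top)
  next
   case False
   define y where "y j = enn2real (f j x)" for j
   have y: "0 <= y j" "f j x = ennreal (y j)" if "j \<in> J" for j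
    using False that by (auto simp: y_def less_top[symmetric])
   have "(\<Prod>j\<in>J. epow (f j x) (w j)) = ennreal (\<Prod>j\<in>J. y j powr w j)"
    using y w by (simp add: prod_ennreal[symmetric] epow_ennreal less_imp_neq[THEN not_sym] cong: prod.cong)
   also have "(\<Prod>j\<in>J. y j powr w j) = P * (\<Prod>j\<in>J. (y j / i j) powr w j)"
    unfolding P_def prod.distrib[symmetric] using i y
    by (intro prod.cong) (auto simp: powr_divide less_imp_le less_imp_neq[THEN not_sym])
   also have "ennreal \<dots> <= ennreal (P * (\<Sum>j\<in>J. w j * (y j / i j)))"
    using Ppos i y w w1 \<open>finite J\<close>
    by (intro ennreal_leI mult_left_mono weighted_AM_GM) (auto simp: less_imp_le)
   also have "\<dots> = ennreal P * ennreal (\<Sum>j\<in>J. w j * (y j / i j))"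
    using Ppos by (intro ennreal_mult') simp
   also have "ennreal (\<Sum>j\<in>J. w j * (y j / i j)) = (\<Sum>j\<in>J. ennreal (w j * (y j / i j)))"
    by (intro sum_ennreal[symmetric] mult_nonneg_nonneg divide_nonneg_nonneg)
     (simp_all add: y i(1) w less_imp_le)
   also have "\<dots> = (\<Sum>j\<in>J. ennreal (w j / i j) * f j x)"
   proof (intro sum.cong refl)
    fix j assume j: "j \<in> J"
    have "ennreal (w j / i j) * ennreal (y j) = ennreal (w j / i j * y j)"
     using i(1)[OF j] w[OF j] by (intro ennreal_mult'[symmetric]) simp
    then show "ennreal (w j * (y j / i j)) = ennreal (w j / i j) * f j x"
     using y[OF j] by simp
   qed
   finally show ?thesis .
  qed
  have "(\<integral>\<^sup>+x. (\<Prod>j\<in>J. epow (f j x) (w j)) \<partial>M) \<le>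
    (\<integral>\<^sup>+x. ennreal P * (\<Sum>j\<in>J. ennreal (w j / i j) * f j x) \<partial>M)"
   by (intro nn_integral_mono pt)
  also have "\<dots> = ennreal P * (\<Sum>j\<in>J. ennreal (w j / i j) * I j)"
   by (simp add: nn_integral_cmult nn_integral_sum I_def)
  also have "(\<Sum>j\<in>J. ennreal (w j / i j) * I j) = (\<Sum>j\<in>J. ennreal (w j))"
  proof (rule sum.cong)
   fix j assume j: "j \<in> J"
   then show "ennreal (w j / i j) * I j = ennreal (w j)"
    using i[OF j] w[OF j] by (simp add: ennreal_mult'[symmetric])
  qed simp
  also have "\<dots> = 1" using w w1 by (subst sum_ennreal) (auto simp: less_imp_le)
  finally show ?thesis using Peq by (simp add: I_def)
 qed
qed

lemma nn_integral_Holder_prod: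
 fixes f :: "'i => 'a => ennreal"
 assumes fin: "finite J" and w: "\<And>j. j \<in> J ==> 0 <= w j" and w1: "sum w J = 1"
  and meas: "\<And>j. j \<in> J ==> f j \<in> borel_measurable M"
 shows "(\<integral>\<^sup>+x. (\<Prod>j\<in>J. epow (f j x) (w j)) \<partial>M) <= (\<Prod>j\<in>J. epow (\<integral>\<^sup>+x. f j x \<partial>M) (w j))"
proof -
 define K where "K = {j\<in>J. 0 < w j}"
 have K: "finite K" "K \<subseteq> J" "\<forall>j\<in>J - K. w j = 0" using fin w by (auto simp: K_def not_less intro: antisym)
 have "sum w K = 1" using w1 sum.mono_neutral_right[OF fin K(2,3)] by simp
 then have "(\<integral>\<^sup>+x. (\<Prod>j\<in>K. epow (f j x) (w j)) \<partial>M) <= (\<Prod>j\<in>K. epow (\<integral>\<^sup>+x. f j x \<partial>M) (w j))"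
  by (intro nn_integral_Holder_prod_pos K(1) meas) (auto simp: K_def)
 moreover have "(\<Prod>j\<in>J. epow (g j) (w j)) = (\<Prod>j\<in>K. epow (g j) (w j))" for g
  using K by (intro prod.mono_neutral_right[OF fin]) auto
 ultimately show ?thesis by simp
qed

text \<open>
 The inequality of Gagliardo for products of line integrals, with an extra power of \<open>f\<close> that makes
 induction on the number of coordinates possible: integrating in one more coordinate by Hoelder's
 inequality turns \<open>f\<close> into its partial integral \<open>F\<close> and shifts the exponent of \<open>f\<close> by \<open>p\<close>. The extra factor
 disappears when \<open>p\<close> is the reciprocal of the number of coordinates minus one.
\<close>

lemma gridlines_PiM:
 fixes f :: "('i => real) => ennreal"
 assumes "finite S" "f \<in> borel_measurable (PiM S (%_. lborel))" "0 < p" "(real (card S) - 1) * p <= 1"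
 shows "(\<integral>\<^sup>+x. epow (f x) (1 - (real (card S) - 1) * p) *
      (\<Prod>j\<in>S. epow (\<integral>\<^sup>+t. f (x(j := t)) \<partial>lborel) p) \<partial>PiM S (%_. lborel))
   <= epow (\<integral>\<^sup>+x. f x \<partial>PiM S (%_. lborel)) (1 + p)"
 using assms
proof (induction S arbitrary: f rule: finite_induct)
 case empty
 interpret product_sigma_finite "%_::'i. lborel :: real measure" by standard
 show ?case by (simp add: nn_integral_empty)
next
 case (insert i S)
 interpret P: product_sigma_finite "%_::'i. lborel :: real measure" by standard
 let ?P = "PiM S (%_. lborel :: real measure)" and ?Q = "PiM (insert i S) (%_. lborel :: real measure)"
 note [measurable] = insert.prems(1)
 define k where "k = real (card S)"
 have k: "real (card (insert i S)) - 1 = k" using insert by (simp add: k_def)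
 have kp: "k * p <= 1" "0 <= k" using insert.prems(3) k by (auto simp: k_def)
 have upd [measurable]: "(%z. (fst z)(i := snd z)) \<in> ?P \<Otimes>\<^sub>M lborel \<rightarrow>\<^sub>M ?Q"
  by (rule measurable_fun_upd[where J = S]) auto
 have updj [measurable]: "(%z. (fst z)(j := snd z)) \<in> ?Q \<Otimes>\<^sub>M lborel \<rightarrow>\<^sub>M ?Q" if "j \<in> S" for j
  by (rule measurable_fun_upd[where J = "insert i S"]) (use that in auto)
 define F where "F x = (\<integral>\<^sup>+t. f (x(i := t)) \<partial>lborel)" for x
 have fx2: "(%(x, t). f (x(i := t))) \<in> borel_measurable (?P \<Otimes>\<^sub>M lborel)"
  using measurable_compose[OF upd insert.prems(1)] unfolding split_beta' by assumption
 then have F [measurable]: "F \<in> borel_measurable ?P"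
  unfolding F_def by (rule lborel.borel_measurable_nn_integral)
 have fj2: "(%(x, t). f (x(j := t))) \<in> borel_measurable (?Q \<Otimes>\<^sub>M lborel)" if "j \<in> S" for j
  using measurable_compose[OF updj[OF that] insert.prems(1)] unfolding split_beta' by assumption
 have fj [measurable]: "(%x. \<integral>\<^sup>+t. f (x(j := t)) \<partial>lborel) \<in> borel_measurable ?Q" if "j \<in> S" for j
  using fj2[OF that] by (rule lborel.borel_measurable_nn_integral)
 have fi2: "(%(x, t). f (x(i := t))) \<in> borel_measurable (?Q \<Otimes>\<^sub>M lborel)"
 proof -
  have "(%z. (fst z)(i := snd z)) \<in> ?Q \<Otimes>\<^sub>M (lborel :: real measure) \<rightarrow>\<^sub>M ?Q"
   by (rule measurable_fun_upd[where J = "insert i S"]) auto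
  from measurable_compose[OF this insert.prems(1)] show ?thesis by (simp add: split_beta' del: fun_upd_apply)
 qed
 have fi [measurable]: "(%x. \<integral>\<^sup>+t. f (x(i := t)) \<partial>lborel) \<in> borel_measurable ?Q"
  using fi2 by (rule lborel.borel_measurable_nn_integral)
 let ?L = "%x. epow (f x) (1 - k * p) * (\<Prod>j\<in>insert i S. epow (\<integral>\<^sup>+t. f (x(j := t)) \<partial>lborel) p)"
 have measL: "?L \<in> borel_measurable ?Q"
  using insert.hyps by (intro borel_measurable_times_ennreal borel_measurable_prod_ennreal epow_measurable) auto
 have step: "(\<integral>\<^sup>+y. ?L (x(i := y)) \<partial>lborel) \<le>
   epow (F x) (1 - (k - 1) * p) * (\<Prod>j\<in>S. epow (\<integral>\<^sup>+t. F (x(j := t)) \<partial>lborel) p)"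
  if x: "x \<in> space ?P" for x
 proof -
  have m1: "(%y. x(i := y)) \<in> lborel \<rightarrow>\<^sub>M ?Q"
   using measurable_compose[OF measurable_Pair1'[OF x] upd] by simp
  have g0 [measurable]: "(%y. f (x(i := y))) \<in> borel_measurable lborel"
   using measurable_compose[OF m1 insert.prems(1)] .
  have gj: "(%y. \<integral>\<^sup>+t. f ((x(i := y))(j := t)) \<partial>lborel) \<in> borel_measurable lborel" if "j \<in> S" for j
   using measurable_compose[OF m1 fj[OF that]] .
  have swap: "(\<integral>\<^sup>+y. (\<integral>\<^sup>+t. f ((x(i := y))(j := t)) \<partial>lborel) \<partial>lborel) = (\<integral>\<^sup>+t. F (x(j := t)) \<partial>lborel)"
   if j: "j \<in> S" for j
  proof -
   have "j \<noteq> i" using j insert.hyps by auto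
   have "(%z. (x(i := fst z), snd z)) \<in> lborel \<Otimes>\<^sub>M lborel \<rightarrow>\<^sub>M ?Q \<Otimes>\<^sub>M (lborel :: real measure)"
    by (intro measurable_Pair measurable_compose[OF measurable_fst m1] measurable_snd)
   from measurable_compose[OF this updj[OF j]]
   have mm: "(%z. (x(i := fst z))(j := snd z)) \<in> lborel \<Otimes>\<^sub>M lborel \<rightarrow>\<^sub>M ?Q"
    unfolding fst_conv snd_conv .
   have "(%(y, t). f ((x(i := y))(j := t))) \<in> borel_measurable (lborel \<Otimes>\<^sub>M lborel)"
    using measurable_compose[OF mm insert.prems(1)] unfolding split_beta' .
   then have "(\<integral>\<^sup>+y. (\<integral>\<^sup>+t. f ((x(i := y))(j := t)) \<partial>lborel) \<partial>lborel) =
     (\<integral>\<^sup>+t. (\<integral>\<^sup>+y. f ((x(i := y))(j := t)) \<partial>lborel) \<partial>lborel)"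
    by (rule lborel_pair.Fubini'[symmetric])
   also have "\<dots> = (\<integral>\<^sup>+t. F (x(j := t)) \<partial>lborel)"
    unfolding F_def using \<open>j \<noteq> i\<close> by (simp add: fun_upd_twist)
   finally show ?thesis .
  qed

  define wt where "wt = case_option (1 - k * p) (%_::'i. p)"
  define g where "g = (%o' y. case o' of None => f (x(i := y))
    | Some j => (\<integral>\<^sup>+t. f ((x(i := y))(j := t)) \<partial>lborel))"
  define J where "J = insert None (Some ` S)"
  have prodJ: "(\<Prod>j\<in>J. h j) = h None * (\<Prod>j\<in>S. h (Some j))" for h :: "'i option => ennreal"
   using insert.hyps by (simp add: J_def prod.reindex)
  have sumJ: "(\<Sum>j\<in>J. h j) = h None + (\<Sum>j\<in>S. h (Some j))" for h :: "'i option => real"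
   using insert.hyps by (simp add: J_def sum.reindex)
  have "(\<integral>\<^sup>+y. ?L (x(i := y)) \<partial>lborel) =
    (\<integral>\<^sup>+y. epow (F x) p * (\<Prod>j\<in>J. epow (g j y) (wt j)) \<partial>lborel)"
   using insert.hyps by (intro nn_integral_cong) (simp add: prodJ g_def wt_def F_def mult_ac)
  also have "\<dots> = epow (F x) p * (\<integral>\<^sup>+y. (\<Prod>j\<in>J. epow (g j y) (wt j)) \<partial>lborel)"
   using gj by (intro nn_integral_cmult borel_measurable_prod_ennreal epow_measurable)
    (auto simp: J_def g_def)
  also have "\<dots> <= epow (F x) p * (\<Prod>j\<in>J. epow (\<integral>\<^sup>+y. g j y \<partial>lborel) (wt j))"
   using gj kp insert.prems insert.hyps
   by (intro mult_left_mono nn_integral_Holder_prod)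
    (auto simp: J_def[symmetric] g_def wt_def sumJ k_def, auto simp: J_def)
  also have "\<dots> = (epow (F x) p * epow (F x) (1 - k * p)) * (\<Prod>j\<in>S. epow (\<integral>\<^sup>+t. F (x(j := t)) \<partial>lborel) p)"
   by (simp add: prodJ g_def wt_def swap mult.assoc F_def[symmetric] cong: prod.cong)
  also have "epow (F x) p * epow (F x) (1 - k * p) = epow (F x) (1 - (k - 1) * p)"
   using kp insert.prems by (subst epow_add[symmetric]) (auto simp: algebra_simps)
  finally show ?thesis .
 qed
 have "(\<integral>\<^sup>+x. ?L x \<partial>?Q) = (\<integral>\<^sup>+x. (\<integral>\<^sup>+y. ?L (x(i := y)) \<partial>lborel) \<partial>?P)"
  using insert.hyps measL by (intro P.product_nn_integral_insert) auto
 also have "\<dots> <= (\<integral>\<^sup>+x. epow (F x) (1 - (k - 1) * p) * (\<Prod>j\<in>S. epow (\<integral>\<^sup>+t. F (x(j := t)) \<partial>lborel) p) \<partial>?P)"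
  by (intro nn_integral_mono step)
 also have "\<dots> <= epow (\<integral>\<^sup>+x. F x \<partial>?P) (1 + p)"
  unfolding k_def by (rule insert.IH[OF F insert.prems(2)])
   (use kp insert.prems(2) in \<open>simp add: k_def left_diff_distrib\<close>)
 also have "(\<integral>\<^sup>+x. F x \<partial>?P) = (\<integral>\<^sup>+x. f x \<partial>?Q)"
  unfolding F_def using insert.hyps insert.prems by (intro P.product_nn_integral_insert[symmetric]) auto
 finally show ?case by (simp add: k)
qed

lemma gridlines_euclidean:
 fixes g :: "'a::euclidean_space => ennreal"
 assumes [measurable]: "g \<in> borel_measurable borel" and n: "2 <= DIM('a)"
 shows "(\<integral>\<^sup>+x. (\<Prod>b\<in>Basis. epow (\<integral>\<^sup>+t. g (x + (t - x \<bullet> b) *R b) \<partial>lborel) (1 / (real DIM('a) - 1))) \<partial>lborel)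
   <= epow (\<integral>\<^sup>+x. g x \<partial>lborel) (real DIM('a) / (real DIM('a) - 1))"
proof -
 let ?P = "PiM Basis (%_::'a. lborel :: real measure)"
 define T where "T = (%f::'a => real. \<Sum>b\<in>Basis. f b *R b)"
 have T [measurable]: "T \<in> ?P \<rightarrow>\<^sub>M borel" unfolding T_def by measurable
 have intT: "(\<integral>\<^sup>+x. h x \<partial>lborel) = (\<integral>\<^sup>+x. h (T x) \<partial>?P)" if "h \<in> borel_measurable borel" for h :: "'a => ennreal"
 proof -
  have "lborel = distr ?P borel T" unfolding T_def by (rule lborel_eq)
  then have "(\<integral>\<^sup>+x. h x \<partial>lborel) = (\<integral>\<^sup>+x. h x \<partial>distr ?P borel T)" by (rule arg_cong)
  also have "\<dots> = (\<integral>\<^sup>+x. h (T x) \<partial>?P)" by (rule nn_integral_distr[OF T]) (use that in simp)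
  finally show ?thesis .
 qed
 have Tb: "T x \<bullet> b = x b" if "b \<in> Basis" for x b
  using that by (simp add: T_def inner_sum_left inner_Basis if_distrib sum.delta cong: if_cong)
 have Tupd: "T (x(b := t)) = T x + (t - T x \<bullet> b) *R b" if b: "b \<in> Basis" for x b t
  by (rule euclidean_eqI) (use b in \<open>auto simp: Tb inner_add_left inner_Basis\<close>)
 have m [measurable]: "(%x. \<integral>\<^sup>+t. g (x + (t - x \<bullet> b) *R b) \<partial>lborel) \<in> borel_measurable borel" for b
  by (rule lborel.borel_measurable_nn_integral) measurable
 define p where "p = 1 / (real DIM('a) - 1)"
 have p: "0 < p" "(real (card (Basis :: 'a set)) - 1) * p = 1" using n by (auto simp: p_def)
 have "(\<integral>\<^sup>+x. (\<Prod>b\<in>Basis. epow (\<integral>\<^sup>+t. g (x + (t - x \<bullet> b) *R b) \<partial>lborel) p) \<partial>lborel) =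
   (\<integral>\<^sup>+x. (\<Prod>b\<in>Basis. epow (\<integral>\<^sup>+t. g (T x + (t - T x \<bullet> b) *R b) \<partial>lborel) p) \<partial>?P)"
  by (rule intT) measurable
 also have "\<dots> = (\<integral>\<^sup>+x. epow (g (T x)) (1 - (real (card (Basis :: 'a set)) - 1) * p) *
   (\<Prod>b\<in>Basis. epow (\<integral>\<^sup>+t. g (T (x(b := t))) \<partial>lborel) p) \<partial>?P)"
  by (intro nn_integral_cong) (simp add: p Tupd)
 also have "\<dots> <= epow (\<integral>\<^sup>+x. g (T x) \<partial>?P) (1 + p)"
  by (rule gridlines_PiM) (use p in auto)
 also have "(\<integral>\<^sup>+x. g (T x) \<partial>?P) = (\<integral>\<^sup>+x. g x \<partial>lborel)" by (rule intT[symmetric]) simp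
 also have "1 + p = real DIM('a) / (real DIM('a) - 1)" using n by (auto simp: p_def field_simps)
 finally show ?thesis by (simp add: p_def)
qed

section \<open>Test functions\<close>

lemma Ck_SucD: "Ck_function (Suc k) f ==> Ck_function k f"
proof (induction k arbitrary: f)
 case 0
 then show ?case by (auto intro!: differentiable_imp_continuous_on simp: differentiable_on_def)
next
 case (Suc k)
 from Suc.prems have "f differentiable (at x)" for x by simp
 moreover from Suc.prems have "Ck_function (Suc k) (%x. frechet_derivative f (at x) b)"
  if "b \<in> Basis" for b
  using that by simp
 ultimately show ?case using Suc.IH by simp
qed

lemma Ck_const [simp]: "Ck_function k (%_. c)"
 by (induction k arbitrary: c) (auto simp: frechet_derivative_const)

lemma frechet_derivative_add_fun:
 assumes "f differentiable (at x)" "g differentiable (at x)"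
 shows "frechet_derivative (%x. f x + g x) (at x) b = frechet_derivative f (at x) b + frechet_derivative g (at x) b"
 using has_derivative_add[OF assms[unfolded frechet_derivative_works]]
 by (simp add: frechet_derivative_at[symmetric])

lemma frechet_derivative_mult_fun:
 fixes f g :: "'a::euclidean_space => real"
 assumes "f differentiable (at x)" "g differentiable (at x)"
 shows "frechet_derivative (%x. f x * g x) (at x) b =
   f x * frechet_derivative g (at x) b + frechet_derivative f (at x) b * g x"
 using has_derivative_mult[OF assms[unfolded frechet_derivative_works]]
 by (simp add: frechet_derivative_at[symmetric])

lemma Ck_add: "Ck_function k f ==> Ck_function k g ==> Ck_function k (%x. f x + g x)"
proof (induction k arbitrary: f g)
 case 0
 then show ?case by (auto intro!: continuous_intros)
next
 case (Suc k)
 have "(%x. frechet_derivative (%x. f x + g x) (at x) b) =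
   (%x. frechet_derivative f (at x) b + frechet_derivative g (at x) b)" for b
  using Suc.prems by (intro ext frechet_derivative_add_fun) auto
 then show ?case using Suc.prems Suc.IH by (simp add: differentiable_add)
qed

lemma Ck_mult: "Ck_function k f ==> Ck_function k g ==> Ck_function k (%x. f x * g x)"
proof (induction k arbitrary: f g)
 case 0
 then show ?case by (auto intro!: continuous_intros)
next
 case (Suc k)
 have eq: "(%x. frechet_derivative (%x. f x * g x) (at x) b) =
   (%x. f x * frechet_derivative g (at x) b + frechet_derivative f (at x) b * g x)" for b
  using Suc.prems by (intro ext frechet_derivative_mult_fun) auto
 have "Ck_function k (%x. frechet_derivative (%x. f x * g x) (at x) b)" if "b \<in> Basis" for b
  unfolding eq using Suc.prems that Ck_SucD[OF Suc.prems(1)] Ck_SucD[OF Suc.prems(2)]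
  by (intro Ck_add Suc.IH) auto
 then show ?case using Suc.prems by (simp add: differentiable_mult)
qed

lemma Ck_prod: "finite I ==> (\<And>i. i \<in> I ==> Ck_function k (f i)) ==> Ck_function k (%x. \<Prod>i\<in>I. f i x)"
 by (induction I rule: finite_induct) (auto intro: Ck_mult)

definition smooth_cutoff :: "nat => real => real" where
 "smooth_cutoff k t = (if t <= 0 then 0 else exp (- (1 / t)) / t ^ k)"

lemma smooth_cutoff_small:
 assumes "0 < t" shows "\<bar>smooth_cutoff k t\<bar> <= real (k + 2) ^ (k + 2) * t\<^sup>2"
proof -
 define m where "m = k + 2"
 have "(1 / (t * m)) ^ m <= exp (1 / (t * m)) ^ m"
  using assms by (intro power_mono order_trans[OF _ exp_ge_add_one_self]) auto
 also have "\<dots> = exp (1 / t)" unfolding exp_of_nat_mult[symmetric] by (simp add: m_def del: of_nat_add)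
 finally have "1 / (real m ^ m * t ^ m) <= exp (1 / t)"
  by (simp only: power_divide power_mult_distrib power_one mult.commute)
 moreover have "0 < real m ^ m * t ^ m" using assms by (simp add: m_def del: of_nat_add)
 ultimately have "1 <= (real m ^ m * t ^ m) * exp (1 / t)"
  by (simp only: pos_divide_le_eq mult.commute)
 then have "exp (- (1 / t)) <= real m ^ m * t ^ m"
  unfolding exp_minus by (simp only: inverse_eq_divide pos_divide_le_eq exp_gt_zero)
 then have "exp (- (1 / t)) / t ^ k <= real m ^ m * t ^ m / t ^ k"
  using assms by (intro divide_right_mono) auto
 also have "\<dots> = real m ^ m * t\<^sup>2" using assms by (simp add: m_def power_add power2_eq_square)
 finally show ?thesis using assms by (simp add: smooth_cutoff_def m_def)
qed

text \<open>
 The derivatives of \<open>exp (- 1 / t)\<close> are combinations of the functions \<open>smooth_cutoff k\<close>, so this family is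
 closed under differentiation, and all its members are smooth across 0.
\<close>

lemma smooth_cutoff_derivative:
 "(smooth_cutoff k has_real_derivative smooth_cutoff (k + 2) t - real k * smooth_cutoff (k + 1) t) (at t)"
proof -
 consider "t < 0" | "t = 0" | "0 < t" by linarith
 then show ?thesis
 proof cases
  case 1
  have "((%_. 0) has_real_derivative 0) (at t)" by simp
  then have "(smooth_cutoff k has_real_derivative 0) (at t)"
   by (rule has_field_derivative_transform_within_open[where S = "{..<0}"])
    (use 1 in \<open>auto simp: smooth_cutoff_def\<close>)
  then show ?thesis using 1 by (simp add: smooth_cutoff_def)
 next
  case 2
  define C where "C = real (k + 2) ^ (k + 2)"
  have "((%h. smooth_cutoff k h / h) \<longlongrightarrow> 0) (at 0)"
  proof (rule Lim_null_comparison)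
   have "norm (smooth_cutoff k h / h) <= C * \<bar>h\<bar>" for h
   proof (cases "h <= 0")
    case False
    then have "\<bar>smooth_cutoff k h\<bar> <= C * h\<^sup>2" using smooth_cutoff_small[of h k] by (simp add: C_def)
    then show ?thesis using False by (simp add: power2_eq_square field_simps)
   next
    case True
    have "0 <= C" by (simp add: C_def)
    then have "0 <= C * \<bar>h\<bar>" by (intro mult_nonneg_nonneg) auto
    moreover have "smooth_cutoff k h = 0" using True by (simp add: smooth_cutoff_def)
    ultimately show ?thesis by (simp only: div_0 norm_zero)
   qed
   then show "\<forall>\<^sub>F h in at 0. norm (smooth_cutoff k h / h) <= C * \<bar>h\<bar>" by simp
   have "((%h::real. C * \<bar>h\<bar>) \<longlongrightarrow> C * \<bar>0\<bar>) (at 0)" by (intro tendsto_intros)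
   then show "((%h::real. C * \<bar>h\<bar>) \<longlongrightarrow> 0) (at 0)" by simp
  qed
  then have "(smooth_cutoff k has_real_derivative 0) (at 0)"
   by (simp add: has_field_derivative_iff smooth_cutoff_def)
  then show ?thesis using 2 by (simp add: smooth_cutoff_def)
 next
  case 3
  have "((%t. exp (- (1 / t)) / t ^ k) has_real_derivative
    (exp (- (1 / t)) * (1 / t\<^sup>2) * t ^ k - exp (- (1 / t)) * (real k * t ^ (k - 1))) / (t ^ k * t ^ k)) (at t)"
   using 3 by (auto intro!: derivative_eq_intros simp: power2_eq_square)
  also have "(exp (- (1 / t)) * (1 / t\<^sup>2) * t ^ k - exp (- (1 / t)) * (real k * t ^ (k - 1))) / (t ^ k * t ^ k)
    = smooth_cutoff (k + 2) t - real k * smooth_cutoff (k + 1) t"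
   using 3 by (cases k) (simp_all add: smooth_cutoff_def field_simps power2_eq_square)
  finally show ?thesis
   by (rule has_field_derivative_transform_within_open[where S = "{0<..}"])
    (use 3 in \<open>auto simp: smooth_cutoff_def\<close>)
 qed
qed

lemma Ck_smooth_cutoff: "Ck_function n (%x::'a::euclidean_space. smooth_cutoff k (x \<bullet> e + a))"
proof (induction n arbitrary: k)
 case 0
 have "continuous_on UNIV (smooth_cutoff k)"
  using smooth_cutoff_derivative by (intro DERIV_continuous_on) (rule has_field_derivative_at_within)
 moreover have "continuous_on UNIV (%x::'a. x \<bullet> e + a)" by (intro continuous_intros)
 ultimately have "continuous_on UNIV (%x::'a. smooth_cutoff k (x \<bullet> e + a))"
  by (rule continuous_on_compose2) simp
 then show ?case by simp
next
 case (Suc n)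
 have D: "((%x::'a. smooth_cutoff k (x \<bullet> e + a)) has_derivative
   (%h. (smooth_cutoff (k + 2) (x \<bullet> e + a) - real k * smooth_cutoff (k + 1) (x \<bullet> e + a)) * (h \<bullet> e))) (at x)" for x
 proof -
  have "((%x::'a. x \<bullet> e + a) has_derivative (%h. h \<bullet> e)) (at x)"
   by (auto intro!: derivative_eq_intros)
  from has_derivative_compose[OF this smooth_cutoff_derivative[unfolded has_field_derivative_def]]
  show ?thesis by simp
 qed
 have "(%x::'a. frechet_derivative (%x. smooth_cutoff k (x \<bullet> e + a)) (at x) b) =
   (%x. (b \<bullet> e) * smooth_cutoff (k + 2) (x \<bullet> e + a) +
      (- real k * (b \<bullet> e)) * smooth_cutoff (k + 1) (x \<bullet> e + a))" for b
  using frechet_derivative_at[OF D, symmetric] by (auto simp: algebra_simps)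
 moreover have "Ck_function n (%x::'a. (b \<bullet> e) * smooth_cutoff (k + 2) (x \<bullet> e + a) +
      (- real k * (b \<bullet> e)) * smooth_cutoff (k + 1) (x \<bullet> e + a))" for b
  by (intro Ck_add Ck_mult Ck_const Suc.IH)
 ultimately show ?case using D by (auto simp: differentiable_def simp del: mult_minus_left)
qed

text \<open>
 The parameter \<open>m\<close> steepens the flanks: as it grows, the bumps tend to the indicator of the open box.
\<close>

definition box_bump :: "real => 'a::euclidean_space => 'a => 'a => real" where
 "box_bump m a b x = (\<Prod>i\<in>Basis. smooth_cutoff 0 (m * (x \<bullet> i - a \<bullet> i)) * smooth_cutoff 0 (m * (b \<bullet> i - x \<bullet> i)))"

lemma smooth_cutoff_0: "0 <= smooth_cutoff 0 t" "smooth_cutoff 0 t <= 1" "t <= 0 ==> smooth_cutoff 0 t = 0"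
 by (auto simp: smooth_cutoff_def)

lemma box_bump_bounds: "0 <= box_bump m a b x" "box_bump m a b x <= 1"
 unfolding box_bump_def
 by (auto intro!: prod_nonneg prod_le_1 mult_le_one smooth_cutoff_0 mult_nonneg_nonneg)

lemma box_bump_outside: assumes "0 < m" "x \<notin> box a b" shows "box_bump m a b x = 0"
proof -
 obtain i where i: "i \<in> Basis" "x \<bullet> i <= a \<bullet> i \<or> b \<bullet> i <= x \<bullet> i"
  using assms by (auto simp: mem_box not_less)
 then have "smooth_cutoff 0 (m * (x \<bullet> i - a \<bullet> i)) * smooth_cutoff 0 (m * (b \<bullet> i - x \<bullet> i)) = 0"
  using assms by (auto simp: smooth_cutoff_0 mult_nonneg_nonpos)
 then show ?thesis unfolding box_bump_def using i by (intro prod_zero) auto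
qed

lemma box_bump_inside: assumes "x \<in> box a b" "0 < m" shows "0 < box_bump m a b x"
 using assms unfolding box_bump_def by (intro prod_pos) (auto simp: smooth_cutoff_def mem_box mult_le_0_iff)

lemma test_function_box_bump:
 assumes "0 < m" "cbox a b \<subseteq> \<Omega>" shows "test_function \<Omega> (box_bump m a b)"
proof -
 have "closure {x. box_bump m a b x \<noteq> 0} \<subseteq> cbox a b"
  using box_bump_outside[OF assms(1)] box_subset_cbox[of a b]
  by (intro closure_minimal) (auto intro: closed_cbox)
 moreover have "Ck_function k (box_bump m a b)" for k
 proof -
  have 1: "m * (x \<bullet> i - a \<bullet> i) = x \<bullet> (m *R i) + (- m * (a \<bullet> i))"
   and 2: "m * (b \<bullet> i - x \<bullet> i) = x \<bullet> (- m *R i) + m * (b \<bullet> i)" for x i :: 'a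
   by (simp_all add: algebra_simps)
  show ?thesis unfolding box_bump_def 1 2
   by (intro Ck_prod Ck_mult Ck_smooth_cutoff) auto
 qed
 moreover have "bounded (closure {x. box_bump m a b x \<noteq> 0})"
  using calculation(1) by (rule bounded_subset[OF bounded_cbox])
 ultimately show ?thesis using assms unfolding test_function_def compact_eq_bounded_closed
  by (meson closed_closure order_trans)
qed

lemma box_bump_tendsto: "(%n. box_bump (real (Suc n)) a b x) ----> indicator (box a b) x"
proof (cases "x \<in> box a b")
 case True
 have *: "(%n. smooth_cutoff 0 (real (Suc n) * c)) ----> 1" if "0 < c" for c
 proof -
  have "(%n. exp (- (inverse (real (Suc n)) * (1 / c)))) ----> exp (- (0 * (1 / c)))"
   by (intro tendsto_intros LIMSEQ_inverse_real_of_nat)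
  moreover have "smooth_cutoff 0 (real (Suc n) * c) = exp (- (inverse (real (Suc n)) * (1 / c)))" for n
  proof -
   have "\<not> real (Suc n) * c <= 0" using that by (simp add: mult_le_0_iff)
   then show ?thesis using that by (simp add: smooth_cutoff_def divide_simps del: of_nat_Suc)
  qed
  ultimately show ?thesis by simp
 qed
 have "(%n. box_bump (real (Suc n)) a b x) ----> (\<Prod>i\<in>(Basis::'a set). 1 * 1)"
  unfolding box_bump_def using True by (intro tendsto_intros *) (auto simp: mem_box)
 then show ?thesis using True by simp
next
 case False
 then show ?thesis by (simp add: box_bump_outside)
qed

subsection \<open>Integrals over boxes determine a function\<close>

text \<open>
 The positive and negative parts of \<open>h\<close> are densities of finite measures that agree on boxes, hence agree.
\<close>

lemma AE_zero_if_box_integrals_zero_borel: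
 fixes h :: "'a::euclidean_space => real"
 assumes h: "integrable lborel h"
  and box: "\<And>a b. (LINT x|lborel. indicator (box a b) x * h x) = 0"
 shows "AE x in lborel. h x = 0"
proof -
 note [measurable] = borel_measurable_integrable[OF h]
 define P where "P x = max 0 (h x)" for x
 define N where "N x = max 0 (- h x)" for x
 have int: "integrable lborel P" "integrable lborel N"
  unfolding P_def N_def using h by (auto intro!: integrable_max)
 note [measurable] = borel_measurable_integrable[OF int(1)] borel_measurable_integrable[OF int(2)]
 have em: "emeasure (density lborel (%x. ennreal (f x))) A = ennreal (LINT x|lborel. indicator A x * f x)"
  if f: "integrable lborel f" "\<And>x. 0 <= f x" "A \<in> sets borel" for f :: "'a => real" and A
 proof -
  have [measurable]: "f \<in> borel_measurable borel" using borel_measurable_integrable[OF f(1)] by simp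
  have "emeasure (density lborel (%x. ennreal (f x))) A = (\<integral>\<^sup>+x. ennreal (f x) * indicator A x \<partial>lborel)"
   using f(3) by (subst emeasure_density) auto
  also have "\<dots> = (\<integral>\<^sup>+x. ennreal (indicator A x * f x) \<partial>lborel)"
   by (intro nn_integral_cong) (auto simp: indicator_def)
  also have "\<dots> = ennreal (LINT x|lborel. indicator A x * f x)"
   using integrable_mult_indicator[of A lborel f] f by (intro nn_integral_eq_integral) auto
  finally show ?thesis .
 qed
 have "density lborel (%x. ennreal (P x)) = density lborel (%x. ennreal (N x))"
 proof (rule measure_eqI_generator_eq)
  let ?E = "range (%(a, b). box a b :: 'a set)"
  show "Int_stable ?E" by (force simp: Int_stable_def box_Int_box)
  show "?E \<subseteq> Pow UNIV" by simp
  show "sets (density lborel (%x. ennreal (P x))) = sigma_sets UNIV ?E"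
   "sets (density lborel (%x. ennreal (N x))) = sigma_sets UNIV ?E"
   by (simp_all add: borel_eq_box)
  let ?A = "%n::nat. box (- (real n *R One)) (real n *R One) :: 'a set"
  show "range ?A \<subseteq> ?E" "(\<Union>i. ?A i) = UNIV" by (auto simp: UN_box_eq_UNIV)
  show "emeasure (density lborel (%x. ennreal (P x))) (?A i) \<noteq> \<infinity>" for i
   using int by (subst em) (auto simp: P_def)
  fix X assume "X \<in> ?E"
  then obtain a b where X: "X = box a b" by auto
  have "(LINT x|lborel. indicator X x * P x) - (LINT x|lborel. indicator X x * N x) =
    (LINT x|lborel. indicator X x * h x)"
   using integrable_mult_indicator[of X lborel P] integrable_mult_indicator[of X lborel N] int
   by (subst Bochner_Integration.integral_diff[symmetric])
    (auto simp: X P_def N_def max_def right_diff_distrib[symmetric] intro!: Bochner_Integration.integral_cong)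
  then show "emeasure (density lborel (%x. ennreal (P x))) X = emeasure (density lborel (%x. ennreal (N x))) X"
   using box[of a b] em[OF int(1), of X] em[OF int(2), of X] by (simp add: X P_def N_def)
 qed
 then have "AE x in lborel. ennreal (P x) = ennreal (N x)"
  by (subst (asm) sigma_finite_measure.density_unique_iff[OF sigma_finite_lborel]) auto
 then show ?thesis by eventually_elim (auto simp: P_def N_def max_def split: if_splits)
qed

lemma AE_zero_if_box_integrals_zero:
 fixes h :: "'a::euclidean_space => real"
 assumes h: "integrable lebesgue h"
  and box: "\<And>a b. (LINT x|lebesgue. indicator (box a b) x * h x) = 0"
 shows "AE x in lebesgue. h x = 0"
proof -
 obtain g where g: "g \<in> borel_measurable lborel" "AE x in lborel. h x = g x"
  using completion_ex_borel_measurable_real[OF borel_measurable_integrable[OF h]] by blast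
 have gm [measurable]: "g \<in> borel_measurable borel" using g by simp
 have hg: "AE x in lebesgue. h x = g x" using g(2) by (rule AE_completion)
 have glm [measurable]: "g \<in> borel_measurable lebesgue" using g(1) by (rule measurable_completion)
 have hm [measurable]: "h \<in> borel_measurable lebesgue" using h by simp
 have boxm [measurable]: "box a b \<in> sets lebesgue" for a b :: 'a by simp
 have "integrable lebesgue g" using h hg by (subst integrable_cong_AE[of _ _ h]) auto
 then have "integrable lborel g" using g(1) by (simp add: integrable_completion)
 moreover have "(LINT x|lborel. indicator (box a b) x * g x) = 0" for a b
 proof -
  have "(LINT x|lborel. indicator (box a b) x * g x) = (LINT x|lebesgue. indicator (box a b) x * g x)"
   by (subst integral_completion) auto
  also have "\<dots> = (LINT x|lebesgue. indicator (box a b) x * h x)"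
  proof (rule integral_cong_AE)
   show "AE x in lebesgue. indicator (box a b) x * g x = indicator (box a b) x * h x"
    using hg by eventually_elim simp
  qed measurable
  finally show ?thesis using box by simp
 qed
 ultimately have "AE x in lborel. g x = 0" by (rule AE_zero_if_box_integrals_zero_borel)
 then have "AE x in lebesgue. g x = 0" by (rule AE_completion)
 with hg show ?thesis by eventually_elim simp
qed

subsection \<open>The fundamental lemma and uniqueness of weak gradients\<close>

lemma lebesgue_on_restrict:
 fixes f :: "'a::euclidean_space => 'b::euclidean_space"
 assumes "A \<in> sets lebesgue"
 shows "integrable (lebesgue_on A) f \<longleftrightarrow> integrable lebesgue (%x. indicator A x *R f x)"
  and "(LINT x|lebesgue_on A. f x) = (LINT x|lebesgue. indicator A x *R f x)"
 using assms by (simp_all add: integrable_restrict_space integral_restrict_space)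

lemma test_function_zero_outside: "test_function \<Omega> \<phi> ==> x \<notin> \<Omega> ==> \<phi> x = 0"
 unfolding test_function_def using closure_subset[of "{x. \<phi> x \<noteq> 0}"] by (metis (mono_tags, lifting) mem_Collect_eq subset_iff)

text \<open>
 Inside a compact cell of \<open>\<Omega>\<close>, bumps approximate the indicator of any box, so \<open>h\<close> has vanishing
 integrals over boxes. Countably many such cells cover \<open>\<Omega>\<close>.
\<close>

lemma fundamental_lemma:
 fixes h :: "'a::euclidean_space => real"
 assumes \<Omega>: "open \<Omega>" and h: "locally_integrable \<Omega> h"
  and test: "\<And>\<phi>. test_function \<Omega> \<phi> ==> (LINT x|lebesgue_on \<Omega>. h x * \<phi> x) = 0"
 shows "AE x in lebesgue_on \<Omega>. h x = 0"
proof -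
 have \<Omega>m [measurable]: "\<Omega> \<in> sets lebesgue" using \<Omega> by auto
 have boxm [measurable]: "box a b \<in> sets lebesgue" for a b :: 'a by simp
 have cell: "AE x in lebesgue. x \<in> cbox c d \<longrightarrow> h x = 0" if cd: "cbox c d \<subseteq> \<Omega>" for c d
 proof -
  define H where "H x = indicator (cbox c d) x * h x" for x
  have H: "integrable lebesgue H"
  proof -
   have "integrable (lebesgue_on (cbox c d)) h"
    using h cd compact_cbox unfolding locally_integrable_def by blast
   then show ?thesis using lebesgue_on_restrict(1)[of "cbox c d" h] unfolding H_def by simp
  qed
  then have Hm [measurable]: "H \<in> borel_measurable lebesgue" by simp
  have bd: "AE x in lebesgue. x \<notin> cbox a b - box a b" for a b :: 'a
   using negligible_frontier_interval[of a b] unfolding negligible_iff_null_sets by (rule AE_not_in)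
  have "(LINT x|lebesgue. indicator (box a b) x * H x) = 0" for a b
  proof -
   obtain a' b' where ab: "box a b \<inter> box c d = box a' b'" by (rule that[OF box_Int_box])
   show ?thesis
   proof (cases "box a' b' = {}")
    case True
    have "AE x in lebesgue. indicator (box a b) x * H x = 0"
     using bd[of c d] by eventually_elim (use True ab in \<open>auto simp: H_def indicator_def\<close>)
    then show ?thesis by (intro integral_eq_zero_AE)
   next
    case False
    have "closure (box a' b') \<subseteq> closure (box c d)" using ab by (intro closure_mono) auto
    also have "closure (box c d) \<subseteq> cbox c d" by (intro closure_minimal box_subset_cbox closed_cbox)
    finally have sub: "cbox a' b' \<subseteq> cbox c d" unfolding closure_box[OF False] .
    then have tf: "test_function \<Omega> (box_bump (real (Suc n)) a' b')" for n
     using cd by (intro test_function_box_bump) auto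
    have "(%n. LINT x|lebesgue. H x * box_bump (real (Suc n)) a' b' x) ---->
      (LINT x|lebesgue. H x * indicator (box a' b') x)"
    proof (rule integral_dominated_convergence[where w = "%x. \<bar>H x\<bar>"])
     have bm: "box_bump (real (Suc n)) a' b' \<in> borel_measurable borel" for n
     proof (rule borel_measurable_continuous_onI)
      show "continuous_on UNIV (box_bump (real (Suc n)) a' b')"
       using tf[of n] Ck_function.simps(1) unfolding test_function_def by blast
     qed
     have [measurable]: "box_bump (real (Suc n)) a' b' \<in> borel_measurable lebesgue" for n
      by (rule measurable_completion) (use bm[of n] in \<open>simp del: of_nat_Suc\<close>)
     show "(%x. H x * indicator (box a' b') x) \<in> borel_measurable lebesgue" by measurable
     show "(%x. H x * box_bump (real (Suc n)) a' b' x) \<in> borel_measurable lebesgue" for n by measurable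
     show "integrable lebesgue (%x. \<bar>H x\<bar>)" using H by simp
     show "AE x in lebesgue. (%n. H x * box_bump (real (Suc n)) a' b' x) ----> H x * indicator (box a' b') x"
      by (intro AE_I2 tendsto_intros box_bump_tendsto)
     show "AE x in lebesgue. norm (H x * box_bump (real (Suc n)) a' b' x) <= \<bar>H x\<bar>" for n
      using box_bump_bounds[of "real (Suc n)" a' b']
      by (intro AE_I2) (auto simp: abs_mult intro: mult_left_le simp del: of_nat_Suc)
    qed
    moreover have "(LINT x|lebesgue. H x * box_bump (real (Suc n)) a' b' x) = 0" for n
    proof -
     have "(LINT x|lebesgue. H x * box_bump (real (Suc n)) a' b' x) =
       (LINT x|lebesgue_on \<Omega>. h x * box_bump (real (Suc n)) a' b' x)"
      unfolding lebesgue_on_restrict(2)[OF \<Omega>m]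
      using cd sub box_bump_outside[of "real (Suc n)" _ a' b'] box_subset_cbox[of a' b']
      by (intro Bochner_Integration.integral_cong) (auto simp: H_def indicator_def simp del: of_nat_Suc)
     then show ?thesis using test[OF tf[of n]] by simp
    qed
    ultimately have "(LINT x|lebesgue. H x * indicator (box a' b') x) = 0"
     using LIMSEQ_unique[OF _ tendsto_const] by simp
    also have "(LINT x|lebesgue. H x * indicator (box a' b') x) = (LINT x|lebesgue. indicator (box a b) x * H x)"
    proof (rule integral_cong_AE)
     show "AE x in lebesgue. H x * indicator (box a' b') x = indicator (box a b) x * H x"
      using bd[of c d] by eventually_elim (use ab in \<open>auto simp: H_def indicator_def\<close>)
    qed measurable
    finally show ?thesis .
   qed
  qed
  then have "AE x in lebesgue. H x = 0" by (rule AE_zero_if_box_integrals_zero[OF H])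
  then show ?thesis by eventually_elim (auto simp: H_def)
 qed
 obtain D where D: "countable D" "\<And>X. X \<in> D ==> \<exists>a b. X = cbox a b" "\<Union>D = \<Omega>" "D \<subseteq> Pow \<Omega>"
  using open_countable_Union_open_cbox[OF \<Omega>] by metis
 have "AE x in lebesgue. \<forall>X\<in>D. x \<in> X \<longrightarrow> h x = 0"
 proof (subst AE_ball_countable[OF D(1)], rule ballI)
  fix X assume "X \<in> D"
  then obtain c d where X: "X = cbox c d" using D(2) by blast
  moreover have "X \<subseteq> \<Omega>" using \<open>X \<in> D\<close> D(4) by blast
  ultimately show "AE x in lebesgue. x \<in> X \<longrightarrow> h x = 0" by (simp add: cell)
 qed
 then have "AE x in lebesgue. x \<in> \<Omega> \<longrightarrow> h x = 0"
  by eventually_elim (use D(3) in blast)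
 then show ?thesis by (subst AE_restrict_space_iff) auto
qed

section \<open>Lebesgue spaces\<close>

lemma tendsto_if_diff_le:
 fixes a :: "nat => 'b::real_normed_vector"
 assumes "\<And>n. norm (a n - l) <= b n" "b ----> 0"
 shows "a ----> l"
proof -
 have "(%n. a n - l) ----> 0"
  by (rule Lim_null_comparison[OF always_eventually assms(2)]) (use assms(1) in blast)
 then show ?thesis by (rule LIM_zero_cancel)
qed

text \<open>
 Lebesgue spaces over an arbitrary measure, with \<open>Ip\<close> the \<open>p\<close>-th power of the norm. Working with this power
 avoids roots; it satisfies the triangle inequality up to the factor \<open>2 powr p\<close>.
\<close>

definition LpM :: "real => 'a measure => ('a => 'b::euclidean_space) set" where
 "LpM p M = {g \<in> borel_measurable M. integrable M (%x. norm (g x) powr p)}"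

definition Ip :: "real => 'a measure => ('a => 'b::euclidean_space) => real" where
 "Ip p M g = (LINT x|M. norm (g x) powr p)"

text \<open>
 The derivative of \<open>norm \<xi> powr p / p\<close>. It maps \<open>L\<^sup>p\<close> into its dual space and is the flux of the
 \<open>p\<close>-Laplacian.
\<close>

definition duality :: "real => 'b::euclidean_space => 'b" where
 "duality p \<xi> = norm \<xi> powr (p - 2) *R \<xi>"

lemma LpM_measurable: "g \<in> LpM p M ==> g \<in> borel_measurable M"
 and LpM_integrable: "g \<in> LpM p M ==> integrable M (%x. norm (g x) powr p)"
 by (auto simp: LpM_def)

lemma Ip_nonneg [simp]: "0 <= Ip p M g"
 by (simp add: Ip_def)

lemma LpM_dominated:
 fixes f :: "'a => 'b::euclidean_space"
 assumes "f \<in> borel_measurable M" "integrable M w" "AE x in M. norm (f x) powr p <= w x"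
 shows "f \<in> LpM p M"
 unfolding LpM_def using assms
 by (auto intro!: Bochner_Integration.integrable_bound[OF assms(2)])

lemma norm_powr_add:
 assumes "0 <= p"
 shows "norm (a + b) powr p <= 2 powr p * (norm a powr p + norm b powr p)"
proof -
 have "norm (a + b) <= 2 * max (norm a) (norm b)" using norm_triangle_ineq[of a b] by linarith
 then have "norm (a + b) powr p <= (2 * max (norm a) (norm b)) powr p"
  using assms by (intro powr_mono2) auto
 also have "\<dots> = 2 powr p * max (norm a) (norm b) powr p" by (intro powr_mult)
 also have "\<dots> <= 2 powr p * (norm a powr p + norm b powr p)"
  by (intro mult_left_mono) (auto simp: max_def)
 finally show ?thesis .
qed

lemma LpM_add:
 fixes f g :: "'a => 'b::euclidean_space"
 assumes "0 <= p" and fg: "f \<in> LpM p M" "g \<in> LpM p M"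
 shows "(%x. f x + g x) \<in> LpM p M"
  and Ip_add_le: "Ip p M (%x. f x + g x) <= 2 powr p * (Ip p M f + Ip p M g)"
proof -
 let ?w = "%x. 2 powr p * (norm (f x) powr p + norm (g x) powr p)"
 have w: "integrable M ?w" using fg by (intro integrable_mult_right Bochner_Integration.integrable_add LpM_integrable)
 show *: "(%x. f x + g x) \<in> LpM p M"
  using LpM_measurable[OF fg(1)] LpM_measurable[OF fg(2)] norm_powr_add[OF assms(1)]
  by (intro LpM_dominated[OF _ w]) auto
 have "Ip p M (%x. f x + g x) <= (LINT x|M. ?w x)"
  unfolding Ip_def using norm_powr_add[OF assms(1)]
  by (intro integral_mono LpM_integrable[OF *] w) auto
 also have "\<dots> = 2 powr p * (Ip p M f + Ip p M g)"
  unfolding Ip_def using fg by (simp add: LpM_integrable)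
 finally show "Ip p M (%x. f x + g x) <= 2 powr p * (Ip p M f + Ip p M g)" .
qed

lemma LpM_scale:
 fixes f :: "'a => 'b::euclidean_space"
 assumes "f \<in> LpM p M" shows "(%x. c *R f x) \<in> LpM p M"
  and Ip_scale: "Ip p M (%x. c *R f x) = \<bar>c\<bar> powr p * Ip p M f"
proof -
 have *: "norm (c *R f x) powr p = \<bar>c\<bar> powr p * norm (f x) powr p" for x
  by (simp add: powr_mult)
 show "(%x. c *R f x) \<in> LpM p M"
  using LpM_measurable[OF assms] LpM_integrable[OF assms] by (auto simp: LpM_def * simp del: norm_scaleR)
 show "Ip p M (%x. c *R f x) = \<bar>c\<bar> powr p * Ip p M f" unfolding Ip_def * by simp
qed

lemma LpM_zero [simp]: "(%x. 0) \<in> LpM p M" and Ip_zero [simp]: "Ip p M (%x. 0) = 0"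
 by (auto simp: LpM_def Ip_def)

lemma LpM_minus: "f \<in> LpM p M ==> (%x. - f x) \<in> LpM p M" and Ip_minus: "Ip p M (%x. - f x) = Ip p M f"
 using LpM_scale[of f p M "-1"] by (auto simp: Ip_def)

lemma LpM_diff:
 fixes f g :: "'a => 'b::euclidean_space"
 assumes "0 <= p" "f \<in> LpM p M" "g \<in> LpM p M"
 shows "(%x. f x - g x) \<in> LpM p M"
  and Ip_diff_le: "Ip p M (%x. f x - g x) <= 2 powr p * (Ip p M f + Ip p M g)"
 using LpM_add[OF assms(1,2) LpM_minus[OF assms(3)]] by (auto simp: Ip_minus)

lemma Ip_diff_commute: "Ip p M (%x. f x - g x) = Ip p M (%x. g x - f x)"
 by (simp add: Ip_def norm_minus_commute)

lemma Ip_triangle: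
 fixes f g h :: "'a => 'b::euclidean_space"
 assumes "0 <= p" "f \<in> LpM p M" "g \<in> LpM p M" "h \<in> LpM p M"
 shows "Ip p M (%x. f x - h x) <= 2 powr p * (Ip p M (%x. f x - g x) + Ip p M (%x. g x - h x))"
 using Ip_add_le[OF assms(1) LpM_diff(1)[OF assms(1,2,3)] LpM_diff(1)[OF assms(1,3,4)]] by simp

lemma Ip_eq_0_iff:
 assumes "f \<in> LpM p M" shows "Ip p M f = 0 \<longleftrightarrow> (AE x in M. f x = 0)"
 unfolding Ip_def using LpM_integrable[OF assms] by (subst integral_nonneg_eq_0_iff_AE) auto

lemma Ip_cong_AE:
 assumes "f \<in> borel_measurable M" "g \<in> borel_measurable M" "AE x in M. f x = g x"
 shows "Ip p M f = Ip p M g"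
 unfolding Ip_def using assms by (intro integral_cong_AE) (auto)

lemma LpM_cong_AE:
 assumes "f \<in> LpM p M" "g \<in> borel_measurable M" "AE x in M. f x = g x"
 shows "g \<in> LpM p M"
 using assms by (intro LpM_dominated[OF assms(2) LpM_integrable[OF assms(1)]]) auto

subsection \<open>Hoelder's inequality\<close>

lemma Holder:
 fixes f :: "'a => 'b::euclidean_space" and g :: "'a => 'c::euclidean_space"
 assumes p: "1 < p" "q = p / (p - 1)" and f: "f \<in> LpM p M" and g: "g \<in> LpM q M"
 shows "integrable M (%x. norm (f x) * norm (g x))"
  and "(LINT x|M. norm (f x) * norm (g x)) <= Ip p M f powr (1 / p) * Ip q M g powr (1 / q)"
proof -
 have q: "1 < q" "1 / p + 1 / q = 1" unfolding p(2) using p(1) by (simp_all add: field_simps)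
 note [measurable] = LpM_measurable[OF f] LpM_measurable[OF g]
 have Y: "norm (f x) * norm (g x) <= norm (f x) powr p / p + norm (g x) powr q / q" for x
  using p q by (intro Youngs_inequality) auto
 show int: "integrable M (%x. norm (f x) * norm (g x))"
  by (rule Bochner_Integration.integrable_bound[where f = "%x. norm (f x) powr p / p + norm (g x) powr q / q"])
   (use LpM_integrable[OF f] LpM_integrable[OF g] order_trans[OF Y abs_ge_self] in auto)
 define a where "a = Ip p M f powr (1 / p)"
 define b where "b = Ip q M g powr (1 / q)"
 show "(LINT x|M. norm (f x) * norm (g x)) <= Ip p M f powr (1 / p) * Ip q M g powr (1 / q)"
 proof (cases "Ip p M f = 0 \<or> Ip q M g = 0")
  case True
  then have "AE x in M. norm (f x) * norm (g x) = 0"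
   using Ip_eq_0_iff[OF f] Ip_eq_0_iff[OF g] by auto
  then have "(LINT x|M. norm (f x) * norm (g x)) = 0" by (rule integral_eq_zero_AE)
  then show ?thesis by simp
 next
  case False
  then have pos: "0 < Ip p M f" "0 < Ip q M g" using Ip_nonneg[of p M f] Ip_nonneg[of q M g] by linarith+
  then have ab: "0 < a" "0 < b" "a powr p = Ip p M f" "b powr q = Ip q M g"
   using p q by (auto simp: a_def b_def powr_powr)
  have "norm (f x) * norm (g x) <= a * b * (norm (f x) powr p / (p * Ip p M f) + norm (g x) powr q / (q * Ip q M g))" for x
  proof -
   have "norm (f x) / a * (norm (g x) / b) <= (norm (f x) / a) powr p / p + (norm (g x) / b) powr q / q"
    using p q ab by (intro Youngs_inequality) auto
   then have "a * b * (norm (f x) / a * (norm (g x) / b)) \<le>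
     a * b * (norm (f x) powr p / (p * Ip p M f) + norm (g x) powr q / (q * Ip q M g))"
    using ab by (intro mult_left_mono) (auto simp: powr_divide mult.commute)
   then show ?thesis using ab by simp
  qed
  then have "(LINT x|M. norm (f x) * norm (g x)) \<le>
    (LINT x|M. a * b * (norm (f x) powr p / (p * Ip p M f) + norm (g x) powr q / (q * Ip q M g)))"
   using LpM_integrable[OF f] LpM_integrable[OF g] by (intro integral_mono int) auto
  also have "\<dots> = a * b * (Ip p M f / (p * Ip p M f) + Ip q M g / (q * Ip q M g))"
   using LpM_integrable[OF f] LpM_integrable[OF g] by (simp add: Ip_def)
  also have "\<dots> = a * b" using pos q by simp
  finally show ?thesis by (simp add: a_def b_def)
 qed
qed

lemma Holder_inner:
 fixes f g :: "'a => 'b::euclidean_space"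
 assumes p: "1 < p" "q = p / (p - 1)" and f: "f \<in> LpM p M" and g: "g \<in> LpM q M"
 shows "integrable M (%x. g x \<bullet> f x)"
  and "\<bar>LINT x|M. g x \<bullet> f x\<bar> <= Ip q M g powr (1 / q) * Ip p M f powr (1 / p)"
proof -
 note [measurable] = LpM_measurable[OF f] LpM_measurable[OF g]
 have le: "\<bar>g x \<bullet> f x\<bar> <= norm (f x) * norm (g x)" for x
  using Cauchy_Schwarz_ineq2[of "g x" "f x"] by (simp add: mult.commute)
 show int: "integrable M (%x. g x \<bullet> f x)"
  by (rule Bochner_Integration.integrable_bound[OF Holder(1)[OF p f g]]) (use le in auto)
 have "\<bar>LINT x|M. g x \<bullet> f x\<bar> <= (LINT x|M. \<bar>g x \<bullet> f x\<bar>)" by (rule integral_abs_bound)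
 also have "\<dots> <= (LINT x|M. norm (f x) * norm (g x))"
  using le int Holder(1)[OF p f g] by (intro integral_mono) auto
 also note Holder(2)[OF p f g]
 finally show "\<bar>LINT x|M. g x \<bullet> f x\<bar> <= Ip q M g powr (1 / q) * Ip p M f powr (1 / p)"
  by (simp add: mult.commute)
qed

lemma tendsto_integral_Holder:
 fixes f :: "nat => 'a => 'b::euclidean_space"
 assumes p: "1 < p" "q = p / (p - 1)" and f: "\<And>n. f n \<in> LpM p M" "f0 \<in> LpM p M" and g: "g \<in> LpM q M"
  and lim: "(%n. Ip p M (%x. f n x - f0 x)) ----> 0"
 shows "(%n. LINT x|M. g x \<bullet> f n x) ----> (LINT x|M. g x \<bullet> f0 x)"
proof -
 have d: "(%x. f n x - f0 x) \<in> LpM p M" for n using p f by (intro LpM_diff) auto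
 have "(%n. Ip q M g powr (1 / q) * Ip p M (%x. f n x - f0 x) powr (1 / p)) ----> Ip q M g powr (1 / q) * 0 powr (1 / p)"
  using p by (intro tendsto_intros lim tendsto_powr') auto
 then have lim0: "(%n. Ip q M g powr (1 / q) * Ip p M (%x. f n x - f0 x) powr (1 / p)) ----> 0" by simp
 have "\<bar>(LINT x|M. g x \<bullet> f n x) - (LINT x|M. g x \<bullet> f0 x)\<bar> \<le>
   Ip q M g powr (1 / q) * Ip p M (%x. f n x - f0 x) powr (1 / p)" for n
 proof -
  have "(LINT x|M. g x \<bullet> f n x) - (LINT x|M. g x \<bullet> f0 x) = (LINT x|M. g x \<bullet> (f n x - f0 x))"
   unfolding inner_diff_right
   by (rule Bochner_Integration.integral_diff[symmetric]) (rule Holder_inner(1)[OF p f(1) g] Holder_inner(1)[OF p f(2) g])+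
  then show ?thesis using Holder_inner(2)[OF p d[of n] g] by (simp only:)
 qed
 then show ?thesis unfolding real_norm_def[symmetric] by (rule tendsto_if_diff_le[OF _ lim0])
qed

lemma norm_le_epsilon_powr:
 assumes "0 < e" "1 <= p" shows "norm a <= e + e powr (1 - p) * norm a powr p"
proof (cases "norm a <= e")
 case True
 have "0 <= e powr (1 - p) * norm a powr p" by simp
 then show ?thesis using True by linarith
next
 case False
 have "norm a powr (1 - p) <= e powr (1 - p)" using False assms by (intro powr_mono2') auto
 then have "norm a powr (1 - p) * norm a powr p <= e powr (1 - p) * norm a powr p"
  by (intro mult_right_mono) auto
 moreover have "norm a powr (1 - p) * norm a powr p = norm a"
  using False assms by (simp add: powr_add[symmetric])
 ultimately show ?thesis using assms by linarith
qed

lemma LpM_imp_integrable: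
 fixes f :: "'a => 'b::euclidean_space"
 assumes "finite_measure M" "1 <= p" "f \<in> LpM p M" shows "integrable M f"
proof -
 interpret finite_measure M by fact
 show ?thesis
  by (rule Bochner_Integration.integrable_bound[where f = "%x. 1 + norm (f x) powr p"])
   (use LpM_measurable[OF assms(3)] LpM_integrable[OF assms(3)] norm_le_epsilon_powr[OF _ assms(2), of 1] in
    \<open>auto intro: order_trans[OF _ abs_ge_self]\<close>)
qed

lemma integral_norm_le_epsilon:
 fixes f :: "'a => 'b::euclidean_space"
 assumes "finite_measure M" "1 <= p" "f \<in> LpM p M" "0 < e"
 shows "(LINT x|M. norm (f x)) <= e * measure M (space M) + e powr (1 - p) * Ip p M f"
proof -
 interpret finite_measure M by fact
 have "(LINT x|M. norm (f x)) <= (LINT x|M. e + e powr (1 - p) * norm (f x) powr p)"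
  using LpM_imp_integrable[OF assms(1-3)] LpM_integrable[OF assms(3)] norm_le_epsilon_powr[OF assms(4,2)]
  by (intro integral_mono) auto
 also have "\<dots> = e * measure M (space M) + e powr (1 - p) * Ip p M f"
  using LpM_integrable[OF assms(3)] by (simp add: Ip_def mult.commute)
 finally show ?thesis .
qed

lemma Lp_tendsto_imp_L1_tendsto:
 fixes f :: "nat => 'a => 'b::euclidean_space"
 assumes M: "finite_measure M" and p: "1 <= p" and f: "\<And>n. f n \<in> LpM p M"
  and lim: "(%n. Ip p M (f n)) ----> 0"
 shows "(%n. LINT x|M. norm (f n x)) ----> 0"
proof (rule LIMSEQ_I)
 fix r :: real assume r: "0 < r"
 define m where "m = measure M (space M)"
 define e where "e = r / (2 * (m + 1))"
 have m: "0 <= m" by (simp add: m_def)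
 have e: "0 < e" using r m by (simp add: e_def)
 have em: "e * m < r / 2" using r m by (simp add: e_def field_simps)
 have "(%n. e powr (1 - p) * Ip p M (f n)) ----> e powr (1 - p) * 0" by (intro tendsto_intros lim)
 then have "\<forall>\<^sub>F n in sequentially. e powr (1 - p) * Ip p M (f n) < r / 2"
  using r by (intro order_tendstoD(2)) auto
 then obtain N where N: "\<And>n. n >= N ==> e powr (1 - p) * Ip p M (f n) < r / 2"
  by (auto simp: eventually_sequentially)
 have "norm ((LINT x|M. norm (f n x)) - 0) < r" if "n >= N" for n
  using integral_norm_le_epsilon[OF M p f e, of n] N[OF that] em by (simp add: m_def)
 then show "\<exists>no. \<forall>n\<ge>no. norm ((LINT x|M. norm (f n x)) - 0) < r" by blast
qed

lemma tendsto_integral_Lp: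
 fixes f :: "nat => 'a => 'b::euclidean_space"
 assumes M: "finite_measure M" and p: "1 <= p" and f: "\<And>n. f n \<in> LpM p M" "f0 \<in> LpM p M"
  and lim: "(%n. Ip p M (%x. f n x - f0 x)) ----> 0"
  and g: "g \<in> borel_measurable M" "\<And>x. norm (g x) <= B"
 shows "(%n. LINT x|M. g x *R f n x) ----> (LINT x|M. g x *R f0 x)"
proof -
 have d: "(%x. f n x - f0 x) \<in> LpM p M" for n using p f by (intro LpM_diff) auto
 have int: "integrable M (%x. g x *R h x)" if "h \<in> LpM p M" for h :: "'a => 'b"
 proof (rule Bochner_Integration.integrable_bound[where f = "%x. B * norm (h x)"])
  show "integrable M (%x. B * norm (h x))" using LpM_imp_integrable[OF M p that] by simp
  show "(%x. g x *R h x) \<in> borel_measurable M" using g(1) LpM_measurable[OF that] by simp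
  have "norm (g x *R h x) <= norm (B * norm (h x))" for x
  proof -
   have "norm (g x *R h x) = norm (g x) * norm (h x)" by simp
   also have "\<dots> <= B * norm (h x)" by (intro mult_right_mono g(2)) simp
   finally show ?thesis by simp
  qed
  then show "AE x in M. norm (g x *R h x) <= norm (B * norm (h x))" by simp
 qed
 have "(%n. B * (LINT x|M. norm (f n x - f0 x))) ----> B * 0"
  by (intro tendsto_intros Lp_tendsto_imp_L1_tendsto[OF M p d lim])
 then have l: "(%n. B * (LINT x|M. norm (f n x - f0 x))) ----> 0" by simp
 have "norm ((LINT x|M. g x *R f n x) - (LINT x|M. g x *R f0 x)) <= B * (LINT x|M. norm (f n x - f0 x))" for n
 proof -
  have "(LINT x|M. g x *R f n x) - (LINT x|M. g x *R f0 x) = (LINT x|M. g x *R (f n x - f0 x))"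
   using int[OF f(1)] int[OF f(2)] by (simp add: scaleR_diff_right)
  also have "norm \<dots> <= (LINT x|M. norm (g x *R (f n x - f0 x)))" by (rule integral_norm_bound)
  also have "\<dots> <= (LINT x|M. B * norm (f n x - f0 x))"
  proof (rule integral_mono)
   show "integrable M (%x. norm (g x *R (f n x - f0 x)))" using int[OF d] by (rule integrable_norm)
   show "integrable M (%x. B * norm (f n x - f0 x))"
    using LpM_imp_integrable[OF M p d] by (intro integrable_mult_right integrable_norm)
   show "norm (g x *R (f n x - f0 x)) <= B * norm (f n x - f0 x)" for x
    unfolding norm_scaleR real_norm_def[symmetric] by (intro mult_right_mono g(2)) simp
  qed
  finally show ?thesis by simp
 qed
 then show ?thesis by (rule tendsto_if_diff_le[OF _ l])
qed

subsection \<open>Completeness\<close>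

definition Lp_Cauchy :: "real => 'a measure => (nat => 'a => 'b::euclidean_space) => bool" where
 "Lp_Cauchy p M f \<longleftrightarrow> (\<forall>e>0. \<exists>N. \<forall>m\<ge>N. \<forall>n\<ge>N. Ip p M (%x. f m x - f n x) < e)"

text \<open>
 A fast subsequence converges almost everywhere, and Fatou's lemma turns the Cauchy property into
 convergence to the pointwise limit.
\<close>

lemma Lp_complete:
 fixes f :: "nat => 'a => 'b::euclidean_space"
 assumes M: "finite_measure M" and p: "1 <= p" and f: "\<And>n. f n \<in> LpM p M" and C: "Lp_Cauchy p M f"
 shows "\<exists>g\<in>LpM p M. (%n. Ip p M (%x. f n x - g x)) ----> 0"
proof -
 have fm [measurable]: "f n \<in> borel_measurable M" for n using LpM_measurable[OF f] .
 have d: "(%x. f m x - f n x) \<in> LpM p M" for m n using p f by (intro LpM_diff) auto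
 obtain r where r: "strict_mono r" "AE x in M. Cauchy (%i. f (r i) x)"
 proof (rule cauchy_L1_AE_cauchy_subseq[of M f])
  show "integrable M (f n)" for n using LpM_imp_integrable[OF M p f] .
  fix e :: real assume e: "0 < e"
  define \<mu> where "\<mu> = measure M (space M)"
  define d' where "d' = e / (2 * (\<mu> + 1))"
  have \<mu>: "0 <= \<mu>" by (simp add: \<mu>_def)
  have d': "0 < d'" "d' * \<mu> < e / 2" using e \<mu> by (auto simp: d'_def field_simps)
  obtain N where N: "\<And>m n. m >= N ==> n >= N ==> Ip p M (%x. f m x - f n x) < d' powr (p - 1) * (e / 2)"
  proof -
   have "0 < d' powr (p - 1) * (e / 2)" using d' e by simp
   then show ?thesis using C that unfolding Lp_Cauchy_def by blast
  qed
  have "(LINT x|M. norm (f i x - f j x)) < e" if "i >= N" "j >= N" for i j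
  proof -
   have "d' powr (1 - p) * Ip p M (%x. f i x - f j x) < d' powr (1 - p) * (d' powr (p - 1) * (e / 2))"
    using N[OF that] d' by (intro mult_strict_left_mono) auto
   also have "\<dots> = e / 2" using d' by (simp add: mult.assoc[symmetric] powr_add[symmetric])
   finally show ?thesis
    using integral_norm_le_epsilon[OF M p d d'(1), of i j] d'(2) by (simp add: \<mu>_def)
  qed
  then show "\<exists>N. \<forall>i\<ge>N. \<forall>j\<ge>N. (LINT x|M. norm (f i x - f j x)) < e" by blast
 qed (use that in blast)
 define g where "g x = lim (%i. f (r i) x)" for x
 have gm [measurable]: "g \<in> borel_measurable M" unfolding g_def by measurable
 have conv: "AE x in M. (%i. f (r i) x) ----> g x"
  using r(2) by eventually_elim (simp add: g_def Cauchy_convergent_iff convergent_LIMSEQ_iff)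
 have bound: "(\<integral>\<^sup>+x. ennreal (norm (f n x - g x) powr p) \<partial>M) <= ennreal e"
  if e: "0 < e" and N: "\<And>m. m >= N ==> Ip p M (%x. f n x - f m x) < e" for n N e
 proof -
  have "(\<integral>\<^sup>+x. ennreal (norm (f n x - g x) powr p) \<partial>M) =
    (\<integral>\<^sup>+x. liminf (%i. ennreal (norm (f n x - f (r i) x) powr p)) \<partial>M)"
  proof (rule nn_integral_cong_AE)
   show "AE x in M. ennreal (norm (f n x - g x) powr p) = liminf (%i. ennreal (norm (f n x - f (r i) x) powr p))"
    using conv
   proof eventually_elim
    case (elim x)
    have "(%i. norm (f n x - f (r i) x) powr p) ----> norm (f n x - g x) powr p"
     using elim p by (intro tendsto_powr' tendsto_intros) auto
    then have "(%i. ennreal (norm (f n x - f (r i) x) powr p)) ----> ennreal (norm (f n x - g x) powr p)"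
     by (rule tendsto_ennrealI)
    then show ?case by (rule lim_imp_Liminf[symmetric, OF sequentially_bot])
   qed
  qed
  also have "\<dots> <= liminf (%i. \<integral>\<^sup>+x. ennreal (norm (f n x - f (r i) x) powr p) \<partial>M)"
   by (intro nn_integral_liminf) simp
  also have "\<dots> = liminf (%i. ennreal (Ip p M (%x. f n x - f (r i) x)))"
   unfolding Ip_def using LpM_integrable[OF d] by (subst nn_integral_eq_integral) auto
  also have "\<dots> <= liminf (%i. ennreal e)"
  proof (rule Liminf_mono)
   have "Ip p M (%x. f n x - f (r i) x) < e" if "i >= N" for i
    using N seq_suble[OF r(1), of i] that by auto
   then show "\<forall>\<^sub>F i in sequentially. ennreal (Ip p M (%x. f n x - f (r i) x)) <= ennreal e"
    unfolding eventually_sequentially by (intro exI[of _ N] allI impI ennreal_leI less_imp_le)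
  qed
  also have "\<dots> = ennreal e" by (simp add: Liminf_const)
  finally show ?thesis .
 qed
 have diff: "(%x. f n x - g x) \<in> LpM p M \<and> Ip p M (%x. f n x - g x) <= e"
  if e: "0 < e" and N: "\<And>m. m >= N ==> Ip p M (%x. f n x - f m x) < e" for n N e
 proof -
  note b = bound[OF that]
  have "integrable M (%x. norm (f n x - g x) powr p)"
  proof (rule integrableI_bounded)
   show "(\<integral>\<^sup>+x. ennreal (norm (norm (f n x - g x) powr p)) \<partial>M) < \<infinity>"
    using le_less_trans[OF b ennreal_less_top] by simp
  qed simp
  then have L: "(%x. f n x - g x) \<in> LpM p M" by (simp add: LpM_def)
  have "ennreal (Ip p M (%x. f n x - g x)) <= ennreal e"
   unfolding Ip_def using b by (subst nn_integral_eq_integral[symmetric, OF LpM_integrable[OF L]]) auto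
  then show ?thesis using L e by simp
 qed
 obtain N1 where N1: "\<And>m n. m >= N1 ==> n >= N1 ==> Ip p M (%x. f m x - f n x) < 1"
  using C[unfolded Lp_Cauchy_def, rule_format, OF zero_less_one] by blast
 have "(%x. f N1 x - g x) \<in> LpM p M" using diff[of 1 N1 N1] N1 by auto
 from LpM_diff(1)[OF _ f[of N1] this] have "g \<in> LpM p M" using p by simp
 moreover have "(%n. Ip p M (%x. f n x - g x)) ----> 0"
 proof (rule LIMSEQ_I)
  fix e :: real assume "0 < e"
  then obtain N where N: "\<And>m n. m >= N ==> n >= N ==> Ip p M (%x. f m x - f n x) < e / 2"
   using C[unfolded Lp_Cauchy_def, rule_format, OF half_gt_zero] by blast
  have "norm (Ip p M (%x. f n x - g x) - 0) < e" if "n >= N" for n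
   using diff[of "e / 2" N n] N[OF that] \<open>0 < e\<close> Ip_nonneg[of p M "%x. f n x - g x"] by auto
  then show "\<exists>no. \<forall>n\<ge>no. norm (Ip p M (%x. f n x - g x) - 0) < e" by blast
 qed
 ultimately show ?thesis by blast
qed

subsection \<open>The duality map and uniform convexity\<close>

lemma norm_duality: "1 < p ==> norm (duality p \<xi>) = norm \<xi> powr (p - 1)"
proof (cases "\<xi> = 0")
 case False
 have "norm \<xi> powr (p - 2) * norm \<xi> = norm \<xi> powr (p - 2) * norm \<xi> powr 1" by simp
 also have "\<dots> = norm \<xi> powr (p - 1)" unfolding powr_add[symmetric] by (simp add: algebra_simps)
 finally show ?thesis by (simp add: duality_def)
qed (simp add: duality_def)

lemma duality_inner_self: "1 < p ==> duality p \<xi> \<bullet> \<xi> = norm \<xi> powr p"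
proof (cases "\<xi> = 0")
 case False
 have "\<xi> \<bullet> \<xi> = norm \<xi> powr 2" using False by (simp add: powr_numeral power2_norm_eq_inner)
 then have "duality p \<xi> \<bullet> \<xi> = norm \<xi> powr (p - 2) * norm \<xi> powr 2" by (simp add: duality_def)
 also have "\<dots> = norm \<xi> powr p" unfolding powr_add[symmetric] by simp
 finally show ?thesis .
qed (simp add: duality_def)

lemma continuous_duality:
 assumes "1 < p" shows "continuous_on UNIV (duality p :: 'b::euclidean_space => 'b)"
proof -
 have "isCont (duality p) x" for x :: 'b
 proof (cases "x = 0")
  case True
  have "((%y::'b. norm y powr (p - 1)) \<longlongrightarrow> norm (0::'b) powr (p - 1)) (at 0)"
   using assms by (intro tendsto_powr' tendsto_intros) auto
  then have "((%y::'b. norm y powr (p - 1)) \<longlongrightarrow> 0) (at 0)" by simp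
  then have "((duality p :: 'b => 'b) \<longlongrightarrow> 0) (at 0)"
   by (rule Lim_null_comparison[rotated]) (simp add: norm_duality assms)
  then show ?thesis using True by (simp add: isCont_def duality_def)
 next
  case False
  then show ?thesis unfolding duality_def by (intro continuous_intros) auto
 qed
 then show ?thesis by (simp add: continuous_at_imp_continuous_on)
qed

lemma duality_measurable [measurable]:
 assumes "1 < p" "f \<in> borel_measurable M"
 shows "(%x. duality p (f x)) \<in> borel_measurable M"
 using borel_measurable_continuous_onI[OF continuous_duality[OF assms(1)]] assms(2) by measurable

lemma norm_duality_powr:
 assumes "1 < p" "q = p / (p - 1)"
 shows "norm (duality p \<xi>) powr q = norm \<xi> powr p"
 using assms by (simp add: norm_duality powr_powr)

lemma duality_Lq:
 fixes f :: "'a => 'b::euclidean_space"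
 assumes "1 < p" "q = p / (p - 1)" "f \<in> LpM p M"
 shows "(%x. duality p (f x)) \<in> LpM q M" and "Ip q M (%x. duality p (f x)) = Ip p M f"
 using assms duality_measurable[OF assms(1) LpM_measurable[OF assms(3)]]
 by (auto simp: LpM_def Ip_def norm_duality_powr)

text \<open>
 Convexity of \<open>norm \<xi> powr p\<close> expressed by its tangent; it is Young's inequality in disguise.
\<close>

lemma duality_subgradient:
 assumes "1 < p"
 shows "norm \<xi> powr p + p * (duality p \<xi> \<bullet> (\<eta> - \<xi>)) <= norm \<eta> powr p"
proof -
 define q where "q = p / (p - 1)"
 have q: "1 < q" "1 / p + 1 / q = 1" unfolding q_def using assms by (simp_all add: field_simps)
 have "duality p \<xi> \<bullet> \<eta> <= norm (duality p \<xi>) * norm \<eta>" by (rule norm_cauchy_schwarz)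
 also have "\<dots> <= norm (duality p \<xi>) powr q / q + norm \<eta> powr p / p"
  using Youngs_inequality[of q p "norm (duality p \<xi>)" "norm \<eta>"] assms q by simp
 also have "\<dots> = norm \<xi> powr p * (1 - 1 / p) + norm \<eta> powr p / p"
 proof -
  have "1 - 1 / p = 1 / q" using q by linarith
  then show ?thesis by (simp add: norm_duality_powr[OF assms q_def])
 qed
 finally have "p * (duality p \<xi> \<bullet> \<eta>) <= p * (norm \<xi> powr p * (1 - 1 / p) + norm \<eta> powr p / p)"
  using assms by (intro mult_left_mono) auto
 also have "\<dots> = (p - 1) * norm \<xi> powr p + norm \<eta> powr p" using assms by (simp add: field_simps)
 finally show ?thesis using duality_inner_self[OF assms, of \<xi>] by (simp add: inner_diff_right algebra_simps)
qed

lemma powr_midpoint_strict: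
 fixes x y :: real
 assumes "1 < p" "0 <= x" "x < y"
 shows "((x + y) / 2) powr p < (x powr p + y powr p) / 2"
proof -
 define m where "m = (x + y) / 2"
 have xm: "x < m" "m < y" using assms by (auto simp: m_def)
 have cont: "continuous_on {a..b} (%z::real. z powr p)" if "0 <= a" for a b
  using that assms by (intro continuous_on_powr' continuous_intros) auto
 have der: "((%z::real. z powr p) has_real_derivative p * z powr (p - 1)) (at z)" if "0 < z" for z
  using that by (rule has_real_derivative_powr)
 have dif: "(%z::real. z powr p) differentiable (at z)" if "0 < z" for z
  using der[OF that] unfolding real_differentiable_def by blast
 obtain l u where u: "x < u" "u < m" "((%z::real. z powr p) has_real_derivative l) (at u)" "m powr p - x powr p = (m - x) * l"
 proof -
  have "(%z::real. z powr p) differentiable (at z)" if "x < z" "z < m" for z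
   using dif assms that by simp
  from MVT[OF xm(1) cont[OF assms(2)] this] show ?thesis using that by blast
 qed
 obtain l' v where v: "m < v" "v < y" "((%z::real. z powr p) has_real_derivative l') (at v)" "y powr p - m powr p = (y - m) * l'"
 proof -
  have "(%z::real. z powr p) differentiable (at z)" if "m < z" "z < y" for z
   using dif assms xm that by simp
  moreover have "0 <= m" using assms xm by simp
  ultimately show ?thesis using MVT[OF xm(2) cont] that by blast
 qed
 have "l = p * u powr (p - 1)" "l' = p * v powr (p - 1)"
  using u v assms xm der by (auto intro!: DERIV_unique[OF _ der])
 moreover have "u powr (p - 1) < v powr (p - 1)" using u v assms by (intro powr_less_mono2) auto
 ultimately have "l < l'" using assms by simp
 moreover have "y - m = m - x" by (simp add: m_def field_simps)
 ultimately have "(m - x) * l < (y - m) * l'" using xm by simp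
 then show ?thesis using u v by (simp add: m_def[symmetric])
qed

definition convexity_gap :: "real => 'b::euclidean_space => 'b => real" where
 "convexity_gap p a b = (norm a powr p + norm b powr p) / 2 - norm ((1/2) *R (a + b)) powr p"

lemma powr_midpoint:
 fixes x y :: real
 assumes "1 < p" "0 <= x" "0 <= y"
 shows "((x + y) / 2) powr p <= (x powr p + y powr p) / 2"
 using powr_midpoint_strict[OF assms(1,2), of y] powr_midpoint_strict[OF assms(1,3), of x]
 by (cases x y rule: linorder_cases) (auto simp: add.commute)

lemma convexity_gap_nonneg: assumes "1 < p" shows "0 <= convexity_gap p a b"
proof -
 have "norm ((1/2) *R (a + b)) powr p <= ((norm a + norm b) / 2) powr p"
  using norm_triangle_ineq[of a b] assms by (intro powr_mono2) auto
 also have "\<dots> <= (norm a powr p + norm b powr p) / 2" using assms by (intro powr_midpoint) auto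
 finally show ?thesis by (simp add: convexity_gap_def)
qed

lemma convexity_gap_pos: assumes "1 < p" "a \<noteq> b" shows "0 < convexity_gap p a b"
proof (rule ccontr)
 assume "\<not> ?thesis"
 then have D: "(norm a powr p + norm b powr p) / 2 <= norm ((1/2) *R (a + b)) powr p"
  by (simp add: convexity_gap_def)
 have n: "norm ((1/2) *R (a + b)) = norm (a + b) / 2" by simp
 have tri: "norm (a + b) / 2 <= (norm a + norm b) / 2" using norm_triangle_ineq[of a b] by simp
 have le: "norm ((1/2) *R (a + b)) powr p <= ((norm a + norm b) / 2) powr p"
  unfolding n using tri assms by (intro powr_mono2) auto
 have "norm a = norm b"
 proof (rule ccontr)
  assume "norm a \<noteq> norm b"
  then have "((norm a + norm b) / 2) powr p < (norm a powr p + norm b powr p) / 2"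
   using powr_midpoint_strict[OF assms(1) norm_ge_zero[of a], of "norm b"]
    powr_midpoint_strict[OF assms(1) norm_ge_zero[of b], of "norm a"]
   by (cases "norm a" "norm b" rule: linorder_cases) (auto simp: add.commute)
  then show False using D le by linarith
 qed
 moreover have "norm (a + b) = norm a + norm b"
 proof (rule ccontr)
  assume "norm (a + b) \<noteq> norm a + norm b"
  then have "norm (a + b) / 2 < (norm a + norm b) / 2" using norm_triangle_ineq[of a b] by simp
  then have "norm ((1/2) *R (a + b)) powr p < ((norm a + norm b) / 2) powr p"
   unfolding n using assms by (intro powr_less_mono2) auto
  then show False using D powr_midpoint[OF assms(1) norm_ge_zero[of a] norm_ge_zero[of b]] by linarith
 qed
 then have "norm a *R b = norm b *R a" by (simp only: norm_triangle_eq)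
 ultimately have "norm b *R (b - a) = 0" by (simp add: scaleR_diff_right)
 then have "norm b = 0 \<or> b = a" by simp
 then show False using assms(2) \<open>norm a = norm b\<close> by auto
qed

text \<open>
 By homogeneity one may restrict to pairs with \<open>norm a powr p + norm b powr p = 1\<close>. Those whose distance is
 not small form a compact set, on which the convexity gap has a positive minimum by strict convexity. This
 covers exponents below and above 2 at once.
\<close>

lemma uniform_convexity_powr:
 assumes p: "1 < p" and e: "0 < e"
 shows "\<exists>C\<ge>0. \<forall>a b::'b::euclidean_space.
      norm (a - b) powr p <= e * (norm a powr p + norm b powr p) + C * convexity_gap p a b"
proof -
 define K where "K = {z::'b \<times> 'b. norm (fst z) powr p + norm (snd z) powr p = 1 \<and> e <= norm (fst z - snd z) powr p}"
 have contn: "continuous_on UNIV (%z. norm (f z) powr p)" if "continuous_on UNIV f" for f :: "'b \<times> 'b => 'b"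
  using p that by (intro continuous_on_powr' continuous_intros) auto
 have cf: "continuous_on UNIV (%z::'b\<times>'b. fst z)" "continuous_on UNIV (%z::'b\<times>'b. snd z)"
  "continuous_on UNIV (%z::'b\<times>'b. fst z - snd z)" "continuous_on UNIV (%z::'b\<times>'b. (1/2) *R (fst z + snd z))"
  by (intro continuous_intros)+
 have "closed K"
  unfolding K_def
  by (intro closed_Collect_conj closed_Collect_eq closed_Collect_le continuous_intros contn cf)
 moreover have "bounded K"
 proof -
  have "norm z <= 2" if "z \<in> K" for z
  proof -
   have "norm (fst z) powr p <= 1" "norm (snd z) powr p <= 1"
   proof -
    have "norm (fst z) powr p + norm (snd z) powr p = 1" using that by (simp add: K_def)
    then show "norm (fst z) powr p <= 1" "norm (snd z) powr p <= 1"
     using powr_ge_zero[of "norm (fst z)" p] powr_ge_zero[of "norm (snd z)" p] by linarith+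
   qed
   then have "norm (fst z) <= 1" "norm (snd z) <= 1"
    using p powr_less_mono2[of p 1] by (force simp: not_le[symmetric])+
   then show ?thesis using norm_Pair_le[of "fst z" "snd z"] by simp
  qed
  then show ?thesis by (rule boundedI)
 qed
 ultimately have "compact K" by (simp add: compact_eq_bounded_closed)
 define D where "D z = convexity_gap p (fst z) (snd z)" for z :: "'b \<times> 'b"
 have contD: "continuous_on K D"
  unfolding D_def convexity_gap_def
  by (intro continuous_intros contn[THEN continuous_on_subset] cf) auto
 have "\<exists>m>0. \<forall>z\<in>K. m <= D z"
 proof (cases "K = {}")
  case False
  obtain z0 where z0: "z0 \<in> K" "\<And>z. z \<in> K ==> D z0 <= D z"
   using continuous_attains_inf[OF \<open>compact K\<close> False contD] by blast
  have "fst z0 \<noteq> snd z0" using z0(1) e p by (auto simp: K_def)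
  then show ?thesis using z0 convexity_gap_pos[OF p] unfolding D_def by blast
 qed (auto intro: exI[of _ 1])
 then obtain m where m: "0 < m" "\<And>z. z \<in> K ==> m <= D z" by blast
 define C where "C = 2 powr p / m"
 have C: "0 <= C" using m by (simp add: C_def)
 have main: "norm (a - b) powr p <= e * (norm a powr p + norm b powr p) + C * convexity_gap p a b" for a b :: 'b
 proof (cases "a = 0 \<and> b = 0")
  case True
  then show ?thesis by (simp add: convexity_gap_def)
 next
  case False
  define s where "s = norm a powr p + norm b powr p"
  have s: "0 < s" using False unfolding s_def by (auto intro: add_pos_nonneg add_nonneg_pos)
  define t where "t = s powr (- 1 / p)"
  have t: "0 < t" "t powr p = 1 / s"
   unfolding t_def powr_powr using s p by (simp_all add: powr_minus_divide)
  have sc: "norm (t *R x) powr p = norm x powr p / s" for x :: 'b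
   using t by (simp add: powr_mult)
  show ?thesis
  proof (cases "norm (a - b) powr p <= e * s")
   case True
   have "0 <= C * convexity_gap p a b" by (intro mult_nonneg_nonneg C convexity_gap_nonneg[OF p])
   then show ?thesis using True unfolding s_def by linarith
  next
   case False
   have d1: "norm (t *R a - t *R b) powr p = norm (a - b) powr p / s"
    unfolding scaleR_diff_right[symmetric] by (rule sc)
   have "(t *R a, t *R b) \<in> K" using False s unfolding K_def mem_Collect_eq fst_conv snd_conv d1 sc
    by (simp add: s_def add_divide_distrib[symmetric] field_simps)
   then have "m <= convexity_gap p (t *R a) (t *R b)" using m(2) unfolding D_def by fastforce
   also have "\<dots> = convexity_gap p a b / s"
   proof -
    have "(1/2) *R (t *R a + t *R b) = t *R ((1/2) *R (a + b))" by (simp add: algebra_simps)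
    then show ?thesis unfolding convexity_gap_def sc by (simp only: sc) (simp add: diff_divide_distrib add_divide_distrib)
   qed
   finally have "m * s <= convexity_gap p a b" using s by (simp add: pos_le_divide_eq)
   then have "C * (m * s) <= C * convexity_gap p a b" using C by (intro mult_left_mono)
   moreover have "C * (m * s) = 2 powr p * s" using m by (simp add: C_def)
   moreover have "norm (a - b) powr p <= 2 powr p * s"
    using norm_powr_add[of p a "- b"] p unfolding s_def by simp
   moreover have "0 <= e * s" using e s by simp
   ultimately show ?thesis unfolding s_def by linarith
  qed
 qed
 show ?thesis using C main by blast
qed

lemma linear_le_epsilon_powr:
 assumes "1 < p" "0 < d" "0 <= C"
 shows "\<exists>K\<ge>0. \<forall>t\<ge>0. C * t <= d * t powr p + (K::real)"
proof -
 define T where "T = (C / d) powr (1 / (p - 1))"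
 have T: "0 <= T" by (simp add: T_def)
 have "C * t <= d * t powr p + C * T" if "0 <= t" for t
 proof (cases "t <= T")
  case True
  have "0 <= d * t powr p" using assms by simp
  moreover have "C * t <= C * T" using True assms by (intro mult_left_mono)
  ultimately show ?thesis by linarith
 next
  case False
  then have "T powr (p - 1) <= t powr (p - 1)" using T assms by (intro powr_mono2) auto
  moreover have "T powr (p - 1) = C / d" using assms by (simp add: T_def powr_powr)
  ultimately have "C <= d * t powr (p - 1)" using assms by (simp add: field_simps)
  then have "C * t <= d * t powr (p - 1) * t" using that by (intro mult_right_mono)
  also have "t powr (p - 1) * t = t powr (p - 1) * t powr 1" using that by simp
  then have "d * t powr (p - 1) * t = d * t powr p" unfolding powr_add[symmetric] by simp
  finally show ?thesis using assms T by (simp add: add_increasing2)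
 qed
 then show ?thesis using assms T by (intro exI[of _ "C * T"]) auto
qed

subsection \<open>Minimisation over closed subspaces\<close>

text \<open>
 Closed subspaces, where closedness is stated as completeness: functions are not identified almost
 everywhere, so a limit need not itself lie in the subspace, but some representative does.
\<close>

definition Lp_subspace :: "real => 'a measure => ('a => 'b::euclidean_space) set => bool" where
 "Lp_subspace p M V \<longleftrightarrow> V \<subseteq> LpM p M \<and> (%_. 0) \<in> V \<and>
   (\<forall>f\<in>V. \<forall>g\<in>V. (%x. f x + g x) \<in> V) \<and> (\<forall>c. \<forall>f\<in>V. (%x. c *R f x) \<in> V) \<and>
   (\<forall>f. (\<forall>n. f n \<in> V) \<and> Lp_Cauchy p M f \<longrightarrow> (\<exists>g\<in>V. (%n. Ip p M (%x. f n x - g x)) ----> 0))"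

definition Lp_functional :: "real => 'a measure => ('a => 'b::euclidean_space) set => (('a => 'b) => real) => bool" where
 "Lp_functional p M V F \<longleftrightarrow> (\<forall>f\<in>V. \<forall>g\<in>V. F (%x. f x + g x) = F f + F g) \<and>
   (\<forall>c. \<forall>f\<in>V. F (%x. c *R f x) = c * F f) \<and> (\<exists>C. \<forall>f\<in>V. \<bar>F f\<bar> <= C * Ip p M f powr (1 / p))"

lemma Lp_subspaceD:
 assumes "Lp_subspace p M V"
 shows "f \<in> V ==> f \<in> LpM p M" "(%_. 0) \<in> V" "f \<in> V ==> g \<in> V ==> (%x. f x + g x) \<in> V"
  "f \<in> V ==> (%x. c *R f x) \<in> V"
  "(\<And>n. h n \<in> V) ==> Lp_Cauchy p M h ==> \<exists>g\<in>V. (%n. Ip p M (%x. h n x - g x)) ----> 0"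
 using assms unfolding Lp_subspace_def by auto

lemma Lp_subspace_diff:
 assumes "Lp_subspace p M V" "f \<in> V" "g \<in> V" shows "(%x. f x - g x) \<in> V"
 using Lp_subspaceD(3)[OF assms(1,2) Lp_subspaceD(4)[OF assms(1,3), of "-1"]] by simp

lemma Lp_subspace_UNIV:
 assumes "finite_measure M" "1 <= p" shows "Lp_subspace p M (LpM p M)"
 unfolding Lp_subspace_def using assms Lp_complete[OF assms] LpM_add(1)[of p] LpM_scale(1) by auto

lemma Ip_midpoint:
 fixes f g :: "'a => 'b::euclidean_space"
 assumes p: "1 < p" and f: "f \<in> LpM p M" and g: "g \<in> LpM p M" and "0 <= C"
  and C: "\<And>a b::'b. norm (a - b) powr p <= e * (norm a powr p + norm b powr p) + C * convexity_gap p a b"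
 shows "Ip p M (%x. f x - g x) <= e * (Ip p M f + Ip p M g) +
   C * ((Ip p M f + Ip p M g) / 2 - Ip p M (%x. (1/2) *R (f x + g x)))"
proof -
 have m: "(%x. (1/2) *R (f x + g x)) \<in> LpM p M" using p f g by (intro LpM_scale LpM_add) auto
 have d: "(%x. f x - g x) \<in> LpM p M" using p f g by (intro LpM_diff) auto
 note i = LpM_integrable[OF f] LpM_integrable[OF g] LpM_integrable[OF m]
 have "Ip p M (%x. f x - g x) <= (LINT x|M. e * (norm (f x) powr p + norm (g x) powr p) +
   C * ((norm (f x) powr p + norm (g x) powr p) / 2 - norm ((1/2) *R (f x + g x)) powr p))"
  unfolding Ip_def using C[unfolded convexity_gap_def] i
  by (intro integral_mono LpM_integrable[OF d] Bochner_Integration.integrable_add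
   integrable_mult_right Bochner_Integration.integrable_diff integrable_divide_zero) auto
 also have "\<dots> = e * (Ip p M f + Ip p M g) +
   C * ((Ip p M f + Ip p M g) / 2 - Ip p M (%x. (1/2) *R (f x + g x)))"
  unfolding Ip_def using i by (simp del: norm_scaleR)
 finally show ?thesis .
qed

lemma Ip_subgradient:
 fixes f g :: "'a => 'b::euclidean_space"
 assumes p: "1 < p" and f: "f \<in> LpM p M" and g: "g \<in> LpM p M"
 shows "Ip p M f + p * (LINT x|M. duality p (f x) \<bullet> (g x - f x)) <= Ip p M g"
proof -
 have d: "(%x. g x - f x) \<in> LpM p M" using p f g by (intro LpM_diff) auto
 have i: "integrable M (%x. duality p (f x) \<bullet> (g x - f x))"
  using Holder_inner(1)[OF p refl d duality_Lq(1)[OF p refl f]] .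
 have "(LINT x|M. norm (f x) powr p + p * (duality p (f x) \<bullet> (g x - f x))) <= Ip p M g"
  unfolding Ip_def using LpM_integrable[OF f] LpM_integrable[OF g] i duality_subgradient[OF p]
  by (intro integral_mono Bochner_Integration.integrable_add integrable_mult_right) auto
 then show ?thesis using LpM_integrable[OF f] i by (simp add: Ip_def)
qed

text \<open>
 The functional is bounded below since \<open>F\<close> grows at most linearly. Uniform convexity makes a minimising
 sequence Cauchy, and the subgradient inequality makes the functional lower semicontinuous. The shift \<open>h0\<close>
 covers distance minimisation (\<open>F = 0\<close>) and Riesz representation (\<open>h0 = 0\<close>) by one argument.
\<close>

lemma Lp_minimizer:
 fixes h0 :: "'a => 'b::euclidean_space"
 assumes p: "1 < p" and V: "Lp_subspace p M V" and h0: "h0 \<in> LpM p M" and F: "Lp_functional p M V F"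
 shows "\<exists>v\<in>V. \<forall>w\<in>V. Ip p M (%x. h0 x + v x) / p - F v <= Ip p M (%x. h0 x + w x) / p - F w"
proof -
 define J where "J v = Ip p M (%x. h0 x + v x) / p - F v" for v
 have Fadd: "F (%x. f x + g x) = F f + F g" if "f \<in> V" "g \<in> V" for f g
  using F that unfolding Lp_functional_def by blast
 have Fsc: "F (%x. c *R f x) = c * F f" if "f \<in> V" for f c
  using F that unfolding Lp_functional_def by blast
 obtain C0 where C0: "\<And>f. f \<in> V ==> \<bar>F f\<bar> <= C0 * Ip p M f powr (1 / p)"
  using F unfolding Lp_functional_def by blast
 define C where "C = \<bar>C0\<bar>"
 have C: "0 <= C" "\<And>f. f \<in> V ==> \<bar>F f\<bar> <= C * Ip p M f powr (1 / p)"
 proof -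
  show "\<bar>F f\<bar> <= C * Ip p M f powr (1 / p)" if "f \<in> V" for f
   unfolding C_def by (rule order_trans[OF C0[OF that] mult_right_mono]) auto
 qed (simp add: C_def)
 note VL = Lp_subspaceD(1)[OF V]
 have hV: "(%x. h0 x + v x) \<in> LpM p M" if "v \<in> V" for v using p h0 VL[OF that] by (intro LpM_add) auto
 define \<delta> where "\<delta> = 1 / (2 * p * 2 powr p)"
 have \<delta>: "0 < \<delta>" using p by (simp add: \<delta>_def)
 obtain K where K: "0 <= K" "\<And>t. 0 <= t ==> C * t <= \<delta> * t powr p + K"
  using linear_le_epsilon_powr[OF p \<delta> C(1)] by blast
 define K' where "K' = K + Ip p M h0 / (2 * p)"
 have lower: "Ip p M (%x. h0 x + v x) / (2 * p) - K' <= J v" if v: "v \<in> V" for v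
 proof -
  have "F v <= C * Ip p M v powr (1 / p)" using C(2)[OF v] by linarith
  also have "\<dots> <= \<delta> * (Ip p M v powr (1 / p)) powr p + K" by (intro K) simp
  also have "(Ip p M v powr (1 / p)) powr p = Ip p M v" using p by (simp add: powr_powr)
  also have "Ip p M v <= 2 powr p * (Ip p M (%x. h0 x + v x) + Ip p M h0)"
   using Ip_diff_le[of p "%x. h0 x + v x" M h0] p hV[OF v] h0 by simp
  also have "\<delta> * (2 powr p * (Ip p M (%x. h0 x + v x) + Ip p M h0)) + K =
    Ip p M (%x. h0 x + v x) / (2 * p) + K'"
   using p by (simp add: \<delta>_def K'_def field_simps)
  finally have "F v <= Ip p M (%x. h0 x + v x) / (2 * p) + K'" using \<delta> by simp
  moreover have "Ip p M (%x. h0 x + v x) / p = Ip p M (%x. h0 x + v x) / (2 * p) + Ip p M (%x. h0 x + v x) / (2 * p)"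
   by simp
  ultimately show ?thesis unfolding J_def by linarith
 qed
 have bdd: "bdd_below (J ` V)"
 proof (rule bdd_belowI2)
  fix v assume "v \<in> V"
  moreover have "0 <= Ip p M (%x. h0 x + v x) / (2 * p)" using p by simp
  ultimately show "- K' <= J v" using lower[of v] by linarith
 qed
 define m where "m = Inf (J ` V)"
 have ml: "m <= J v" if "v \<in> V" for v using that bdd unfolding m_def by (rule cINF_lower[rotated])
 have "\<exists>v\<in>V. J v < m + 1 / real (Suc n)" for n
 proof -
  have "Inf (J ` V) < m + 1 / real (Suc n)" by (simp add: m_def)
  then show ?thesis using cInf_lessD[of "J ` V"] Lp_subspaceD(2)[OF V] by blast
 qed
 then obtain v where v: "\<And>n. v n \<in> V" "\<And>n. J (v n) < m + 1 / real (Suc n)" by metis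
 define B where "B = 2 * p * (m + 1 + K')"
 have B: "Ip p M (%x. h0 x + v n x) <= B" for n
 proof -
  have "1 / real (Suc n) <= 1" by simp
  then have "Ip p M (%x. h0 x + v n x) / (2 * p) <= m + 1 + K'" using lower[OF v(1)[of n]] v(2)[of n] by linarith
  then show ?thesis using p by (simp add: B_def field_simps)
 qed
 have B0: "0 <= B" using order_trans[OF Ip_nonneg B] .
 have gap: "(Ip p M (%x. h0 x + v i x) + Ip p M (%x. h0 x + v j x)) / 2 -
   Ip p M (%x. (1/2) *R ((h0 x + v i x) + (h0 x + v j x))) <= p * (1 / real (Suc i) + 1 / real (Suc j)) / 2" for i j
 proof -
  define u where "u = (%x. (1/2) *R (v i x + v j x))"
  have u: "u \<in> V" unfolding u_def by (intro Lp_subspaceD(3,4)[OF V] v)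
  have Fu: "F u = (F (v i) + F (v j)) / 2"
   unfolding u_def by (simp add: Fsc[OF Lp_subspaceD(3)[OF V v(1) v(1)]] Fadd[OF v(1) v(1)])
  have eq: "(%x. (1/2) *R ((h0 x + v i x) + (h0 x + v j x))) = (%x. h0 x + u x)"
   unfolding u_def by (intro ext) (simp add: algebra_simps flip: scaleR_2)
  have JJ: "J (v i) + J (v j) <= 2 * J u + (1 / real (Suc i) + 1 / real (Suc j))"
   using v(2)[of i] v(2)[of j] ml[OF u] by linarith
  have "(J (v i) + J (v j)) / 2 - J u <= (1 / real (Suc i) + 1 / real (Suc j)) / 2"
  proof -
   have "A / 2 - B <= S / 2" if "A <= 2 * B + S" for A B S :: real using that by linarith
   from this[OF JJ] show ?thesis .
  qed
  then have "p * ((J (v i) + J (v j)) / 2 - J u) <= p * ((1 / real (Suc i) + 1 / real (Suc j)) / 2)"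
   using p by (intro mult_left_mono) auto
  moreover have "p * ((J (v i) + J (v j)) / 2 - J u) =
   (Ip p M (%x. h0 x + v i x) + Ip p M (%x. h0 x + v j x)) / 2 - Ip p M (%x. h0 x + u x)"
   unfolding J_def Fu using p by (simp add: field_simps)
  ultimately show ?thesis unfolding eq by simp
 qed
 have "Lp_Cauchy p M v"
  unfolding Lp_Cauchy_def
 proof (intro allI impI)
  fix e :: real assume e: "0 < e"
  define e' where "e' = e / (4 * (B + 1))"
  have e': "0 < e'" "e' * (2 * B) < e / 2" using e B0 by (auto simp: e'_def field_simps)
  obtain C' where C': "0 <= C'" "\<And>a b::'b. norm (a - b) powr p <= e' * (norm a powr p + norm b powr p) + C' * convexity_gap p a b"
   using uniform_convexity_powr[OF p e'(1)] by blast
  obtain N where N: "0 < N" "C' * p / real N < e / 2"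
  proof -
   obtain N :: nat where N: "2 * C' * p / e < real N" using reals_Archimedean2 by blast
   then have "2 * C' * p / e < real (Suc N)" by simp
   then have "C' * p / real (Suc N) < e / 2" using e by (simp add: field_simps del: of_nat_Suc)
   then show ?thesis using that[of "Suc N"] by simp
  qed
  have "Ip p M (%x. v i x - v j x) < e" if "i >= N" "j >= N" for i j
  proof -
   have "Ip p M (%x. v i x - v j x) = Ip p M (%x. (h0 x + v i x) - (h0 x + v j x))" by simp
   also have "\<dots> <= e' * (Ip p M (%x. h0 x + v i x) + Ip p M (%x. h0 x + v j x)) +
     C' * ((Ip p M (%x. h0 x + v i x) + Ip p M (%x. h0 x + v j x)) / 2 -
      Ip p M (%x. (1/2) *R ((h0 x + v i x) + (h0 x + v j x))))"
    by (rule Ip_midpoint[OF p hV[OF v(1)] hV[OF v(1)] C'])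
   also have "\<dots> <= e' * (2 * B) + C' * (p / real N)"
   proof (intro add_mono mult_left_mono)
    show "Ip p M (%x. h0 x + v i x) + Ip p M (%x. h0 x + v j x) <= 2 * B" using B[of i] B[of j] by linarith
    have "1 / real (Suc i) <= 1 / real N" "1 / real (Suc j) <= 1 / real N"
     using N(1) that by (auto intro!: divide_left_mono)
    then have "p * (1 / real (Suc i) + 1 / real (Suc j)) / 2 <= p * (1 / real N + 1 / real N) / 2"
     using p by (intro divide_right_mono mult_left_mono add_mono) auto
    then show "(Ip p M (%x. h0 x + v i x) + Ip p M (%x. h0 x + v j x)) / 2 -
      Ip p M (%x. (1/2) *R ((h0 x + v i x) + (h0 x + v j x))) <= p / real N"
     by (intro order_trans[OF gap]) simp
   qed (use e' C' in auto)
   also have "\<dots> < e" using e'(2) N(2) unfolding times_divide_eq_right by linarith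
   finally show ?thesis .
  qed
  then show "\<exists>N. \<forall>i\<ge>N. \<forall>j\<ge>N. Ip p M (%x. v i x - v j x) < e" by blast
 qed
 from Lp_subspaceD(5)[OF V v(1) this]
 obtain v0 where v0: "v0 \<in> V" and lim: "(%n. Ip p M (%x. v n x - v0 x)) ----> 0" by blast
 have limF: "(%n. F (v n)) ----> F v0"
 proof (rule tendsto_if_diff_le)
  fix n
  have "F (v n) - F v0 = F (%x. v n x - v0 x)"
   using Fadd[OF Lp_subspace_diff[OF V v(1)[of n] v0] v0] by simp
  then show "norm (F (v n) - F v0) <= C * Ip p M (%x. v n x - v0 x) powr (1 / p)"
   using C(2)[OF Lp_subspace_diff[OF V v(1)[of n] v0]] by simp
  have "(%n. C * Ip p M (%x. v n x - v0 x) powr (1 / p)) ----> C * 0 powr (1 / p)"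
   using p by (intro tendsto_intros tendsto_powr' lim) auto
  then show "(%n. C * Ip p M (%x. v n x - v0 x) powr (1 / p)) ----> 0" by simp
 qed
 define g where "g = (%x. h0 x + v0 x)"
 have g: "g \<in> LpM p M" unfolding g_def by (rule hV[OF v0])
 have lim': "(%n. Ip p M (%x. (h0 x + v n x) - g x)) ----> 0" using lim by (simp add: g_def)
 have dg: "(%x. duality p (g x)) \<in> LpM (p / (p - 1)) M" by (rule duality_Lq(1)[OF p refl g])
 have limd: "(%n. LINT x|M. duality p (g x) \<bullet> (h0 x + v n x)) ----> (LINT x|M. duality p (g x) \<bullet> g x)"
  by (rule tendsto_integral_Holder[OF p refl hV[OF v(1)] g dg lim'])
 have "Ip p M g / p - F v0 <= m"
 proof (rule LIMSEQ_le)
  have "(%n. m + 1 / real (Suc n) - ((LINT x|M. duality p (g x) \<bullet> (h0 x + v n x)) - (LINT x|M. duality p (g x) \<bullet> g x)) + F (v n) - F v0)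
    ----> m + 0 - ((LINT x|M. duality p (g x) \<bullet> g x) - (LINT x|M. duality p (g x) \<bullet> g x)) + F v0 - F v0"
   using LIMSEQ_inverse_real_of_nat by (intro tendsto_intros limF limd) (simp add: inverse_eq_divide)
  then show "(%n. m + 1 / real (Suc n) - ((LINT x|M. duality p (g x) \<bullet> (h0 x + v n x)) - (LINT x|M. duality p (g x) \<bullet> g x)) + F (v n) - F v0) ----> m"
   by simp
  show "(%n. Ip p M g / p - F v0) ----> Ip p M g / p - F v0" by simp
  have "Ip p M g / p - F v0 <= m + 1 / real (Suc n) - ((LINT x|M. duality p (g x) \<bullet> (h0 x + v n x)) - (LINT x|M. duality p (g x) \<bullet> g x)) + F (v n) - F v0" for n
  proof -
   have "(LINT x|M. duality p (g x) \<bullet> ((h0 x + v n x) - g x)) =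
     (LINT x|M. duality p (g x) \<bullet> (h0 x + v n x)) - (LINT x|M. duality p (g x) \<bullet> g x)"
    unfolding inner_diff_right
    by (intro Bochner_Integration.integral_diff Holder_inner(1)[OF p refl _ dg] hV v g)
   then have "Ip p M g / p + ((LINT x|M. duality p (g x) \<bullet> (h0 x + v n x)) - (LINT x|M. duality p (g x) \<bullet> g x))
     <= Ip p M (%x. h0 x + v n x) / p"
   proof -
    have "A / p + X <= C / p" if "A + p * X <= C" for A X C :: real
     using divide_right_mono[OF that, of p] p by (simp add: add_divide_distrib)
    then show ?thesis
     using Ip_subgradient[OF p g hV[OF v(1)[of n]]]
      \<open>(LINT x|M. duality p (g x) \<bullet> ((h0 x + v n x) - g x)) = _\<close> by simp
   qed
   then show ?thesis using v(2)[of n] unfolding J_def by linarith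
  qed
  then show "\<exists>N. \<forall>n\<ge>N. Ip p M g / p - F v0 <= m + 1 / real (Suc n) - ((LINT x|M. duality p (g x) \<bullet> (h0 x + v n x)) - (LINT x|M. duality p (g x) \<bullet> g x)) + F (v n) - F v0" by blast
 qed
 then have "\<forall>w\<in>V. J v0 <= J w" using ml unfolding J_def g_def by (meson order_trans)
 then show ?thesis using v0 unfolding J_def by blast
qed

text \<open>
 This is the Euler equation of the minimisation problem. The subgradient inequality at \<open>v + t w\<close> gives an
 upper bound for \<open>F w\<close> as \<open>t\<close> tends to 0, and replacing \<open>w\<close> by \<open>- w\<close> gives equality.
\<close>

lemma Lp_shifted_riesz:
 fixes h0 :: "'a => 'b::euclidean_space"
 assumes p: "1 < p" and V: "Lp_subspace p M V" and h0: "h0 \<in> LpM p M" and F: "Lp_functional p M V F"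
 shows "\<exists>v\<in>V. \<forall>w\<in>V. (LINT x|M. duality p (h0 x + v x) \<bullet> w x) = F w"
proof -
 obtain v where v: "v \<in> V" and
  min: "\<And>w. w \<in> V ==> Ip p M (%x. h0 x + v x) / p - F v <= Ip p M (%x. h0 x + w x) / p - F w"
  using Lp_minimizer[OF assms] by blast
 define g where "g = (%x. h0 x + v x)"
 have g: "g \<in> LpM p M" unfolding g_def using p by (intro LpM_add h0 Lp_subspaceD(1)[OF V v]) auto
 have dg: "(%x. duality p (g x)) \<in> LpM (p / (p - 1)) M" by (rule duality_Lq(1)[OF p refl g])
 have Fadd: "F (%x. f x + g x) = F f + F g" if "f \<in> V" "g \<in> V" for f g
  using F that unfolding Lp_functional_def by blast
 have Fsc: "F (%x. c *R f x) = c * F f" if "f \<in> V" for f c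
  using F that unfolding Lp_functional_def by blast
 have le: "F w <= (LINT x|M. duality p (g x) \<bullet> w x)" if w: "w \<in> V" for w
 proof (rule LIMSEQ_le_const)
  note wL = Lp_subspaceD(1)[OF V w]
  note [measurable] = LpM_measurable[OF g] LpM_measurable[OF wL]
  define t where "t n = 1 / real (Suc n)" for n
  have t: "0 < t n" "t n <= 1" for n by (auto simp: t_def)
  have tlim: "t ----> 0" unfolding t_def using LIMSEQ_inverse_real_of_nat by (simp add: inverse_eq_divide)
  have gt: "(%x. g x + t n *R w x) \<in> LpM p M" for n using p by (intro LpM_add LpM_scale g wL) auto
  show "(%n. LINT x|M. duality p (g x + t n *R w x) \<bullet> w x) ----> (LINT x|M. duality p (g x) \<bullet> w x)"
  proof (rule integral_dominated_convergence[where w = "%x. 2 powr p * (norm (g x) powr p + norm (w x) powr p)"])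
   show "(%x. duality p (g x) \<bullet> w x) \<in> borel_measurable M"
    "(%x. duality p (g x + t n *R w x) \<bullet> w x) \<in> borel_measurable M" for n
    using duality_measurable[OF p, of g M] duality_measurable[OF p, of "%x. g x + t n *R w x" M]
    by measurable
   show "integrable M (%x. 2 powr p * (norm (g x) powr p + norm (w x) powr p))"
    by (intro integrable_mult_right Bochner_Integration.integrable_add LpM_integrable[OF g] LpM_integrable[OF wL])
   have "(%n. duality p (g x + t n *R w x) \<bullet> w x) ----> duality p (g x) \<bullet> w x" for x
   proof -
    have "(%n. g x + t n *R w x) ----> g x + 0 *R w x" by (intro tendsto_intros tlim)
    then have "(%n. g x + t n *R w x) ----> g x" by simp
    moreover have "isCont (duality p) (g x)"
     using continuous_duality[OF p, where 'b = 'b] by (simp add: continuous_on_eq_continuous_at)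
    ultimately have "(%n. duality p (g x + t n *R w x)) ----> duality p (g x)" by (rule isCont_tendsto_compose[rotated])
    then show ?thesis by (intro tendsto_intros)
   qed
   then show "AE x in M. (%n. duality p (g x + t n *R w x) \<bullet> w x) ----> duality p (g x) \<bullet> w x" by simp
   have "norm (duality p (g x + t n *R w x) \<bullet> w x) <= 2 powr p * (norm (g x) powr p + norm (w x) powr p)" for x n
   proof -
    define s where "s = norm (g x) + norm (w x)"
    have "norm (g x + t n *R w x) <= norm (g x) + norm (t n *R w x)" by (rule norm_triangle_ineq)
    also have "norm (t n *R w x) <= norm (w x)" using t[of n] by (simp add: mult_left_le_one_le)
    finally have s: "norm (g x + t n *R w x) <= s" "norm (w x) <= s" "0 <= s" by (auto simp: s_def)
    have "norm (duality p (g x + t n *R w x) \<bullet> w x) <= norm (duality p (g x + t n *R w x)) * norm (w x)"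
     using Cauchy_Schwarz_ineq2 by simp
    also have "\<dots> <= s powr (p - 1) * s"
     unfolding norm_duality[OF p] using s p by (intro mult_mono powr_mono2) auto
    also have "\<dots> = s powr (p - 1) * s powr 1" using s by simp
    also have "\<dots> = s powr p" unfolding powr_add[symmetric] by simp
    also have "\<dots> <= 2 powr p * (norm (g x) powr p + norm (w x) powr p)"
     using norm_powr_add[of p "norm (g x)" "norm (w x)"] p by (simp add: s_def)
    finally show ?thesis .
   qed
   then show "AE x in M. norm (duality p (g x + t n *R w x) \<bullet> w x) <= 2 powr p * (norm (g x) powr p + norm (w x) powr p)" for n
    by simp
  qed
  have "F w <= (LINT x|M. duality p (g x + t n *R w x) \<bullet> w x)" for n
  proof -
   have tw: "(%x. t n *R w x) \<in> V" by (rule Lp_subspaceD(4)[OF V w])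
   have "Ip p M g / p - F v <= Ip p M (%x. h0 x + (v x + t n *R w x)) / p - F (%x. v x + t n *R w x)"
    unfolding g_def by (rule min[OF Lp_subspaceD(3)[OF V v tw]])
   also have "(%x. h0 x + (v x + t n *R w x)) = (%x. g x + t n *R w x)"
    unfolding g_def by (simp add: add.assoc)
   also have "F (%x. v x + t n *R w x) = F v + t n * F w" using Fadd[OF v tw] Fsc[OF w] by simp
   finally have 1: "t n * F w <= Ip p M (%x. g x + t n *R w x) / p - Ip p M g / p" by linarith
   have "Ip p M (%x. g x + t n *R w x) + p * (LINT x|M. duality p (g x + t n *R w x) \<bullet> (g x - (g x + t n *R w x))) <= Ip p M g"
    by (rule Ip_subgradient[OF p gt g])
   also have "(LINT x|M. duality p (g x + t n *R w x) \<bullet> (g x - (g x + t n *R w x))) =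
     - (t n * (LINT x|M. duality p (g x + t n *R w x) \<bullet> w x))" by simp
   finally have "Ip p M (%x. g x + t n *R w x) - Ip p M g <= p * (t n * (LINT x|M. duality p (g x + t n *R w x) \<bullet> w x))"
    by simp
   then have "(Ip p M (%x. g x + t n *R w x) - Ip p M g) / p <= t n * (LINT x|M. duality p (g x + t n *R w x) \<bullet> w x)"
    using p by (simp add: pos_divide_le_eq mult.commute)
   then have "t n * F w <= t n * (LINT x|M. duality p (g x + t n *R w x) \<bullet> w x)"
    using 1 by (simp add: diff_divide_distrib)
   then show ?thesis using t[of n] by simp
  qed
  then show "\<exists>N. \<forall>n\<ge>N. F w <= (LINT x|M. duality p (g x + t n *R w x) \<bullet> w x)" by blast
 qed
 have "(LINT x|M. duality p (g x) \<bullet> w x) = F w" if w: "w \<in> V" for w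
 proof -
  have "F (%x. (-1) *R w x) <= (LINT x|M. duality p (g x) \<bullet> ((-1) *R w x))"
   by (rule le[OF Lp_subspaceD(4)[OF V w]])
  then have "(LINT x|M. duality p (g x) \<bullet> w x) <= F w" using Fsc[OF w, of "-1"] by simp
  then show ?thesis using le[OF w] by simp
 qed
 then show ?thesis using v unfolding g_def by blast
qed

lemma Lp_riesz:
 fixes V :: "('a => 'b::euclidean_space) set"
 assumes "1 < p" "Lp_subspace p M V" "Lp_functional p M V F"
 shows "\<exists>g\<in>V. \<forall>w\<in>V. F w = (LINT x|M. duality p (g x) \<bullet> w x)"
proof -
 obtain v where "v \<in> V" "\<forall>w\<in>V. (LINT x|M. duality p (0 + v x) \<bullet> w x) = F w"
  using Lp_shifted_riesz[OF assms(1,2) LpM_zero assms(3)] by blast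
 then show ?thesis by (intro bexI[of _ v]) auto
qed

text \<open>
 With \<open>v\<close> minimising the distance of \<open>- h\<close> to \<open>V\<close>, the functional given by \<open>duality p (h + v)\<close> annihilates
 \<open>V\<close>. If it annihilates \<open>h\<close> too, then \<open>h + v\<close> has norm zero. No extension theorem is involved.
\<close>

lemma Lp_separation:
 fixes V :: "('a => 'b::euclidean_space) set"
 assumes p: "1 < p" "q = p / (p - 1)" and V: "Lp_subspace p M V" and h: "h \<in> LpM p M"
  and ann: "\<And>G. G \<in> LpM q M ==> (\<And>w. w \<in> V ==> (LINT x|M. G x \<bullet> w x) = 0) ==> (LINT x|M. G x \<bullet> h x) = 0"
 shows "\<exists>v\<in>V. AE x in M. h x = v x"
proof -
 have "Lp_functional p M V (%_. 0)" unfolding Lp_functional_def by (auto intro: exI[of _ 0])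
 from Lp_shifted_riesz[OF p(1) V h this]
 obtain v where v: "v \<in> V" and orth: "\<And>w. w \<in> V ==> (LINT x|M. duality p (h x + v x) \<bullet> w x) = 0" by blast
 have s: "(%x. h x + v x) \<in> LpM p M" using p by (intro LpM_add h Lp_subspaceD(1)[OF V v]) auto
 have G: "(%x. duality p (h x + v x)) \<in> LpM q M" by (rule duality_Lq(1)[OF p s])
 have "(LINT x|M. duality p (h x + v x) \<bullet> (h x + v x)) =
   (LINT x|M. duality p (h x + v x) \<bullet> h x) + (LINT x|M. duality p (h x + v x) \<bullet> v x)"
  unfolding inner_add_right
  by (intro Bochner_Integration.integral_add Holder_inner(1)[OF p _ G] h Lp_subspaceD(1)[OF V v])
 also have "(LINT x|M. duality p (h x + v x) \<bullet> h x) = 0" by (rule ann[OF G]) (rule orth)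
 also have "(LINT x|M. duality p (h x + v x) \<bullet> v x) = 0" by (rule orth[OF v])
 finally have "Ip p M (%x. h x + v x) = 0" unfolding Ip_def duality_inner_self[OF p(1)] by simp
 then have "AE x in M. h x + v x = 0" using Ip_eq_0_iff[OF s] by simp
 then have "AE x in M. h x = (-1) *R v x" by eventually_elim (simp only: scaleR_minus1_left eq_neg_iff_add_eq_0)
 then show ?thesis by (rule bexI[OF _ Lp_subspaceD(4)[OF V v]])
qed

section \<open>Calculus of test functions\<close>

definition grad :: "('a::euclidean_space => real) => 'a => 'a" where
 "grad \<phi> x = (\<Sum>b\<in>Basis. frechet_derivative \<phi> (at x) b *R b)"

lemma test_function_Ck: "test_function \<Omega> \<phi> ==> Ck_function k \<phi>"
 by (simp add: test_function_def)

lemma test_function_has_derivative: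
 assumes "test_function \<Omega> \<phi>"
 shows "(\<phi> has_derivative (%h. grad \<phi> x \<bullet> h)) (at x)"
proof -
 have "\<phi> differentiable (at x)" using test_function_Ck[OF assms, of 1] by simp
 then have D: "(\<phi> has_derivative frechet_derivative \<phi> (at x)) (at x)" by (simp add: frechet_derivative_works)
 then have lin: "linear (frechet_derivative \<phi> (at x))" by (rule has_derivative_linear)
 have "frechet_derivative \<phi> (at x) h = grad \<phi> x \<bullet> h" for h
 proof -
  have "frechet_derivative \<phi> (at x) h = frechet_derivative \<phi> (at x) (\<Sum>b\<in>Basis. (h \<bullet> b) *R b)"
   by (simp add: euclidean_representation)
  also have "\<dots> = (\<Sum>b\<in>Basis. (h \<bullet> b) * frechet_derivative \<phi> (at x) b)"
   using lin by (simp add: linear_sum linear_cmul)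
  also have "\<dots> = grad \<phi> x \<bullet> h"
   unfolding grad_def inner_sum_left inner_scaleR_left by (intro sum.cong) (auto simp: inner_commute mult.commute)
  finally show ?thesis .
 qed
 then have "frechet_derivative \<phi> (at x) = (%h. grad \<phi> x \<bullet> h)" by blast
 then show ?thesis using D by simp
qed

lemma frechet_derivative_eq_grad:
 assumes "test_function \<Omega> \<phi>" shows "frechet_derivative \<phi> (at x) b = grad \<phi> x \<bullet> b"
 using frechet_derivative_at[OF test_function_has_derivative[OF assms, of x]] by metis

lemma continuous_test_function: "test_function \<Omega> \<phi> ==> continuous_on UNIV \<phi>"
 using test_function_Ck[of \<Omega> \<phi> 0] by simp

lemma continuous_grad: "test_function \<Omega> \<phi> ==> continuous_on UNIV (grad \<phi>)"
 using test_function_Ck[of \<Omega> \<phi> "Suc 0"] unfolding grad_def by (intro continuous_intros) auto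

lemma test_function_support:
 assumes "test_function \<Omega> \<phi>"
 obtains K where "compact K" "K \<subseteq> \<Omega>" "\<And>x. x \<notin> K ==> \<phi> x = 0" "\<And>x. x \<notin> K ==> grad \<phi> x = 0"
proof
 define K where "K = closure {x. \<phi> x \<noteq> 0}"
 show "compact K" "K \<subseteq> \<Omega>" using assms by (auto simp: test_function_def K_def)
 show z: "\<phi> x = 0" if "x \<notin> K" for x
  using that closure_subset[of "{x. \<phi> x \<noteq> 0}"] unfolding K_def by blast
 show "grad \<phi> x = 0" if "x \<notin> K" for x
 proof -
  have "((%_. 0) has_derivative (%h. 0)) (at x)" by simp
  then have "(\<phi> has_derivative (%h. 0)) (at x)"
  proof (rule has_derivative_transform_within_open)
   show "open (- K)" by (simp add: K_def open_Compl)
   show "x \<in> - K" using that by simp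
   show "0 = \<phi> y" if "y \<in> - K" for y using z[of y] that by simp
  qed
  then have "(%h. 0) = (%h. grad \<phi> x \<bullet> h)"
   by (rule has_derivative_unique) (rule test_function_has_derivative[OF assms])
  from fun_cong[OF this, of "grad \<phi> x"] have "grad \<phi> x \<bullet> grad \<phi> x = 0" by (rule sym)
  then show ?thesis by (simp only: inner_eq_zero_iff)
 qed
qed

lemma compact_support_integrable:
 fixes f :: "'a::euclidean_space => 'b::{banach,second_countable_topology}"
 assumes "continuous_on UNIV f" "compact K" "\<And>x. x \<notin> K ==> f x = 0"
 shows "integrable lborel f"
proof -
 have "integrable lborel (%x. indicator K x *R f x)"
  by (intro borel_integrable_compact assms(2) continuous_on_subset[OF assms(1)] subset_UNIV)
 moreover have "(%x. indicator K x *R f x) = f" using assms(3) by (auto simp: indicator_def)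
 ultimately show ?thesis by simp
qed

lemma compact_support_bounded:
 fixes f :: "'a::euclidean_space => 'b::euclidean_space"
 assumes "continuous_on UNIV f" "compact K" "\<And>x. x \<notin> K ==> f x = 0"
 obtains B where "0 <= B" "\<And>x. norm (f x) <= B"
proof -
 have "bounded (f ` K)"
  by (intro compact_imp_bounded compact_continuous_image assms(2) continuous_on_subset[OF assms(1)] subset_UNIV)
 then obtain B where B: "0 < B" "\<And>x. x \<in> K ==> norm (f x) <= B" unfolding bounded_pos by auto
 have "norm (f x) <= B" for x using B assms(3)[of x] by (cases "x \<in> K") auto
 then show ?thesis using that[of B] B by simp
qed

lemma borel_measurable_continuous: "continuous_on UNIV f ==> f \<in> borel_measurable borel"
 by (rule borel_measurable_continuous_onI)

lemma lebesgue_on_zero_outside: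
 fixes f :: "'a::euclidean_space => 'b::euclidean_space"
 assumes \<Omega>: "\<Omega> \<in> sets lebesgue" and f: "f \<in> borel_measurable borel" and z: "\<And>x. x \<notin> \<Omega> ==> f x = 0"
 shows "integrable (lebesgue_on \<Omega>) f \<longleftrightarrow> integrable lborel f"
  and "(LINT x|lebesgue_on \<Omega>. f x) = (LINT x|lborel. f x)"
proof -
 have eq: "(%x. indicator \<Omega> x *R f x) = f" using z by (auto simp: indicator_def)
 have f': "f \<in> borel_measurable lborel" using f by simp
 show "integrable (lebesgue_on \<Omega>) f \<longleftrightarrow> integrable lborel f"
  unfolding lebesgue_on_restrict(1)[OF \<Omega>] eq by (rule integrable_completion[OF f'])
 show "(LINT x|lebesgue_on \<Omega>. f x) = (LINT x|lborel. f x)"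
  unfolding lebesgue_on_restrict(2)[OF \<Omega>] eq by (rule integral_completion[OF f'])
qed

lemma integral_translation:
 fixes f :: "'a::euclidean_space => 'b::{banach,second_countable_topology}"
 assumes "f \<in> borel_measurable borel" shows "(LINT x|lborel. f (c + x)) = (LINT x|lborel. f x)"
proof -
 have "(LINT x|lborel. f x) = (LINT x|distr lborel borel ((+) c). f x)" by (simp add: lborel_distr_plus)
 also have "\<dots> = (LINT x|lborel. f (c + x))" using assms by (intro integral_distr) auto
 finally show ?thesis by simp
qed

lemma nn_integral_translation:
 fixes f :: "'a::euclidean_space => ennreal"
 assumes "f \<in> borel_measurable borel" shows "(\<integral>\<^sup>+x. f (c + x) \<partial>lborel) = (\<integral>\<^sup>+x. f x \<partial>lborel)"
proof -
 have "(\<integral>\<^sup>+x. f x \<partial>lborel) = (\<integral>\<^sup>+x. f x \<partial>distr lborel borel ((+) c))" by (simp add: lborel_distr_plus)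
 also have "\<dots> = (\<integral>\<^sup>+x. f (c + x) \<partial>lborel)" using assms by (intro nn_integral_distr) auto
 finally show ?thesis by simp
qed

text \<open>
 The integral of a compactly supported function is invariant under translations in the direction \<open>b\<close>.
\<close>

lemma integral_derivative_eq_0:
 fixes F :: "'a::euclidean_space => real"
 assumes D: "\<And>x. (F has_derivative (%h. F' x \<bullet> h)) (at x)" and cont: "continuous_on UNIV F'"
  and K: "compact K" and F0: "\<And>x. x \<notin> K ==> F x = 0" and F'0: "\<And>x. x \<notin> K ==> F' x = 0"
 shows "(LINT x|lborel. F' x \<bullet> b) = 0"
proof -
 have cF: "continuous_on UNIV F"
  using D by (intro differentiable_imp_continuous_on) (auto simp: differentiable_on_def differentiable_def)
 obtain B where B: "0 <= B" "\<And>x. norm (F' x) <= B" using compact_support_bounded[OF cont K F'0] by blast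
 define K' where "K' = (\<Union>x\<in>K. \<Union>y\<in>cball 0 (norm b). {x + y})"
 have K': "compact K'" unfolding K'_def by (intro compact_sums' K) simp
 have out: "x \<notin> K \<and> x + t *R b \<notin> K" if x: "x \<notin> K'" and t: "\<bar>t\<bar> <= 1" for x t
 proof -
  have "x + s *R b \<notin> K" if "\<bar>s\<bar> <= 1" for s
  proof
   assume "x + s *R b \<in> K"
   moreover have "- s *R b \<in> cball 0 (norm b)" using that by (simp add: mult_left_le_one_le)
   moreover have "x = (x + s *R b) + (- s *R b)" by simp
   ultimately show False using x unfolding K'_def by blast
  qed
  from this[of 0] this[of t] show ?thesis using t by simp
 qed
 define t where "t n = 1 / real (Suc n)" for n
 have t: "0 < t n" "\<bar>t n\<bar> <= 1" "t n \<noteq> 0" for n by (auto simp: t_def)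
 have tlim: "t ----> 0" unfolding t_def using LIMSEQ_inverse_real_of_nat by (simp add: inverse_eq_divide)
 define d where "d n x = (F (x + t n *R b) - F x) / t n" for n x
 have iF: "integrable lborel F" by (rule compact_support_integrable[OF cF K F0])
 have Fm [measurable]: "F \<in> borel_measurable borel" and F'm [measurable]: "F' \<in> borel_measurable borel"
  using cF cont by (auto intro: borel_measurable_continuous)
 have "(LINT x|lborel. d n x) = 0" for n
 proof -
  have e: "(LINT x|lborel. F (x + t n *R b)) = (LINT x|lborel. F x)"
   using integral_translation[OF Fm, of "t n *R b"] by (simp add: add.commute)
  have i2: "integrable lborel (%x. F (x + t n *R b))"
  proof (rule compact_support_integrable[OF _ K'])
   show "continuous_on UNIV (%x. F (x + t n *R b))"
    by (rule continuous_on_compose2[OF cF]) (auto intro!: continuous_intros)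
   show "F (x + t n *R b) = 0" if "x \<notin> K'" for x using out[OF that t(2)[of n]] F0 by blast
  qed
  show ?thesis unfolding d_def using iF i2 e by simp
 qed
 moreover have "(%n. LINT x|lborel. d n x) ----> (LINT x|lborel. F' x \<bullet> b)"
 proof (rule integral_dominated_convergence[where w = "%x. indicator K' x *R (B * norm b)"])
  show "(%x. F' x \<bullet> b) \<in> borel_measurable lborel" "d n \<in> borel_measurable lborel" for n
   unfolding d_def by measurable
  show "integrable lborel (%x. indicator K' x *R (B * norm b))"
   by (rule borel_integrable_compact[OF K']) simp
  show "AE x in lborel. (%n. d n x) ----> F' x \<bullet> b"
  proof (rule AE_I2)
   fix x
   have "((%s::real. x + s *R b) has_derivative (%s. s *R b)) (at 0)" by (auto intro!: derivative_eq_intros)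
   moreover have "(F has_derivative (%h. F' x \<bullet> h)) (at (x + 0 *R b))" using D[of x] by simp
   ultimately have "((%s. F (x + s *R b)) has_derivative (%s. F' x \<bullet> (s *R b))) (at 0)"
    by (rule has_derivative_compose)
   moreover have "(%s::real. F' x \<bullet> (s *R b)) = (*) (F' x \<bullet> b)" by (auto simp: mult.commute)
   ultimately have "((%s. F (x + s *R b)) has_real_derivative (F' x \<bullet> b)) (at 0)"
    by (simp add: has_field_derivative_def)
   then have "((%h. (F (x + h *R b) - F x) / h) \<longlongrightarrow> F' x \<bullet> b) (at 0)"
    by (simp add: has_field_derivative_iff)
   then have "((%h. (F (x + h *R b) - F x) / h) \<circ> t) ----> F' x \<bullet> b"
    using tlim t(3) unfolding tendsto_at_iff_sequentially by auto
   then show "(%n. d n x) ----> F' x \<bullet> b" by (simp add: o_def d_def)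
  qed
  show "AE x in lborel. norm (d n x) <= indicator K' x *R (B * norm b)" for n
  proof (rule AE_I2)
   fix x
   show "norm (d n x) <= indicator K' x *R (B * norm b)"
   proof (cases "x \<in> K'")
    case True
    have "norm (F (x + t n *R b) - F x) <= B * norm ((x + t n *R b) - x)"
    proof (rule differentiable_bound[of UNIV])
     show "(F has_derivative (%h. F' x \<bullet> h)) (at x within UNIV)" for x using D by simp
     show "onorm (%h. F' x \<bullet> h) <= B" for x
     proof (rule onorm_le)
      fix h
      have "norm (F' x \<bullet> h) <= norm (F' x) * norm h" using Cauchy_Schwarz_ineq2 by simp
      also have "\<dots> <= B * norm h" using B by (intro mult_right_mono) auto
      finally show "norm (F' x \<bullet> h) <= B * norm h" .
     qed
    qed auto
    also have "\<dots> = t n * (B * norm b)" using t[of n] by simp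
    finally show ?thesis using True t(1)[of n] by (simp add: d_def pos_divide_le_eq mult.commute)
   next
    case False
    then show ?thesis using out[OF False t(2)[of n]] F0 by (simp add: d_def)
   qed
  qed
 qed
 ultimately show ?thesis using LIMSEQ_unique[OF _ tendsto_const] by simp
qed

lemma has_weak_gradient_test:
 assumes \<Omega>: "open \<Omega>" and \<phi>: "test_function \<Omega> \<phi>"
 shows "has_weak_gradient \<Omega> \<phi> (grad \<phi>)"
 unfolding has_weak_gradient_def
proof (intro conjI allI impI ballI)
 obtain K where K: "compact K" "K \<subseteq> \<Omega>" "\<And>x. x \<notin> K ==> \<phi> x = 0" "\<And>x. x \<notin> K ==> grad \<phi> x = 0"
  using test_function_support[OF \<phi>] by blast
 have li: "locally_integrable \<Omega> f" if "integrable lborel f" for f :: "'a => 'c::euclidean_space"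
  unfolding locally_integrable_def
 proof (intro allI impI)
  fix S assume "compact S \<and> S \<subseteq> \<Omega>"
  then have S: "S \<in> sets lebesgue" by (auto dest: compact_imp_closed)
  have "integrable lebesgue f" using that by (simp add: integrable_completion)
  then show "integrable (lebesgue_on S) f"
   unfolding lebesgue_on_restrict(1)[OF S] using S by (intro integrable_mult_indicator)
 qed
 show "locally_integrable \<Omega> \<phi>"
  by (intro li compact_support_integrable[OF continuous_test_function[OF \<phi>] K(1,3)])
 show "locally_integrable \<Omega> (grad \<phi>)"
  by (intro li compact_support_integrable[OF continuous_grad[OF \<phi>] K(1,4)])
 fix \<psi> and b :: 'a assume \<psi>: "test_function \<Omega> \<psi>"
 have \<Omega>m: "\<Omega> \<in> sets lebesgue" using \<Omega> by auto
 note c = continuous_test_function[OF \<phi>] continuous_grad[OF \<phi>] continuous_test_function[OF \<psi>] continuous_grad[OF \<psi>]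
 have i1: "integrable lborel (%x. \<phi> x * (grad \<psi> x \<bullet> b))" and i2: "integrable lborel (%x. (grad \<phi> x \<bullet> b) * \<psi> x)"
  by (rule compact_support_integrable[OF _ K(1)], use c K in \<open>auto intro!: continuous_intros\<close>)+
 have "(LINT x|lborel. (\<phi> x *R grad \<psi> x + \<psi> x *R grad \<phi> x) \<bullet> b) = 0"
 proof (rule integral_derivative_eq_0[OF _ _ K(1)])
  show "((%x. \<phi> x * \<psi> x) has_derivative (%h. (\<phi> x *R grad \<psi> x + \<psi> x *R grad \<phi> x) \<bullet> h)) (at x)" for x
   using has_derivative_mult[OF test_function_has_derivative[OF \<phi>] test_function_has_derivative[OF \<psi>], of x]
   by (simp add: inner_add_left mult.commute)
  show "continuous_on UNIV (%x. \<phi> x *R grad \<psi> x + \<psi> x *R grad \<phi> x)"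
   using c by (intro continuous_intros)
 qed (use K in auto)
 then have "(LINT x|lborel. \<phi> x * (grad \<psi> x \<bullet> b) + (grad \<phi> x \<bullet> b) * \<psi> x) = 0"
  by (simp add: inner_add_left mult.commute)
 then have s: "(LINT x|lborel. \<phi> x * (grad \<psi> x \<bullet> b)) = - (LINT x|lborel. (grad \<phi> x \<bullet> b) * \<psi> x)"
  using i1 i2 by simp
 have m: "(%x. \<phi> x * (grad \<psi> x \<bullet> b)) \<in> borel_measurable borel" "(%x. (grad \<phi> x \<bullet> b) * \<psi> x) \<in> borel_measurable borel"
  using c by (auto intro!: borel_measurable_continuous continuous_intros)
 show "(LINT x|lebesgue_on \<Omega>. \<phi> x * frechet_derivative \<psi> (at x) b) = - (LINT x|lebesgue_on \<Omega>. (grad \<phi> x \<bullet> b) * \<psi> x)"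
  unfolding frechet_derivative_eq_grad[OF \<psi>]
  using lebesgue_on_zero_outside(2)[OF \<Omega>m m(1)] lebesgue_on_zero_outside(2)[OF \<Omega>m m(2)]
   test_function_zero_outside[OF \<phi>] test_function_zero_outside[OF \<psi>] s by simp
qed

section \<open>The Sobolev inequality for test functions\<close>

lemma increment_le_nn_integral:
 fixes g :: "real => real"
 assumes "a <= b" and D: "\<And>t. (g has_real_derivative g' t) (at t)" and c: "continuous_on UNIV g'"
 shows "ennreal \<bar>g b - g a\<bar> <= (\<integral>\<^sup>+t. ennreal \<bar>g' t\<bar> * indicator {a..b} t \<partial>lborel)"
proof -
 have "has_bochner_integral lborel (%x. g' x * indicator {a..b} x) (g b - g a)"
  using assms by (intro has_bochner_integral_FTC_Icc_real)
   (auto intro: has_field_derivative_at_within simp: continuous_on_eq_continuous_at)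
 then have i: "integrable lborel (%x. g' x * indicator {a..b} x)"
  and e: "(LINT x|lborel. g' x * indicator {a..b} x) = g b - g a"
  by (auto simp: has_bochner_integral_iff)
 have "ennreal (norm (LINT x|lborel. g' x * indicator {a..b} x)) <= (\<integral>\<^sup>+x. ennreal (norm (g' x * indicator {a..b} x)) \<partial>lborel)"
  by (rule integral_norm_bound_ennreal[OF i])
 also have "\<dots> = (\<integral>\<^sup>+t. ennreal \<bar>g' t\<bar> * indicator {a..b} t \<partial>lborel)"
  by (intro nn_integral_cong) (auto simp: indicator_def)
 finally show ?thesis by (simp add: e)
qed

lemma has_derivative_line:
 fixes F :: "'a::euclidean_space => real"
 assumes "(F has_derivative (%h. v \<bullet> h)) (at (x + t *R e))"
 shows "((%t. F (x + t *R e)) has_real_derivative (v \<bullet> e)) (at t)"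
proof -
 have "((%s::real. x + s *R e) has_derivative (%s. s *R e)) (at t)" by (auto intro!: derivative_eq_intros)
 then have "((%s. F (x + s *R e)) has_derivative (%s. v \<bullet> (s *R e))) (at t)"
  by (rule has_derivative_compose[where g = F and g' = "%h. v \<bullet> h"]) (rule assms)
 moreover have "(%s::real. v \<bullet> (s *R e)) = (*) (v \<bullet> e)" by (auto simp: mult.commute)
 ultimately show ?thesis by (simp add: has_field_derivative_def)
qed

lemma abs_powr_has_derivative:
 assumes "1 < g"
 shows "((%y::real. \<bar>y\<bar> powr g) has_real_derivative g * sgn y * \<bar>y\<bar> powr (g - 1)) (at y)"
proof (cases "y = 0")
 case True
 have "((%h::real. \<bar>h\<bar> powr g / h) \<longlongrightarrow> 0) (at 0)"
 proof (rule Lim_null_comparison)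
  have "norm (\<bar>h\<bar> powr g / h) <= \<bar>h\<bar> powr (g - 1)" for h :: real
  proof (cases "h = 0")
   case False
   have "\<bar>h\<bar> powr g = \<bar>h\<bar> powr (g - 1) * \<bar>h\<bar> powr 1" unfolding powr_add[symmetric] by simp
   then show ?thesis using False by simp
  qed simp
  then show "\<forall>\<^sub>F h in at 0. norm (\<bar>h\<bar> powr g / h) <= \<bar>h\<bar> powr (g - 1)" by simp
  have "((%h::real. \<bar>h\<bar> powr (g - 1)) \<longlongrightarrow> \<bar>0\<bar> powr (g - 1)) (at 0)"
   using assms by (intro tendsto_powr' tendsto_intros) auto
  then show "((%h::real. \<bar>h\<bar> powr (g - 1)) \<longlongrightarrow> 0) (at 0)" by simp
 qed
 then show ?thesis using True by (simp add: has_field_derivative_iff)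
next
 case False
 have 1: "((%z. z powr g) has_real_derivative g * \<bar>y\<bar> powr (g - 1)) (at \<bar>y\<bar>)"
  using False by (intro has_real_derivative_powr) simp
 have 2: "((%y::real. \<bar>y\<bar>) has_real_derivative sgn y) (at y)"
 proof -
  have "((%z. sgn y * z) has_real_derivative sgn y) (at y)"
   by (auto intro!: derivative_eq_intros)
  then show ?thesis
  proof (rule has_field_derivative_transform_within)
   show "sgn y * z = \<bar>z\<bar>" if "dist z y < \<bar>y\<bar>" for z
    using that False by (auto simp: dist_real_def sgn_if split: if_splits)
  qed (use False in auto)
 qed
 show ?thesis using DERIV_chain2[OF 1 2] by (simp add: mult_ac)
qed

lemma continuous_sgn_powr:
 assumes "0 < g" shows "continuous_on UNIV (%y::real. sgn y * \<bar>y\<bar> powr g)"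
proof -
 have "isCont (%y::real. sgn y * \<bar>y\<bar> powr g) y" for y
 proof (cases "y = 0")
  case True
  have "((%h::real. \<bar>h\<bar> powr g) \<longlongrightarrow> \<bar>0\<bar> powr g) (at 0)"
   using assms by (intro tendsto_powr' tendsto_intros) auto
  then have "((%h::real. \<bar>h\<bar> powr g) \<longlongrightarrow> 0) (at 0)" by simp
  then have "((%y::real. sgn y * \<bar>y\<bar> powr g) \<longlongrightarrow> 0) (at 0)"
   by (rule Lim_null_comparison[rotated]) (auto simp: abs_mult sgn_if)
  then show ?thesis using True by (simp add: isCont_def)
 next
  case False
  then show ?thesis by (intro continuous_intros isCont_sgn) auto
 qed
 then show ?thesis by (simp add: continuous_at_imp_continuous_on)
qed

text \<open>
 The function \<open>abs \<phi> powr g\<close> vanishes far away, so its value at \<open>x\<close> is at most the integral of the absolute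
 value of its derivative along the line through \<open>x\<close> in the direction \<open>b\<close>.
\<close>

lemma Sobolev_line_bound:
 fixes \<phi> :: "'a::euclidean_space => real"
 assumes \<phi>: "test_function \<Omega> \<phi>" and g: "1 < g" and b: "b \<in> Basis"
 shows "ennreal (\<bar>\<phi> x\<bar> powr g) \<le>
   (\<integral>\<^sup>+t. ennreal (g * \<bar>\<phi> (x + (t - x \<bullet> b) *R b)\<bar> powr (g - 1) * norm (grad \<phi> (x + (t - x \<bullet> b) *R b))) \<partial>lborel)"
proof -
 obtain K where K: "compact K" "\<And>x. x \<notin> K ==> \<phi> x = 0" using test_function_support[OF \<phi>] by metis
 obtain R where R: "\<And>x. x \<in> K ==> norm x <= R" using compact_imp_bounded[OF K(1)] unfolding bounded_iff by blast
 define y where "y = x - (x \<bullet> b) *R b"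
 have line: "x + (t - x \<bullet> b) *R b = y + t *R b" for t by (simp add: y_def algebra_simps)
 have yb: "y \<bullet> b = 0" using b by (simp add: y_def inner_diff_left)
 define \<theta> where "\<theta> t = \<bar>\<phi> (y + t *R b)\<bar> powr g" for t
 define \<theta>' where "\<theta>' t = g * (sgn (\<phi> (y + t *R b)) * \<bar>\<phi> (y + t *R b)\<bar> powr (g - 1)) * (grad \<phi> (y + t *R b) \<bullet> b)" for t
 have D: "(\<theta> has_real_derivative \<theta>' t) (at t)" for t
 proof -
  have "((%t. \<phi> (y + t *R b)) has_real_derivative (grad \<phi> (y + t *R b) \<bullet> b)) (at t)"
   by (rule has_derivative_line) (rule test_function_has_derivative[OF \<phi>])
  from DERIV_chain2[OF abs_powr_has_derivative[OF g] this] show ?thesis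
   unfolding \<theta>_def \<theta>'_def by (simp only: mult.assoc)
 qed
 have cl: "continuous_on UNIV (%t. y + t *R b)" by (intro continuous_intros)
 have c: "continuous_on UNIV \<theta>'"
  unfolding \<theta>'_def using g
  by (intro continuous_intros continuous_on_compose2[OF continuous_sgn_powr[of "g - 1"]]
   continuous_on_compose2[OF continuous_test_function[OF \<phi>] cl] continuous_on_compose2[OF continuous_grad[OF \<phi>] cl]) auto
 define a where "a = min (x \<bullet> b) (- \<bar>R\<bar> - 1)"
 have "\<bar>R\<bar> < norm (y + a *R b)"
 proof -
  have "\<bar>R\<bar> + 1 <= \<bar>a\<bar>" unfolding a_def by linarith
  also have "\<bar>a\<bar> = \<bar>(y + a *R b) \<bullet> b\<bar>" using b yb by (simp add: inner_add_left)
  also have "\<dots> <= norm (y + a *R b)" by (rule Basis_le_norm[OF b])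
  finally show ?thesis by simp
 qed
 then have "y + a *R b \<notin> K" using R by force
 then have "\<theta> a = 0" using K(2) by (simp add: \<theta>_def)
 moreover have "\<theta> (x \<bullet> b) = \<bar>\<phi> x\<bar> powr g" by (simp add: \<theta>_def y_def)
 ultimately have "ennreal (\<bar>\<phi> x\<bar> powr g) = ennreal \<bar>\<theta> (x \<bullet> b) - \<theta> a\<bar>" by simp
 also have "\<dots> <= (\<integral>\<^sup>+t. ennreal \<bar>\<theta>' t\<bar> * indicator {a..x \<bullet> b} t \<partial>lborel)"
  by (rule increment_le_nn_integral[OF _ D c]) (simp add: a_def)
 also have "\<dots> <= (\<integral>\<^sup>+t. ennreal (g * \<bar>\<phi> (y + t *R b)\<bar> powr (g - 1) * norm (grad \<phi> (y + t *R b))) \<partial>lborel)"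
 proof (rule nn_integral_mono)
  fix t
  have "\<bar>\<theta>' t\<bar> = g * (\<bar>sgn (\<phi> (y + t *R b))\<bar> * \<bar>\<phi> (y + t *R b)\<bar> powr (g - 1)) * \<bar>grad \<phi> (y + t *R b) \<bullet> b\<bar>"
   using g by (simp add: \<theta>'_def abs_mult)
  also have "\<dots> <= g * (1 * \<bar>\<phi> (y + t *R b)\<bar> powr (g - 1)) * norm (grad \<phi> (y + t *R b))"
   using g by (intro mult_mono Basis_le_norm[OF b]) (auto simp: sgn_if)
  finally have "\<bar>\<theta>' t\<bar> <= g * \<bar>\<phi> (y + t *R b)\<bar> powr (g - 1) * norm (grad \<phi> (y + t *R b))" by simp
  then show "ennreal \<bar>\<theta>' t\<bar> * indicator {a..x \<bullet> b} t <= ennreal (g * \<bar>\<phi> (y + t *R b)\<bar> powr (g - 1) * norm (grad \<phi> (y + t *R b)))"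
   by (auto simp: indicator_def intro: ennreal_leI)
 qed
 finally show ?thesis unfolding line .
qed

lemma prod_mono_ennreal:
 fixes f g :: "'i => ennreal"
 shows "(\<And>i. i \<in> I ==> f i <= g i) ==> (\<Prod>i\<in>I. f i) <= (\<Prod>i\<in>I. g i)"
 by (induction I rule: infinite_finite_induct) (auto intro: mult_mono)

text \<open>
 Multiplying the line bounds over all coordinate directions and integrating with the inequality for
 coordinate lines gives the case of exponent 1 for \<open>abs \<phi> powr g\<close>. With \<open>g = p (N - 1) / (N - p)\<close>, Hoelder's
 inequality splits off the gradient and leaves a power of the critical norm that can be divided out.
\<close>

theorem Sobolev_test_function:
 fixes \<phi> :: "'a::euclidean_space => real"
 assumes \<phi>: "test_function \<Omega> \<phi>" and n: "2 <= DIM('a)" and p: "1 < p" "p < real DIM('a)"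
  and ps: "ps = sobolev_exp DIM('a) p"
 shows "(LINT x|lborel. \<bar>\<phi> x\<bar> powr ps) powr (1 / ps) \<le>
   (p * (real DIM('a) - 1) / (real DIM('a) - p)) * (LINT x|lborel. norm (grad \<phi> x) powr p) powr (1 / p)"
proof -
 define N where "N = real DIM('a)"
 define g where "g = p * (N - 1) / (N - p)"
 define q where "q = p / (p - 1)"
 have N: "2 <= N" "p < N" using n p by (auto simp: N_def)
 have g: "1 < g"
 proof -
  have "N - p < p * (N - 1)" using N p mult_strict_right_mono[of 1 p N] by (simp add: algebra_simps)
  then show ?thesis using N by (simp add: g_def)
 qed
 have ps0: "0 < ps" using N p by (simp add: ps sobolev_exp_def N_def[symmetric])
 have e1: "g * (N / (N - 1)) = ps" using N by (simp add: g_def ps sobolev_exp_def N_def[symmetric])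
 have e2: "(g - 1) * q = ps"
 proof -
  have "g - 1 = (p * (N - 1) - (N - p)) / (N - p)" unfolding g_def using N by (simp add: diff_divide_distrib)
  also have "p * (N - 1) - (N - p) = N * (p - 1)" by (simp add: algebra_simps)
  finally show ?thesis using p by (simp add: q_def ps sobolev_exp_def N_def[symmetric])
 qed
 have e3: "(N - 1) / N - 1 / q = 1 / ps"
  using N p by (simp add: q_def ps sobolev_exp_def N_def[symmetric] divide_simps) (simp add: algebra_simps)
 obtain K where K: "compact K" "\<And>x. x \<notin> K ==> \<phi> x = 0" "\<And>x. x \<notin> K ==> grad \<phi> x = 0" using test_function_support[OF \<phi>] by metis
 have c: "continuous_on UNIV (%x. \<bar>\<phi> x\<bar> powr r)" if "0 < r" for r
  using that by (intro continuous_on_powr' continuous_intros continuous_test_function[OF \<phi>]) auto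
 have cg: "continuous_on UNIV (%x. norm (grad \<phi> x))" by (intro continuous_intros continuous_grad[OF \<phi>])
 have cgp: "continuous_on UNIV (%x. norm (grad \<phi> x) powr p)"
  using p by (intro continuous_on_powr' continuous_intros continuous_grad[OF \<phi>]) auto
 define S where "S = (LINT x|lborel. \<bar>\<phi> x\<bar> powr ps)"
 define G where "G = (LINT x|lborel. norm (grad \<phi> x) powr p)"
 define h where "h x = g * \<bar>\<phi> x\<bar> powr (g - 1) * norm (grad \<phi> x)" for x
 have ch: "continuous_on UNIV h" unfolding h_def using g by (intro continuous_intros c cg) auto
 have h0: "0 <= h x" for x using g by (simp add: h_def)
 have hm [measurable]: "h \<in> borel_measurable borel" by (rule borel_measurable_continuous[OF ch])
 have ih: "integrable lborel h" by (rule compact_support_integrable[OF ch K(1)]) (simp add: h_def K)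
 have iS: "integrable lborel (%x. \<bar>\<phi> x\<bar> powr ps)" by (rule compact_support_integrable[OF c[OF ps0] K(1)]) (simp add: K)
 have iG: "integrable lborel (%x. norm (grad \<phi> x) powr p)" by (rule compact_support_integrable[OF cgp K(1)]) (simp add: K)
 have S0: "0 <= S" and G0: "0 <= G" by (auto simp: S_def G_def)
 have H: "(LINT x|lborel. h x) <= g * (S powr (1 / q) * G powr (1 / p))"
 proof -
  have q: "1 < q" "p = q / (q - 1)" unfolding q_def using p by (simp_all add: field_simps)
  have m: "\<phi> \<in> borel_measurable borel" "grad \<phi> \<in> borel_measurable borel"
   by (intro borel_measurable_continuous continuous_test_function[OF \<phi>] continuous_grad[OF \<phi>])+
  have pw: "norm (\<bar>\<phi> x\<bar> powr (g - 1)) powr q = \<bar>\<phi> x\<bar> powr ps" for x by (simp add: powr_powr e2)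
  have f1: "(%x. \<bar>\<phi> x\<bar> powr (g - 1)) \<in> LpM q lborel" unfolding LpM_def mem_Collect_eq pw using m iS by auto
  have f2: "grad \<phi> \<in> LpM p lborel" unfolding LpM_def using m iG by auto
  have "(LINT x|lborel. norm (\<bar>\<phi> x\<bar> powr (g - 1)) * norm (grad \<phi> x)) \<le>
    Ip q lborel (%x. \<bar>\<phi> x\<bar> powr (g - 1)) powr (1 / q) * Ip p lborel (grad \<phi>) powr (1 / p)"
   by (rule Holder(2)[OF q f1 f2])
  also have "\<dots> = S powr (1 / q) * G powr (1 / p)" unfolding Ip_def pw S_def G_def ..
  finally have "g * (LINT x|lborel. \<bar>\<phi> x\<bar> powr (g - 1) * norm (grad \<phi> x)) <= g * (S powr (1 / q) * G powr (1 / p))"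
   using g by (intro mult_left_mono) auto
  then show ?thesis by (simp add: h_def mult.assoc)
 qed
 have main: "S <= (LINT x|lborel. h x) powr (N / (N - 1))"
 proof -
  have "ennreal S = (\<integral>\<^sup>+x. ennreal (\<bar>\<phi> x\<bar> powr ps) \<partial>lborel)"
   unfolding S_def by (intro nn_integral_eq_integral[symmetric] iS) simp
  also have "\<dots> <= (\<integral>\<^sup>+x. (\<Prod>b\<in>Basis. epow (\<integral>\<^sup>+t. ennreal (h (x + (t - x \<bullet> b) *R b)) \<partial>lborel) (1 / (N - 1))) \<partial>lborel)"
  proof (rule nn_integral_mono)
   fix x :: 'a
   have "ennreal (\<bar>\<phi> x\<bar> powr ps) = (\<Prod>b\<in>(Basis::'a set). epow (ennreal (\<bar>\<phi> x\<bar> powr g)) (1 / (N - 1)))"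
   proof -
    have "(\<Prod>b\<in>(Basis::'a set). epow (ennreal (\<bar>\<phi> x\<bar> powr g)) (1 / (N - 1))) = ennreal (\<bar>\<phi> x\<bar> powr (g * (1 / (N - 1)))) ^ DIM('a)"
     using N by (simp add: epow_ennreal powr_powr)
    also have "\<dots> = ennreal ((\<bar>\<phi> x\<bar> powr (g * (1 / (N - 1)))) ^ DIM('a))" by (simp add: ennreal_power)
    also have "(\<bar>\<phi> x\<bar> powr (g * (1 / (N - 1)))) ^ DIM('a) = \<bar>\<phi> x\<bar> powr (g * (1 / (N - 1)) * N)"
     by (cases "\<phi> x = 0") (simp_all add: powr_realpow[symmetric] powr_powr N_def)
    also have "g * (1 / (N - 1)) * N = ps" unfolding e1[symmetric] by simp
    finally show ?thesis by simp
   qed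
   also have "\<dots> <= (\<Prod>b\<in>Basis. epow (\<integral>\<^sup>+t. ennreal (h (x + (t - x \<bullet> b) *R b)) \<partial>lborel) (1 / (N - 1)))"
   proof (rule prod_mono_ennreal)
    fix b :: 'a assume b: "b \<in> Basis"
    show "epow (ennreal (\<bar>\<phi> x\<bar> powr g)) (1 / (N - 1)) <= epow (\<integral>\<^sup>+t. ennreal (h (x + (t - x \<bullet> b) *R b)) \<partial>lborel) (1 / (N - 1))"
     unfolding h_def using N by (intro epow_mono Sobolev_line_bound[OF \<phi> g b]) auto
   qed
   finally show "ennreal (\<bar>\<phi> x\<bar> powr ps) <= (\<Prod>b\<in>Basis. epow (\<integral>\<^sup>+t. ennreal (h (x + (t - x \<bullet> b) *R b)) \<partial>lborel) (1 / (N - 1)))" .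
  qed
  also have "\<dots> <= epow (\<integral>\<^sup>+x. ennreal (h x) \<partial>lborel) (N / (N - 1))"
   unfolding N_def by (rule gridlines_euclidean[OF _ n]) measurable
  also have "(\<integral>\<^sup>+x. ennreal (h x) \<partial>lborel) = ennreal (LINT x|lborel. h x)"
   by (intro nn_integral_eq_integral ih) (simp add: h0)
  also have "epow (ennreal (LINT x|lborel. h x)) (N / (N - 1)) = ennreal ((LINT x|lborel. h x) powr (N / (N - 1)))"
   using N by (intro epow_ennreal) (auto simp: h0)
  finally show ?thesis by (simp add: ennreal_le_iff)
 qed
 show ?thesis
 proof (cases "S = 0")
  case True
  then show ?thesis using g G0 by (simp add: S_def[symmetric] G_def[symmetric] g_def[symmetric] N_def[symmetric])
 next
  case False
  then have Sp: "0 < S" using S0 by simp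
  have "S powr ((N - 1) / N) <= ((LINT x|lborel. h x) powr (N / (N - 1))) powr ((N - 1) / N)"
   using main S0 N by (intro powr_mono2) auto
  also have "\<dots> = (LINT x|lborel. h x)" using N by (simp add: powr_powr h0)
  also note H
  finally have "S powr ((N - 1) / N) * S powr (- (1 / q)) <= g * (S powr (1 / q) * G powr (1 / p)) * S powr (- (1 / q))"
   by (intro mult_right_mono) auto
  also have "\<dots> = g * G powr (1 / p) * (S powr (1 / q) * S powr (- (1 / q)))" by (simp only: mult_ac)
  also have "S powr (1 / q) * S powr (- (1 / q)) = 1" using Sp unfolding powr_add[symmetric] by simp
  also have "S powr ((N - 1) / N) * S powr (- (1 / q)) = S powr (1 / ps)"
   unfolding powr_add[symmetric] e3[symmetric] by simp
  finally show ?thesis by (simp add: S_def[symmetric] G_def[symmetric] g_def[symmetric] N_def[symmetric])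
 qed
qed

section \<open>Compactness for test functions\<close>

lemma test_function_translation:
 fixes \<phi> :: "'a::euclidean_space => real"
 assumes \<phi>: "test_function \<Omega> \<phi>"
 shows "(\<integral>\<^sup>+x. ennreal \<bar>\<phi> (x + h) - \<phi> x\<bar> \<partial>lborel) <= ennreal (norm h * (LINT x|lborel. norm (grad \<phi> x)))"
proof -
 obtain K where K: "compact K" "\<And>x. x \<notin> K ==> grad \<phi> x = 0" using test_function_support[OF \<phi>] by metis
 have [measurable]: "\<phi> \<in> borel_measurable borel" "grad \<phi> \<in> borel_measurable borel"
  by (intro borel_measurable_continuous continuous_test_function[OF \<phi>] continuous_grad[OF \<phi>])+
 have ig: "integrable lborel (%x. norm (grad \<phi> x))"
  by (rule compact_support_integrable[OF _ K(1)]) (auto intro!: continuous_intros continuous_grad[OF \<phi>] simp: K)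
 have "ennreal \<bar>\<phi> (x + h) - \<phi> x\<bar> <= (\<integral>\<^sup>+t. ennreal (norm h) * (ennreal (norm (grad \<phi> (x + t *R h))) * indicator {0..1} t) \<partial>lborel)" for x
 proof -
  have "ennreal \<bar>\<phi> (x + 1 *R h) - \<phi> (x + 0 *R h)\<bar> <= (\<integral>\<^sup>+t. ennreal \<bar>grad \<phi> (x + t *R h) \<bullet> h\<bar> * indicator {0..1} t \<partial>lborel)"
  proof (rule increment_le_nn_integral)
   show "((%t. \<phi> (x + t *R h)) has_real_derivative grad \<phi> (x + t *R h) \<bullet> h) (at t)" for t
    by (rule has_derivative_line) (rule test_function_has_derivative[OF \<phi>])
   have "continuous_on UNIV (%t::real. x + t *R h)" by (intro continuous_intros)
   then show "continuous_on UNIV (%t. grad \<phi> (x + t *R h) \<bullet> h)"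
    by (intro continuous_intros continuous_on_compose2[OF continuous_grad[OF \<phi>]]) auto
  qed simp
  also have "\<dots> <= (\<integral>\<^sup>+t. ennreal (norm h) * (ennreal (norm (grad \<phi> (x + t *R h))) * indicator {0..1} t) \<partial>lborel)"
  proof (rule nn_integral_mono)
   fix t :: real
   have "\<bar>grad \<phi> (x + t *R h) \<bullet> h\<bar> <= norm h * norm (grad \<phi> (x + t *R h))"
    using Cauchy_Schwarz_ineq2[of "grad \<phi> (x + t *R h)" h] by (simp add: mult.commute)
   then have "ennreal \<bar>grad \<phi> (x + t *R h) \<bullet> h\<bar> <= ennreal (norm h) * ennreal (norm (grad \<phi> (x + t *R h)))"
    by (simp add: ennreal_leI flip: ennreal_mult)
   then show "ennreal \<bar>grad \<phi> (x + t *R h) \<bullet> h\<bar> * indicator {0..1} t \<le>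
     ennreal (norm h) * (ennreal (norm (grad \<phi> (x + t *R h))) * indicator {0..1} t)"
    by (simp add: indicator_def)
  qed
  finally show ?thesis by simp
 qed
 then have "(\<integral>\<^sup>+x. ennreal \<bar>\<phi> (x + h) - \<phi> x\<bar> \<partial>lborel) \<le>
   (\<integral>\<^sup>+x. (\<integral>\<^sup>+t. ennreal (norm h) * (ennreal (norm (grad \<phi> (x + t *R h))) * indicator {0..1} t) \<partial>lborel) \<partial>lborel)"
  by (intro nn_integral_mono)
 also have "\<dots> = (\<integral>\<^sup>+t. (\<integral>\<^sup>+x. ennreal (norm h) * (ennreal (norm (grad \<phi> (x + t *R h))) * indicator {0..1} t) \<partial>lborel) \<partial>(lborel :: real measure))"
  by (rule lborel_pair.Fubini'[symmetric]) measurable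
 also have "\<dots> = (\<integral>\<^sup>+t. (ennreal (norm h) * ennreal (LINT x|lborel. norm (grad \<phi> x))) * indicator {0..1} t \<partial>(lborel :: real measure))"
 proof (rule nn_integral_cong)
  fix t :: real
  have "(\<integral>\<^sup>+x. ennreal (norm h) * (ennreal (norm (grad \<phi> (x + t *R h))) * indicator {0..1} t) \<partial>lborel) =
    (\<integral>\<^sup>+x. (ennreal (norm h) * indicator {0..1} t) * ennreal (norm (grad \<phi> (t *R h + x))) \<partial>lborel)"
   by (intro nn_integral_cong) (simp add: add.commute mult_ac)
  also have "\<dots> = (ennreal (norm h) * indicator {0..1} t) * (\<integral>\<^sup>+x. ennreal (norm (grad \<phi> (t *R h + x))) \<partial>lborel)"
   by (rule nn_integral_cmult) measurable
  also have "(\<integral>\<^sup>+x. ennreal (norm (grad \<phi> (t *R h + x))) \<partial>lborel) = (\<integral>\<^sup>+x. ennreal (norm (grad \<phi> x)) \<partial>lborel)"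
   by (rule nn_integral_translation[of "%x. ennreal (norm (grad \<phi> x))"]) measurable
  also have "\<dots> = ennreal (LINT x|lborel. norm (grad \<phi> x))" by (rule nn_integral_eq_integral[OF ig]) simp
  finally show "(\<integral>\<^sup>+x. ennreal (norm h) * (ennreal (norm (grad \<phi> (x + t *R h))) * indicator {0..1} t) \<partial>lborel) =
    (ennreal (norm h) * ennreal (LINT x|lborel. norm (grad \<phi> x))) * indicator {0..1} t" by (simp only: mult_ac)
 qed
 also have "\<dots> = ennreal (norm h) * ennreal (LINT x|lborel. norm (grad \<phi> x))"
  by (simp add: nn_integral_cmult_indicator)
 also have "\<dots> = ennreal (norm h * (LINT x|lborel. norm (grad \<phi> x)))"
  by (rule ennreal_mult'[symmetric]) simp
 finally show ?thesis .
qed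

text \<open>
 A function differs from its mean over the cube \<open>x + Q\<close> by the mean of the differences
 \<open>\<psi> (x + h) - \<psi> x\<close>, whose \<open>L\<^sup>1\<close> norms are at most \<open>norm h\<close> times that of the gradient. Both sides are
 multiplied by the volume of the cube.
\<close>

lemma test_function_average:
 fixes \<psi> :: "'a::euclidean_space => real"
 assumes \<psi>: "test_function \<Omega> \<psi>" and d: "0 < d"
 defines "Q \<equiv> cbox (0::'a) (d *R One)"
 shows "d ^ DIM('a) * (LINT x|lborel. \<bar>\<psi> x\<bar>) \<le>
   d ^ DIM('a) * (d * real DIM('a) * (LINT x|lborel. norm (grad \<psi> x))) +
   (LINT x|lborel. \<bar>LINT h|lborel. indicator Q h * \<psi> (x + h)\<bar>)"
  and "integrable lborel (%x. \<bar>LINT h|lborel. indicator Q h * \<psi> (x + h)\<bar>)"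
proof -
 obtain K where K: "compact K" "\<And>x. x \<notin> K ==> \<psi> x = 0" using test_function_support[OF \<psi>] by metis
 have c: "continuous_on UNIV \<psi>" by (rule continuous_test_function[OF \<psi>])
 have [measurable]: "\<psi> \<in> borel_measurable borel" by (rule borel_measurable_continuous[OF c])
 have Qm [measurable]: "Q \<in> sets borel" by (simp add: Q_def)
 have Qem: "emeasure lborel Q = ennreal (d ^ DIM('a))"
  using d by (simp add: Q_def emeasure_lborel_cbox inner_diff_left)
 have Qn: "norm h <= d * real DIM('a)" if "h \<in> Q" for h
 proof -
  have "norm h <= (\<Sum>b\<in>Basis. \<bar>h \<bullet> b\<bar>)" by (rule norm_le_l1)
  also have "\<dots> <= (\<Sum>b\<in>(Basis::'a set). d)" using that by (intro sum_mono) (auto simp: Q_def mem_box)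
  finally show ?thesis by (simp add: mult.commute)
 qed
 have i\<psi>: "integrable lborel (%x. \<bar>\<psi> x\<bar>)"
  by (rule compact_support_integrable[OF _ K(1)]) (auto intro!: continuous_intros c simp: K)
 obtain B where B: "0 <= B" "\<And>x. norm (\<psi> x) <= B" using compact_support_bounded[OF c K] by blast
 define I where "I = (LINT x|lborel. \<bar>\<psi> x\<bar>)"
 define G where "G = (LINT x|lborel. norm (grad \<psi> x))"
 have G0: "0 <= G" and I0: "0 <= I" by (auto simp: G_def I_def)
 define a where "a x = (LINT h|lborel. indicator Q h * \<psi> (x + h))" for x
 have ia: "integrable lborel (%h. indicator Q h * \<psi> (x + h))" for x
 proof -
  have "continuous_on Q (%h. \<psi> (x + h))"
   by (rule continuous_on_compose2[OF c]) (auto intro!: continuous_intros)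
  then show ?thesis using borel_integrable_compact[of Q "%h. \<psi> (x + h)"] by (simp add: Q_def)
 qed
 have iQ: "integrable lborel (%h. indicator Q h :: real)"
  using Qem by (simp add: integrable_indicator_iff)
 have mQ: "measure lborel Q = d ^ DIM('a)" using Qem d by (simp add: measure_def)
 have am [measurable]: "a \<in> borel_measurable borel"
  unfolding a_def by (intro lborel.borel_measurable_lebesgue_integral) measurable
 define K' where "K' = (\<Union>x\<in>K. \<Union>y\<in>uminus ` Q. {x + y})"
 have K': "compact K'"
  unfolding K'_def by (intro compact_sums' K compact_negations) (simp add: Q_def)
 have a0: "a x = 0" if x: "x \<notin> K'" for x
 proof -
  have "indicator Q h * \<psi> (x + h) = 0" for h
  proof (cases "h \<in> Q")
   case True
   have "x + h \<notin> K"
   proof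
    assume "x + h \<in> K"
    moreover have "- h \<in> uminus ` Q" using True by simp
    moreover have "x = (x + h) + (- h)" by simp
    ultimately show False using x unfolding K'_def by blast
   qed
   then show ?thesis using K by simp
  qed simp
  then have "(%h. indicator Q h * \<psi> (x + h)) = (%_. 0)" by (rule ext)
  then show ?thesis by (simp add: a_def)
 qed
 have ab: "\<bar>a x\<bar> <= d ^ DIM('a) * B" for x
 proof -
  have "\<bar>a x\<bar> <= (LINT h|lborel. \<bar>indicator Q h * \<psi> (x + h)\<bar>)" unfolding a_def by (rule integral_abs_bound)
  also have "\<dots> <= (LINT h|lborel. indicator Q h * B)"
   using ia[of x] iQ B(2) by (intro integral_mono) (auto simp: indicator_def)
  also have "\<dots> = d ^ DIM('a) * B" using mQ by simp
  finally show ?thesis .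
 qed
 show ia': "integrable lborel (%x. \<bar>LINT h|lborel. indicator Q h * \<psi> (x + h)\<bar>)"
  unfolding a_def[symmetric]
 proof (rule Bochner_Integration.integrable_bound)
  show "integrable lborel (%x. indicator K' x *R (d ^ DIM('a) * B))" by (rule borel_integrable_compact[OF K']) simp
  show "AE x in lborel. norm \<bar>a x\<bar> <= norm (indicator K' x *R (d ^ DIM('a) * B))"
  proof (rule AE_I2)
   fix x show "norm \<bar>a x\<bar> <= norm (indicator K' x *R (d ^ DIM('a) * B))"
    using ab[of x] a0[of x] by (cases "x \<in> K'") auto
  qed
 qed measurable
 have pt: "ennreal (d ^ DIM('a) * \<bar>\<psi> x\<bar>) <= (\<integral>\<^sup>+h. ennreal \<bar>\<psi> (x + h) - \<psi> x\<bar> * indicator Q h \<partial>lborel) + ennreal \<bar>a x\<bar>" for x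
 proof -
  have e: "d ^ DIM('a) * \<psi> x = a x - (LINT h|lborel. indicator Q h * (\<psi> (x + h) - \<psi> x))"
   unfolding a_def right_diff_distrib using ia[of x] iQ mQ by simp
  have i1: "integrable lborel (%h. indicator Q h * (\<psi> (x + h) - \<psi> x))"
   unfolding right_diff_distrib using ia[of x] iQ by simp
  have "d ^ DIM('a) * \<bar>\<psi> x\<bar> = \<bar>d ^ DIM('a) * \<psi> x\<bar>" using d by (simp add: abs_mult)
  also have "\<dots> <= \<bar>LINT h|lborel. indicator Q h * (\<psi> (x + h) - \<psi> x)\<bar> + \<bar>a x\<bar>" unfolding e by linarith
  finally have "ennreal (d ^ DIM('a) * \<bar>\<psi> x\<bar>) <= ennreal (\<bar>LINT h|lborel. indicator Q h * (\<psi> (x + h) - \<psi> x)\<bar> + \<bar>a x\<bar>)"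
   by (rule ennreal_leI)
  also have "\<dots> = ennreal \<bar>LINT h|lborel. indicator Q h * (\<psi> (x + h) - \<psi> x)\<bar> + ennreal \<bar>a x\<bar>" by (rule ennreal_plus) auto
  also have "ennreal \<bar>LINT h|lborel. indicator Q h * (\<psi> (x + h) - \<psi> x)\<bar> \<le>
    (\<integral>\<^sup>+h. ennreal (norm (indicator Q h * (\<psi> (x + h) - \<psi> x))) \<partial>lborel)"
   using integral_norm_bound_ennreal[OF i1] by simp
  also have "\<dots> = (\<integral>\<^sup>+h. ennreal \<bar>\<psi> (x + h) - \<psi> x\<bar> * indicator Q h \<partial>lborel)"
   by (intro nn_integral_cong) (auto simp: indicator_def)
  finally show ?thesis by (simp add: add_right_mono)
 qed
 have "ennreal (d ^ DIM('a) * I) = (\<integral>\<^sup>+x. ennreal (d ^ DIM('a) * \<bar>\<psi> x\<bar>) \<partial>lborel)"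
  unfolding I_def integral_mult_right_zero[symmetric]
  using d i\<psi> by (intro nn_integral_eq_integral[symmetric] integrable_mult_right) auto
 also have "\<dots> <= (\<integral>\<^sup>+x. ((\<integral>\<^sup>+h. ennreal \<bar>\<psi> (x + h) - \<psi> x\<bar> * indicator Q h \<partial>lborel) + ennreal \<bar>a x\<bar>) \<partial>lborel)"
  by (intro nn_integral_mono pt)
 also have "\<dots> = (\<integral>\<^sup>+x. (\<integral>\<^sup>+h. ennreal \<bar>\<psi> (x + h) - \<psi> x\<bar> * indicator Q h \<partial>lborel) \<partial>lborel) + (\<integral>\<^sup>+x. ennreal \<bar>a x\<bar> \<partial>lborel)"
  by (intro nn_integral_add lborel.borel_measurable_nn_integral) measurable
 also have "(\<integral>\<^sup>+x. (\<integral>\<^sup>+h. ennreal \<bar>\<psi> (x + h) - \<psi> x\<bar> * indicator Q h \<partial>lborel) \<partial>lborel) =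
   (\<integral>\<^sup>+h. (\<integral>\<^sup>+x. ennreal \<bar>\<psi> (x + h) - \<psi> x\<bar> * indicator Q h \<partial>lborel) \<partial>lborel)"
  by (rule lborel_pair.Fubini'[symmetric]) measurable
 also have "\<dots> <= (\<integral>\<^sup>+h. ennreal (d * real DIM('a) * G) * indicator Q h \<partial>(lborel :: 'a measure))"
 proof (rule nn_integral_mono)
  fix h :: 'a
  have "(\<integral>\<^sup>+x. ennreal \<bar>\<psi> (x + h) - \<psi> x\<bar> * indicator Q h \<partial>lborel) = (\<integral>\<^sup>+x. ennreal \<bar>\<psi> (x + h) - \<psi> x\<bar> \<partial>lborel) * indicator Q h"
   by (rule nn_integral_multc) measurable
  also have "\<dots> <= ennreal (norm h * G) * indicator Q h"
   unfolding G_def by (intro mult_right_mono test_function_translation[OF \<psi>]) simp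
  also have "\<dots> <= ennreal (d * real DIM('a) * G) * indicator Q h"
   using Qn[of h] G0 by (cases "h \<in> Q") (auto intro!: ennreal_leI mult_right_mono)
  finally show "(\<integral>\<^sup>+x. ennreal \<bar>\<psi> (x + h) - \<psi> x\<bar> * indicator Q h \<partial>lborel) <= ennreal (d * real DIM('a) * G) * indicator Q h" .
 qed
 also have "\<dots> = ennreal (d * real DIM('a) * G) * ennreal (d ^ DIM('a))"
  by (simp add: nn_integral_cmult_indicator Qem)
 also have "\<dots> = ennreal (d ^ DIM('a) * (d * real DIM('a) * G))"
  by (subst mult.commute, rule ennreal_mult'[symmetric]) (use d in simp)
 also have "(\<integral>\<^sup>+x. ennreal \<bar>a x\<bar> \<partial>lborel) = ennreal (LINT x|lborel. \<bar>a x\<bar>)"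
  using ia' unfolding a_def[symmetric] by (rule nn_integral_eq_integral) simp
 finally have "ennreal (d ^ DIM('a) * I) <= ennreal (d ^ DIM('a) * (d * real DIM('a) * G)) + ennreal (LINT x|lborel. \<bar>a x\<bar>)"
  by (simp add: add_right_mono)
 also have "\<dots> = ennreal (d ^ DIM('a) * (d * real DIM('a) * G) + (LINT x|lborel. \<bar>a x\<bar>))"
  using d G0 by (intro ennreal_plus[symmetric]) auto
 finally have "d ^ DIM('a) * I <= d ^ DIM('a) * (d * real DIM('a) * G) + (LINT x|lborel. \<bar>a x\<bar>)"
  using d G0 by (subst (asm) ennreal_le_iff) auto
 then show "d ^ DIM('a) * (LINT x|lborel. \<bar>\<psi> x\<bar>) \<le>
   d ^ DIM('a) * (d * real DIM('a) * (LINT x|lborel. norm (grad \<psi> x))) +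
   (LINT x|lborel. \<bar>LINT h|lborel. indicator Q h * \<psi> (x + h)\<bar>)"
  unfolding I_def G_def a_def .
qed

text \<open>
 Up to an error proportional to the side of a small cube, uniformly in \<open>k\<close>, the \<open>L\<^sup>1\<close> norm of \<open>\<psi> k\<close> is that
 of its averages. The averages are integrals over boxes, so they tend to 0 pointwise; they are uniformly
 bounded and supported in a fixed bounded set, hence tend to 0 in \<open>L\<^sup>1\<close>.
\<close>

theorem Rellich_test_functions:
 fixes \<psi> :: "nat => 'a::euclidean_space => real"
 assumes \<Omega>: "bounded \<Omega>" and \<psi>: "\<And>k. test_function \<Omega> (\<psi> k)"
  and G: "\<And>k. (LINT x|lborel. norm (grad (\<psi> k) x)) <= C" and L: "\<And>k. (LINT x|lborel. \<bar>\<psi> k x\<bar>) <= C"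
  and box: "\<And>a b. (%k. LINT x|lborel. indicator (cbox a b) x * \<psi> k x) ----> 0"
 shows "(%k. LINT x|lborel. \<bar>\<psi> k x\<bar>) ----> 0"
proof (rule LIMSEQ_I)
 fix e :: real assume e: "0 < e"
 have "0 <= (LINT x|lborel. \<bar>\<psi> 0 x\<bar>)" by simp
 then have C0: "0 <= C" using L[of 0] by linarith
 define n where "n = DIM('a)"
 have n: "0 < n" by (simp add: n_def)
 define d where "d = e / (2 * real n * (C + 1))"
 have d: "0 < d" using e n C0 by (simp add: d_def)
 have dC: "d * real n * C < e / 2"
 proof -
  have "d * real n * C = e / 2 * (C / (C + 1))" using n C0 by (simp add: d_def)
  also have "\<dots> < e / 2 * 1" using e C0 by (intro mult_strict_left_mono) auto
  finally show ?thesis by simp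
 qed
 define Q where "Q = cbox (0::'a) (d *R One)"
 define a where "a k x = (LINT h|lborel. indicator Q h * \<psi> k (x + h))" for k x
 have [measurable]: "\<psi> k \<in> borel_measurable borel" for k
  by (rule borel_measurable_continuous[OF continuous_test_function[OF \<psi>]])
 have Qm [measurable]: "Q \<in> sets borel" by (simp add: Q_def)
 have i\<psi>: "integrable lborel (\<psi> k)" for k
 proof -
  obtain K where "compact K" "\<And>x. x \<notin> K ==> \<psi> k x = 0" using test_function_support[OF \<psi>[of k]] by metis
  then show ?thesis by (intro compact_support_integrable[OF continuous_test_function[OF \<psi>]]) auto
 qed
 have am [measurable]: "a k \<in> borel_measurable borel" for k
  unfolding a_def by (intro lborel.borel_measurable_lebesgue_integral) measurable
 have a_eq: "a k x = (LINT y|lborel. indicator (cbox x (x + d *R One)) y * \<psi> k y)" for k x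
 proof -
  have "(LINT y|lborel. indicator (cbox x (x + d *R One)) y * \<psi> k y) =
    (LINT h|lborel. indicator (cbox x (x + d *R One)) (x + h) * \<psi> k (x + h))"
   by (rule integral_translation[symmetric]) measurable
  also have "\<dots> = a k x"
   unfolding a_def by (intro Bochner_Integration.integral_cong)
    (auto simp: indicator_def Q_def mem_box inner_add_left)
  finally show ?thesis by simp
 qed
 have ab: "\<bar>a k x\<bar> <= C" for k x
 proof -
  have i: "integrable lborel (%y. indicator (cbox x (x + d *R One)) y * \<psi> k y)"
   using integrable_mult_indicator[of "cbox x (x + d *R One)" lborel "\<psi> k"] i\<psi>[of k] by simp
  have "\<bar>a k x\<bar> <= (LINT y|lborel. \<bar>indicator (cbox x (x + d *R One)) y * \<psi> k y\<bar>)"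
   unfolding a_eq by (rule integral_abs_bound)
  also have "\<dots> <= (LINT y|lborel. \<bar>\<psi> k y\<bar>)"
   using i i\<psi>[of k] by (intro integral_mono) (auto simp: indicator_def)
  finally show ?thesis using L[of k] by linarith
 qed
 obtain R where R: "\<And>x. x \<in> \<Omega> ==> norm x <= R" using \<Omega> unfolding bounded_iff by blast
 have a0: "a k x = 0" if x: "R + d * real n < norm x" for k x
 proof -
  have "indicator Q h * \<psi> k (x + h) = 0" for h
  proof (cases "h \<in> Q")
   case True
   have "norm h <= (\<Sum>b\<in>Basis. \<bar>h \<bullet> b\<bar>)" by (rule norm_le_l1)
   also have "\<dots> <= (\<Sum>b\<in>(Basis::'a set). d)" using True by (intro sum_mono) (auto simp: Q_def mem_box)
   finally have "norm h <= d * real n" by (simp add: mult.commute n_def)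
   then have "R < norm (x + h)" using x norm_triangle_ineq2[of x "- h"] by simp
   then have "x + h \<notin> \<Omega>" using R by force
   then show ?thesis using test_function_zero_outside[OF \<psi>] by simp
  qed simp
  then have "(%h. indicator Q h * \<psi> k (x + h)) = (%_. 0)" by (rule ext)
  then show ?thesis by (simp add: a_def)
 qed
 have "(%k. LINT x|lborel. \<bar>a k x\<bar>) ----> (LINT x|(lborel::'a measure). 0)"
 proof (rule integral_dominated_convergence[where w = "%x. indicator (cball 0 (R + d * real n)) x *R C"])
  show "integrable lborel (%x. indicator (cball (0::'a) (R + d * real n)) x *R C)" by (rule borel_integrable_compact) auto
  show "AE x in lborel. (%k. \<bar>a k x\<bar>) ----> 0"
   unfolding a_eq using box tendsto_rabs_zero by (intro AE_I2) blast
  show "AE x in lborel. norm \<bar>a k x\<bar> <= indicator (cball 0 (R + d * real n)) x *R C" for k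
  proof (rule AE_I2)
   fix x show "norm \<bar>a k x\<bar> <= indicator (cball 0 (R + d * real n)) x *R C"
    using ab[of k x] a0[where k = k and x = x] by (cases "norm x <= R + d * real n") auto
  qed
 qed measurable
 then have "(%k. LINT x|lborel. \<bar>a k x\<bar>) ----> 0" by simp
 then have "\<forall>\<^sub>F k in sequentially. (LINT x|lborel. \<bar>a k x\<bar>) < d ^ n * (e / 2)"
  using d e by (intro order_tendstoD(2)) auto
 then obtain N where N: "\<And>k. k >= N ==> (LINT x|lborel. \<bar>a k x\<bar>) < d ^ n * (e / 2)" unfolding eventually_sequentially by blast
 have "norm ((LINT x|lborel. \<bar>\<psi> k x\<bar>) - 0) < e" if k: "k >= N" for k
 proof -
  have "d ^ n * (LINT x|lborel. \<bar>\<psi> k x\<bar>) <= d ^ n * (d * real n * (LINT x|lborel. norm (grad (\<psi> k) x))) + (LINT x|lborel. \<bar>a k x\<bar>)"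
   using test_function_average(1)[OF \<psi> d, of k] unfolding a_def Q_def n_def .
  also have "d ^ n * (d * real n * (LINT x|lborel. norm (grad (\<psi> k) x))) <= d ^ n * (d * real n * C)"
   using d G[of k] by (intro mult_left_mono) auto
  also have "d ^ n * (d * real n * C) + (LINT x|lborel. \<bar>a k x\<bar>) < d ^ n * (e / 2) + d ^ n * (e / 2)"
   using N[OF k] dC d by (intro add_strict_mono mult_strict_left_mono) auto
  also have "\<dots> = d ^ n * e" unfolding distrib_left[symmetric] by simp
  finally have "(LINT x|lborel. \<bar>\<psi> k x\<bar>) < e" using d by simp
  then show ?thesis by simp
 qed
 then show "\<exists>no. \<forall>k\<ge>no. norm ((LINT x|lborel. \<bar>\<psi> k x\<bar>) - 0) < e" by blast
qed

section \<open>The space W10\<close>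

lemma Lp_space_eq: "Lp_space r \<Omega> = LpM r (lebesgue_on \<Omega>)"
 by (simp add: Lp_space_def LpM_def)

lemma Lp_norm_eq: "Lp_norm r \<Omega> g = Ip r (lebesgue_on \<Omega>) g powr (1 / r)"
 by (simp add: Lp_norm_def Ip_def)

lemma Lp_norm_powr: "0 < r ==> Lp_norm r \<Omega> g powr r = Ip r (lebesgue_on \<Omega>) g"
 by (simp add: Lp_norm_eq powr_powr)

lemma Lp_norm_tendsto_0_iff:
 assumes "0 < r"
 shows "(%n. Lp_norm r \<Omega> (f n)) ----> 0 \<longleftrightarrow> (%n. Ip r (lebesgue_on \<Omega>) (f n)) ----> 0"
proof
 assume "(%n. Lp_norm r \<Omega> (f n)) ----> 0"
 then have "(%n. Lp_norm r \<Omega> (f n) powr r) ----> 0 powr r"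
  using assms by (intro tendsto_powr') (auto simp: Lp_norm_eq)
 then show "(%n. Ip r (lebesgue_on \<Omega>) (f n)) ----> 0" using assms by (simp add: Lp_norm_powr)
next
 assume "(%n. Ip r (lebesgue_on \<Omega>) (f n)) ----> 0"
 then have "(%n. Ip r (lebesgue_on \<Omega>) (f n) powr (1 / r)) ----> 0 powr (1 / r)"
  using assms by (intro tendsto_powr') auto
 then show "(%n. Lp_norm r \<Omega> (f n)) ----> 0" by (simp add: Lp_norm_eq)
qed

lemma lebesgue_on_measurable_AE:
 fixes f g :: "'a::euclidean_space => 'b::euclidean_space"
 assumes \<Omega>: "\<Omega> \<in> sets lebesgue" and f: "f \<in> borel_measurable (lebesgue_on \<Omega>)" and eq: "AE x in lebesgue_on \<Omega>. f x = g x"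
 shows "g \<in> borel_measurable (lebesgue_on \<Omega>)"
proof -
 have f': "(%x. indicator \<Omega> x *R f x) \<in> borel_measurable lebesgue"
  using f \<Omega> by (subst (asm) borel_measurable_restrict_space_iff) auto
 have "AE x in lebesgue. indicator \<Omega> x *R f x = indicator \<Omega> x *R g x"
  using eq \<Omega> by (subst (asm) AE_restrict_space_iff) (auto elim!: eventually_mono simp: indicator_def)
 with f' have "(%x. indicator \<Omega> x *R g x) \<in> borel_measurable lebesgue" by (rule borel_measurable_AE)
 then show ?thesis using \<Omega> by (subst borel_measurable_restrict_space_iff) auto
qed

lemma grad_eqI:
 assumes "(\<phi> has_derivative (%h. v \<bullet> h)) (at x)" shows "grad \<phi> x = v"
 unfolding grad_def frechet_derivative_at[OF assms, symmetric] by (rule euclidean_representation)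

lemma test_function_add:
 assumes "test_function \<Omega> \<phi>" "test_function \<Omega> \<psi>"
 shows "test_function \<Omega> (%x. \<phi> x + \<psi> x)" "grad (%x. \<phi> x + \<psi> x) x = grad \<phi> x + grad \<psi> x"
proof -
 have "closure {x. \<phi> x + \<psi> x \<noteq> 0} \<subseteq> closure ({x. \<phi> x \<noteq> 0} \<union> {x. \<psi> x \<noteq> 0})" by (intro closure_mono) auto
 then have sub: "closure {x. \<phi> x + \<psi> x \<noteq> 0} \<subseteq> closure {x. \<phi> x \<noteq> 0} \<union> closure {x. \<psi> x \<noteq> 0}" by (simp add: closure_Un)
 have "compact (closure {x. \<phi> x \<noteq> 0} \<union> closure {x. \<psi> x \<noteq> 0})" using assms by (intro compact_Un) (auto simp: test_function_def)
 then have "compact (closure {x. \<phi> x + \<psi> x \<noteq> 0})"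
  using sub bounded_subset unfolding compact_eq_bounded_closed by blast
 then show "test_function \<Omega> (%x. \<phi> x + \<psi> x)" using assms sub unfolding test_function_def by (auto intro: Ck_add)
 show "grad (%x. \<phi> x + \<psi> x) x = grad \<phi> x + grad \<psi> x"
  using has_derivative_add[OF test_function_has_derivative[OF assms(1)] test_function_has_derivative[OF assms(2)], of x]
  by (intro grad_eqI) (simp add: inner_add_left)
qed

lemma test_function_cmult:
 assumes "test_function \<Omega> \<phi>"
 shows "test_function \<Omega> (%x. c * \<phi> x)" "grad (%x. c * \<phi> x) x = c *R grad \<phi> x"
proof -
 have sub: "closure {x. c * \<phi> x \<noteq> 0} \<subseteq> closure {x. \<phi> x \<noteq> 0}" by (intro closure_mono) auto
 have "compact (closure {x. \<phi> x \<noteq> 0})" using assms by (auto simp: test_function_def)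
 then have "compact (closure {x. c * \<phi> x \<noteq> 0})"
  using sub bounded_subset unfolding compact_eq_bounded_closed by blast
 then show "test_function \<Omega> (%x. c * \<phi> x)" using assms sub unfolding test_function_def by (auto intro: Ck_mult)
 show "grad (%x. c * \<phi> x) x = c *R grad \<phi> x"
  using has_derivative_mult_right[OF test_function_has_derivative[OF assms], of c x]
  by (intro grad_eqI) simp
qed

locale sobolev_domain =
 fixes \<Omega> :: "'a::euclidean_space set" and p :: real
 assumes \<Omega>_open: "open \<Omega>" and \<Omega>_bounded: "bounded \<Omega>" and dim: "2 <= DIM('a)"
  and p1: "1 < p" and pN: "p < real DIM('a)"
begin

abbreviation "M \<equiv> lebesgue_on \<Omega>"

lemma \<Omega>_lebesgue [measurable]: "\<Omega> \<in> sets lebesgue" using \<Omega>_open by auto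

lemma finite_M: "finite_measure M"
proof
 have "\<Omega> \<in> lmeasurable" using \<Omega>_open \<Omega>_bounded by (rule lmeasurable_open[rotated])
 then show "emeasure M (space M) \<noteq> \<infinity>" by (simp add: emeasure_restrict_space fmeasurable_def less_top)
qed

sublocale finite_measure M by (rule finite_M)

lemma p0: "0 <= p" "0 < p" "1 <= p" using p1 by auto

lemma continuous_measurable_M:
 fixes f :: "'a => 'b::euclidean_space"
 assumes "continuous_on UNIV f" shows "f \<in> borel_measurable M"
proof -
 have "f \<in> borel_measurable lebesgue"
  by (rule measurable_completion) (use borel_measurable_continuous[OF assms] in simp)
 then show ?thesis by (rule measurable_restrict_space1)
qed

lemma bounded_in_LpM:
 fixes f :: "'a => 'b::euclidean_space"
 assumes "f \<in> borel_measurable M" "\<And>x. norm (f x) <= B" "0 <= r"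
 shows "f \<in> LpM r M"
 by (rule LpM_dominated[OF assms(1), where w = "%_. B powr r"]) (use assms in \<open>auto intro!: powr_mono2\<close>)

lemma test_LpM:
 assumes "test_function \<Omega> \<phi>" "0 <= r"
 shows "\<phi> \<in> LpM r M" "grad \<phi> \<in> LpM r M"
proof -
 obtain K where K: "compact K" "\<And>x. x \<notin> K ==> \<phi> x = 0" "\<And>x. x \<notin> K ==> grad \<phi> x = 0"
  using test_function_support[OF assms(1)] by metis
 obtain B where "\<And>x. norm (\<phi> x) <= B" using compact_support_bounded[OF continuous_test_function[OF assms(1)] K(1,2)] by blast
 then show "\<phi> \<in> LpM r M" using assms by (intro bounded_in_LpM continuous_measurable_M continuous_test_function) auto
 obtain B where "\<And>x. norm (grad \<phi> x) <= B" using compact_support_bounded[OF continuous_grad[OF assms(1)] K(1,3)] by blast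
 then show "grad \<phi> \<in> LpM r M" using assms by (intro bounded_in_LpM continuous_measurable_M continuous_grad) auto
qed

lemma test_Ip_lborel:
 assumes "test_function \<Omega> \<phi>" "0 < r"
 shows "Ip r M \<phi> = (LINT x|lborel. \<bar>\<phi> x\<bar> powr r)" "Ip r M (grad \<phi>) = (LINT x|lborel. norm (grad \<phi> x) powr r)"
proof -
 have z: "\<phi> x = 0" "grad \<phi> x = 0" if "x \<notin> \<Omega>" for x
  using test_function_support[OF assms(1)] that by (metis subset_iff)+
 have [measurable]: "\<phi> \<in> borel_measurable borel" "grad \<phi> \<in> borel_measurable borel"
  by (intro borel_measurable_continuous continuous_test_function[OF assms(1)] continuous_grad[OF assms(1)])+
 show "Ip r M \<phi> = (LINT x|lborel. \<bar>\<phi> x\<bar> powr r)"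
  unfolding Ip_def real_norm_def by (rule lebesgue_on_zero_outside(2)[OF \<Omega>_lebesgue]) (use z in auto)
 show "Ip r M (grad \<phi>) = (LINT x|lborel. norm (grad \<phi> x) powr r)"
  unfolding Ip_def by (rule lebesgue_on_zero_outside(2)[OF \<Omega>_lebesgue]) (use z in auto)
qed

lemma integrable_imp_locally_integrable:
 fixes f :: "'a => 'b::euclidean_space"
 assumes "integrable M f" shows "locally_integrable \<Omega> f"
 unfolding locally_integrable_def
proof (intro allI impI)
 fix K assume K: "compact K \<and> K \<subseteq> \<Omega>"
 then have Km: "K \<in> sets lebesgue" by (auto dest: compact_imp_closed)
 have "integrable lebesgue (%x. indicator \<Omega> x *R f x)"
  using assms unfolding lebesgue_on_restrict(1)[OF \<Omega>_lebesgue] .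
 then have "integrable lebesgue (%x. indicator K x *R (indicator \<Omega> x *R f x))"
  by (rule integrable_mult_indicator[OF Km])
 also have "(%x. indicator K x *R (indicator \<Omega> x *R f x)) = (%x. indicator K x *R f x)"
  by (intro ext) (use K in \<open>auto simp: indicator_def\<close>)
 finally show "integrable (lebesgue_on K) f" unfolding lebesgue_on_restrict(1)[OF Km] .
qed

lemma weak_gradient_unique:
 assumes "has_weak_gradient \<Omega> u g" "has_weak_gradient \<Omega> u g'"
 shows "AE x in M. g x = g' x"
proof -
 have li: "locally_integrable \<Omega> g" "locally_integrable \<Omega> g'" using assms by (auto simp: has_weak_gradient_def)
 have int: "integrable M (%x. (f x \<bullet> b) * \<phi> x)"
  if f: "locally_integrable \<Omega> f" and \<phi>: "test_function \<Omega> \<phi>" for f :: "'a => 'a" and \<phi> b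
 proof -
  obtain K where K: "compact K" "K \<subseteq> \<Omega>" "\<And>x. x \<notin> K ==> \<phi> x = 0"
   using test_function_support[OF \<phi>] by metis
  obtain B where B: "0 <= B" "\<And>x. norm (\<phi> x) <= B" using compact_support_bounded[OF continuous_test_function[OF \<phi>] K(1,3)] by blast
  have Km: "K \<in> sets lebesgue" using K by (auto dest: compact_imp_closed)
  have i: "integrable lebesgue (%x. indicator K x *R f x)"
   using f K unfolding locally_integrable_def lebesgue_on_restrict(1)[OF Km, symmetric] by blast
  have \<phi>m: "\<phi> \<in> borel_measurable lebesgue"
   by (rule measurable_completion) (use borel_measurable_continuous[OF continuous_test_function[OF \<phi>]] in simp)
  have fm: "(%x. indicator K x *R f x) \<in> borel_measurable lebesgue" using i by simp
  have "integrable lebesgue (%x. ((indicator K x *R f x) \<bullet> b) * \<phi> x)"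
  proof (rule Bochner_Integration.integrable_bound)
   show "integrable lebesgue (%x. norm (indicator K x *R f x) * (norm b * B))" using i by (intro integrable_mult_left integrable_norm)
   show "(%x. ((indicator K x *R f x) \<bullet> b) * \<phi> x) \<in> borel_measurable lebesgue" using fm \<phi>m by measurable
   show "AE x in lebesgue. norm (((indicator K x *R f x) \<bullet> b) * \<phi> x) <= norm (norm (indicator K x *R f x) * (norm b * B))"
   proof (rule AE_I2)
    fix x
    have "\<bar>(indicator K x *R f x) \<bullet> b\<bar> * \<bar>\<phi> x\<bar> <= (norm (indicator K x *R f x) * norm b) * B"
     using B(1,2) by (intro mult_mono Cauchy_Schwarz_ineq2) auto
    then show "norm (((indicator K x *R f x) \<bullet> b) * \<phi> x) <= norm (norm (indicator K x *R f x) * (norm b * B))"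
     unfolding real_norm_def by (intro order_trans[OF _ abs_ge_self]) (simp only: abs_mult mult.assoc)
   qed
  qed
  also have "(%x. ((indicator K x *R f x) \<bullet> b) * \<phi> x) = (%x. indicator \<Omega> x *R ((f x \<bullet> b) * \<phi> x))"
  proof
   fix x show "((indicator K x *R f x) \<bullet> b) * \<phi> x = indicator \<Omega> x *R ((f x \<bullet> b) * \<phi> x)"
    using K(2) K(3)[of x] by (cases "x \<in> K") (auto simp: indicator_def)
  qed
  finally show ?thesis unfolding lebesgue_on_restrict(1)[OF \<Omega>_lebesgue] .
 qed
 have "AE x in M. (g x - g' x) \<bullet> b = 0" if b: "b \<in> Basis" for b
 proof (rule fundamental_lemma[OF \<Omega>_open])
  show "locally_integrable \<Omega> (%x. (g x - g' x) \<bullet> b)"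
   using li unfolding locally_integrable_def by simp
  fix \<phi> assume \<phi>: "test_function \<Omega> \<phi>"
  have "(LINT x|M. (g x \<bullet> b) * \<phi> x) = (LINT x|M. (g' x \<bullet> b) * \<phi> x)"
  proof -
   have "(LINT x|M. u x * frechet_derivative \<phi> (at x) b) = - (LINT x|M. (g x \<bullet> b) * \<phi> x)"
    "(LINT x|M. u x * frechet_derivative \<phi> (at x) b) = - (LINT x|M. (g' x \<bullet> b) * \<phi> x)"
    using assms \<phi> b unfolding has_weak_gradient_def by blast+
   then show ?thesis by simp
  qed
  moreover have "integrable M (%x. (g x \<bullet> b) * \<phi> x)" "integrable M (%x. (g' x \<bullet> b) * \<phi> x)"
   by (rule int[OF li(1) \<phi>] int[OF li(2) \<phi>])+
  ultimately show "(LINT x|M. (g x - g' x) \<bullet> b * \<phi> x) = 0"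
   by (simp add: inner_diff_left left_diff_distrib)
 qed
 then have "AE x in M. \<forall>b\<in>Basis. (g x - g' x) \<bullet> b = 0" by (intro AE_finite_allI) auto
 then show ?thesis
 proof eventually_elim
  case (elim x)
  then have "g x - g' x = 0" by (subst euclidean_all_zero_iff[symmetric]) auto
  then show ?case by simp
 qed
qed

lemma has_weak_gradient_weak_gradient: "has_weak_gradient \<Omega> u g ==> has_weak_gradient \<Omega> u (weak_gradient \<Omega> u)"
 unfolding weak_gradient_def by (rule someI[of "has_weak_gradient \<Omega> u"])

lemma weak_gradient_AE: "has_weak_gradient \<Omega> u g ==> AE x in M. g x = weak_gradient \<Omega> u x"
 using has_weak_gradient_weak_gradient weak_gradient_unique by blast

text \<open>
 A member of \<open>W10 p \<Omega>\<close> together with a version of its gradient. Approximation by test functions is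
 stated with classical gradients, so that the choice operator in the weak gradient does not interfere.
\<close>

definition W10_pair :: "('a => real) => ('a => 'a) => bool" where
 "W10_pair u G \<longleftrightarrow> u \<in> LpM p M \<and> G \<in> LpM p M \<and>
   (\<forall>e>0. \<exists>\<phi>. test_function \<Omega> \<phi> \<and> Ip p M (%x. \<phi> x - u x) < e \<and> Ip p M (%x. grad \<phi> x - G x) < e)"

lemma W10_pairD: assumes "W10_pair u G" shows "u \<in> LpM p M" "G \<in> LpM p M"
 and "0 < e ==> \<exists>\<phi>. test_function \<Omega> \<phi> \<and> Ip p M (%x. \<phi> x - u x) < e \<and> Ip p M (%x. grad \<phi> x - G x) < e"
 using assms unfolding W10_pair_def by blast+

lemma W10_pair_seq:
 assumes "W10_pair u G"
 obtains \<phi> where "\<And>n::nat. test_function \<Omega> (\<phi> n)" "(%n. Ip p M (%x. \<phi> n x - u x)) ----> 0" "(%n. Ip p M (%x. grad (\<phi> n) x - G x)) ----> 0"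
proof -
 have "\<exists>\<phi>. test_function \<Omega> \<phi> \<and> Ip p M (%x. \<phi> x - u x) < 1 / real (Suc n) \<and> Ip p M (%x. grad \<phi> x - G x) < 1 / real (Suc n)" for n
  by (rule W10_pairD(3)[OF assms]) simp
 then obtain \<phi> where \<phi>: "\<And>n. test_function \<Omega> (\<phi> n)" "\<And>n. Ip p M (%x. \<phi> n x - u x) < 1 / real (Suc n)"
  "\<And>n. Ip p M (%x. grad (\<phi> n) x - G x) < 1 / real (Suc n)" by metis
 have lim: "(%n. 1 / real (Suc n)) ----> 0" using LIMSEQ_inverse_real_of_nat by (simp add: inverse_eq_divide)
 have "(%n. Ip p M (%x. \<phi> n x - u x)) ----> 0"
  by (rule tendsto_if_diff_le[OF _ lim]) (use \<phi>(2) in \<open>simp add: less_imp_le\<close>)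
 moreover have "(%n. Ip p M (%x. grad (\<phi> n) x - G x)) ----> 0"
  by (rule tendsto_if_diff_le[OF _ lim]) (use \<phi>(3) in \<open>simp add: less_imp_le\<close>)
 ultimately show ?thesis by (rule that[OF \<phi>(1)])
qed

lemma W10_pairI_seq:
 assumes "u \<in> LpM p M" "G \<in> LpM p M" "\<And>n::nat. test_function \<Omega> (\<phi> n)"
  "(%n. Ip p M (%x. \<phi> n x - u x)) ----> 0" "(%n. Ip p M (%x. grad (\<phi> n) x - G x)) ----> 0"
 shows "W10_pair u G"
 unfolding W10_pair_def
proof (intro conjI assms allI impI)
 fix e :: real assume e: "0 < e"
 have "\<forall>\<^sub>F n in sequentially. Ip p M (%x. \<phi> n x - u x) < e \<and> Ip p M (%x. grad (\<phi> n) x - G x) < e"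
  by (intro eventually_conj order_tendstoD(2)[OF assms(4) e] order_tendstoD(2)[OF assms(5) e])
 then obtain n where "Ip p M (%x. \<phi> n x - u x) < e \<and> Ip p M (%x. grad (\<phi> n) x - G x) < e"
  unfolding eventually_sequentially by blast
 then show "\<exists>\<phi>. test_function \<Omega> \<phi> \<and> Ip p M (%x. \<phi> x - u x) < e \<and> Ip p M (%x. grad \<phi> x - G x) < e" using assms(3) by blast
qed

lemma test_W10_pair: "test_function \<Omega> \<phi> ==> W10_pair \<phi> (grad \<phi>)"
 unfolding W10_pair_def using test_LpM p0 by (auto intro!: exI[of _ \<phi>])

text \<open>
 Integration by parts holds for the approximating test functions and is preserved by convergence in \<open>L\<^sup>p\<close>.
\<close>

lemma W10_pair_has_weak_gradient:
 assumes "W10_pair u G" shows "has_weak_gradient \<Omega> u G"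
 unfolding has_weak_gradient_def
proof (intro conjI allI impI ballI)
 note uG = W10_pairD(1,2)[OF assms]
 have i: "integrable M u" "integrable M G" using LpM_imp_integrable[OF finite_M p0(3)] uG by blast+
 then show "locally_integrable \<Omega> u" "locally_integrable \<Omega> G" by (intro integrable_imp_locally_integrable; simp)+
 fix \<psi> and b :: 'a assume \<psi>: "test_function \<Omega> \<psi>" and b: "b \<in> Basis"
 obtain K where K: "compact K" "\<And>x. x \<notin> K ==> \<psi> x = 0" "\<And>x. x \<notin> K ==> grad \<psi> x = 0"
  using test_function_support[OF \<psi>] by metis
 obtain B1 where B1: "\<And>x. norm (\<psi> x) <= B1" using compact_support_bounded[OF continuous_test_function[OF \<psi>] K(1,2)] by blast
 obtain B2 where B2: "\<And>x. norm (grad \<psi> x) <= B2" using compact_support_bounded[OF continuous_grad[OF \<psi>] K(1,3)] by blast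
 have B3: "norm (grad \<psi> x \<bullet> b) <= B2" for x using Basis_le_norm[OF b, of "grad \<psi> x"] B2[of x] by simp
 obtain \<phi> where \<phi>: "\<And>n::nat. test_function \<Omega> (\<phi> n)" "(%n. Ip p M (%x. \<phi> n x - u x)) ----> 0" "(%n. Ip p M (%x. grad (\<phi> n) x - G x)) ----> 0"
  by (rule W10_pair_seq[OF assms]) (rule that)
 have m: "\<psi> \<in> borel_measurable M" "(%x. grad \<psi> x \<bullet> b) \<in> borel_measurable M"
  by (intro continuous_measurable_M continuous_intros continuous_test_function[OF \<psi>] continuous_grad[OF \<psi>])+
 have l1: "(%n. LINT x|M. (grad \<psi> x \<bullet> b) *R \<phi> n x) ----> (LINT x|M. (grad \<psi> x \<bullet> b) *R u x)"
  by (rule tendsto_integral_Lp[OF finite_M p0(3) test_LpM(1)[OF \<phi>(1) p0(1)] uG(1) \<phi>(2) m(2) B3])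
 have "(%n. LINT x|M. \<psi> x *R grad (\<phi> n) x) ----> (LINT x|M. \<psi> x *R G x)"
  by (rule tendsto_integral_Lp[OF finite_M p0(3) test_LpM(2)[OF \<phi>(1) p0(1)] uG(2) \<phi>(3) m(1) B1])
 then have l2: "(%n. (LINT x|M. \<psi> x *R grad (\<phi> n) x) \<bullet> b) ----> (LINT x|M. \<psi> x *R G x) \<bullet> b" by (intro tendsto_intros)
 have ie: "(LINT x|M. \<psi> x *R H x) \<bullet> b = (LINT x|M. (H x \<bullet> b) * \<psi> x)" if H: "H \<in> LpM p M" for H
 proof -
  have "integrable M (%x. \<psi> x *R H x)"
  proof (rule Bochner_Integration.integrable_bound)
   show "integrable M (%x. B1 *R norm (H x))" using LpM_imp_integrable[OF finite_M p0(3) H] by (intro integrable_scaleR_right integrable_norm)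
   show "(%x. \<psi> x *R H x) \<in> borel_measurable M" using m LpM_measurable[OF H] by simp
   have "norm (\<psi> x *R H x) <= norm (B1 *R norm (H x))" for x
   proof -
    have *: "norm (\<psi> x *R H x) <= B1 * norm (H x)" using B1[of x] by (simp add: mult_right_mono)
    then show ?thesis using order_trans[OF norm_ge_zero *] by simp
   qed
   then show "AE x in M. norm (\<psi> x *R H x) <= norm (B1 *R norm (H x))" by simp
  qed
  then have "(LINT x|M. \<psi> x *R H x) \<bullet> b = (LINT x|M. (\<psi> x *R H x) \<bullet> b)" by (rule integral_inner_left[symmetric])
  then show ?thesis by (simp add: mult.commute)
 qed
 have "(LINT x|M. (grad \<psi> x \<bullet> b) *R \<phi> n x) = - ((LINT x|M. \<psi> x *R grad (\<phi> n) x) \<bullet> b)" for n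
  using has_weak_gradient_test[OF \<Omega>_open \<phi>(1)[of n]] \<psi> b
  unfolding has_weak_gradient_def ie[OF test_LpM(2)[OF \<phi>(1) p0(1)]] frechet_derivative_eq_grad[OF \<psi>, symmetric]
  by (simp add: mult.commute)
 then have "(%n. LINT x|M. (grad \<psi> x \<bullet> b) *R \<phi> n x) ----> - ((LINT x|M. \<psi> x *R G x) \<bullet> b)"
  using tendsto_minus[OF l2] by simp
 then have "(LINT x|M. (grad \<psi> x \<bullet> b) *R u x) = - ((LINT x|M. \<psi> x *R G x) \<bullet> b)" using l1 LIMSEQ_unique by blast
 then show "(LINT x|M. u x * frechet_derivative \<psi> (at x) b) = - (LINT x|M. (G x \<bullet> b) * \<psi> x)"
  unfolding frechet_derivative_eq_grad[OF \<psi>] ie[OF uG(2)] by (simp add: mult.commute)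
qed

lemma W10_pair_add:
 assumes "W10_pair u G" "W10_pair v H" shows "W10_pair (%x. u x + v x) (%x. G x + H x)"
 unfolding W10_pair_def
proof (intro conjI allI impI)
 note L = W10_pairD(1,2)[OF assms(1)] W10_pairD(1,2)[OF assms(2)]
 show "(%x. u x + v x) \<in> LpM p M" "(%x. G x + H x) \<in> LpM p M" using L p0 by (auto intro: LpM_add)
 fix e :: real assume "0 < e"
 then have e: "0 < e / (2 * 2 powr p)" by simp
 obtain \<phi> where \<phi>: "test_function \<Omega> \<phi>" "Ip p M (%x. \<phi> x - u x) < e / (2 * 2 powr p)" "Ip p M (%x. grad \<phi> x - G x) < e / (2 * 2 powr p)"
  using W10_pairD(3)[OF assms(1) e] by blast
 obtain \<psi> where \<psi>: "test_function \<Omega> \<psi>" "Ip p M (%x. \<psi> x - v x) < e / (2 * 2 powr p)" "Ip p M (%x. grad \<psi> x - H x) < e / (2 * 2 powr p)"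
  using W10_pairD(3)[OF assms(2) e] by blast
 note T = test_LpM[OF \<phi>(1) p0(1)] test_LpM[OF \<psi>(1) p0(1)]
 have t: "test_function \<Omega> (%x. \<phi> x + \<psi> x)" "grad (%x. \<phi> x + \<psi> x) x = grad \<phi> x + grad \<psi> x" for x
  using test_function_add[OF \<phi>(1) \<psi>(1)] by auto
 have s: "2 powr p * (a + b) < e" if "a < e / (2 * 2 powr p)" "b < e / (2 * 2 powr p)" for a b :: real
 proof -
  have "2 powr p * (a + b) < 2 powr p * (e / (2 * 2 powr p) + e / (2 * 2 powr p))" using that by (intro mult_strict_left_mono add_strict_mono) auto
  then show ?thesis by (simp add: distrib_left)
 qed
 have "Ip p M (%x. (\<phi> x - u x) + (\<psi> x - v x)) < e"
  using Ip_add_le[OF p0(1) LpM_diff(1)[OF p0(1) T(1) L(1)] LpM_diff(1)[OF p0(1) T(3) L(3)]] s[OF \<phi>(2) \<psi>(2)] by linarith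
 moreover have "Ip p M (%x. (grad \<phi> x - G x) + (grad \<psi> x - H x)) < e"
  using Ip_add_le[OF p0(1) LpM_diff(1)[OF p0(1) T(2) L(2)] LpM_diff(1)[OF p0(1) T(4) L(4)]] s[OF \<phi>(3) \<psi>(3)] by linarith
 ultimately show "\<exists>\<phi>. test_function \<Omega> \<phi> \<and> Ip p M (%x. \<phi> x - (u x + v x)) < e \<and> Ip p M (%x. grad \<phi> x - (G x + H x)) < e"
  by (intro exI[of _ "%x. \<phi> x + \<psi> x"]) (simp add: t algebra_simps)
qed

lemma W10_pair_scale:
 assumes "W10_pair u G" shows "W10_pair (%x. c * u x) (%x. c *R G x)"
 unfolding W10_pair_def
proof (intro conjI allI impI)
 note L = W10_pairD(1,2)[OF assms(1)]
 show "(%x. c * u x) \<in> LpM p M" "(%x. c *R G x) \<in> LpM p M" using LpM_scale(1)[OF L(1), of c] LpM_scale(1)[OF L(2), of c] by auto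
 fix e :: real assume e0: "0 < e"
 define C where "C = \<bar>c\<bar> powr p + 1"
 have C: "0 < C" by (simp add: C_def add_nonneg_pos)
 have e: "0 < e / C" using C e0 by simp
 obtain \<phi> where \<phi>: "test_function \<Omega> \<phi>" "Ip p M (%x. \<phi> x - u x) < e / C" "Ip p M (%x. grad \<phi> x - G x) < e / C"
  using W10_pairD(3)[OF assms(1) e] by blast
 note T = test_LpM[OF \<phi>(1) p0(1)]
 have t: "test_function \<Omega> (%x. c * \<phi> x)" "grad (%x. c * \<phi> x) x = c *R grad \<phi> x" for x
  using test_function_cmult[OF \<phi>(1)] by auto
 have s: "\<bar>c\<bar> powr p * a < e" if "a < e / C" "0 <= a" for a :: real
 proof -
  have "\<bar>c\<bar> powr p * a <= C * a" using that by (intro mult_right_mono) (auto simp: C_def)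
  also have "\<dots> < C * (e / C)" using that C by (intro mult_strict_left_mono) auto
  finally show ?thesis using C by simp
 qed
 have "Ip p M (%x. c *R (\<phi> x - u x)) < e" "Ip p M (%x. c *R (grad \<phi> x - G x)) < e"
  using Ip_scale[OF LpM_diff(1)[OF p0(1) T(1) L(1)], of c] s[OF \<phi>(2) Ip_nonneg]
   Ip_scale[OF LpM_diff(1)[OF p0(1) T(2) L(2)], of c] s[OF \<phi>(3) Ip_nonneg] by linarith+
 then show "\<exists>\<phi>. test_function \<Omega> \<phi> \<and> Ip p M (%x. \<phi> x - c * u x) < e \<and> Ip p M (%x. grad \<phi> x - c *R G x) < e"
  by (intro exI[of _ "%x. c * \<phi> x"]) (simp add: t algebra_simps)
qed

lemma W10_pair_zero: "W10_pair (%_. 0) (%_. 0)"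
proof -
 have "test_function \<Omega> (%_. 0)" by (simp add: test_function_def)
 from W10_pair_scale[OF test_W10_pair[OF this], of 0] show ?thesis by simp
qed

lemma W10_pair_cong_AE:
 assumes "W10_pair u G" "AE x in M. u x = u' x" "AE x in M. G x = G' x"
 shows "W10_pair u' G'"
proof -
 note L = W10_pairD(1,2)[OF assms(1)]
 have m: "u' \<in> borel_measurable M" "G' \<in> borel_measurable M"
  using lebesgue_on_measurable_AE[OF \<Omega>_lebesgue LpM_measurable[OF L(1)] assms(2)]
   lebesgue_on_measurable_AE[OF \<Omega>_lebesgue LpM_measurable[OF L(2)] assms(3)] by auto
 have L': "u' \<in> LpM p M" "G' \<in> LpM p M"
  using LpM_cong_AE[OF L(1) m(1) assms(2)] LpM_cong_AE[OF L(2) m(2) assms(3)] by auto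
 have e1: "Ip p M (%x. \<phi> x - u' x) = Ip p M (%x. \<phi> x - u x)"
  and e2: "Ip p M (%x. grad \<phi> x - G' x) = Ip p M (%x. grad \<phi> x - G x)" if "test_function \<Omega> \<phi>" for \<phi>
 proof -
  note T = LpM_measurable[OF test_LpM(1)[OF that p0(1)]] LpM_measurable[OF test_LpM(2)[OF that p0(1)]]
   LpM_measurable[OF L(1)] LpM_measurable[OF L(2)]
  show "Ip p M (%x. \<phi> x - u' x) = Ip p M (%x. \<phi> x - u x)"
  proof (rule Ip_cong_AE)
   show "AE x in M. \<phi> x - u' x = \<phi> x - u x" using assms(2) by eventually_elim simp
  qed (intro borel_measurable_diff T m)+
  show "Ip p M (%x. grad \<phi> x - G' x) = Ip p M (%x. grad \<phi> x - G x)"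
  proof (rule Ip_cong_AE)
   show "AE x in M. grad \<phi> x - G' x = grad \<phi> x - G x" using assms(3) by eventually_elim simp
  qed (intro borel_measurable_diff T m)+
 qed
 have "\<exists>\<phi>. test_function \<Omega> \<phi> \<and> Ip p M (%x. \<phi> x - u' x) < e \<and> Ip p M (%x. grad \<phi> x - G' x) < e" if "0 < e" for e
 proof -
  obtain \<phi> where "test_function \<Omega> \<phi>" "Ip p M (%x. \<phi> x - u x) < e" "Ip p M (%x. grad \<phi> x - G x) < e"
   using W10_pairD(3)[OF assms(1) \<open>0 < e\<close>] by blast
  then show ?thesis using e1 e2 by (intro exI[of _ \<phi>]) simp
 qed
 then show ?thesis unfolding W10_pair_def using L' by blast
qed

lemma W10_pair_closed:
 assumes uG: "\<And>n::nat. W10_pair (u n) (G n)" and L: "v \<in> LpM p M" "H \<in> LpM p M"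
  and lim: "(%n. Ip p M (%x. u n x - v x)) ----> 0" "(%n. Ip p M (%x. G n x - H x)) ----> 0"
 shows "W10_pair v H"
 unfolding W10_pair_def
proof (intro conjI L allI impI)
 fix e :: real assume "0 < e"
 then have e: "0 < e / (2 * 2 powr p)" by simp
 have "\<forall>\<^sub>F n in sequentially. Ip p M (%x. u n x - v x) < e / (2 * 2 powr p) \<and> Ip p M (%x. G n x - H x) < e / (2 * 2 powr p)"
  by (intro eventually_conj order_tendstoD(2)[OF lim(1) e] order_tendstoD(2)[OF lim(2) e])
 then obtain n where n: "Ip p M (%x. u n x - v x) < e / (2 * 2 powr p)" "Ip p M (%x. G n x - H x) < e / (2 * 2 powr p)"
  unfolding eventually_sequentially by blast
 obtain \<phi> where \<phi>: "test_function \<Omega> \<phi>" "Ip p M (%x. \<phi> x - u n x) < e / (2 * 2 powr p)" "Ip p M (%x. grad \<phi> x - G n x) < e / (2 * 2 powr p)"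
  using W10_pairD(3)[OF uG e] by blast
 have s: "2 powr p * (a + b) < e" if "a < e / (2 * 2 powr p)" "b < e / (2 * 2 powr p)" for a b :: real
 proof -
  have "2 powr p * (a + b) < 2 powr p * (e / (2 * 2 powr p) + e / (2 * 2 powr p))" using that by (intro mult_strict_left_mono add_strict_mono) auto
  then show ?thesis by (simp add: distrib_left)
 qed
 have "Ip p M (%x. \<phi> x - v x) < e"
  using Ip_triangle[OF p0(1) test_LpM(1)[OF \<phi>(1) p0(1)] W10_pairD(1)[OF uG] L(1), of n] s[OF \<phi>(2) n(1)] by linarith
 moreover have "Ip p M (%x. grad \<phi> x - H x) < e"
  using Ip_triangle[OF p0(1) test_LpM(2)[OF \<phi>(1) p0(1)] W10_pairD(2)[OF uG] L(2), of n] s[OF \<phi>(3) n(2)] by linarith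
 ultimately show "\<exists>\<phi>. test_function \<Omega> \<phi> \<and> Ip p M (%x. \<phi> x - v x) < e \<and> Ip p M (%x. grad \<phi> x - H x) < e" using \<phi>(1) by blast
qed

lemma has_weak_gradient_test_diff:
 assumes \<phi>: "test_function \<Omega> \<phi>" and L: "u \<in> LpM p M" "g \<in> LpM p M" and hw: "has_weak_gradient \<Omega> u g"
 shows "has_weak_gradient \<Omega> (%x. \<phi> x - u x) (%x. grad \<phi> x - g x)"
 unfolding has_weak_gradient_def
proof (intro conjI allI impI ballI)
 note T = test_LpM[OF \<phi> p0(1)]
 note i = LpM_imp_integrable[OF finite_M p0(3) T(1)] LpM_imp_integrable[OF finite_M p0(3) T(2)]
  LpM_imp_integrable[OF finite_M p0(3) L(1)] LpM_imp_integrable[OF finite_M p0(3) L(2)]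
 show "locally_integrable \<Omega> (%x. \<phi> x - u x)" "locally_integrable \<Omega> (%x. grad \<phi> x - g x)"
  by (intro integrable_imp_locally_integrable Bochner_Integration.integrable_diff i)+
 fix \<psi> and b :: 'a assume \<psi>: "test_function \<Omega> \<psi>" and b: "b \<in> Basis"
 obtain K where K: "compact K" "\<And>x. x \<notin> K ==> \<psi> x = 0" "\<And>x. x \<notin> K ==> grad \<psi> x = 0"
  using test_function_support[OF \<psi>] by metis
 obtain B1 where B1: "\<And>x. norm (\<psi> x) <= B1" using compact_support_bounded[OF continuous_test_function[OF \<psi>] K(1,2)] by blast
 obtain B2 where B2: "\<And>x. norm (grad \<psi> x) <= B2" using compact_support_bounded[OF continuous_grad[OF \<psi>] K(1,3)] by blast
 have B3: "norm (grad \<psi> x \<bullet> b) <= B2" for x using Basis_le_norm[OF b, of "grad \<psi> x"] B2[of x] by simp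
 have m: "\<psi> \<in> borel_measurable M" "(%x. grad \<psi> x \<bullet> b) \<in> borel_measurable M"
  by (intro continuous_measurable_M continuous_intros continuous_test_function[OF \<psi>] continuous_grad[OF \<psi>])+
 have bm: "integrable M (%x. f x * k x)" if f: "integrable M f" and k: "k \<in> borel_measurable M" "\<And>x. norm (k x) <= B" for f k :: "'a => real" and B
 proof (rule Bochner_Integration.integrable_bound[where f = "%x. B * f x"])
  show "integrable M (%x. B * f x)" using f by simp
  show "(%x. f x * k x) \<in> borel_measurable M" using f k by simp
  have "norm (f x * k x) <= norm (B * f x)" for x
  proof -
   have "0 <= B" using order_trans[OF norm_ge_zero k(2)] .
   then show ?thesis using mult_left_mono[OF k(2)[of x], of "\<bar>f x\<bar>"] by (simp add: abs_mult mult.commute)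
  qed
  then show "AE x in M. norm (f x * k x) <= norm (B * f x)" by simp
 qed
 have ib: "integrable M (%x. grad \<phi> x \<bullet> b)" "integrable M (%x. g x \<bullet> b)" using i by auto
 have e1: "(LINT x|M. \<phi> x * (grad \<psi> x \<bullet> b)) = - (LINT x|M. (grad \<phi> x \<bullet> b) * \<psi> x)"
  using has_weak_gradient_test[OF \<Omega>_open \<phi>] \<psi> b unfolding has_weak_gradient_def frechet_derivative_eq_grad[OF \<psi>, symmetric] by blast
 have e2: "(LINT x|M. u x * (grad \<psi> x \<bullet> b)) = - (LINT x|M. (g x \<bullet> b) * \<psi> x)"
  using hw \<psi> b unfolding has_weak_gradient_def frechet_derivative_eq_grad[OF \<psi>, symmetric] by blast
 show "(LINT x|M. (\<phi> x - u x) * frechet_derivative \<psi> (at x) b) = - (LINT x|M. ((grad \<phi> x - g x) \<bullet> b) * \<psi> x)"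
  unfolding frechet_derivative_eq_grad[OF \<psi>] inner_diff_left left_diff_distrib
  using bm[OF i(1) m(2) B3] bm[OF i(3) m(2) B3] bm[OF ib(1) m(1) B1] bm[OF ib(2) m(1) B1] e1 e2 by simp
qed

lemma W10_iff_pair: "u \<in> W10 p \<Omega> \<longleftrightarrow> W10_pair u (weak_gradient \<Omega> u)"
proof
 assume u: "W10_pair u (weak_gradient \<Omega> u)"
 note L = W10_pairD(1,2)[OF u]
 note hw = W10_pair_has_weak_gradient[OF u]
 obtain \<phi> where \<phi>: "\<And>n::nat. test_function \<Omega> (\<phi> n)" "(%n. Ip p M (%x. \<phi> n x - u x)) ----> 0" "(%n. Ip p M (%x. grad (\<phi> n) x - weak_gradient \<Omega> u x)) ----> 0"
  by (rule W10_pair_seq[OF u]) (rule that)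
 have e: "\<phi> n - u = (%x. \<phi> n x - u x)" for n by (simp add: fun_eq_iff)
 have d: "W10_pair (%x. \<phi> n x - u x) (%x. grad (\<phi> n) x - weak_gradient \<Omega> u x)" for n
  using W10_pair_add[OF test_W10_pair[OF \<phi>(1)] W10_pair_scale[OF u, of "-1"]] by simp
 have "AE x in M. grad (\<phi> n) x - weak_gradient \<Omega> u x = weak_gradient \<Omega> (\<phi> n - u) x" for n
  unfolding e by (rule weak_gradient_AE[OF W10_pair_has_weak_gradient[OF d]])
 from Ip_cong_AE[OF LpM_measurable[OF W10_pairD(2)[OF d]] lebesgue_on_measurable_AE[OF \<Omega>_lebesgue LpM_measurable[OF W10_pairD(2)[OF d]] this] this]
 have "Ip p M (%x. grad (\<phi> n) x - weak_gradient \<Omega> u x) = Ip p M (weak_gradient \<Omega> (\<phi> n - u))" for n .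
 then show "u \<in> W10 p \<Omega>"
  unfolding W10_def W1_def Lp_norm_tendsto_0_iff[OF p0(2)] Lp_space_eq using L hw \<phi> by (auto simp: e intro!: exI[of _ \<phi>])
next
 assume "u \<in> W10 p \<Omega>"
 then obtain g \<phi> where L: "u \<in> LpM p M" "g \<in> LpM p M" and hw: "has_weak_gradient \<Omega> u g" and \<phi>: "\<And>n::nat. test_function \<Omega> (\<phi> n)"
  and lim: "(%n. Ip p M (\<phi> n - u)) ----> 0" "(%n. Ip p M (weak_gradient \<Omega> (\<phi> n - u))) ----> 0"
  unfolding W10_def W1_def Lp_norm_tendsto_0_iff[OF p0(2)] Lp_space_eq by auto
 have e: "\<phi> n - u = (%x. \<phi> n x - u x)" for n by (simp add: fun_eq_iff)
 have hd: "has_weak_gradient \<Omega> (%x. \<phi> n x - u x) (%x. grad (\<phi> n) x - g x)" for n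
  using has_weak_gradient_test_diff[OF \<phi>(1) L hw] .
 have d: "(%x. grad (\<phi> n) x - g x) \<in> LpM p M" for n using p0 L test_LpM(2)[OF \<phi>] by (intro LpM_diff) auto
 have "AE x in M. grad (\<phi> n) x - g x = weak_gradient \<Omega> (\<phi> n - u) x" for n
  unfolding e by (rule weak_gradient_AE[OF hd])
 from Ip_cong_AE[OF LpM_measurable[OF d] lebesgue_on_measurable_AE[OF \<Omega>_lebesgue LpM_measurable[OF d] this] this]
 have "Ip p M (%x. grad (\<phi> n) x - g x) = Ip p M (weak_gradient \<Omega> (\<phi> n - u))" for n .
 then have "W10_pair u g" using lim unfolding e by (intro W10_pairI_seq[OF L \<phi>]) auto
 then show "W10_pair u (weak_gradient \<Omega> u)" by (rule W10_pair_cong_AE) (use weak_gradient_AE[OF hw] in auto)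
qed

lemma W10_pair_imp_W10:
 assumes "W10_pair u G" shows "u \<in> W10 p \<Omega>" "AE x in M. G x = weak_gradient \<Omega> u x"
proof -
 show w: "AE x in M. G x = weak_gradient \<Omega> u x" by (rule weak_gradient_AE[OF W10_pair_has_weak_gradient[OF assms]])
 show "u \<in> W10 p \<Omega>" unfolding W10_iff_pair by (rule W10_pair_cong_AE[OF assms _ w]) simp
qed

end

section \<open>Weak sequential compactness\<close>

text \<open>
 Continuous functions on a compact set form a separable space in the uniform metric, also within a given
 family. A finite list of pairs of basic open sets describes a function if the first sets cover \<open>K\<close> and the
 function maps each into its partner; functions with the same description are close when the partners are
 small, and there are countably many lists. Choosing one function for each list gives the net.
\<close>

lemma countable_uniform_net:
 fixes J :: "'c => 'a::second_countable_topology => 'd::{metric_space, second_countable_topology}"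
 assumes K: "compact K" and \<phi>0: "\<phi>0 \<in> F" and J: "\<And>\<phi>. \<phi> \<in> F ==> continuous_on K (J \<phi>)"
 obtains c :: "nat => 'c" where "\<And>k. c k \<in> F" "\<And>\<phi> e. \<phi> \<in> F ==> 0 < e ==> \<exists>k. \<forall>x\<in>K. dist (J \<phi> x) (J (c k) x) < e"
proof -
 obtain B1 :: "'a set set" where B1: "countable B1" "topological_basis B1" using ex_countable_basis by blast
 obtain B2 :: "'d set set" where B2: "countable B2" "topological_basis B2" using ex_countable_basis by blast
 define good where "good L \<phi> \<longleftrightarrow> \<phi> \<in> F \<and> (\<forall>x\<in>K. \<exists>z\<in>set L. x \<in> fst z) \<and> (\<forall>z\<in>set L. J \<phi> ` (fst z \<inter> K) \<subseteq> snd z)" for L \<phi>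
 define c where "c L = (if \<exists>\<phi>. good L \<phi> then SOME \<phi>. good L \<phi> else \<phi>0)" for L
 have cg: "good L (c L)" if "good L \<phi>" for L \<phi>
  unfolding c_def using that someI[of "good L" \<phi>] by auto
 have cF: "c L \<in> F" for L
 proof (cases "\<exists>\<phi>. good L \<phi>")
  case True
  then obtain \<phi> where "good L \<phi>" ..
  from cg[OF this] show ?thesis unfolding good_def by (rule conjunct1)
 qed (simp add: c_def \<phi>0)
 have ex: "\<exists>L\<in>lists (B1 \<times> B2). good L \<phi> \<and> (\<forall>z\<in>set L. \<forall>y\<in>snd z. \<forall>y'\<in>snd z. dist y y' < e)" if \<phi>: "\<phi> \<in> F" and e: "0 < e" for \<phi> e
 proof -
  have "\<exists>U V. U \<in> B1 \<and> V \<in> B2 \<and> x \<in> U \<and> J \<phi> ` (U \<inter> K) \<subseteq> V \<and> V \<subseteq> ball (J \<phi> x) (e / 2)" if x: "x \<in> K" for x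
  proof -
   obtain V where V: "V \<in> B2" "J \<phi> x \<in> V" "V \<subseteq> ball (J \<phi> x) (e / 2)"
    by (rule topological_basisE[OF B2(2) open_ball, of "J \<phi> x" "J \<phi> x" "e / 2"]) (use e in auto)
   obtain O' where O': "open O'" "O' \<inter> K = J \<phi> -` V \<inter> K"
    using J[OF \<phi>] topological_basis_open[OF B2(2) V(1)] unfolding continuous_on_open_invariant by blast
   have "x \<in> O'" using O'(2) V(2) x by blast
   then obtain U where "U \<in> B1" "x \<in> U" "U \<subseteq> O'" by (rule topological_basisE[OF B1(2) O'(1)])
   then show ?thesis using V O'(2) by blast
  qed
  then obtain U V where UV: "\<And>x. x \<in> K ==> U x \<in> B1 \<and> V x \<in> B2 \<and> x \<in> U x \<and> J \<phi> ` (U x \<inter> K) \<subseteq> V x \<and> V x \<subseteq> ball (J \<phi> x) (e / 2)"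
   by metis
  obtain C where C: "C \<subseteq> K" "finite C" "K \<subseteq> (\<Union>x\<in>C. U x)"
  proof (rule compactE_image[OF K, of K U])
   show "open (U x)" if "x \<in> K" for x using UV[OF that] topological_basis_open[OF B1(2)] by blast
   show "K \<subseteq> (\<Union>x\<in>K. U x)" using UV by blast
  qed
  obtain l where l: "set l = C" using finite_list[OF C(2)] by blast
  have "dist y y' < e" if "y \<in> ball z (e / 2)" "y' \<in> ball z (e / 2)" for y y' z :: 'd
   using that dist_triangle_half_r[of z y e y'] by auto
  note half = this
  have sL: "set (map (%x. (U x, V x)) l) = (%x. (U x, V x)) ` C" by (simp add: l)
  have UVC: "U x \<in> B1" "V x \<in> B2" "J \<phi> ` (U x \<inter> K) \<subseteq> V x" "V x \<subseteq> ball (J \<phi> x) (e / 2)" if "x \<in> C" for x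
   using UV[of x] C(1) that by auto
  show ?thesis
  proof (intro bexI[of _ "map (%x. (U x, V x)) l"] conjI)
   show "map (%x. (U x, V x)) l \<in> lists (B1 \<times> B2)" using UVC(1,2) by (simp add: lists_eq_set image_subset_iff l)
   show "good (map (%x. (U x, V x)) l) \<phi>" unfolding good_def sL using \<phi> C(3) UVC(3) by simp blast
   show "\<forall>z\<in>set (map (%x. (U x, V x)) l). \<forall>y\<in>snd z. \<forall>y'\<in>snd z. dist y y' < e"
   proof -
    have "dist y y' < e" if "x \<in> C" "y \<in> V x" "y' \<in> V x" for x y y'
     using half[of y "J \<phi> x" y'] UVC(4)[OF that(1)] that by blast
    then show ?thesis unfolding sL by simp
   qed
  qed
 qed
 have cnt: "countable (lists (B1 \<times> B2))" by (intro countable_lists countable_SIGMA B1 B2)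
 show ?thesis
 proof (rule that[of "%k. c (from_nat_into (lists (B1 \<times> B2)) k)"])
  fix \<phi> and e :: real assume "\<phi> \<in> F" "0 < e"
  from ex[OF this] obtain L where L: "L \<in> lists (B1 \<times> B2)" "good L \<phi>" "\<forall>z\<in>set L. \<forall>y\<in>snd z. \<forall>y'\<in>snd z. dist y y' < e"
   by blast
  obtain k where k: "from_nat_into (lists (B1 \<times> B2)) k = L" using from_nat_into_surj[OF cnt L(1)] by blast
  have "dist (J \<phi> x) (J (c L) x) < e" if x: "x \<in> K" for x
  proof -
   obtain z where z: "z \<in> set L" "x \<in> fst z" using L(2) x unfolding good_def by blast
   have "J \<psi> x \<in> snd z" if "good L \<psi>" for \<psi> using that z x unfolding good_def by blast
   then show ?thesis using L(2,3) cg[OF L(2)] z(1) by simp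
  qed
  then show "\<exists>k. \<forall>x\<in>K. dist (J \<phi> x) (J (c (from_nat_into (lists (B1 \<times> B2)) k)) x) < e" using k by metis
 qed (rule cF)
qed

context sobolev_domain begin

lemma test_functions_separable:
 obtains c :: "nat => 'a => real" where "\<And>k. test_function \<Omega> (c k)"
  "\<And>\<phi> e. test_function \<Omega> \<phi> ==> 0 < e ==> \<exists>k. \<forall>x\<in>\<Omega>. \<bar>\<phi> x - c k x\<bar> < e \<and> norm (grad \<phi> x - grad (c k) x) < e"
proof (rule countable_uniform_net[where K = "closure \<Omega>" and F = "{\<phi>. test_function \<Omega> \<phi>}" and J = "%\<phi> x. (\<phi> x, grad \<phi> x)"])
 show "compact (closure \<Omega>)" using \<Omega>_bounded by (simp add: compact_closure)
 show "(%_. 0) \<in> {\<phi>. test_function \<Omega> \<phi>}" by (simp add: test_function_def)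
 show "continuous_on (closure \<Omega>) (%x. (\<phi> x, grad \<phi> x))" if "\<phi> \<in> {\<phi>. test_function \<Omega> \<phi>}" for \<phi>
  using continuous_on_Pair[OF continuous_test_function continuous_grad, of \<Omega> \<phi> \<Omega>] that continuous_on_subset by blast
 fix c assume c: "\<And>k::nat. c k \<in> {\<phi>. test_function \<Omega> \<phi>}"
  and d: "\<And>\<phi> e. \<phi> \<in> {\<phi>. test_function \<Omega> \<phi>} ==> 0 < e ==> \<exists>k. \<forall>x\<in>closure \<Omega>. dist (\<phi> x, grad \<phi> x) (c k x, grad (c k) x) < e"
 show thesis
 proof (rule that)
  fix \<phi> and e :: real assume "test_function \<Omega> \<phi>" "0 < e"
  then obtain k where k: "\<And>x. x \<in> closure \<Omega> ==> dist (\<phi> x, grad \<phi> x) (c k x, grad (c k) x) < e" using d[of \<phi> e] by auto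
  have "\<bar>\<phi> x - c k x\<bar> < e \<and> norm (grad \<phi> x - grad (c k) x) < e" if "x \<in> \<Omega>" for x
   using k[of x] that closure_subset dist_fst_le[of "(\<phi> x, grad \<phi> x)" "(c k x, grad (c k) x)"]
    dist_snd_le[of "(\<phi> x, grad \<phi> x)" "(c k x, grad (c k) x)"] by (fastforce simp: dist_norm)
  then show "\<exists>k. \<forall>x\<in>\<Omega>. \<bar>\<phi> x - c k x\<bar> < e \<and> norm (grad \<phi> x - grad (c k) x) < e" by blast
 qed (use c in simp)
qed

text \<open>
 A diagonal sequence makes the pairings with countably many test fields converge. The fields \<open>G\<close> for which
 the pairings converge form a closed subspace of the dual Lebesgue space, and only 0 annihilates all test
 fields, so by separation it is the whole space. The limit is then a bounded functional, which is
 represented by a function; a second use of separation puts this function into \<open>V\<close>.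
\<close>

lemma Lp_weak_compact:
 fixes f :: "nat => 'a => 'b::euclidean_space"
 assumes V: "Lp_subspace p M V" and f: "\<And>n. f n \<in> V" and B: "\<And>n. Ip p M (f n) <= B"
 obtains r g where "strict_mono (r :: nat => nat)" "g \<in> V"
  "\<And>G. G \<in> LpM (p / (p - 1)) M ==> (%n. LINT x|M. G x \<bullet> f (r n) x) ----> (LINT x|M. G x \<bullet> g x)"
proof -
 define q where "q = p / (p - 1)"
 have q: "1 < q" "p = q / (q - 1)" unfolding q_def using p1 by (simp_all add: field_simps)
 note fL = Lp_subspaceD(1)[OF V f]
 define C where "C = B powr (1 / p)"
 have C: "0 <= C" by (simp add: C_def)
 define N where "N G = Ip q M G powr (1 / q)" for G :: "'a => 'b"
 have bd: "\<bar>LINT x|M. G x \<bullet> f n x\<bar> <= C * N G" if G: "G \<in> LpM q M" for G n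
 proof -
  have "\<bar>LINT x|M. G x \<bullet> f n x\<bar> <= N G * Ip p M (f n) powr (1 / p)"
   unfolding N_def by (rule Holder_inner(2)[OF p1 q_def fL G])
  also have "\<dots> <= N G * C" unfolding C_def N_def using p0 B by (intro mult_left_mono powr_mono2) auto
  finally show ?thesis by (simp add: mult.commute)
 qed
 obtain c where c: "\<And>k. test_function \<Omega> (c k)"
  "\<And>\<phi> e. test_function \<Omega> \<phi> ==> 0 < e ==> \<exists>k::nat. \<forall>x\<in>\<Omega>. \<bar>\<phi> x - c k x\<bar> < e \<and> norm (grad \<phi> x - grad (c k) x) < e"
  by (rule test_functions_separable) (rule that)
 define D where "D = (%(k, i :: 'b) x. c k x *R i)"
 have D: "D z \<in> LpM q M" for z :: "nat \<times> 'b"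
 proof (cases z)
  case (Pair k i)
  note L = test_LpM(1)[OF c(1)[of k], of q]
  show ?thesis
  proof (rule LpM_dominated[where w = "%x. norm (c k x) powr q * norm i powr q"])
   show "D z \<in> borel_measurable M" using LpM_measurable[OF L] q by (simp add: D_def Pair)
   show "integrable M (%x. norm (c k x) powr q * norm i powr q)" using LpM_integrable[OF L] q by simp
  qed (simp add: D_def Pair powr_mult)
 qed
 obtain r where r: "strict_mono (r :: nat => nat)"
  and rc: "\<And>z. z \<in> UNIV \<times> Basis ==> \<exists>l. (%n. (LINT x|M. D z x \<bullet> f (r n) x) / (1 + N (D z))) ----> l"
 proof (rule function_convergent_subsequence[of "UNIV \<times> Basis" "%n z. (LINT x|M. D z x \<bullet> f n x) / (1 + N (D z))" C])
  show "countable ((UNIV :: nat set) \<times> (Basis :: 'b set))" by (rule countable_SIGMA) (simp_all add: countable_finite)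
  fix n z
  have N0: "0 <= N (D z)" by (simp add: N_def)
  have "\<bar>LINT x|M. D z x \<bullet> f n x\<bar> <= C * (1 + N (D z))" using bd[OF D, of z n] C by (simp add: algebra_simps)
  then show "norm ((LINT x|M. D z x \<bullet> f n x) / (1 + N (D z))) <= C" using N0 by (simp add: pos_divide_le_eq)
 qed (use that in auto)
 have DN: "1 + N (D z) \<noteq> 0" for z using powr_ge_zero[of "Ip q M (D z)" "1 / q"] unfolding N_def by linarith
 define W where "W = {G \<in> LpM q M. convergent (%n. LINT x|M. G x \<bullet> f (r n) x)}"
 note I = Holder_inner(1)[OF p1 q_def fL]
 have cl: "G \<in> W" if F: "\<And>j::nat. F j \<in> W" and G: "G \<in> LpM q M" and lim: "(%j. Ip q M (%x. F j x - G x)) ----> 0" for F G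
 proof -
  have FL: "F j \<in> LpM q M" for j using F[of j] by (simp add: W_def)
  have "Cauchy (%n. LINT x|M. G x \<bullet> f (r n) x)"
  proof (rule CauchyI)
   fix e :: real assume e: "0 < e"
   define d where "d = (e / (4 * (C + 1))) powr q"
   have d: "0 < d" "d powr (1 / q) = e / (4 * (C + 1))" using e C q by (auto simp: d_def powr_powr)
   obtain j where j: "Ip q M (%x. F j x - G x) < d" using order_tendstoD(2)[OF lim d(1)] by (auto simp: eventually_sequentially)
   have FG: "(%x. F j x - G x) \<in> LpM q M" using q by (intro LpM_diff G FL) auto
   have "C * N (%x. F j x - G x) <= C * (e / (4 * (C + 1)))"
    unfolding d(2)[symmetric] N_def using j C q by (intro mult_left_mono powr_mono2) auto
   also have "\<dots> <= e / 4" using e C by (simp add: field_simps)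
   finally have small: "\<bar>LINT x|M. (F j x - G x) \<bullet> f n x\<bar> <= e / 4" for n using bd[OF FG, of n] by linarith
   have diff: "(LINT x|M. (F j x - G x) \<bullet> f n x) = (LINT x|M. F j x \<bullet> f n x) - (LINT x|M. G x \<bullet> f n x)" for n
    unfolding inner_diff_left by (intro Bochner_Integration.integral_diff I G FL)
   have "Cauchy (%n. LINT x|M. F j x \<bullet> f (r n) x)" using F[of j] by (simp add: W_def convergent_Cauchy)
   then obtain n0 where n0: "\<And>m n. m >= n0 ==> n >= n0 ==> norm ((LINT x|M. F j x \<bullet> f (r m) x) - (LINT x|M. F j x \<bullet> f (r n) x)) < e / 4"
    using CauchyD[of "%n. LINT x|M. F j x \<bullet> f (r n) x" "e / 4"] e by auto
   have "norm ((LINT x|M. G x \<bullet> f (r m) x) - (LINT x|M. G x \<bullet> f (r n) x)) < e" if "m >= n0" "n >= n0" for m n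
    using n0[OF that] small[of "r m"] small[of "r n"] diff[of "r m"] diff[of "r n"] e unfolding real_norm_def by linarith
   then show "\<exists>n0. \<forall>m\<ge>n0. \<forall>n\<ge>n0. norm ((LINT x|M. G x \<bullet> f (r m) x) - (LINT x|M. G x \<bullet> f (r n) x)) < e" by blast
  qed
  then show ?thesis using G by (simp add: W_def Cauchy_convergent_iff)
 qed
 have W: "Lp_subspace q M W"
  unfolding Lp_subspace_def
 proof (intro conjI ballI allI impI)
  fix G H assume G: "G \<in> W" and H: "H \<in> W"
  have "(LINT x|M. (G x + H x) \<bullet> f (r n) x) = (LINT x|M. G x \<bullet> f (r n) x) + (LINT x|M. H x \<bullet> f (r n) x)" for n
   unfolding inner_add_left using G H by (intro Bochner_Integration.integral_add I) (auto simp: W_def)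
  then show "(%x. G x + H x) \<in> W" using G H q by (auto simp: W_def intro!: convergent_add LpM_add(1))
 next
  fix a G assume "G \<in> W"
  then show "(%x. a *R G x) \<in> W" by (auto simp: W_def intro!: convergent_mult convergent_const LpM_scale(1))
 next
  fix F assume F: "(\<forall>n. F n \<in> W) \<and> Lp_Cauchy q M F"
  then have "F n \<in> LpM q M" for n by (auto simp: W_def)
  then obtain G where "G \<in> LpM q M" "(%n. Ip q M (%x. F n x - G x)) ----> 0"
   using Lp_complete[OF finite_M _ _ conjunct2[OF F]] q by fastforce
  then show "\<exists>G\<in>W. (%n. Ip q M (%x. F n x - G x)) ----> 0" using cl F by blast
 qed (auto simp: W_def convergent_const)
 have conv: "convergent (%n. LINT x|M. G x \<bullet> f (r n) x)" if G: "G \<in> LpM q M" for G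
 proof -
  have "\<exists>G'\<in>W. AE x in M. G x = G' x"
  proof (rule Lp_separation[OF q W G])
   fix h :: "'a => 'b" assume h: "h \<in> LpM p M" and ann: "\<And>w. w \<in> W ==> (LINT x|M. h x \<bullet> w x) = 0"
   have "AE x in M. h x \<bullet> i = 0" if i: "i \<in> Basis" for i
   proof (rule fundamental_lemma[OF \<Omega>_open])
    have hi: "integrable M (%x. h x \<bullet> i)" using LpM_imp_integrable[OF finite_M p0(3) h] by simp
    then show "locally_integrable \<Omega> (%x. h x \<bullet> i)" by (rule integrable_imp_locally_integrable)
    have Dc: "integrable M (%x. h x \<bullet> i * c k x)" "(LINT x|M. h x \<bullet> i * c k x) = 0" for k
    proof -
     obtain l where "(%n. (LINT x|M. D (k, i) x \<bullet> f (r n) x) / (1 + N (D (k, i)))) ----> l" using rc[of "(k, i)"] i by blast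
     then have "(%n. (1 + N (D (k, i))) * ((LINT x|M. D (k, i) x \<bullet> f (r n) x) / (1 + N (D (k, i))))) ----> (1 + N (D (k, i))) * l"
      by (rule tendsto_mult_left)
     then have "D (k, i) \<in> W" using D DN[of "(k, i)"] by (auto simp: W_def convergent_def)
     from ann[OF this] show "(LINT x|M. h x \<bullet> i * c k x) = 0" by (simp add: D_def mult.commute)
     show "integrable M (%x. h x \<bullet> i * c k x)"
      using Holder_inner(1)[OF p1 q_def h D, of "(k, i)"] by (simp add: D_def inner_commute mult.commute)
    qed
    fix \<phi> assume \<phi>: "test_function \<Omega> \<phi>"
    define J where "J = (LINT x|M. \<bar>h x \<bullet> i\<bar>)"
    have J0: "0 <= J" by (simp add: J_def)
    have "\<bar>LINT x|M. h x \<bullet> i * \<phi> x\<bar> <= 0 + \<delta>" if \<delta>: "0 < \<delta>" for \<delta>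
    proof -
     obtain k where k: "\<And>x. x \<in> \<Omega> ==> \<bar>\<phi> x - c k x\<bar> < \<delta> / (J + 1)" using c(2)[OF \<phi>, of "\<delta> / (J + 1)"] \<delta> J0 by auto
     have m: "(%x. h x \<bullet> i * (\<phi> x - c k x)) \<in> borel_measurable M"
      using LpM_measurable[OF h] LpM_measurable[OF test_LpM(1)[OF \<phi> p0(1)]] LpM_measurable[OF test_LpM(1)[OF c(1) p0(1)]] by simp
     have ib: "integrable M (%x. \<delta> / (J + 1) * \<bar>h x \<bullet> i\<bar>)" using hi by simp
     have le: "AE x in M. norm (h x \<bullet> i * (\<phi> x - c k x)) <= \<delta> / (J + 1) * \<bar>h x \<bullet> i\<bar>"
     proof (rule AE_I2)
      fix x assume "x \<in> space M"
      then have "\<bar>\<phi> x - c k x\<bar> <= \<delta> / (J + 1)" using k[of x] by simp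
      then have "\<bar>h x \<bullet> i\<bar> * \<bar>\<phi> x - c k x\<bar> <= \<bar>h x \<bullet> i\<bar> * (\<delta> / (J + 1))" by (intro mult_left_mono) auto
      then show "norm (h x \<bullet> i * (\<phi> x - c k x)) <= \<delta> / (J + 1) * \<bar>h x \<bullet> i\<bar>" by (simp add: abs_mult mult.commute)
     qed
     have i1: "integrable M (%x. h x \<bullet> i * (\<phi> x - c k x))"
      by (rule Bochner_Integration.integrable_bound[OF ib m]) (use le in \<open>eventually_elim, use \<delta> J0 in \<open>simp add: abs_mult\<close>\<close>)
     have "h x \<bullet> i * \<phi> x = h x \<bullet> i * c k x + h x \<bullet> i * (\<phi> x - c k x)" for x by (simp add: algebra_simps)
     then have "(LINT x|M. h x \<bullet> i * \<phi> x) = (LINT x|M. h x \<bullet> i * (\<phi> x - c k x))"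
      using Dc i1 by (simp add: Bochner_Integration.integral_add)
     also have "\<bar>\<dots>\<bar> <= (LINT x|M. \<delta> / (J + 1) * \<bar>h x \<bullet> i\<bar>)"
      by (rule order_trans[OF integral_abs_bound]) (use integral_mono_AE[OF integrable_norm[OF i1] ib le] in simp)
     also have "\<dots> = \<delta> / (J + 1) * J" by (simp add: J_def)
     also have "\<dots> <= \<delta>" using \<delta> J0 by (simp add: field_simps)
     finally show ?thesis by simp
    qed
    then have "\<bar>LINT x|M. h x \<bullet> i * \<phi> x\<bar> <= 0" by (rule field_le_epsilon)
    then show "(LINT x|M. h x \<bullet> i * \<phi> x) = 0" by simp
   qed
   then have "AE x in M. \<forall>i\<in>Basis. h x \<bullet> i = 0" by (intro AE_finite_allI) auto
   then have "AE x in M. h x \<bullet> G x = 0"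
    by eventually_elim (metis euclidean_all_zero_iff inner_zero_left)
   then show "(LINT x|M. h x \<bullet> G x) = 0" by (rule integral_eq_zero_AE)
  qed
  then obtain G' where G': "G' \<in> W" "AE x in M. G x = G' x" by blast
  have "(LINT x|M. G x \<bullet> f (r n) x) = (LINT x|M. G' x \<bullet> f (r n) x)" for n
  proof (rule integral_cong_AE)
   show "(%x. G x \<bullet> f (r n) x) \<in> borel_measurable M" "(%x. G' x \<bullet> f (r n) x) \<in> borel_measurable M"
    using I[OF G] I[of G'] G'(1) by (auto simp: W_def)
   show "AE x in M. G x \<bullet> f (r n) x = G' x \<bullet> f (r n) x" using G'(2) by eventually_elim simp
  qed
  then show ?thesis using G'(1) by (simp add: W_def)
 qed
 define L where "L G = lim (%n. LINT x|M. G x \<bullet> f (r n) x)" for G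
 have L: "(%n. LINT x|M. G x \<bullet> f (r n) x) ----> L G" if "G \<in> LpM q M" for G
  using conv[OF that] by (simp add: L_def convergent_LIMSEQ_iff)
 have "Lp_functional q M (LpM q M) L"
  unfolding Lp_functional_def
 proof (intro conjI ballI allI exI[of _ C])
  fix G H :: "'a => 'b" and c assume G: "G \<in> LpM q M"
  show "L (%x. c *R G x) = c * L G"
   using tendsto_mult_left[OF L[OF G], of c] L[OF LpM_scale(1)[OF G, of c]] by (intro LIMSEQ_unique) auto
  show "\<bar>L G\<bar> <= C * Ip q M G powr (1 / q)"
   by (rule LIMSEQ_le_const2[OF tendsto_rabs[OF L[OF G]]]) (use bd[OF G] in \<open>auto simp: N_def\<close>)
  assume H: "H \<in> LpM q M"
  have GH: "(%x. G x + H x) \<in> LpM q M" using q by (intro LpM_add G H) auto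
  have "(LINT x|M. (G x + H x) \<bullet> f (r n) x) = (LINT x|M. G x \<bullet> f (r n) x) + (LINT x|M. H x \<bullet> f (r n) x)" for n
   unfolding inner_add_left by (intro Bochner_Integration.integral_add I G H)
  then show "L (%x. G x + H x) = L G + L H"
   using tendsto_add[OF L[OF G] L[OF H]] L[OF GH] by (intro LIMSEQ_unique) auto
 qed
 from Lp_riesz[OF q(1) Lp_subspace_UNIV[OF finite_M less_imp_le[OF q(1)]] this]
 obtain g where g: "g \<in> LpM q M" "\<And>G. G \<in> LpM q M ==> L G = (LINT x|M. duality q (g x) \<bullet> G x)" by blast
 define h where "h = (%x. duality q (g x))"
 have h: "h \<in> LpM p M" unfolding h_def by (rule duality_Lq(1)[OF q g(1)])
 have Lh: "L G = (LINT x|M. G x \<bullet> h x)" if "G \<in> LpM q M" for G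
  using g(2)[OF that] by (simp add: h_def inner_commute)
 have "\<exists>v\<in>V. AE x in M. h x = v x"
 proof (rule Lp_separation[OF p1 q_def V h])
  fix G :: "'a => 'b" assume G: "G \<in> LpM q M" and ann: "\<And>w. w \<in> V ==> (LINT x|M. G x \<bullet> w x) = 0"
  have "L G = 0" using L[OF G] ann[OF f] LIMSEQ_unique[OF _ tendsto_const] by simp
  then show "(LINT x|M. G x \<bullet> h x) = 0" using Lh[OF G] by simp
 qed
 then obtain v where v: "v \<in> V" "AE x in M. h x = v x" by blast
 have "L G = (LINT x|M. G x \<bullet> v x)" if G: "G \<in> LpM q M" for G
  unfolding Lh[OF G]
 proof (rule integral_cong_AE)
  show "(%x. G x \<bullet> h x) \<in> borel_measurable M" "(%x. G x \<bullet> v x) \<in> borel_measurable M"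
   using LpM_measurable[OF G] LpM_measurable[OF h] LpM_measurable[OF Lp_subspaceD(1)[OF V v(1)]] by auto
  show "AE x in M. G x \<bullet> h x = G x \<bullet> v x" using v(2) by eventually_elim simp
 qed
 then show ?thesis using that[OF r v(1)] L by (simp add: q_def)
qed

end

section \<open>Embeddings of W10\<close>

context sobolev_domain begin

definition ps :: real where "ps = sobolev_exp DIM('a) p"

definition sobolev_const :: real where
 "sobolev_const = p * (real DIM('a) - 1) / (real DIM('a) - p)"

lemma sobolev_const_nonneg: "0 <= sobolev_const"
 using p1 pN dim by (auto simp: sobolev_const_def)

lemma ps_gt: "p < ps" "1 < ps" "0 < ps"
proof -
 have "p * (real DIM('a) - p) < real DIM('a) * p" using p1 by (simp add: algebra_simps)
 then show "p < ps" using pN by (simp add: ps_def sobolev_exp_def pos_less_divide_eq)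
 then show "1 < ps" "0 < ps" using p1 by auto
qed

lemma AE_subseq_of_Ip_tendsto:
 fixes f :: "nat => 'a => 'b::euclidean_space"
 assumes "1 <= s" "\<And>n. f n \<in> LpM s M" "g \<in> LpM s M" "(%n. Ip s M (%x. f n x - g x)) ----> 0"
 obtains r where "strict_mono (r :: nat => nat)" "AE x in M. (%n. f (r n) x) ----> g x"
proof -
 have d: "(%x. f n x - g x) \<in> LpM s M" for n using assms by (intro LpM_diff) auto
 have "(%n. LINT x|M. norm (f n x - g x)) ----> 0"
  by (rule Lp_tendsto_imp_L1_tendsto[OF finite_M assms(1) d assms(4)])
 then obtain r where r: "strict_mono (r :: nat => nat)" "AE x in M. (%n. f (r n) x - g x) ----> 0"
  using tendsto_L1_AE_subseq[of M "%n x. f n x - g x"] LpM_imp_integrable[OF finite_M assms(1) d] by blast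
 from r(2) have "AE x in M. (%n. f (r n) x) ----> g x" by eventually_elim (rule LIM_zero_cancel)
 then show ?thesis using r(1) that by blast
qed

lemma Fatou_Ip:
 fixes f :: "nat => 'a => 'b::euclidean_space"
 assumes s: "0 < s" and f: "\<And>n. f n \<in> LpM s M" and g: "g \<in> borel_measurable M"
  and lim: "AE x in M. (%n. f n x) ----> g x" and B: "\<forall>\<^sub>F n in sequentially. Ip s M (f n) <= B"
 shows "g \<in> LpM s M" "Ip s M g <= B"
proof -
 have B0: "0 <= B"
 proof -
  obtain n where "Ip s M (f n) <= B" using B unfolding eventually_sequentially by blast
  then show ?thesis using Ip_nonneg[of s M "f n"] by linarith
 qed
 have "(\<integral>\<^sup>+x. ennreal (norm (g x) powr s) \<partial>M) = (\<integral>\<^sup>+x. liminf (%n. ennreal (norm (f n x) powr s)) \<partial>M)"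
 proof (rule nn_integral_cong_AE)
  show "AE x in M. ennreal (norm (g x) powr s) = liminf (%n. ennreal (norm (f n x) powr s))"
   using lim
  proof eventually_elim
   case (elim x)
   have "(%n. norm (f n x) powr s) ----> norm (g x) powr s"
    using elim s by (intro tendsto_powr' tendsto_intros) auto
   then have "(%n. ennreal (norm (f n x) powr s)) ----> ennreal (norm (g x) powr s)" by (rule tendsto_ennrealI)
   then show ?case by (rule lim_imp_Liminf[symmetric, OF sequentially_bot])
  qed
 qed
 also have "\<dots> <= liminf (%n. \<integral>\<^sup>+x. ennreal (norm (f n x) powr s) \<partial>M)"
  using LpM_measurable[OF f] by (intro nn_integral_liminf) auto
 also have "\<dots> = liminf (%n. ennreal (Ip s M (f n)))"
  unfolding Ip_def using LpM_integrable[OF f] by (subst nn_integral_eq_integral) auto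
 also have "\<dots> <= liminf (%n::nat. ennreal B)"
  by (rule Liminf_mono) (use B in eventually_elim, rule ennreal_leI)
 also have "\<dots> = ennreal B" by (simp add: Liminf_const)
 finally have b: "(\<integral>\<^sup>+x. ennreal (norm (g x) powr s) \<partial>M) <= ennreal B" .
 have "integrable M (%x. norm (g x) powr s)"
 proof (rule integrableI_bounded)
  show "(\<integral>\<^sup>+x. ennreal (norm (norm (g x) powr s)) \<partial>M) < \<infinity>" using le_less_trans[OF b ennreal_less_top] by simp
 qed (use g in simp)
 then show L: "g \<in> LpM s M" using g by (simp add: LpM_def)
 have "ennreal (Ip s M g) <= ennreal B"
  unfolding Ip_def using b by (subst nn_integral_eq_integral[symmetric, OF LpM_integrable[OF L]]) auto
 then show "Ip s M g <= B" using B0 by (simp add: ennreal_le_iff)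
qed

theorem Sobolev_inequality:
 assumes "W10_pair u G"
 shows "u \<in> LpM ps M" "Ip ps M u powr (1 / ps) <= 2 * sobolev_const * (Ip p M G + 1 / real (Suc k)) powr (1 / p)"
proof -
 note L = W10_pairD(1,2)[OF assms]
 have "u \<in> LpM ps M \<and> Ip ps M u powr (1 / ps) <= 2 * sobolev_const * (Ip p M G + e) powr (1 / p)" if e: "0 < e" for e
 proof -
  obtain \<phi> where \<phi>: "\<And>n::nat. test_function \<Omega> (\<phi> n)" "(%n. Ip p M (%x. \<phi> n x - u x)) ----> 0" "(%n. Ip p M (%x. grad (\<phi> n) x - G x)) ----> 0"
   by (rule W10_pair_seq[OF assms]) (rule that)
  obtain r where r: "strict_mono (r :: nat => nat)" "AE x in M. (%n. \<phi> (r n) x) ----> u x"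
   by (rule AE_subseq_of_Ip_tendsto[OF p0(3) test_LpM(1)[OF \<phi>(1) p0(1)] L(1) \<phi>(2)]) (rule that)
  define B where "B = (2 * sobolev_const * (Ip p M G + e) powr (1 / p)) powr ps"
  have "\<forall>\<^sub>F n in sequentially. Ip p M (%x. grad (\<phi> (r n)) x - G x) < e"
   by (rule order_tendstoD(2)[OF LIMSEQ_subseq_LIMSEQ[OF \<phi>(3) r(1), unfolded o_def] e])
  then have "\<forall>\<^sub>F n in sequentially. Ip ps M (\<phi> (r n)) <= B"
  proof eventually_elim
   case (elim n)
   have "Ip p M (grad (\<phi> (r n))) <= 2 powr p * (Ip p M (%x. grad (\<phi> (r n)) x - G x) + Ip p M G)"
    using Ip_add_le[OF p0(1) LpM_diff(1)[OF p0(1) test_LpM(2)[OF \<phi>(1)[of "r n"] p0(1)] L(2)] L(2)] by simp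
   also have "\<dots> <= 2 powr p * (Ip p M G + e)" using elim by (intro mult_left_mono) auto
   finally have 1: "Ip p M (grad (\<phi> (r n))) <= 2 powr p * (Ip p M G + e)" .
   have "Ip ps M (\<phi> (r n)) powr (1 / ps) <= sobolev_const * Ip p M (grad (\<phi> (r n))) powr (1 / p)"
    unfolding test_Ip_lborel(1)[OF \<phi>(1) ps_gt(3)] test_Ip_lborel(2)[OF \<phi>(1) p0(2)] sobolev_const_def
    by (rule Sobolev_test_function[OF \<phi>(1) dim p1 pN ps_def])
   also have "\<dots> <= sobolev_const * (2 powr p * (Ip p M G + e)) powr (1 / p)"
    using 1 p0 sobolev_const_nonneg by (intro mult_left_mono powr_mono2) auto
   also have "\<dots> = 2 * sobolev_const * (Ip p M G + e) powr (1 / p)"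
    using e p0 Ip_nonneg[of p M G] by (simp add: powr_mult powr_powr)
   finally have "(Ip ps M (\<phi> (r n)) powr (1 / ps)) powr ps <= B"
    unfolding B_def using ps_gt by (intro powr_mono2) auto
   then show ?case using ps_gt by (simp add: powr_powr)
  qed
  from Fatou_Ip[OF ps_gt(3) test_LpM(1)[OF \<phi>(1)] LpM_measurable[OF L(1)] r(2) this]
  have 2: "u \<in> LpM ps M" "Ip ps M u <= B" using ps_gt by auto
  have "Ip ps M u powr (1 / ps) <= B powr (1 / ps)" using 2 ps_gt by (intro powr_mono2) auto
  also have "\<dots> = 2 * sobolev_const * (Ip p M G + e) powr (1 / p)"
   unfolding B_def using ps_gt sobolev_const_nonneg by (simp add: powr_powr)
  finally show ?thesis using 2 by blast
 qed
 from this[of 1] this[of "1 / real (Suc k)"]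
 show "u \<in> LpM ps M" "Ip ps M u powr (1 / ps) <= 2 * sobolev_const * (Ip p M G + 1 / real (Suc k)) powr (1 / p)" by auto
qed

theorem Sobolev_inequality_sharp:
 assumes "W10_pair u G"
 shows "Ip ps M u powr (1 / ps) <= 2 * sobolev_const * Ip p M G powr (1 / p)"
proof (rule LIMSEQ_le_const)
 have "(%k. 2 * sobolev_const * (Ip p M G + 1 / real (Suc k)) powr (1 / p)) ----> 2 * sobolev_const * (Ip p M G + 0) powr (1 / p)"
  using LIMSEQ_inverse_real_of_nat p0
  by (intro tendsto_intros tendsto_powr') (auto simp: inverse_eq_divide)
 then show "(%k. 2 * sobolev_const * (Ip p M G + 1 / real (Suc k)) powr (1 / p)) ----> 2 * sobolev_const * Ip p M G powr (1 / p)" by simp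
 show "\<exists>N. \<forall>k\<ge>N. Ip ps M u powr (1 / ps) <= 2 * sobolev_const * (Ip p M G + 1 / real (Suc k)) powr (1 / p)"
  using Sobolev_inequality(2)[OF assms] by blast
qed

lemma Sobolev_subcritical:
 assumes r: "0 < r" "r < ps"
 obtains C where "0 < C" "\<And>u G. W10_pair u G ==> u \<in> LpM r M"
  "\<And>u G. W10_pair u G ==> Ip r M u powr (1 / r) <= C * Ip p M G powr (1 / p)"
proof -
 define s where "s = ps / r"
 define s' where "s' = s / (s - 1)"
 have s: "1 < s" using r by (simp add: s_def)
 have s': "0 < s'" using s by (simp add: s'_def)
 define m where "m = measure M (space M) powr (1 / s')"
 define C where "C = 2 * sobolev_const * m powr (1 / r) + 1"
 have C: "0 < C" using sobolev_const_nonneg by (simp add: C_def add_nonneg_pos)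
 have "u \<in> LpM r M \<and> Ip r M u powr (1 / r) <= C * Ip p M G powr (1 / p)" if uG: "W10_pair u G" for u G
 proof
  note L = Sobolev_inequality(1)[OF uG] W10_pairD(1)[OF uG]
  have pw: "norm (norm (u x) powr r) powr s = norm (u x) powr ps" for x using r by (simp add: powr_powr s_def)
  have 1: "(%x. norm (u x) powr r) \<in> LpM s M"
   unfolding LpM_def mem_Collect_eq pw using LpM_integrable[OF L(1)] LpM_measurable[OF L(2)] by simp
  then have "integrable M (%x. norm (u x) powr r)" using LpM_imp_integrable[OF finite_M less_imp_le[OF s]] by blast
  then show "u \<in> LpM r M" using LpM_measurable[OF L(2)] by (simp add: LpM_def)
  have 2: "(%x. 1::real) \<in> LpM s' M" by (simp add: LpM_def)
  have "(LINT x|M. norm (norm (u x) powr r) * norm (1::real)) <= Ip s M (%x. norm (u x) powr r) powr (1 / s) * Ip s' M (%x. 1::real) powr (1 / s')"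
   by (rule Holder(2)[OF s s'_def 1 2])
  then have "Ip r M u <= Ip ps M u powr (1 / s) * m"
   unfolding Ip_def pw m_def by simp
  then have "Ip r M u powr (1 / r) <= (Ip ps M u powr (1 / s) * m) powr (1 / r)"
   using r by (intro powr_mono2) auto
  also have "\<dots> = Ip ps M u powr (1 / ps) * m powr (1 / r)"
   using r by (simp add: powr_mult powr_powr s_def m_def)
  also have "\<dots> <= (2 * sobolev_const * Ip p M G powr (1 / p)) * m powr (1 / r)"
   by (intro mult_right_mono Sobolev_inequality_sharp[OF uG]) simp
  also have "\<dots> = (C - 1) * Ip p M G powr (1 / p)" by (simp add: C_def mult_ac)
  also have "\<dots> <= C * Ip p M G powr (1 / p)" by (intro mult_right_mono) auto
  finally show "Ip r M u powr (1 / r) <= C * Ip p M G powr (1 / p)" .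
 qed
 then show ?thesis using C that by blast
qed

lemma Poincare:
 obtains C where "0 < C" "\<And>u G. W10_pair u G ==> Ip p M u <= C * Ip p M G"
proof -
 obtain C where C: "0 < C" "\<And>u G. W10_pair u G ==> Ip p M u powr (1 / p) <= C * Ip p M G powr (1 / p)"
  by (rule Sobolev_subcritical[OF p0(2) ps_gt(1)]) (rule that)
 have "Ip p M u <= C powr p * Ip p M G" if "W10_pair u G" for u G
 proof -
  have "(Ip p M u powr (1 / p)) powr p <= (C * Ip p M G powr (1 / p)) powr p"
   using p0 by (intro powr_mono2 C(2)[OF that]) auto
  then show ?thesis using p0 C(1) by (simp add: powr_mult powr_powr)
 qed
 moreover have "0 < C powr p" using C(1) by simp
 ultimately show ?thesis by (rule that[rotated])
qed

lemma W10_pair_unique: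
 assumes "W10_pair u G" "W10_pair v G" shows "AE x in M. u x = v x"
proof -
 obtain C where C: "\<And>u G. W10_pair u G ==> Ip p M u <= C * Ip p M G" using Poincare by metis
 have d: "W10_pair (%x. u x - v x) (%x. 0)" using W10_pair_add[OF assms(1) W10_pair_scale[OF assms(2), of "-1"]] by simp
 have "Ip p M (%x. u x - v x) = 0" using C[OF d] Ip_nonneg[of p M "%x. u x - v x"] by simp
 then have "AE x in M. u x - v x = 0" using Ip_eq_0_iff[OF W10_pairD(1)[OF d]] by simp
 then show ?thesis by simp
qed

definition gradients :: "('a => 'a) set" where
 "gradients = {G. \<exists>u. W10_pair u G}"

lemma Lp_subspace_gradients: "Lp_subspace p M gradients"
 unfolding Lp_subspace_def
proof (intro conjI ballI allI impI)
 show "gradients \<subseteq> LpM p M" using W10_pairD(2) by (auto simp: gradients_def)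
 show "(%_. 0) \<in> gradients" using W10_pair_zero by (auto simp: gradients_def)
 show "(%x. f x + g x) \<in> gradients" if "f \<in> gradients" "g \<in> gradients" for f g
  using that W10_pair_add unfolding gradients_def by blast
 show "(%x. c *R f x) \<in> gradients" if "f \<in> gradients" for f c
  using that W10_pair_scale unfolding gradients_def by blast
 fix G assume G: "(\<forall>n. G n \<in> gradients) \<and> Lp_Cauchy p M G"
 then obtain u where u: "\<And>n. W10_pair (u n) (G n)" unfolding gradients_def mem_Collect_eq by metis
 obtain C where C: "0 < C" "\<And>u G. W10_pair u G ==> Ip p M u <= C * Ip p M G" by (rule Poincare) (rule that)
 obtain H where H: "H \<in> LpM p M" "(%n. Ip p M (%x. G n x - H x)) ----> 0"
  using Lp_complete[OF finite_M p0(3) W10_pairD(2)[OF u] conjunct2[OF G]] by blast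
 have uC: "Lp_Cauchy p M u"
  unfolding Lp_Cauchy_def
 proof (intro allI impI)
  fix e :: real assume e: "0 < e"
  then have "0 < e / C" using C by simp
  then obtain N where N: "\<And>m n. m >= N ==> n >= N ==> Ip p M (%x. G m x - G n x) < e / C"
   using conjunct2[OF G] unfolding Lp_Cauchy_def by blast
  have "Ip p M (%x. u m x - u n x) < e" if "m >= N" "n >= N" for m n
  proof -
   have "W10_pair (%x. u m x - u n x) (%x. G m x - G n x)"
    using W10_pair_add[OF u[of m] W10_pair_scale[OF u[of n], of "-1"]] by simp
   then have "Ip p M (%x. u m x - u n x) <= C * Ip p M (%x. G m x - G n x)" by (rule C)
   also have "\<dots> < C * (e / C)" using C N[OF that] by (intro mult_strict_left_mono) auto
   finally show ?thesis using C by simp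
  qed
  then show "\<exists>N. \<forall>m\<ge>N. \<forall>n\<ge>N. Ip p M (%x. u m x - u n x) < e" by blast
 qed
 obtain v where v: "v \<in> LpM p M" "(%n. Ip p M (%x. u n x - v x)) ----> 0"
  using Lp_complete[OF finite_M p0(3) W10_pairD(1)[OF u] uC] by blast
 have "W10_pair v H" by (rule W10_pair_closed[OF u v(1) H(1) v(2) H(2)])
 then show "\<exists>g\<in>gradients. (%n. Ip p M (%x. G n x - g x)) ----> 0" using H(2) unfolding gradients_def by blast
qed

text \<open>
 By Poincare's inequality, \<open>u \<mapsto> \<integral> k u\<close> is a bounded functional of the gradient of \<open>u\<close>, so it is given by a
 function paired with the gradient.
\<close>

lemma bounded_functional_weak_limit:
 assumes k: "k \<in> borel_measurable M" "\<And>x. norm (k x :: real) <= B"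
  and uG: "\<And>n::nat. W10_pair (u n) (G n)"
  and weak: "\<And>F. F \<in> LpM (p / (p - 1)) M ==> (%n. LINT x|M. F x \<bullet> G n x) ----> 0"
 shows "(%n. LINT x|M. k x * u n x) ----> 0"
proof -
 define S where "S G = (SOME u. W10_pair u G)" for G
 have S: "W10_pair (S G) G" if "G \<in> gradients" for G
  using that unfolding S_def gradients_def mem_Collect_eq by (rule someI_ex)
 have q: "1 < p / (p - 1)" using p1 by (simp add: field_simps)
 have kq: "k \<in> LpM (p / (p - 1)) M" using q by (intro bounded_in_LpM[OF k]) auto
 have ki: "integrable M (%x. k x * v x)" if "v \<in> LpM p M" for v :: "'a => real"
  using Holder_inner(1)[OF p1 refl that kq] by simp
 define F where "F G = (LINT x|M. k x * S G x)" for G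
 have FS: "F G = (LINT x|M. k x * v x)" if "W10_pair v G" for v G
 proof -
  have G: "G \<in> gradients" using that unfolding gradients_def by blast
  show ?thesis unfolding F_def
  proof (rule integral_cong_AE)
   show "(%x. k x * S G x) \<in> borel_measurable M" "(%x. k x * v x) \<in> borel_measurable M"
    using k LpM_measurable[OF W10_pairD(1)[OF S[OF G]]] LpM_measurable[OF W10_pairD(1)[OF that]] by auto
   show "AE x in M. k x * S G x = k x * v x" using W10_pair_unique[OF S[OF G] that] by eventually_elim simp
  qed
 qed
 obtain C where C: "0 < C" "\<And>u G. W10_pair u G ==> Ip p M u <= C * Ip p M G" by (rule Poincare) (rule that)
 have "Lp_functional p M gradients F"
  unfolding Lp_functional_def
 proof (intro conjI ballI allI exI)
  fix f c assume f: "f \<in> gradients"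
  show "F (%x. c *R f x) = c * F f"
   using FS[OF W10_pair_scale[OF S[OF f], of c]] by (simp add: F_def mult.left_commute)
  have "\<bar>F f\<bar> <= Ip (p / (p - 1)) M k powr (1 / (p / (p - 1))) * Ip p M (S f) powr (1 / p)"
   using Holder_inner(2)[OF p1 refl W10_pairD(1)[OF S[OF f]] kq] by (simp add: F_def)
  also have "\<dots> <= Ip (p / (p - 1)) M k powr (1 / (p / (p - 1))) * (C * Ip p M f) powr (1 / p)"
   using p0 C S[OF f] by (intro mult_left_mono powr_mono2) auto
  also have "\<dots> = (Ip (p / (p - 1)) M k powr (1 / (p / (p - 1))) * C powr (1 / p)) * Ip p M f powr (1 / p)"
   using C by (simp add: powr_mult)
  finally show "\<bar>F f\<bar> <= (Ip (p / (p - 1)) M k powr (1 / (p / (p - 1))) * C powr (1 / p)) * Ip p M f powr (1 / p)" .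
  fix g assume g: "g \<in> gradients"
  show "F (%x. f x + g x) = F f + F g"
   using FS[OF W10_pair_add[OF S[OF f] S[OF g]]] ki[OF W10_pairD(1)[OF S[OF f]]] ki[OF W10_pairD(1)[OF S[OF g]]]
   by (simp add: F_def distrib_left)
 qed
 from Lp_riesz[OF p1 Lp_subspace_gradients this]
 obtain g where g: "g \<in> gradients" "\<And>w. w \<in> gradients ==> F w = (LINT x|M. duality p (g x) \<bullet> w x)" by blast
 have "(%x. duality p (g x)) \<in> LpM (p / (p - 1)) M"
  by (rule duality_Lq(1)[OF p1 refl Lp_subspaceD(1)[OF Lp_subspace_gradients g(1)]])
 moreover have "G n \<in> gradients" for n using uG unfolding gradients_def by blast
 ultimately have "(%n. F (G n)) ----> 0" using g(2) weak by simp
 then show ?thesis using FS[OF uG] by simp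
qed

text \<open>
 Test functions approximating \<open>u n\<close> with error \<open>1 / (n + 1)\<close> have bounded gradients and vanishing limits of
 their integrals over boxes, and their \<open>L\<^sup>1\<close> norms differ from those of \<open>u n\<close> by a null sequence.
\<close>

theorem Rellich:
 assumes uG: "\<And>n::nat. W10_pair (u n) (G n)" and B: "\<And>n. Ip p M (G n) <= B"
  and weak: "\<And>F. F \<in> LpM (p / (p - 1)) M ==> (%n. LINT x|M. F x \<bullet> G n x) ----> 0"
 shows "(%n. LINT x|M. \<bar>u n x\<bar>) ----> 0"
proof -
 have "\<exists>\<phi>. test_function \<Omega> \<phi> \<and> Ip p M (%x. \<phi> x - u n x) < 1 / real (Suc n) \<and> Ip p M (%x. grad \<phi> x - G n x) < 1 / real (Suc n)" for n
  by (rule W10_pairD(3)[OF uG]) simp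
 then obtain \<psi> where \<psi>: "\<And>n. test_function \<Omega> (\<psi> n)" "\<And>n. Ip p M (%x. \<psi> n x - u n x) < 1 / real (Suc n)"
  "\<And>n. Ip p M (%x. grad (\<psi> n) x - G n x) < 1 / real (Suc n)" by metis
 note T = test_LpM[OF \<psi>(1) p0(1)]
 note L = W10_pairD(1,2)[OF uG]
 have lim0: "(%n. 1 / real (Suc n)) ----> 0" using LIMSEQ_inverse_real_of_nat by (simp add: inverse_eq_divide)
 have l\<psi>: "(%n. Ip p M (%x. \<psi> n x - u n x)) ----> 0"
  by (rule tendsto_if_diff_le[OF _ lim0]) (use \<psi>(2) in \<open>simp add: less_imp_le\<close>)
 have d: "(%x. \<psi> n x - u n x) \<in> LpM p M" for n using p0 by (intro LpM_diff T L)
 have l1: "(%n. LINT x|M. norm (\<psi> n x - u n x)) ----> 0"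
  by (rule Lp_tendsto_imp_L1_tendsto[OF finite_M p0(3) d l\<psi>])
 obtain C where C: "0 < C" "\<And>u G. W10_pair u G ==> Ip p M u <= C * Ip p M G" by (rule Poincare) (rule that)
 have B0: "0 <= B" using order_trans[OF Ip_nonneg B] .
 define B' where "B' = 2 powr p * (1 + B)"
 have bg: "Ip p M (grad (\<psi> n)) <= B'" for n
 proof -
  have "Ip p M (grad (\<psi> n)) <= 2 powr p * (Ip p M (%x. grad (\<psi> n) x - G n x) + Ip p M (G n))"
   using Ip_add_le[OF p0(1) LpM_diff(1)[OF p0(1) T(2)[of n] L(2)[of n]] L(2)[of n]] by simp
  also have "\<dots> <= B'"
   unfolding B'_def using less_le_trans[OF \<psi>(3)[of n], of 1] B[of n] by (intro mult_left_mono add_mono) auto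
  finally show ?thesis .
 qed
 define m where "m = measure M (space M)"
 have nb: "(LINT x|M. norm (f x)) <= m + K" if "f \<in> LpM p M" "Ip p M f <= K" for f :: "'a => 'b::euclidean_space" and K
  using integral_norm_le_epsilon[OF finite_M p0(3) that(1), of 1] that(2) by (simp add: m_def)
 have conv1: "(LINT x|M. norm (\<psi> n x)) = (LINT x|lborel. \<bar>\<psi> n x\<bar>)" "(LINT x|M. norm (grad (\<psi> n) x)) = (LINT x|lborel. norm (grad (\<psi> n) x))" for n
  using test_Ip_lborel[OF \<psi>(1), of 1 n] by (simp_all add: Ip_def)
 have "(%n. LINT x|lborel. \<bar>\<psi> n x\<bar>) ----> 0"
 proof (rule Rellich_test_functions[OF \<Omega>_bounded \<psi>(1)])
  show "(LINT x|lborel. norm (grad (\<psi> n) x)) <= m + (C + 1) * B'" for n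
  proof -
   have "B' <= (C + 1) * B'" using C B0 by (simp add: B'_def)
   then show ?thesis using nb[OF T(2) bg, of n] unfolding conv1 by linarith
  qed
  show "(LINT x|lborel. \<bar>\<psi> n x\<bar>) <= m + (C + 1) * B'" for n
  proof -
   have "Ip p M (\<psi> n) <= C * Ip p M (grad (\<psi> n))" by (rule C(2)[OF test_W10_pair[OF \<psi>(1)]])
   also have "\<dots> <= C * B'" using C bg by (intro mult_left_mono) auto
   also have "\<dots> <= (C + 1) * B'" using B0 by (simp add: B'_def algebra_simps)
   finally show ?thesis using nb[OF T(1), of n] unfolding conv1 by blast
  qed
  fix a b :: 'a
  have km: "indicat_real (cbox a b) \<in> borel_measurable M" by (intro measurable_restrict_space1 borel_measurable_indicator) simp
  have k1: "norm (indicat_real (cbox a b) x) <= 1" for x by (simp add: indicator_def)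
  have 1: "(%n. LINT x|M. indicat_real (cbox a b) x * u n x) ----> 0"
   by (rule bounded_functional_weak_limit[OF km k1 uG weak])
  have 2: "(%n. LINT x|M. indicat_real (cbox a b) x *R (\<psi> n x - u n x)) ----> (LINT x|M. indicat_real (cbox a b) x *R (0::real))"
   by (rule tendsto_integral_Lp[OF finite_M p0(3) d LpM_zero _ km k1]) (use l\<psi> in simp)
  have ii: "integrable M (%x. indicat_real (cbox a b) x * f x)" if "f \<in> LpM p M" for f :: "'a => real"
   using Holder_inner(1)[OF p1 refl that, of "indicat_real (cbox a b)"] bounded_in_LpM[OF km k1, of "p / (p - 1)"] p1 by simp
  have "(LINT x|M. indicat_real (cbox a b) x * \<psi> n x) = (LINT x|M. indicat_real (cbox a b) x * u n x) + (LINT x|M. indicat_real (cbox a b) x *R (\<psi> n x - u n x))" for n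
   using ii[OF T(1)[of n]] ii[OF L(1)[of n]] by (simp add: right_diff_distrib)
  then have 3: "(%n. LINT x|M. indicat_real (cbox a b) x * \<psi> n x) ----> 0" using tendsto_add[OF 1 2] by simp
  have "(LINT x|M. indicat_real (cbox a b) x * \<psi> n x) = (LINT x|lborel. indicat_real (cbox a b) x * \<psi> n x)" for n
   using borel_measurable_continuous[OF continuous_test_function[OF \<psi>(1)[of n]]] test_function_zero_outside[OF \<psi>(1)[of n]]
   by (intro lebesgue_on_zero_outside(2)[OF \<Omega>_lebesgue]) auto
  then show "(%n. LINT x|lborel. indicat_real (cbox a b) x * \<psi> n x) ----> 0" using 3 by simp
 qed
 then have "(%n. (LINT x|M. norm (\<psi> n x)) + (LINT x|M. norm (\<psi> n x - u n x))) ----> 0 + 0"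
  unfolding conv1 by (intro tendsto_add l1)
 then have l: "(%n. (LINT x|M. norm (\<psi> n x)) + (LINT x|M. norm (\<psi> n x - u n x))) ----> 0" by simp
 have "norm ((LINT x|M. \<bar>u n x\<bar>) - 0) <= (LINT x|M. norm (\<psi> n x)) + (LINT x|M. norm (\<psi> n x - u n x))" for n
 proof -
  note i = LpM_imp_integrable[OF finite_M p0(3) T(1)[of n]] LpM_imp_integrable[OF finite_M p0(3) L(1)[of n]] LpM_imp_integrable[OF finite_M p0(3) d[of n]]
  have "(LINT x|M. \<bar>u n x\<bar>) <= (LINT x|M. norm (\<psi> n x) + norm (\<psi> n x - u n x))"
   using i by (intro integral_mono) auto
  then show ?thesis using i by simp
 qed
 then show ?thesis by (rule tendsto_if_diff_le[OF _ l])
qed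

text \<open>
 Large values are controlled by the bounded critical norm, small ones by the \<open>L\<^sup>1\<close> norm.
\<close>

lemma subcritical_interpolation:
 assumes uG: "\<And>n::nat. W10_pair (u n) (G n)" and B: "\<And>n. Ip p M (G n) <= B"
  and l1: "(%n. LINT x|M. \<bar>u n x\<bar>) ----> 0" and r: "1 <= r" "r < ps"
 shows "(%n. Ip r M (u n)) ----> 0"
proof (rule LIMSEQ_I)
 fix e :: real assume e: "0 < e"
 define A where "A = (2 * sobolev_const * B powr (1 / p)) powr ps + 1"
 have A: "0 < A" by (simp add: A_def add_nonneg_pos)
 have S: "Ip ps M (u n) <= A" for n
 proof -
  have "Ip ps M (u n) powr (1 / ps) <= 2 * sobolev_const * Ip p M (G n) powr (1 / p)" by (rule Sobolev_inequality_sharp[OF uG])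
  also have "\<dots> <= 2 * sobolev_const * B powr (1 / p)"
   using B sobolev_const_nonneg p0 by (intro mult_left_mono powr_mono2) auto
  finally have "(Ip ps M (u n) powr (1 / ps)) powr ps <= (2 * sobolev_const * B powr (1 / p)) powr ps"
   using ps_gt by (intro powr_mono2) auto
  then show ?thesis using ps_gt by (simp add: powr_powr A_def)
 qed
 \<comment> \<open>the level at which the tail of the critical integral contributes \<open>e / 2\<close>\<close>
 define K where "K = (2 * A / e) powr (1 / (ps - r))"
 have K: "0 < K" using A e by (simp add: K_def)
 have KA: "K powr (r - ps) * A = e / 2"
 proof -
  have "K powr (r - ps) = (2 * A / e) powr (1 / (ps - r) * (r - ps))" by (simp add: K_def powr_powr)
  also have "1 / (ps - r) * (r - ps) = -1" using r by (simp add: field_simps)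
  finally show ?thesis using A e by (simp add: powr_minus field_simps)
 qed
 have pt: "norm (t::real) powr r <= K powr (r - ps) * norm t powr ps + K powr (r - 1) * \<bar>t\<bar>" for t
 proof (cases "\<bar>t\<bar> >= K")
  case True
  have "\<bar>t\<bar> powr r = \<bar>t\<bar> powr (r - ps) * \<bar>t\<bar> powr ps" unfolding powr_add[symmetric] by simp
  also have "\<dots> <= K powr (r - ps) * \<bar>t\<bar> powr ps" using True K r by (intro mult_right_mono powr_mono2') auto
  finally show ?thesis using K by (simp add: add_increasing2)
 next
  case False
  have "\<bar>t\<bar> powr r = \<bar>t\<bar> powr (r - 1) * \<bar>t\<bar> powr 1" unfolding powr_add[symmetric] by simp
  also have "\<dots> <= K powr (r - 1) * \<bar>t\<bar>" using False r by (intro mult_mono powr_mono2) auto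
  finally show ?thesis by (simp add: add_increasing)
 qed
 have "(%n. K powr (r - 1) * (LINT x|M. \<bar>u n x\<bar>)) ----> K powr (r - 1) * 0" by (intro tendsto_intros l1)
 then have "\<forall>\<^sub>F n in sequentially. K powr (r - 1) * (LINT x|M. \<bar>u n x\<bar>) < e / 2" using e by (intro order_tendstoD(2)) auto
 then obtain N where N: "\<And>n. n >= N ==> K powr (r - 1) * (LINT x|M. \<bar>u n x\<bar>) < e / 2" unfolding eventually_sequentially by blast
 have "norm (Ip r M (u n) - 0) < e" if n: "n >= N" for n
 proof -
  note i = LpM_integrable[OF Sobolev_inequality(1)[OF uG[of n]]] LpM_imp_integrable[OF finite_M p0(3) W10_pairD(1)[OF uG[of n]]]
  have m: "u n \<in> borel_measurable M" by (rule LpM_measurable[OF W10_pairD(1)[OF uG]])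
  have w: "integrable M (%x. K powr (r - ps) * norm (u n x) powr ps + K powr (r - 1) * \<bar>u n x\<bar>)" using i by simp
  have rl: "u n \<in> LpM r M" by (rule LpM_dominated[OF m w]) (use pt in simp)
  have "Ip r M (u n) <= (LINT x|M. K powr (r - ps) * norm (u n x) powr ps + K powr (r - 1) * \<bar>u n x\<bar>)"
   unfolding Ip_def by (intro integral_mono LpM_integrable[OF rl] w pt)
  also have "\<dots> = K powr (r - ps) * Ip ps M (u n) + K powr (r - 1) * (LINT x|M. \<bar>u n x\<bar>)"
   using i by (simp add: Ip_def)
  also have "\<dots> <= K powr (r - ps) * A + K powr (r - 1) * (LINT x|M. \<bar>u n x\<bar>)" using S[of n] by (intro add_right_mono mult_left_mono) auto
  also have "\<dots> < e" using KA N[OF n] by linarith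
  finally show ?thesis by simp
 qed
 then show "\<exists>no. \<forall>n\<ge>no. norm (Ip r M (u n) - 0) < e" by blast
qed

end

section \<open>Finite dimensional subspaces\<close>

definition quasi_seminorm_on :: "'v::real_vector set => ('v => real) => bool" where
 "quasi_seminorm_on V N \<longleftrightarrow> subspace V \<and> (\<forall>x\<in>V. 0 <= N x) \<and> (\<forall>a. \<forall>x\<in>V. N (a *R x) = \<bar>a\<bar> * N x) \<and>
   (\<exists>K. \<forall>x\<in>V. \<forall>y\<in>V. N (x + y) <= K * (N x + N y))"

lemma dual_spaceD:
 assumes "F \<in> dual_space V nrm"
 shows "x \<in> V ==> y \<in> V ==> F (x + y) = F x + F y" "x \<in> V ==> F (c *R x) = c * F x"
  "\<exists>C. \<forall>x\<in>V. \<bar>F x\<bar> <= C * nrm x"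
 using assms unfolding dual_space_def by auto

lemma dual_space_sum:
 assumes V: "subspace V" and F: "F \<in> dual_space V nrm" and e: "\<And>i. i < (m::nat) ==> e i \<in> V"
 shows "(\<Sum>i<m. c i *R e i) \<in> V" "F (\<Sum>i<m. c i *R e i) = (\<Sum>i<m. c i * F (e i))"
proof -
 have "(\<Sum>i<k. c i *R e i) \<in> V \<and> F (\<Sum>i<k. c i *R e i) = (\<Sum>i<k. c i * F (e i))" if "k <= m" for k
  using that
 proof (induction k)
  case 0
  have "F (0 *R 0) = 0 * F 0" by (rule dual_spaceD(2)[OF F]) (rule subspace_0[OF V])
  then show ?case using subspace_0[OF V] by simp
 next
  case (Suc k)
  have ek: "c k *R e k \<in> V" using Suc.prems by (intro subspace_mul[OF V] e) simp
  have "F (\<Sum>i<Suc k. c i *R e i) = F (\<Sum>i<k. c i *R e i) + F (c k *R e k)"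
   using dual_spaceD(1)[OF F _ ek] Suc by simp
  also have "F (c k *R e k) = c k * F (e k)" using Suc.prems by (intro dual_spaceD(2)[OF F] e) simp
  finally show ?case using Suc ek subspace_add[OF V _ ek] by simp
 qed
 from this[of m] show "(\<Sum>i<m. c i *R e i) \<in> V" "F (\<Sum>i<m. c i *R e i) = (\<Sum>i<m. c i * F (e i))" by auto
qed

text \<open>
 Every finite list of vectors has a subfamily whose coefficients are bounded by the norm of the combination
 and which determines bounded functionals on the list. Vectors are added one at a time; one at distance 0
 from the span of the previous ones is skipped. Linear independence alone would not give the bound, as \<open>N\<close>
 may vanish on nonzero vectors.
\<close>

lemma independent_family_exists:
 fixes d :: "nat => 'v::real_vector"
 assumes N: "quasi_seminorm_on V N" and d: "\<And>k. d k \<in> V"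
 shows "\<exists>(m::nat) e B. (\<forall>i<m. e i \<in> V) \<and> (\<forall>c. \<forall>i<m. \<bar>c i\<bar> <= B * N (\<Sum>i<m. c i *R e i)) \<and>
   (\<forall>k<n. \<forall>F\<in>dual_space V N. (\<forall>i<m. F (e i) = 0) \<longrightarrow> F (d k) = 0)"
proof (induction n)
 case 0
 show ?case by (intro exI[of _ "0::nat"]) auto
next
 case (Suc n)
 have V: "subspace V" using N by (simp add: quasi_seminorm_on_def)
 have N0: "0 <= N x" if "x \<in> V" for x using N that by (simp add: quasi_seminorm_on_def)
 have Nsc: "N (a *R x) = \<bar>a\<bar> * N x" if "x \<in> V" for a x using N that by (simp add: quasi_seminorm_on_def)
 obtain K0 where K0: "\<And>x y. x \<in> V ==> y \<in> V ==> N (x + y) <= K0 * (N x + N y)"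
  using N unfolding quasi_seminorm_on_def by blast
 define K where "K = \<bar>K0\<bar>"
 have K: "0 <= K" "\<And>x y. x \<in> V ==> y \<in> V ==> N (x + y) <= K * (N x + N y)"
 proof -
  fix x y assume xy: "x \<in> V" "y \<in> V"
  have "K0 * (N x + N y) <= K * (N x + N y)" using N0[OF xy(1)] N0[OF xy(2)] by (intro mult_right_mono) (auto simp: K_def)
  then show "N (x + y) <= K * (N x + N y)" using K0[OF xy] by linarith
 qed (simp add: K_def)
 obtain m :: nat and e B where e: "\<forall>i<m. e i \<in> V" and B: "\<forall>c. \<forall>i<m. \<bar>c i\<bar> <= B * N (\<Sum>i<m. c i *R e i)"
  and ann: "\<forall>k<n. \<forall>F\<in>dual_space V N. (\<forall>i<m. F (e i) = 0) \<longrightarrow> F (d k) = 0"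
  using Suc.IH by (elim exE conjE) (rule that)
 have sV: "(\<Sum>i<m. c i *R e i) \<in> V" for c using e V by (intro subspace_sum subspace_mul) auto
 show ?case
 proof (cases "\<forall>\<epsilon>>0. \<exists>c. N (d n + (\<Sum>i<m. c i *R e i)) < \<epsilon>")
  case True
  have "F (d n) = 0" if F: "F \<in> dual_space V N" and z: "\<forall>i<m. F (e i) = 0" for F
  proof -
   obtain C0 where C0: "\<forall>x\<in>V. \<bar>F x\<bar> <= C0 * N x" using dual_spaceD(3)[OF F] by blast
   define C where "C = \<bar>C0\<bar> + 1"
   have C: "0 < C" "\<And>x. x \<in> V ==> \<bar>F x\<bar> <= C * N x"
   proof -
    fix x assume x: "x \<in> V"
    have "C0 * N x <= C * N x" using N0[OF x] by (intro mult_right_mono) (auto simp: C_def)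
    then show "\<bar>F x\<bar> <= C * N x" using C0 x by fastforce
   qed (simp add: C_def add_nonneg_pos)
   have "\<bar>F (d n)\<bar> <= \<epsilon>" if "0 < \<epsilon>" for \<epsilon>
   proof -
    have "0 < \<epsilon> / C" using that C(1) by simp
    then obtain c where c: "N (d n + (\<Sum>i<m. c i *R e i)) < \<epsilon> / C" using True by blast
    have "F (\<Sum>i<m. c i *R e i) = (\<Sum>i<m. c i * F (e i))" using dual_space_sum(2)[OF V F] e by blast
    also have "\<dots> = 0" using z by simp
    finally have "F (d n) = F (d n + (\<Sum>i<m. c i *R e i))" using dual_spaceD(1)[OF F d sV] by simp
    then have "\<bar>F (d n)\<bar> <= C * N (d n + (\<Sum>i<m. c i *R e i))" using C(2)[OF subspace_add[OF V d sV]] by simp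
    also have "\<dots> <= C * (\<epsilon> / C)" using c C by (intro mult_left_mono) auto
    finally show ?thesis using C by simp
   qed
   then have "\<bar>F (d n)\<bar> <= 0" by (rule field_le_epsilon[of _ 0, simplified])
   then show ?thesis by simp
  qed
  then show ?thesis using e B ann by (intro exI[of _ m] exI[of _ e] exI[of _ B]) (auto simp: less_Suc_eq)
 next
  case False
  then obtain \<delta> where \<delta>: "0 < \<delta>" "\<And>c. \<delta> <= N (d n + (\<Sum>i<m. c i *R e i))" by (auto simp: not_less)
  define e' where "e' = e(m := d n)"
  have e'V: "\<forall>i<Suc m. e' i \<in> V" using e d by (auto simp: e'_def less_Suc_eq)
  have sum': "(\<Sum>i<Suc m. c i *R e' i) = (\<Sum>i<m. c i *R e i) + c m *R d n" for c
   by (simp add: e'_def)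
  define L where "L = K * (1 + N (d n) / \<delta>)"
  have L0: "0 <= L" using K \<delta> N0[OF d[of n]] by (simp add: L_def)
  define B' where "B' = \<bar>B\<bar> * L + 1 / \<delta>"
  have B': "\<bar>c i\<bar> <= B' * N (\<Sum>i<Suc m. c i *R e' i)" if i: "i < Suc m" for c i
  proof -
   define w where "w = (\<Sum>i<Suc m. c i *R e' i)"
   have w: "w = (\<Sum>i<m. c i *R e i) + c m *R d n" unfolding w_def by (rule sum')
   have wV: "w \<in> V" unfolding w by (intro subspace_add[OF V] sV subspace_mul[OF V] d)
   have cm: "\<bar>c m\<bar> * \<delta> <= N w"
   proof (cases "c m = 0")
    case False
    have "w = c m *R (d n + (\<Sum>i<m. (c i / c m) *R e i))"
     unfolding w using False by (simp add: scaleR_add_right scaleR_sum_right)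
    moreover have "d n + (\<Sum>i<m. (c i / c m) *R e i) \<in> V" by (intro subspace_add[OF V] sV d)
    ultimately have "N w = \<bar>c m\<bar> * N (d n + (\<Sum>i<m. (c i / c m) *R e i))" using Nsc by simp
    then show ?thesis using \<delta>(2)[of "%i. c i / c m"] by (simp add: mult_left_mono)
   qed (use N0[OF wV] in simp)
   then have cm': "\<bar>c m\<bar> <= N w / \<delta>" using \<delta> by (simp add: pos_le_divide_eq)
   have "N (\<Sum>i<m. c i *R e i) = N (w + (- c m) *R d n)" unfolding w by simp
   also have "\<dots> <= K * (N w + N ((- c m) *R d n))" by (intro K wV subspace_mul[OF V] d)
   also have "N ((- c m) *R d n) = \<bar>c m\<bar> * N (d n)" using Nsc[OF d[of n], of "- c m"] by simp
   also have "K * (N w + \<bar>c m\<bar> * N (d n)) <= K * (N w + N w / \<delta> * N (d n))"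
    using K cm' N0[OF d] by (intro mult_left_mono add_left_mono mult_right_mono) auto
   also have "\<dots> = L * N w" by (simp add: L_def algebra_simps)
   finally have sm: "N (\<Sum>i<m. c i *R e i) <= L * N w" .
   have Nw: "0 <= N w" by (rule N0[OF wV])
   show ?thesis
   proof (cases "i = m")
    case True
    have "N w / \<delta> <= B' * N w" using L0 Nw by (simp add: B'_def distrib_right)
    then show ?thesis using cm' unfolding True w_def by linarith
   next
    case False
    have "B * N (\<Sum>i<m. c i *R e i) <= \<bar>B\<bar> * N (\<Sum>i<m. c i *R e i)" using N0[OF sV] by (intro mult_right_mono) auto
    also have "\<dots> <= \<bar>B\<bar> * (L * N w)" using sm by (intro mult_left_mono) auto
    also have "\<dots> <= B' * N w" using Nw \<delta> by (simp add: B'_def distrib_right)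
    finally have "B * N (\<Sum>i<m. c i *R e i) <= B' * N w" .
    moreover have "\<bar>c i\<bar> <= B * N (\<Sum>i<m. c i *R e i)" using B False i by simp
    ultimately show ?thesis unfolding w_def by linarith
   qed
  qed
  have "F (d k) = 0" if k: "k < Suc n" and F: "F \<in> dual_space V N" and z: "\<forall>i<Suc m. F (e' i) = 0" for k F
  proof (cases "k = n")
   case True
   then show ?thesis using z[rule_format, of m] by (simp add: e'_def)
  next
   case False
   have "\<forall>i<m. F (e i) = 0"
   proof (intro allI impI)
    fix i assume "i < m" then show "F (e i) = 0" using z[rule_format, of i] by (simp add: e'_def)
   qed
   then show ?thesis using ann F k False by simp
  qed
  then show ?thesis using e'V B' by (intro exI[of _ "Suc m"] exI[of _ e'] exI[of _ B']) blast
 qed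
qed

section \<open>Limits of bounded sequences converging almost everywhere\<close>

text \<open>
 The majorants \<open>A n\<close> are bounded in \<open>L\<^sup>s\<close> but need not converge. Where they are large compared with \<open>h\<close>,
 their bound makes the contribution small; elsewhere \<open>h\<close> and \<open>\<sigma>\<close> dominate the integrand.
\<close>

lemma tendsto_integral_bounded_AE:
 fixes g :: "nat => 'a => 'b::euclidean_space"
 assumes s: "1 < s" "s' = s / (s - 1)"
  and gm: "\<And>n. g n \<in> borel_measurable M" "g0 \<in> borel_measurable M"
  and A: "\<And>n. A n \<in> LpM s M" "A0 \<in> LpM s M" and C: "\<And>n. Ip s M (A n :: 'a => real) <= C"
  and h: "h \<in> LpM s' M" and \<sigma>h: "integrable M (%x. \<sigma> x * norm (h x))"
  and dom: "\<And>n. AE x in M. norm (g n x) <= \<bar>A n x\<bar> + \<sigma> x" "AE x in M. norm (g0 x) <= \<bar>A0 x\<bar> + \<sigma> x"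
  and \<sigma>0: "AE x in M. 0 <= \<sigma> x"
  and lim: "AE x in M. (%n. g n x) ----> g0 x"
 shows "(%n. LINT x|M. g n x \<bullet> h x) ----> (LINT x|M. g0 x \<bullet> h x)"
proof -
 have s': "1 < s'" "s = s' / (s' - 1)" unfolding s(2) using s(1) by (simp_all add: field_simps)
 have ss: "(s' - 1) * (s - 1) = 1" unfolding s(2) using s(1) by (simp add: field_simps)
 note [measurable] = gm LpM_measurable[OF A(1)] LpM_measurable[OF A(2)] LpM_measurable[OF h]
 have int: "integrable M (%x. k x \<bullet> h x)"
  if k: "k \<in> borel_measurable M" "a \<in> LpM s M" "AE x in M. norm (k x) <= \<bar>a x\<bar> + \<sigma> x" for k :: "'a => 'b" and a :: "'a => real"
 proof (rule Bochner_Integration.integrable_bound)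
  show "integrable M (%x. norm (a x) * norm (h x) + \<sigma> x * norm (h x))"
   by (intro Bochner_Integration.integrable_add Holder(1)[OF s k(2) h] \<sigma>h)
  show "(%x. k x \<bullet> h x) \<in> borel_measurable M" using k(1) by measurable
  show "AE x in M. norm (k x \<bullet> h x) <= norm (norm (a x) * norm (h x) + \<sigma> x * norm (h x))"
   using k(3)
  proof eventually_elim
   case (elim x)
   have "norm (k x \<bullet> h x) <= norm (k x) * norm (h x)" using Cauchy_Schwarz_ineq2 by simp
   also have "\<dots> <= (\<bar>a x\<bar> + \<sigma> x) * norm (h x)" using elim by (intro mult_right_mono) auto
   also have "\<dots> <= norm (norm (a x) * norm (h x) + \<sigma> x * norm (h x))" by (simp add: distrib_right)
   finally show ?case .
  qed
 qed
 note ig = int[OF gm(1) A(1) dom(1)] and ig0 = int[OF gm(2) A(2) dom(2)]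
 define H where "H n x = \<bar>A n x\<bar> + \<bar>A0 x\<bar>" for n x
 define C' where "C' = 2 powr s * (C + Ip s M A0)"
 have HL: "H n \<in> LpM s M" "Ip s M (H n) <= C'" for n
 proof -
  have a: "(%x. \<bar>A n x\<bar>) \<in> LpM s M" "(%x. \<bar>A0 x\<bar>) \<in> LpM s M" "Ip s M (%x. \<bar>A n x\<bar>) = Ip s M (A n)" "Ip s M (%x. \<bar>A0 x\<bar>) = Ip s M A0"
   using A by (auto simp: LpM_def Ip_def)
  show "H n \<in> LpM s M" unfolding H_def using s by (intro LpM_add a) auto
  have "Ip s M (H n) <= 2 powr s * (Ip s M (A n) + Ip s M A0)"
   unfolding H_def using Ip_add_le[OF _ a(1,2)] s a by simp
  also have "\<dots> <= C'" unfolding C'_def using C[of n] by (intro mult_left_mono) auto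
  finally show "Ip s M (H n) <= C'" .
 qed
 have C'0: "0 <= C'" using order_trans[OF Ip_nonneg HL(2)] .
 have \<sigma>m: "(%x. \<sigma> x * norm (h x)) \<in> borel_measurable M" using \<sigma>h by simp
 show ?thesis
 proof (rule LIMSEQ_I)
  fix e :: real assume e: "0 < e"
  define K where "K = (2 * (C' + 1) / e) powr (1 / (s - 1))"
  have K: "0 < K" using C'0 e by (simp add: K_def)
  have Ks: "K powr (s - 1) = 2 * (C' + 1) / e" using C'0 e s by (simp add: K_def powr_powr)
  have KC: "C' / K powr (s - 1) < e / 2" unfolding Ks using C'0 e by (simp add: field_simps)
  define D where "D n x = norm (g n x - g0 x) * norm (h x)" for n x
  define T where "T n x = min (D n x) (K * norm (h x) powr s' + 2 * (\<sigma> x * norm (h x)))" for n x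
  have Dm [measurable]: "D n \<in> borel_measurable M" for n unfolding D_def by measurable
  have Tm: "T n \<in> borel_measurable M" for n unfolding T_def using \<sigma>m by measurable
  have wi: "integrable M (%x. K * norm (h x) powr s' + 2 * (\<sigma> x * norm (h x)))"
   using LpM_integrable[OF h] \<sigma>h by simp
  have Ti: "integrable M (T n)" for n
   by (rule Bochner_Integration.integrable_bound[OF wi Tm])
    (use \<sigma>0 in eventually_elim, use K in \<open>auto simp: T_def D_def min_def\<close>)
  have "(%n. LINT x|M. T n x) ----> (LINT x|M. 0)"
  proof (rule integral_dominated_convergence[OF _ Tm wi])
   show "AE x in M. (%n. T n x) ----> 0"
    using lim \<sigma>0
   proof eventually_elim
    case (elim x)
    have "(%n. D n x) ----> norm (g0 x - g0 x) * norm (h x)" unfolding D_def by (intro tendsto_intros elim)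
    then have "(%n. D n x) ----> 0" by simp
    then show ?case
    proof (rule tendsto_if_diff_le[rotated])
     show "norm (T n x - 0) <= D n x" for n
      using elim K by (auto simp: T_def D_def min_def)
    qed
   qed
   show "AE x in M. norm (T n x) <= K * norm (h x) powr s' + 2 * (\<sigma> x * norm (h x))" for n
    using \<sigma>0 by eventually_elim (use K in \<open>auto simp: T_def D_def min_def\<close>)
  qed simp
  then have "\<forall>\<^sub>F n in sequentially. (LINT x|M. T n x) < e / 2" using e by (intro order_tendstoD(2)) auto
  then obtain N where N: "\<And>n. n >= N ==> (LINT x|M. T n x) < e / 2" unfolding eventually_sequentially by blast
  have "norm ((LINT x|M. g n x \<bullet> h x) - (LINT x|M. g0 x \<bullet> h x)) < e" if n: "n >= N" for n
  proof -
   have pt: "AE x in M. norm ((g n x - g0 x) \<bullet> h x) <= T n x + norm (H n x) powr s / K powr (s - 1)"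
    using dom(1)[of n] dom(2) \<sigma>0
   proof eventually_elim
    case (elim x)
    define t where "t = norm (h x)"
    define y where "y = H n x"
    have t0: "0 <= t" and y0: "0 <= y" by (auto simp: t_def y_def H_def)
    have dn: "norm (g n x - g0 x) <= y + 2 * \<sigma> x"
     using norm_triangle_ineq4[of "g n x" "g0 x"] elim by (simp add: y_def H_def)
    have "norm ((g n x - g0 x) \<bullet> h x) <= D n x" unfolding D_def using Cauchy_Schwarz_ineq2 by simp
    also have "D n x <= T n x + y powr s / K powr (s - 1)"
    proof (cases "D n x <= K * t powr s' + 2 * (\<sigma> x * t)")
     case True
     then show ?thesis using K by (simp add: T_def t_def)
    next
     case False
     then have T: "T n x = K * t powr s' + 2 * (\<sigma> x * t)" by (simp add: T_def t_def)
     have tp: "0 < t" using False t0 by (cases "t = 0") (auto simp: D_def t_def)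
     have "D n x <= (y + 2 * \<sigma> x) * t" unfolding D_def t_def using dn by (intro mult_right_mono) auto
     then have Dy: "D n x <= y * t + 2 * (\<sigma> x * t)" by (simp add: algebra_simps)
     then have "K * t powr s' < y * t" using False by linarith
     also have "t powr s' = t powr (s' - 1) * t powr 1" unfolding powr_add[symmetric] by simp
     finally have "(K * t powr (s' - 1)) * t < y * t" using tp by simp
     then have "K * t powr (s' - 1) < y" using tp by simp
     then have "t powr (s' - 1) <= y / K" using K by (simp add: field_simps)
     then have "(t powr (s' - 1)) powr (s - 1) <= (y / K) powr (s - 1)" using s by (intro powr_mono2) auto
     then have "t <= y powr (s - 1) / K powr (s - 1)" using tp y0 K by (simp add: powr_powr ss powr_divide)
     then have "y * t <= y * (y powr (s - 1) / K powr (s - 1))" using y0 by (intro mult_left_mono)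
     also have "\<dots> = y powr 1 * y powr (s - 1) / K powr (s - 1)" using y0 by simp
     also have "y powr 1 * y powr (s - 1) = y powr s" unfolding powr_add[symmetric] by simp
     finally have yt: "y * t <= y powr s / K powr (s - 1)" .
     have "0 <= K * t powr s'" using K by simp
     then show ?thesis using Dy yt T by linarith
    qed
    finally show ?case using y0 by (simp add: y_def)
   qed
   have i1: "integrable M (%x. (g n x - g0 x) \<bullet> h x)" unfolding inner_diff_left using ig ig0 by (intro Bochner_Integration.integrable_diff)
   have i2: "integrable M (%x. norm (H n x) powr s / K powr (s - 1))" using LpM_integrable[OF HL(1)[of n]] by simp
   have "norm ((LINT x|M. g n x \<bullet> h x) - (LINT x|M. g0 x \<bullet> h x)) = norm (LINT x|M. (g n x - g0 x) \<bullet> h x)"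
    unfolding inner_diff_left using ig ig0 by simp
   also have "\<dots> <= (LINT x|M. norm ((g n x - g0 x) \<bullet> h x))" by (rule integral_norm_bound)
   also have "\<dots> <= (LINT x|M. T n x + norm (H n x) powr s / K powr (s - 1))"
    by (intro integral_mono_AE integrable_norm i1 Bochner_Integration.integrable_add Ti i2 pt)
   also have "\<dots> = (LINT x|M. T n x) + Ip s M (H n) / K powr (s - 1)" using Ti i2 by (simp add: Ip_def)
   also have "\<dots> <= (LINT x|M. T n x) + C' / K powr (s - 1)" using HL(2)[of n] by (intro add_left_mono divide_right_mono) auto
   also have "\<dots> < e" using N[OF n] KC by linarith
   finally show ?thesis .
  qed
  then show "\<exists>no. \<forall>n\<ge>no. norm ((LINT x|M. g n x \<bullet> h x) - (LINT x|M. g0 x \<bullet> h x)) < e" by blast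
 qed
qed

section \<open>Monotonicity of the duality map\<close>

text \<open>
 Both summands are nonnegative: the first compares the lengths of the vectors, the second their
 directions. Thus smallness of the left side forces both to agree.
\<close>

lemma duality_monotone_eq:
 assumes "1 < p"
 shows "(duality p \<xi> - duality p \<eta>) \<bullet> (\<xi> - \<eta>) =
  (norm \<xi> powr (p - 1) - norm \<eta> powr (p - 1)) * (norm \<xi> - norm \<eta>) +
  (norm \<xi> powr (p - 2) + norm \<eta> powr (p - 2)) * (norm \<xi> * norm \<eta> - \<xi> \<bullet> \<eta>)"
proof -
 have m: "norm x powr (p - 2) * norm x = norm x powr (p - 1)" for x :: 'a
  using norm_duality[OF assms, of x] by (simp add: duality_def)
 have m2: "norm x powr (p - 2) * (x \<bullet> x) = norm x powr (p - 1) * norm x" for x :: 'a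
  unfolding m[symmetric] by (simp add: power2_norm_eq_inner[symmetric] power2_eq_square)
 have "(duality p \<xi> - duality p \<eta>) \<bullet> (\<xi> - \<eta>) = norm \<xi> powr (p - 2) * (\<xi> \<bullet> \<xi>) + norm \<eta> powr (p - 2) * (\<eta> \<bullet> \<eta>)
   - (norm \<xi> powr (p - 2) + norm \<eta> powr (p - 2)) * (\<xi> \<bullet> \<eta>)"
  by (simp add: duality_def inner_diff_left inner_diff_right inner_commute algebra_simps)
 also have "\<dots> = norm \<xi> powr (p - 1) * norm \<xi> + norm \<eta> powr (p - 1) * norm \<eta>
   - (norm \<xi> powr (p - 2) + norm \<eta> powr (p - 2)) * (\<xi> \<bullet> \<eta>)" unfolding m2 ..
 also have "\<dots> = (norm \<xi> powr (p - 1) - norm \<eta> powr (p - 1)) * (norm \<xi> - norm \<eta>) +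
  (norm \<xi> powr (p - 2) + norm \<eta> powr (p - 2)) * (norm \<xi> * norm \<eta> - \<xi> \<bullet> \<eta>)"
  unfolding m[symmetric] by (simp add: algebra_simps)
 finally show ?thesis .
qed

lemma powr_monotone_product: "0 < (r::real) ==> 0 <= (norm \<xi> powr r - norm \<eta> powr r) * (norm \<xi> - norm \<eta>)"
proof (cases "norm \<xi> <= norm \<eta>")
 case True
 moreover assume "0 < r"
 ultimately have "norm \<xi> powr r <= norm \<eta> powr r" by (intro powr_mono2) auto
 then show ?thesis using True by (intro mult_nonpos_nonpos) auto
next
 case False
 moreover assume "0 < r"
 ultimately have "norm \<eta> powr r <= norm \<xi> powr r" by (intro powr_mono2) auto
 then show ?thesis using False by (intro mult_nonneg_nonneg) auto
qed

lemma duality_monotone: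
 assumes "1 < p" shows "0 <= (duality p \<xi> - duality p \<eta>) \<bullet> (\<xi> - \<eta>)"
 unfolding duality_monotone_eq[OF assms]
 using assms norm_cauchy_schwarz[of \<xi> \<eta>] by (intro add_nonneg_nonneg mult_nonneg_nonneg powr_monotone_product) auto

lemma duality_monotone_tendsto:
 fixes \<xi> :: "nat => 'b::euclidean_space"
 assumes p: "1 < p" and lim: "(%n. (duality p (\<xi> n) - duality p \<eta>) \<bullet> (\<xi> n - \<eta>)) ----> 0"
 shows "\<xi> ----> \<eta>"
proof -
 have p': "0 < p - 1" using p by simp
 define a where "a n = norm (\<xi> n)" for n
 define b where "b = norm \<eta>"
 have a0: "0 <= a n" for n by (simp add: a_def)
 have b0: "0 <= b" by (simp add: b_def)
 have 1: "norm ((a n powr (p - 1) - b powr (p - 1)) * (a n - b) - 0) <= (duality p (\<xi> n) - duality p \<eta>) \<bullet> (\<xi> n - \<eta>)" for n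
  unfolding duality_monotone_eq[OF p] a_def b_def
  using powr_monotone_product[OF p', of "\<xi> n" \<eta>] norm_cauchy_schwarz[of "\<xi> n" \<eta>] by simp
 have l1: "(%n. (a n powr (p - 1) - b powr (p - 1)) * (a n - b)) ----> 0" by (rule tendsto_if_diff_le[OF 1 lim])
 have la: "a ----> b"
 proof (rule LIMSEQ_I)
  fix e :: real assume e: "0 < e"
  define u where "u = ((b + e) powr (p - 1) - b powr (p - 1)) * e"
  have u: "0 < u" unfolding u_def using e b0 p' by (intro mult_pos_pos) (auto intro!: powr_less_mono2)
  define l where "l = (b powr (p - 1) - (b - e) powr (p - 1)) * e"
  have l: "0 < l" if "e <= b" unfolding l_def using e b0 p' that by (intro mult_pos_pos) (auto intro!: powr_less_mono2)
  define \<delta> where "\<delta> = (if e <= b then min u l else u)"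
  have \<delta>: "0 < \<delta>" using u l by (auto simp: \<delta>_def)
  obtain N where N: "\<And>n. n >= N ==> norm ((a n powr (p - 1) - b powr (p - 1)) * (a n - b)) < \<delta>"
   using LIMSEQ_D[OF l1 \<delta>] by auto
  have "norm (a n - b) < e" if n: "n >= N" for n
  proof (rule ccontr)
   assume "\<not> ?thesis"
   then consider "b + e <= a n" | "a n <= b - e" unfolding real_norm_def by linarith
   then show False
   proof cases
    case 1
    have "u <= (a n powr (p - 1) - b powr (p - 1)) * (a n - b)"
     unfolding u_def using 1 e b0 p' by (intro mult_mono diff_right_mono powr_mono2) (auto intro!: powr_mono2)
    then show False using N[OF n] u by (auto simp: \<delta>_def split: if_splits)
   next
    case 2
    then have eb: "e <= b" using a0[of n] by linarith
    have "l <= (b powr (p - 1) - a n powr (p - 1)) * (b - a n)"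
     unfolding l_def using 2 e eb p' a0[of n] by (intro mult_mono diff_left_mono powr_mono2) (auto intro!: powr_mono2)
    also have "\<dots> = (a n powr (p - 1) - b powr (p - 1)) * (a n - b)" by (simp add: algebra_simps)
    finally show False using N[OF n] l[OF eb] eb by (auto simp: \<delta>_def split: if_splits)
   qed
  qed
  then show "\<exists>no. \<forall>n\<ge>no. norm (a n - b) < e" by blast
 qed
 show ?thesis
 proof (cases "\<eta> = 0")
  case True
  have "a = (%n. norm (\<xi> n))" by (rule ext) (rule a_def)
  then have "(%n. norm (\<xi> n)) ----> 0" using la True by (simp add: b_def)
  then show ?thesis unfolding True by (rule tendsto_norm_zero_cancel)
 next
  case False
  then have bp: "0 < b powr (p - 2)" by (simp add: b_def)
  have 2: "norm ((a n * b - \<xi> n \<bullet> \<eta>) - 0) <= (duality p (\<xi> n) - duality p \<eta>) \<bullet> (\<xi> n - \<eta>) / b powr (p - 2)" for n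
  proof -
   have cs: "0 <= a n * b - \<xi> n \<bullet> \<eta>" using norm_cauchy_schwarz[of "\<xi> n" \<eta>] by (simp add: a_def b_def)
   have "b powr (p - 2) * (a n * b - \<xi> n \<bullet> \<eta>) <= (a n powr (p - 2) + b powr (p - 2)) * (a n * b - \<xi> n \<bullet> \<eta>)"
    using cs by (intro mult_right_mono) auto
   also have "\<dots> <= (duality p (\<xi> n) - duality p \<eta>) \<bullet> (\<xi> n - \<eta>)"
    unfolding duality_monotone_eq[OF p] a_def b_def using powr_monotone_product[OF p', of "\<xi> n" \<eta>] by simp
   finally show ?thesis using cs bp by (simp add: pos_le_divide_eq mult.commute)
  qed
  have "(%n. (duality p (\<xi> n) - duality p \<eta>) \<bullet> (\<xi> n - \<eta>) / b powr (p - 2)) ----> 0 / b powr (p - 2)"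
   using bp by (intro tendsto_divide lim tendsto_const) auto
  then have "(%n. a n * b - \<xi> n \<bullet> \<eta>) ----> 0" using tendsto_if_diff_le[OF 2] by simp
  then have "(%n. (a n)\<^sup>2 - 2 * (a n * b) + 2 * (a n * b - \<xi> n \<bullet> \<eta>) + b\<^sup>2) ----> b\<^sup>2 - 2 * (b * b) + 2 * 0 + b\<^sup>2"
   by (intro tendsto_intros la)
  moreover have "(a n)\<^sup>2 - 2 * (a n * b) + 2 * (a n * b - \<xi> n \<bullet> \<eta>) + b\<^sup>2 = (norm (\<xi> n - \<eta>))\<^sup>2" for n
   by (simp add: a_def b_def power2_norm_eq_inner inner_diff_left inner_diff_right inner_commute algebra_simps)
  ultimately have "(%n. (norm (\<xi> n - \<eta>))\<^sup>2) ----> 0" by (simp add: power2_eq_square)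
  then have "(%n. sqrt ((norm (\<xi> n - \<eta>))\<^sup>2)) ----> sqrt 0" by (intro tendsto_intros)
  then have "(%n. \<xi> n - \<eta>) ----> 0" by (simp add: tendsto_norm_zero_iff)
  then show ?thesis by (rule LIM_zero_cancel)
 qed
qed

section \<open>The first eigenvalue\<close>

context sobolev_domain begin

abbreviation "wg \<equiv> weak_gradient \<Omega>"

lemma W10_pair_wg: "u \<in> W10 p \<Omega> ==> W10_pair u (wg u)" by (simp add: W10_iff_pair)

lemma wg_LpM: "u \<in> W10 p \<Omega> ==> wg u \<in> LpM p M" using W10_pairD(2)[OF W10_pair_wg] .

lemma W10_LpM: "u \<in> W10 p \<Omega> ==> u \<in> LpM p M" using W10_pairD(1)[OF W10_pair_wg] .

lemma W10_norm_eq: "W10_norm p \<Omega> u = Ip p M (wg u) powr (1 / p)"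
 by (simp add: W10_norm_def Lp_norm_eq)

lemma W10_norm_nonneg: "0 <= W10_norm p \<Omega> u" by (simp add: W10_norm_eq)

lemma W10_norm_powr: "W10_norm p \<Omega> u powr p = Ip p M (wg u)"
 using p0 by (simp add: W10_norm_eq powr_powr)

lemma nontrivial_test_function:
 assumes "\<Omega> \<noteq> {}" obtains \<phi> where "test_function \<Omega> \<phi>" "\<not> (AE x in M. \<phi> x = 0)"
proof -
 obtain x where x: "x \<in> \<Omega>" using assms by blast
 obtain a b where ab: "cbox a b \<subseteq> \<Omega>" "x \<in> box a b"
  by (rule open_contains_cbox[OF \<Omega>_open x]) (rule that)
 define \<phi> where "\<phi> = box_bump 1 a b"
 have t: "test_function \<Omega> \<phi>" unfolding \<phi>_def by (rule test_function_box_bump[OF _ ab(1)]) simp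
 have "\<not> (AE x in M. \<phi> x = 0)"
 proof
  assume "AE x in M. \<phi> x = 0"
  then have ae: "AE x in lebesgue. x \<in> \<Omega> \<longrightarrow> \<phi> x = 0" by (subst (asm) AE_restrict_space_iff) auto
  have "AE x in lebesgue. x \<notin> box a b"
   using ae
  proof eventually_elim
   case (elim x)
   show ?case
   proof
    assume "x \<in> box a b"
    then have "x \<in> \<Omega>" "0 < \<phi> x" using ab(1) box_subset_cbox[of a b] box_bump_inside[of x a b 1] by (auto simp: \<phi>_def)
    then show False using elim by simp
   qed
  qed
  then have "box a b \<in> null_sets lebesgue" by (subst AE_iff_null_sets) auto
  then have "negligible (box a b)" by (simp add: negligible_iff_null_sets)
  then show False using ab(2) by (auto simp: negligible_interval)
 qed
 then show ?thesis using t that by blast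
qed

lemma first_eigenvalue_pos_le:
 assumes "\<Omega> \<noteq> {}"
 shows "0 < first_eigenvalue p \<Omega>" "u \<in> W10 p \<Omega> ==> first_eigenvalue p \<Omega> * Ip p M u <= Ip p M (wg u)"
proof -
 define S where "S = {u \<in> W10 p \<Omega>. \<not> (AE x in M. u x = 0)}"
 have fe: "first_eigenvalue p \<Omega> = (INF u\<in>S. Ip p M (wg u) / Ip p M u)"
  unfolding first_eigenvalue_def S_def W10_norm_powr Lp_norm_powr[OF p0(2)] ..
 obtain C where C: "0 < C" "\<And>u G. W10_pair u G ==> Ip p M u <= C * Ip p M G" by (rule Poincare) (rule that)
 have pos: "0 < Ip p M u" if "u \<in> S" for u
 proof -
  have "Ip p M u \<noteq> 0" using that Ip_eq_0_iff[OF W10_LpM[of u]] by (simp add: S_def)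
  then show ?thesis using Ip_nonneg[of p M u] by linarith
 qed
 have lb: "1 / C <= Ip p M (wg u) / Ip p M u" if u: "u \<in> S" for u
 proof -
  have "Ip p M u <= C * Ip p M (wg u)" using u by (intro C W10_pair_wg) (simp add: S_def)
  then show ?thesis using pos[OF u] C(1) by (simp add: field_simps)
 qed
 have ne: "S \<noteq> {}"
 proof -
  obtain \<phi> where \<phi>: "test_function \<Omega> \<phi>" "\<not> (AE x in M. \<phi> x = 0)" by (rule nontrivial_test_function[OF assms]) (rule that)
  then have "\<phi> \<in> S" using W10_pair_imp_W10(1)[OF test_W10_pair[OF \<phi>(1)]] by (simp add: S_def)
  then show ?thesis by blast
 qed
 have "1 / C <= first_eigenvalue p \<Omega>" unfolding fe using ne lb by (rule cINF_greatest)
 then show "0 < first_eigenvalue p \<Omega>" using C(1) by (meson less_le_trans zero_less_divide_1_iff)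
 show "first_eigenvalue p \<Omega> * Ip p M u <= Ip p M (wg u)" if u: "u \<in> W10 p \<Omega>"
 proof (cases "u \<in> S")
  case True
  have "bdd_below ((%u. Ip p M (wg u) / Ip p M u) ` S)" using lb by (rule bdd_belowI2)
  then have "first_eigenvalue p \<Omega> <= Ip p M (wg u) / Ip p M u" unfolding fe using True by (rule cINF_lower)
  then show ?thesis using pos[OF True] by (simp add: pos_le_divide_eq)
 next
  case False
  then have "Ip p M u = 0" using u Ip_eq_0_iff[OF W10_LpM[OF u]] by (simp add: S_def)
  then show ?thesis by simp
 qed
qed

section \<open>W10 as a vector space\<close>

lemma plus_fun_eq: "u + v = (%x. u x + v x)" for u v :: "'c => 'd::plus" by (simp add: fun_eq_iff)
lemma scaleR_fun_eq: "c *R u = (%x. c *R u x)" for u :: "'c => 'd::real_vector" by (simp add: scaleR_fun_def)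

lemma W10_add:
 assumes "u \<in> W10 p \<Omega>" "v \<in> W10 p \<Omega>"
 shows "u + v \<in> W10 p \<Omega>" "AE x in M. wg (u + v) x = wg u x + wg v x"
proof -
 have P: "W10_pair (u + v) (%x. wg u x + wg v x)"
  unfolding plus_fun_eq by (intro W10_pair_add W10_pair_wg assms)
 show "u + v \<in> W10 p \<Omega>" by (rule W10_pair_imp_W10(1)[OF P])
 show "AE x in M. wg (u + v) x = wg u x + wg v x" using W10_pair_imp_W10(2)[OF P] by eventually_elim simp
qed

lemma W10_scale:
 assumes "u \<in> W10 p \<Omega>"
 shows "c *R u \<in> W10 p \<Omega>" "AE x in M. wg (c *R u) x = c *R wg u x"
proof -
 have P: "W10_pair (c *R u) (%x. c *R wg u x)"
  unfolding scaleR_fun_eq real_scaleR_def by (intro W10_pair_scale W10_pair_wg assms)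
 show "c *R u \<in> W10 p \<Omega>" by (rule W10_pair_imp_W10(1)[OF P])
 show "AE x in M. wg (c *R u) x = c *R wg u x" using W10_pair_imp_W10(2)[OF P] by eventually_elim simp
qed

lemma W10_zero: "0 \<in> W10 p \<Omega>" "AE x in M. wg 0 x = 0"
proof -
 have P: "W10_pair 0 (%x. 0)" using W10_pair_zero by (simp add: zero_fun_def)
 show "0 \<in> W10 p \<Omega>" by (rule W10_pair_imp_W10(1)[OF P])
 show "AE x in M. wg 0 x = 0" using W10_pair_imp_W10(2)[OF P] by eventually_elim simp
qed

lemma subspace_W10: "subspace (W10 p \<Omega>)"
 unfolding subspace_def using W10_zero(1) W10_add(1) W10_scale(1) by blast

lemma W10_diff:
 assumes "u \<in> W10 p \<Omega>" "v \<in> W10 p \<Omega>"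
 shows "u - v \<in> W10 p \<Omega>" "AE x in M. wg (u - v) x = wg u x - wg v x"
proof -
 have e: "u - v = u + (-1) *R v" by simp
 show "u - v \<in> W10 p \<Omega>" unfolding e by (intro W10_add W10_scale assms)
 show "AE x in M. wg (u - v) x = wg u x - wg v x"
  unfolding e using W10_add(2)[OF assms(1) W10_scale(1)[OF assms(2), of "-1"]] W10_scale(2)[OF assms(2), of "-1"]
  by eventually_elim simp
qed

lemma Ip_wg_cong:
 assumes "u \<in> W10 p \<Omega>" "AE x in M. wg u x = G x" shows "Ip p M (wg u) = Ip p M G"
 by (rule Ip_cong_AE[OF LpM_measurable[OF wg_LpM[OF assms(1)]] _ assms(2)])
  (rule lebesgue_on_measurable_AE[OF \<Omega>_lebesgue LpM_measurable[OF wg_LpM[OF assms(1)]] assms(2)])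

lemma W10_norm_scale: "u \<in> W10 p \<Omega> ==> W10_norm p \<Omega> (c *R u) = \<bar>c\<bar> * W10_norm p \<Omega> u"
 using Ip_wg_cong[OF W10_scale, of u c] Ip_scale[OF wg_LpM, of u c] p0
 by (simp add: W10_norm_eq powr_mult powr_powr)

lemma W10_norm_zero: "W10_norm p \<Omega> 0 = 0"
 using W10_norm_scale[OF W10_zero(1), of 0] by simp

lemma W10_norm_add:
 assumes "u \<in> W10 p \<Omega>" "v \<in> W10 p \<Omega>"
 shows "W10_norm p \<Omega> (u + v) <= 4 * (W10_norm p \<Omega> u + W10_norm p \<Omega> v)"
proof -
 define a where "a = Ip p M (wg u)"
 define b where "b = Ip p M (wg v)"
 have ab: "0 <= a" "0 <= b" by (auto simp: a_def b_def)
 have "Ip p M (wg (u + v)) <= 2 powr p * (a + b)"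
  unfolding Ip_wg_cong[OF W10_add[OF assms]] a_def b_def by (intro Ip_add_le p0 wg_LpM assms)
 also have "\<dots> <= 2 powr p * (2 * max a b)" by (intro mult_left_mono) auto
 finally have "Ip p M (wg (u + v)) powr (1 / p) <= (2 powr p * (2 * max a b)) powr (1 / p)"
  using p0 by (intro powr_mono2) auto
 also have "\<dots> = 2 * (2 powr (1 / p) * max a b powr (1 / p))" using p0 ab by (simp add: powr_mult powr_powr)
 also have "2 powr (1 / p) <= 2 powr (1::real)" using p1 by (intro powr_mono) auto
 also have "max a b powr (1 / p) <= a powr (1 / p) + b powr (1 / p)" by (simp add: max_def)
 finally show ?thesis unfolding W10_norm_eq a_def[symmetric] b_def[symmetric] by (simp add: mult_left_mono mult_right_mono)
qed

text \<open>
 A bounded functional on \<open>W10 p \<Omega>\<close> depends only on the gradient, and gradients form a closed subspace of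
 \<open>L\<^sup>p\<close>, to which Riesz representation applies.
\<close>

lemma W10_functional_repr:
 assumes F: "F \<in> dual_space (W10 p \<Omega>) (W10_norm p \<Omega>)"
 shows "\<exists>G\<in>LpM (p / (p - 1)) M. \<forall>u\<in>W10 p \<Omega>. F u = (LINT x|M. G x \<bullet> wg u x)"
proof -
 obtain C where C: "\<And>u. u \<in> W10 p \<Omega> ==> \<bar>F u\<bar> <= C * W10_norm p \<Omega> u" using dual_spaceD(3)[OF F] by blast
 define S where "S G = (SOME u. W10_pair u G)" for G
 have S: "W10_pair (S G) G" if "G \<in> gradients" for G
  using that unfolding S_def gradients_def mem_Collect_eq by (rule someI_ex)
 define F' where "F' G = F (S G)" for G
 have F': "F' G = F u" if P: "W10_pair u G" for u G
 proof -
  have G: "G \<in> gradients" using P unfolding gradients_def by blast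
  note s = W10_pair_imp_W10[OF S[OF G]] W10_pair_imp_W10[OF P]
  have d: "S G - u \<in> W10 p \<Omega>" "AE x in M. wg (S G - u) x = 0"
   using W10_diff[OF s(1,3)] s(2,4) by (auto elim!: eventually_elim2[of _ _ _ "%x. wg (S G - u) x = 0"])
  then have "W10_norm p \<Omega> (S G - u) = 0" unfolding W10_norm_eq Ip_wg_cong[OF d] by simp
  then have "F (S G - u) = 0" using C[OF d(1)] by simp
  moreover have "F (S G) = F (S G - u) + F u" using dual_spaceD(1)[OF F d(1) s(3)] by simp
  ultimately show ?thesis by (simp add: F'_def)
 qed
 have "Lp_functional p M gradients F'"
  unfolding Lp_functional_def
 proof (intro conjI ballI allI exI[of _ C])
  fix f g c assume f: "f \<in> gradients"
  note sf = W10_pair_imp_W10[OF S[OF f]]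
  have "W10_pair (c *R S f) (%x. c *R f x)" unfolding scaleR_fun_eq real_scaleR_def by (intro W10_pair_scale S f)
  from F'[OF this] show "F' (%x. c *R f x) = c * F' f" using dual_spaceD(2)[OF F sf(1)] by (simp add: F'_def)
  have "W10_norm p \<Omega> (S f) = Ip p M f powr (1 / p)"
   unfolding W10_norm_eq using Ip_wg_cong[OF sf(1), of f] sf(2) by (simp add: eq_commute)
  then show "\<bar>F' f\<bar> <= C * Ip p M f powr (1 / p)" using C[OF sf(1)] by (simp add: F'_def)
  assume g: "g \<in> gradients"
  note sg = W10_pair_imp_W10[OF S[OF g]]
  have "W10_pair (S f + S g) (%x. f x + g x)" unfolding plus_fun_eq by (intro W10_pair_add S f g)
  from F'[OF this] show "F' (%x. f x + g x) = F' f + F' g" using dual_spaceD(1)[OF F sf(1) sg(1)] by (simp add: F'_def)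
 qed
 from Lp_riesz[OF p1 Lp_subspace_gradients this]
 obtain g where g: "g \<in> gradients" "\<And>w. w \<in> gradients ==> F' w = (LINT x|M. duality p (g x) \<bullet> w x)" by blast
 show ?thesis
 proof (intro bexI[of _ "%x. duality p (g x)"] ballI)
  show "(%x. duality p (g x)) \<in> LpM (p / (p - 1)) M"
   by (rule duality_Lq(1)[OF p1 refl Lp_subspaceD(1)[OF Lp_subspace_gradients g(1)]])
  fix u assume u: "u \<in> W10 p \<Omega>"
  then have "wg u \<in> gradients" using W10_pair_wg unfolding gradients_def by blast
  then show "F u = (LINT x|M. duality p (g x) \<bullet> wg u x)" using g(2) F'[OF W10_pair_wg[OF u]] by simp
 qed
qed

text \<open>
 The functional is pairing with some function of \<open>L\<^sup>p\<close>, and separation shows that this function is a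
 gradient. This is the reflexivity of \<open>W10 p \<Omega>\<close>.
\<close>

lemma Lq_functional_repr_gradient:
 assumes \<Psi>: "Lp_functional (p / (p - 1)) M (LpM (p / (p - 1)) M) \<Psi>"
  and ann: "\<And>G. G \<in> LpM (p / (p - 1)) M ==> (\<And>u. u \<in> W10 p \<Omega> ==> (LINT x|M. G x \<bullet> wg u x) = 0) ==> \<Psi> G = 0"
 shows "\<exists>u\<in>W10 p \<Omega>. \<forall>G\<in>LpM (p / (p - 1)) M. \<Psi> G = (LINT x|M. G x \<bullet> wg u x)"
proof -
 define q where "q = p / (p - 1)"
 have q: "1 < q" "p = q / (q - 1)" unfolding q_def using p1 by (simp_all add: field_simps)
 from Lp_riesz[OF q(1) Lp_subspace_UNIV[OF finite_M less_imp_le[OF q(1)]] \<Psi>[folded q_def]]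
 obtain g where g: "g \<in> LpM q M" "\<And>G. G \<in> LpM q M ==> \<Psi> G = (LINT x|M. duality q (g x) \<bullet> G x)" by blast
 define h where "h = (%x. duality q (g x))"
 have h: "h \<in> LpM p M" unfolding h_def by (rule duality_Lq(1)[OF q g(1)])
 have \<Psi>h: "\<Psi> G = (LINT x|M. G x \<bullet> h x)" if "G \<in> LpM q M" for G using g(2)[OF that] by (simp add: h_def inner_commute)
 have "\<exists>v\<in>gradients. AE x in M. h x = v x"
 proof (rule Lp_separation[OF p1 q_def Lp_subspace_gradients h])
  fix G assume G: "G \<in> LpM q M" and z: "\<And>w. w \<in> gradients ==> (LINT x|M. G x \<bullet> w x) = 0"
  have "\<Psi> G = 0"
   by (rule ann[OF G[unfolded q_def]]) (use z W10_pair_wg in \<open>auto simp: gradients_def\<close>)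
  then show "(LINT x|M. G x \<bullet> h x) = 0" using \<Psi>h[OF G] by simp
 qed
 then obtain v u where v: "AE x in M. h x = v x" "W10_pair u v" unfolding gradients_def by blast
 have u: "u \<in> W10 p \<Omega>" "AE x in M. h x = wg u x"
  using W10_pair_imp_W10[OF v(2)] v(1) by (auto elim!: eventually_elim2[of _ _ _ "%x. h x = wg u x"])
 have "\<Psi> G = (LINT x|M. G x \<bullet> wg u x)" if G: "G \<in> LpM q M" for G
  unfolding \<Psi>h[OF G]
 proof (rule integral_cong_AE)
  show "(%x. G x \<bullet> h x) \<in> borel_measurable M" "(%x. G x \<bullet> wg u x) \<in> borel_measurable M"
   using LpM_measurable[OF G] LpM_measurable[OF h] LpM_measurable[OF wg_LpM[OF u(1)]] by auto
  show "AE x in M. G x \<bullet> h x = G x \<bullet> wg u x" using u(2) by eventually_elim simp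
 qed
 then show ?thesis using u(1) unfolding q_def by blast
qed

lemma W10_weak_compact:
 assumes u: "\<And>n::nat. u n \<in> W10 p \<Omega>" and B: "\<And>n. Ip p M (wg (u n)) <= B"
 obtains r v where "strict_mono (r :: nat => nat)" "v \<in> W10 p \<Omega>"
  "\<And>G. G \<in> LpM (p / (p - 1)) M ==> (%n. LINT x|M. G x \<bullet> wg (u (r n)) x) ----> (LINT x|M. G x \<bullet> wg v x)"
proof -
 have g: "wg (u n) \<in> gradients" for n using W10_pair_wg[OF u] unfolding gradients_def by blast
 obtain r w where r: "strict_mono (r :: nat => nat)" and w: "w \<in> gradients"
  and lim: "\<And>G. G \<in> LpM (p / (p - 1)) M ==> (%n. LINT x|M. G x \<bullet> wg (u (r n)) x) ----> (LINT x|M. G x \<bullet> w x)"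
  by (rule Lp_weak_compact[where f = "%n. wg (u n)", OF Lp_subspace_gradients g B]) (rule that)
 obtain v where v: "W10_pair v w" using w unfolding gradients_def by blast
 have eq: "(LINT x|M. G x \<bullet> w x) = (LINT x|M. G x \<bullet> wg v x)" if G: "G \<in> LpM (p / (p - 1)) M" for G
 proof (rule integral_cong_AE)
  show "(%x. G x \<bullet> w x) \<in> borel_measurable M" "(%x. G x \<bullet> wg v x) \<in> borel_measurable M"
   using LpM_measurable[OF G] LpM_measurable[OF W10_pairD(2)[OF v]] LpM_measurable[OF wg_LpM[OF W10_pair_imp_W10(1)[OF v]]] by auto
  show "AE x in M. G x \<bullet> w x = G x \<bullet> wg v x" using W10_pair_imp_W10(2)[OF v] by eventually_elim simp
 qed
 show ?thesis by (rule that[OF r W10_pair_imp_W10(1)[OF v]]) (use lim eq in simp)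
qed

lemma W10_Rellich:
 assumes u: "\<And>n::nat. u n \<in> W10 p \<Omega>" "v \<in> W10 p \<Omega>" and B: "\<And>n. Ip p M (wg (u n)) <= B"
  and weak: "\<And>G. G \<in> LpM (p / (p - 1)) M ==> (%n. LINT x|M. G x \<bullet> wg (u n) x) ----> (LINT x|M. G x \<bullet> wg v x)"
 shows "(%n. LINT x|M. \<bar>u n x - v x\<bar>) ----> 0"
  and "1 <= r ==> r < ps ==> (%n. Ip r M (%x. u n x - v x)) ----> 0"
proof -
 have P: "W10_pair (%x. u n x - v x) (%x. wg (u n) x - wg v x)" for n
  using W10_pair_add[OF W10_pair_wg[OF u(1)] W10_pair_scale[OF W10_pair_wg[OF u(2)], of "-1"]] by simp
 define B' where "B' = 2 powr p * (B + Ip p M (wg v))"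
 have B': "Ip p M (%x. wg (u n) x - wg v x) <= B'" for n
 proof -
  have "Ip p M (%x. wg (u n) x - wg v x) <= 2 powr p * (Ip p M (wg (u n)) + Ip p M (wg v))"
   by (intro Ip_diff_le p0 wg_LpM u)
  also have "\<dots> <= B'" unfolding B'_def using B by (intro mult_left_mono) auto
  finally show ?thesis .
 qed
 have w: "(%n. LINT x|M. G x \<bullet> (wg (u n) x - wg v x)) ----> 0" if G: "G \<in> LpM (p / (p - 1)) M" for G
 proof -
  have "(LINT x|M. G x \<bullet> (wg (u n) x - wg v x)) = (LINT x|M. G x \<bullet> wg (u n) x) - (LINT x|M. G x \<bullet> wg v x)" for n
   unfolding inner_diff_right by (intro Bochner_Integration.integral_diff Holder_inner(1)[OF p1 refl wg_LpM G] u)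
  then show ?thesis using LIM_zero[OF weak[OF G]] by simp
 qed
 show 1: "(%n. LINT x|M. \<bar>u n x - v x\<bar>) ----> 0" by (rule Rellich[OF P B' w])
 show "1 <= r ==> r < ps ==> (%n. Ip r M (%x. u n x - v x)) ----> 0"
  by (rule subcritical_interpolation[OF P B' 1])
qed

text \<open>
 Test functions are dense, and a countable set of them is dense for uniform convergence of gradients.
\<close>

lemma W10_separable:
 obtains d where "\<And>k::nat. d k \<in> W10 p \<Omega>" "\<And>u e. u \<in> W10 p \<Omega> ==> 0 < e ==> \<exists>k. W10_norm p \<Omega> (u - d k) < e"
proof -
 obtain c where c: "\<And>k. test_function \<Omega> (c k)"
  "\<And>\<phi> e. test_function \<Omega> \<phi> ==> 0 < e ==> \<exists>k::nat. \<forall>x\<in>\<Omega>. \<bar>\<phi> x - c k x\<bar> < e \<and> norm (grad \<phi> x - grad (c k) x) < e"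
  by (rule test_functions_separable) (rule that)
 note ck = W10_pair_imp_W10[OF test_W10_pair[OF c(1)]]
 define m where "m = measure M (space M) + 1"
 have m: "0 < m" by (simp add: m_def add_nonneg_pos)
 show ?thesis
 proof (rule that[of c, OF ck(1)])
  fix u and e :: real assume u: "u \<in> W10 p \<Omega>" and e: "0 < e"
  define b where "b = e powr p / (2 * 2 powr p)"
  have b: "0 < b" using e by (simp add: b_def)
  define \<delta> where "\<delta> = (b / m) powr (1 / p)"
  have \<delta>: "0 < \<delta>" "\<delta> powr p = b / m" using b m p0 by (auto simp: \<delta>_def powr_powr)
  obtain \<phi> where \<phi>: "test_function \<Omega> \<phi>" "Ip p M (%x. grad \<phi> x - wg u x) < b"
   using W10_pairD(3)[OF W10_pair_wg[OF u] b] by blast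
  obtain k where k: "\<And>x. x \<in> \<Omega> ==> norm (grad \<phi> x - grad (c k) x) < \<delta>" using c(2)[OF \<phi>(1) \<delta>(1)] by blast
  note L = test_LpM(2)[OF \<phi>(1) p0(1)] test_LpM(2)[OF c(1) p0(1)]
  note const = finite_measure.integrable_const[OF finite_M]
  have "Ip p M (%x. grad \<phi> x - grad (c k) x) <= (LINT x|M. b / m)"
   unfolding Ip_def
  proof (rule integral_mono[OF LpM_integrable[OF LpM_diff(1)[OF p0(1) L]] const])
   fix x assume "x \<in> space M"
   then have "norm (grad \<phi> x - grad (c k) x) powr p <= \<delta> powr p" using k[of x] p0 by (intro powr_mono2) auto
   then show "norm (grad \<phi> x - grad (c k) x) powr p <= b / m" by (simp add: \<delta>)
  qed
  also have "\<dots> <= b" using b m by (simp add: m_def field_simps)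
  finally have 1: "Ip p M (%x. grad \<phi> x - grad (c k) x) <= b" .
  have "AE x in M. wg (u - c k) x = wg u x - grad (c k) x"
   using W10_diff(2)[OF u ck(1)[of k]] ck(2)[of k] by eventually_elim simp
  from Ip_wg_cong[OF W10_diff(1)[OF u ck(1)] this]
  have "Ip p M (wg (u - c k)) = Ip p M (%x. wg u x - grad (c k) x)" .
  also have "\<dots> <= 2 powr p * (Ip p M (%x. wg u x - grad \<phi> x) + Ip p M (%x. grad \<phi> x - grad (c k) x))"
   by (rule Ip_triangle[OF p0(1) wg_LpM[OF u] L])
  also have "\<dots> < 2 powr p * (b + b)"
   using 1 \<phi>(2) Ip_diff_commute[of p M "grad \<phi>" "wg u"] by (intro mult_strict_left_mono add_less_le_mono) auto
  also have "\<dots> = e powr p" by (simp add: b_def)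
  finally have "Ip p M (wg (u - c k)) powr (1 / p) < (e powr p) powr (1 / p)" using p0 by (intro powr_less_mono2) auto
  then show "\<exists>k. W10_norm p \<Omega> (u - c k) < e" unfolding W10_norm_eq using e p0 by (auto simp: powr_powr)
 qed
qed

end

section \<open>The product space X\<close>

locale sobolev_pair = D1: sobolev_domain \<Omega> p1 + D2: sobolev_domain \<Omega> p2
 for \<Omega> :: "'a::euclidean_space set" and p1 p2 :: real
begin

abbreviation "M \<equiv> lebesgue_on \<Omega>"
abbreviation "wg \<equiv> weak_gradient \<Omega>"
abbreviation "X \<equiv> X_space \<Omega> p1 p2"
abbreviation "N \<equiv> X_norm \<Omega> p1 p2"
abbreviation "pc1 \<equiv> p1 / (p1 - 1)"
abbreviation "pc2 \<equiv> p2 / (p2 - 1)"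

lemma X_iff: "(u, v) \<in> X \<longleftrightarrow> u \<in> W10 p1 \<Omega> \<and> v \<in> W10 p2 \<Omega>" by (simp add: X_space_def)

lemma N_eq: "N (u, v) = W10_norm p1 \<Omega> u + W10_norm p2 \<Omega> v" by (simp add: X_norm_def)

lemma subspace_X: "subspace X"
 unfolding subspace_def X_space_def using D1.subspace_W10 D2.subspace_W10
 by (auto simp: subspace_def zero_prod_def)

lemma quasi_seminorm_X: "quasi_seminorm_on X N"
 unfolding quasi_seminorm_on_def
proof (intro conjI ballI allI exI[of _ 4] subspace_X)
 fix x y a assume x: "x \<in> X"
 obtain u v where uv: "x = (u, v)" by (cases x)
 have uvW: "u \<in> W10 p1 \<Omega>" "v \<in> W10 p2 \<Omega>" using x uv by (auto simp: X_iff)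
 show "0 <= N x" using D1.W10_norm_nonneg D2.W10_norm_nonneg by (simp add: uv N_eq)
 show "N (a *R x) = \<bar>a\<bar> * N x" using uvW by (simp add: uv N_eq D1.W10_norm_scale D2.W10_norm_scale distrib_left)
 assume y: "y \<in> X"
 obtain u' v' where uv': "y = (u', v')" by (cases y)
 have "u' \<in> W10 p1 \<Omega>" "v' \<in> W10 p2 \<Omega>" using y uv' by (auto simp: X_iff)
 then show "N (x + y) <= 4 * (N x + N y)"
  using D1.W10_norm_add[OF uvW(1)] D2.W10_norm_add[OF uvW(2)] by (fastforce simp: uv uv' N_eq)
qed

definition grad_functional :: "('a => 'a) => ('a => 'a) => ('a => real) \<times> ('a => real) => real" where
 "grad_functional G1 G2 = (%(u, v). (LINT x|M. G1 x \<bullet> wg u x) + (LINT x|M. G2 x \<bullet> wg v x))"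

lemma grad_functional_bound:
 assumes G: "G1 \<in> LpM pc1 M" "G2 \<in> LpM pc2 M" and x: "x \<in> X"
 shows "\<bar>grad_functional G1 G2 x\<bar> <= (Ip pc1 M G1 powr (1 / pc1) + Ip pc2 M G2 powr (1 / pc2)) * N x"
proof -
 obtain u v where uv: "x = (u, v)" "u \<in> W10 p1 \<Omega>" "v \<in> W10 p2 \<Omega>" using x by (cases x) (auto simp: X_iff)
 have "\<bar>LINT x|M. G1 x \<bullet> wg u x\<bar> <= Ip pc1 M G1 powr (1 / pc1) * W10_norm p1 \<Omega> u"
  unfolding D1.W10_norm_eq by (rule Holder_inner(2)[OF D1.p1 refl D1.wg_LpM[OF uv(2)] G(1)])
 moreover have "\<bar>LINT x|M. G2 x \<bullet> wg v x\<bar> <= Ip pc2 M G2 powr (1 / pc2) * W10_norm p2 \<Omega> v"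
  unfolding D2.W10_norm_eq by (rule Holder_inner(2)[OF D2.p1 refl D2.wg_LpM[OF uv(3)] G(2)])
 moreover have "0 <= Ip pc1 M G1 powr (1 / pc1) * W10_norm p2 \<Omega> v" "0 <= Ip pc2 M G2 powr (1 / pc2) * W10_norm p1 \<Omega> u"
  using D1.W10_norm_nonneg D2.W10_norm_nonneg by (auto intro!: mult_nonneg_nonneg)
 ultimately show ?thesis unfolding grad_functional_def uv(1) N_eq prod.case distrib_left distrib_right
  by linarith
qed

lemma integral_wg_add:
 assumes "sobolev_domain \<Omega> p" "u \<in> W10 p \<Omega>" "v \<in> W10 p \<Omega>" "G \<in> LpM (p / (p - 1)) M"
 shows "(LINT x|M. G x \<bullet> wg (u + v) x) = (LINT x|M. G x \<bullet> wg u x) + (LINT x|M. G x \<bullet> wg v x)"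
proof -
 interpret D: sobolev_domain \<Omega> p by fact
 note L = D.wg_LpM[OF assms(2)] D.wg_LpM[OF assms(3)] D.wg_LpM[OF D.W10_add(1)[OF assms(2,3)]]
 have "(LINT x|M. G x \<bullet> wg (u + v) x) = (LINT x|M. G x \<bullet> wg u x + G x \<bullet> wg v x)"
 proof (rule integral_cong_AE)
  show "AE x in M. G x \<bullet> wg (u + v) x = G x \<bullet> wg u x + G x \<bullet> wg v x"
   using D.W10_add(2)[OF assms(2,3)] by eventually_elim (simp add: inner_add_right)
 qed (use LpM_measurable[OF assms(4)] LpM_measurable[OF L(1)] LpM_measurable[OF L(2)] LpM_measurable[OF L(3)] in auto)
 also have "\<dots> = (LINT x|M. G x \<bullet> wg u x) + (LINT x|M. G x \<bullet> wg v x)"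
  by (intro Bochner_Integration.integral_add Holder_inner(1)[OF D.p1 refl _ assms(4)] L)
 finally show ?thesis .
qed

lemma integral_wg_scale:
 assumes "sobolev_domain \<Omega> p" "u \<in> W10 p \<Omega>" "G \<in> LpM (p / (p - 1)) M"
 shows "(LINT x|M. G x \<bullet> wg (c *R u) x) = c * (LINT x|M. G x \<bullet> wg u x)"
proof -
 interpret D: sobolev_domain \<Omega> p by fact
 note L = D.wg_LpM[OF assms(2)] D.wg_LpM[OF D.W10_scale(1)[OF assms(2)]]
 have "(LINT x|M. G x \<bullet> wg (c *R u) x) = (LINT x|M. c * (G x \<bullet> wg u x))"
 proof (rule integral_cong_AE)
  show "AE x in M. G x \<bullet> wg (c *R u) x = c * (G x \<bullet> wg u x)"
   using D.W10_scale(2)[OF assms(2), of c] by eventually_elim simp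
 qed (use LpM_measurable[OF assms(3)] LpM_measurable[OF L(1)] LpM_measurable[OF L(2)] in auto)
 then show ?thesis by simp
qed

lemma grad_functional_dual:
 assumes G: "G1 \<in> LpM pc1 M" "G2 \<in> LpM pc2 M"
 shows "grad_functional G1 G2 \<in> dual_space X N"
 unfolding dual_space_def
proof (intro CollectI conjI ballI allI exI)
 fix x y c assume x: "x \<in> X"
 obtain u v where uv: "x = (u, v)" "u \<in> W10 p1 \<Omega>" "v \<in> W10 p2 \<Omega>" using x by (cases x) (auto simp: X_iff)
 show "\<bar>grad_functional G1 G2 x\<bar> <= (Ip pc1 M G1 powr (1 / pc1) + Ip pc2 M G2 powr (1 / pc2)) * N x"
  by (rule grad_functional_bound[OF G x])
 show "grad_functional G1 G2 (c *R x) = c * grad_functional G1 G2 x"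
  using integral_wg_scale[OF D1.sobolev_domain_axioms uv(2) G(1)] integral_wg_scale[OF D2.sobolev_domain_axioms uv(3) G(2)]
  by (simp add: grad_functional_def uv(1) distrib_left)
 assume y: "y \<in> X"
 obtain u' v' where uv': "y = (u', v')" "u' \<in> W10 p1 \<Omega>" "v' \<in> W10 p2 \<Omega>" using y by (cases y) (auto simp: X_iff)
 show "grad_functional G1 G2 (x + y) = grad_functional G1 G2 x + grad_functional G1 G2 y"
  using integral_wg_add[OF D1.sobolev_domain_axioms uv(2) uv'(2) G(1)] integral_wg_add[OF D2.sobolev_domain_axioms uv(3) uv'(3) G(2)]
  by (simp add: grad_functional_def uv(1) uv'(1))
qed

lemma dual_space_X_repr:
 assumes F: "F \<in> dual_space X N"
 obtains G1 G2 where "G1 \<in> LpM pc1 M" "G2 \<in> LpM pc2 M" "\<And>x. x \<in> X ==> F x = grad_functional G1 G2 x"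
proof -
 obtain C where C: "\<And>x. x \<in> X ==> \<bar>F x\<bar> <= C * N x" using dual_spaceD(3)[OF F] by blast
 have X0: "(u, 0) \<in> X" if "u \<in> W10 p1 \<Omega>" for u using that D2.W10_zero(1) by (simp add: X_iff)
 have X1: "(0, v) \<in> X" if "v \<in> W10 p2 \<Omega>" for v using that D1.W10_zero(1) by (simp add: X_iff)
 have F1: "(%u. F (u, 0)) \<in> dual_space (W10 p1 \<Omega>) (W10_norm p1 \<Omega>)"
  unfolding dual_space_def
 proof (intro CollectI conjI ballI allI exI[of _ C])
  fix u u' c assume u: "u \<in> W10 p1 \<Omega>"
  show "\<bar>F (u, 0)\<bar> <= C * W10_norm p1 \<Omega> u" using C[OF X0[OF u]] by (simp add: N_eq D2.W10_norm_zero)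
  show "F (c *R u, 0) = c * F (u, 0)" using dual_spaceD(2)[OF F X0[OF u], of c] by simp
  assume u': "u' \<in> W10 p1 \<Omega>"
  show "F (u + u', 0) = F (u, 0) + F (u', 0)" using dual_spaceD(1)[OF F X0[OF u] X0[OF u']] by simp
 qed
 have F2: "(%v. F (0, v)) \<in> dual_space (W10 p2 \<Omega>) (W10_norm p2 \<Omega>)"
  unfolding dual_space_def
 proof (intro CollectI conjI ballI allI exI[of _ C])
  fix v v' c assume v: "v \<in> W10 p2 \<Omega>"
  show "\<bar>F (0, v)\<bar> <= C * W10_norm p2 \<Omega> v" using C[OF X1[OF v]] by (simp add: N_eq D1.W10_norm_zero)
  show "F (0, c *R v) = c * F (0, v)" using dual_spaceD(2)[OF F X1[OF v], of c] by simp
  assume v': "v' \<in> W10 p2 \<Omega>"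
  show "F (0, v + v') = F (0, v) + F (0, v')" using dual_spaceD(1)[OF F X1[OF v] X1[OF v']] by simp
 qed
 obtain G1 where G1: "G1 \<in> LpM pc1 M" "\<And>u. u \<in> W10 p1 \<Omega> ==> F (u, 0) = (LINT x|M. G1 x \<bullet> wg u x)"
  using D1.W10_functional_repr[OF F1] by blast
 obtain G2 where G2: "G2 \<in> LpM pc2 M" "\<And>v. v \<in> W10 p2 \<Omega> ==> F (0, v) = (LINT x|M. G2 x \<bullet> wg v x)"
  using D2.W10_functional_repr[OF F2] by blast
 show ?thesis
 proof (rule that[OF G1(1) G2(1)])
  fix x assume x: "x \<in> X"
  obtain u v where uv: "x = (u, v)" "u \<in> W10 p1 \<Omega>" "v \<in> W10 p2 \<Omega>" using x by (cases x) (auto simp: X_iff)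
  have "F x = F (u, 0) + F (0, v)" using dual_spaceD(1)[OF F X0[OF uv(2)] X1[OF uv(3)]] by (simp add: uv(1))
  then show "F x = grad_functional G1 G2 x" using G1(2)[OF uv(2)] G2(2)[OF uv(3)] by (simp add: grad_functional_def uv(1))
 qed
qed

lemma weakly_converges_X:
 assumes w: "\<And>n. (u n, v n) \<in> X" and z: "(u0, v0) \<in> X"
  and l1: "\<And>G. G \<in> LpM pc1 M ==> (%n. LINT x|M. G x \<bullet> wg (u n) x) ----> (LINT x|M. G x \<bullet> wg u0 x)"
  and l2: "\<And>G. G \<in> LpM pc2 M ==> (%n. LINT x|M. G x \<bullet> wg (v n) x) ----> (LINT x|M. G x \<bullet> wg v0 x)"
 shows "weakly_converges X N (%n. (u n, v n)) (u0, v0)"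
 unfolding weakly_converges_def
proof (intro conjI allI ballI w z)
 fix F assume "F \<in> dual_space X N"
 then obtain G1 G2 where G: "G1 \<in> LpM pc1 M" "G2 \<in> LpM pc2 M" "\<And>x. x \<in> X ==> F x = grad_functional G1 G2 x"
  by (rule dual_space_X_repr) (rule that)
 have "(%n. grad_functional G1 G2 (u n, v n)) ----> grad_functional G1 G2 (u0, v0)"
  unfolding grad_functional_def prod.case by (intro tendsto_add l1 l2 G)
 then show "(%n. F (u n, v n)) ----> F (u0, v0)" using G(3) w z by simp
qed

lemma dual_norm_le:
 assumes "\<And>x. x \<in> X ==> \<bar>F x\<bar> <= C * N x" "0 <= C" shows "dual_norm X N F <= C"
 unfolding dual_norm_def
proof (rule cSUP_least)
 have "0 \<in> X" by (rule subspace_0[OF subspace_X])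
 moreover have "N 0 = 0" using D1.W10_norm_zero D2.W10_norm_zero by (simp add: zero_prod_def N_eq)
 ultimately have "0 \<in> {x \<in> X. N x <= 1}" by simp
 then show "{x \<in> X. N x <= 1} \<noteq> {}" by blast
 fix x assume x: "x \<in> {x \<in> X. N x <= 1}"
 then have "\<bar>F x\<bar> <= C * N x" using assms(1) by blast
 also have "\<dots> <= C * 1" using x assms(2) by (intro mult_left_mono) auto
 finally show "\<bar>F x\<bar> <= C" by simp
qed

lemma dual_norm_nonneg:
 assumes "F \<in> dual_space X N" shows "0 <= dual_norm X N F"
proof -
 obtain C0 where C0: "\<And>x. x \<in> X ==> \<bar>F x\<bar> <= C0 * N x" using dual_spaceD(3)[OF assms] by blast
 have N0: "0 <= N x" if "x \<in> X" for x using quasi_seminorm_X that by (simp add: quasi_seminorm_on_def)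
 have x0: "0 \<in> X" by (rule subspace_0[OF subspace_X])
 have n0: "N 0 = 0" using D1.W10_norm_zero D2.W10_norm_zero by (simp add: zero_prod_def N_eq)
 have "bdd_above ((%x. \<bar>F x\<bar>) ` {x \<in> X. N x <= 1})"
 proof (rule bdd_aboveI2)
  fix x assume x: "x \<in> {x \<in> X. N x <= 1}"
  then have "\<bar>F x\<bar> <= C0 * N x" using C0 by blast
  also have "\<dots> <= \<bar>C0\<bar> * N x" using x N0 by (intro mult_right_mono) auto
  also have "\<dots> <= \<bar>C0\<bar> * 1" using x by (intro mult_left_mono) auto
  finally show "\<bar>F x\<bar> <= \<bar>C0\<bar>" by simp
 qed
 then have "\<bar>F 0\<bar> <= dual_norm X N F" unfolding dual_norm_def using x0 n0 by (intro cSUP_upper) auto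
 then show ?thesis by linarith
qed

text \<open>
 A functional on the dual of \<open>X\<close> restricts to functionals of the two fields that represent elements of the
 dual. Each restriction is pairing with a gradient, and the two potentials form the point \<open>h\<close>.
\<close>

lemma bidual_evaluation:
 assumes \<Phi>: "\<Phi> \<in> dual_space (dual_space X N) (dual_norm X N)"
 obtains h where "h \<in> X" "\<And>F. F \<in> dual_space X N ==> \<Phi> F = F h"
proof -
 obtain C0 where C0: "\<And>F. F \<in> dual_space X N ==> \<bar>\<Phi> F\<bar> <= C0 * dual_norm X N F" using dual_spaceD(3)[OF \<Phi>] by blast
 define C where "C = \<bar>C0\<bar>"
 have C: "0 <= C" "\<And>F. F \<in> dual_space X N ==> \<bar>\<Phi> F\<bar> <= C * dual_norm X N F"
 proof -
  fix F assume F: "F \<in> dual_space X N"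
  show "\<bar>\<Phi> F\<bar> <= C * dual_norm X N F" unfolding C_def
   by (rule order_trans[OF C0[OF F] mult_right_mono]) (use dual_norm_nonneg[OF F] in auto)
 qed (simp add: C_def)
 have cong: "\<Phi> F = \<Phi> F'" if F: "F \<in> dual_space X N" "F' \<in> dual_space X N" and eq: "\<And>x. x \<in> X ==> F x = F' x" for F F'
 proof -
  define D where "D = F - F'"
  have D0: "D x = 0" if "x \<in> X" for x using eq[OF that] by (simp add: D_def)
  have DD: "D \<in> dual_space X N"
   unfolding dual_space_def using subspace_X D0
   by (auto simp: subspace_add subspace_mul intro!: exI[of _ 0])
  have "dual_norm X N D <= 0" by (rule dual_norm_le) (simp_all add: D0)
  then have "C * dual_norm X N D <= 0" using C(1) by (intro mult_nonneg_nonpos) auto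
  then have "\<Phi> D = 0" using C(2)[OF DD] by linarith
  moreover have "F = F' + D" by (simp add: D_def)
  ultimately show ?thesis using dual_spaceD(1)[OF \<Phi> that(2) DD] by simp
 qed
 have z1: "(%_. 0) \<in> LpM pc1 M" and z2: "(%_. 0) \<in> LpM pc2 M" by auto
 have q1: "0 <= pc1" "0 <= pc2" using D1.p1 D2.p1 by auto
 have \<Phi>0: "\<Phi> F = 0" if "F \<in> dual_space X N" "\<And>x. x \<in> X ==> F x = 0" for F
 proof -
  have "\<Phi> F = \<Phi> (0 *R F)"
  proof (rule cong[OF that(1)])
   show "0 *R F \<in> dual_space X N" unfolding dual_space_def by (auto intro!: exI[of _ 0] simp: scaleR_fun_def)
   show "F x = (0 *R F) x" if "x \<in> X" for x using \<open>\<And>x. x \<in> X ==> F x = 0\<close>[OF that] by (simp add: scaleR_fun_def)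
  qed
  also have "\<dots> = 0" using dual_spaceD(2)[OF \<Phi> that(1), of 0] by simp
  finally show ?thesis .
 qed
 have add1: "grad_functional (%x. G x + G' x) H x = grad_functional G H x + grad_functional G' (%_. 0) x"
  if "G \<in> LpM pc1 M" "G' \<in> LpM pc1 M" "x \<in> X" for G G' H x
  using that D1.wg_LpM Holder_inner(1)[OF D1.p1 refl _ that(1)] Holder_inner(1)[OF D1.p1 refl _ that(2)]
  by (cases x) (simp add: grad_functional_def inner_add_left X_iff)
 have add2: "grad_functional H (%x. G x + G' x) x = grad_functional H G x + grad_functional (%_. 0) G' x"
  if "G \<in> LpM pc2 M" "G' \<in> LpM pc2 M" "x \<in> X" for G G' H x
  using that D2.wg_LpM Holder_inner(1)[OF D2.p1 refl _ that(1)] Holder_inner(1)[OF D2.p1 refl _ that(2)]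
  by (cases x) (simp add: grad_functional_def inner_add_left X_iff)
 define \<Psi>1 where "\<Psi>1 G = \<Phi> (grad_functional G (%_. 0))" for G
 define \<Psi>2 where "\<Psi>2 G = \<Phi> (grad_functional (%_. 0) G)" for G
 have pl: "\<Phi> F = \<Phi> F1 + \<Phi> F2" if "F \<in> dual_space X N" "F1 \<in> dual_space X N" "F2 \<in> dual_space X N" "F1 + F2 \<in> dual_space X N"
  "\<And>x. x \<in> X ==> F x = F1 x + F2 x" for F F1 F2
  using cong[OF that(1,4)] that(5) dual_spaceD(1)[OF \<Phi> that(2,3)] by simp
 have dadd: "F1 + F2 \<in> dual_space X N" if F: "F1 \<in> dual_space X N" "F2 \<in> dual_space X N" for F1 F2
 proof -
  obtain A B where AB: "\<And>x. x \<in> X ==> \<bar>F1 x\<bar> <= A * N x" "\<And>x. x \<in> X ==> \<bar>F2 x\<bar> <= B * N x"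
   using dual_spaceD(3)[OF F(1)] dual_spaceD(3)[OF F(2)] by blast
  show ?thesis unfolding dual_space_def
  proof (intro CollectI conjI ballI allI exI[of _ "A + B"])
   fix x y c assume x: "x \<in> X"
   show "\<bar>(F1 + F2) x\<bar> <= (A + B) * N x" using AB(1)[OF x] AB(2)[OF x] by (simp add: distrib_right)
   show "(F1 + F2) (c *R x) = c * (F1 + F2) x" using dual_spaceD(2)[OF F(1) x] dual_spaceD(2)[OF F(2) x] by (simp add: distrib_left)
   assume y: "y \<in> X"
   show "(F1 + F2) (x + y) = (F1 + F2) x + (F1 + F2) y" using dual_spaceD(1)[OF F(1) x y] dual_spaceD(1)[OF F(2) x y] by simp
  qed
 qed
 have sc: "\<Phi> F = c * \<Phi> F1" if F: "F \<in> dual_space X N" "F1 \<in> dual_space X N" "\<And>x. x \<in> X ==> F x = c * F1 x" for F F1 c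
 proof -
  have "c *R F1 \<in> dual_space X N" unfolding dual_space_def
  proof (intro CollectI conjI ballI allI)
   obtain A where A: "\<And>x. x \<in> X ==> \<bar>F1 x\<bar> <= A * N x" using dual_spaceD(3)[OF F(2)] by blast
   then show "\<exists>C. \<forall>x\<in>X. \<bar>(c *R F1) x\<bar> <= C * N x"
    by (intro exI[of _ "\<bar>c\<bar> * A"]) (simp add: scaleR_fun_def abs_mult mult_left_mono mult.assoc)
   fix x y d assume x: "x \<in> X"
   show "(c *R F1) (d *R x) = d * (c *R F1) x" using dual_spaceD(2)[OF F(2) x] by (simp add: scaleR_fun_def)
   assume y: "y \<in> X"
   show "(c *R F1) (x + y) = (c *R F1) x + (c *R F1) y" using dual_spaceD(1)[OF F(2) x y] by (simp add: scaleR_fun_def distrib_left)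
  qed
  from cong[OF F(1) this] show ?thesis using F(3) dual_spaceD(2)[OF \<Phi> F(2), of c] by (simp add: scaleR_fun_def)
 qed
 have L1: "Lp_functional pc1 M (LpM pc1 M) \<Psi>1"
  unfolding Lp_functional_def
 proof (intro conjI ballI allI exI[of _ C])
  fix G G' :: "'a => 'a" and c assume G: "G \<in> LpM pc1 M"
  note g = grad_functional_dual[OF G z2]
  show "\<Psi>1 (%x. c *R G x) = c * \<Psi>1 G" unfolding \<Psi>1_def
   by (rule sc[OF grad_functional_dual[OF LpM_scale(1)[OF G] z2] g]) (auto simp: grad_functional_def)
  have "dual_norm X N (grad_functional G (%_. 0)) <= Ip pc1 M G powr (1 / pc1)"
   using grad_functional_bound[OF G z2] by (intro dual_norm_le) auto
  then have "C * dual_norm X N (grad_functional G (%_. 0)) <= C * Ip pc1 M G powr (1 / pc1)" using C(1) by (intro mult_left_mono)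
  then show "\<bar>\<Psi>1 G\<bar> <= C * Ip pc1 M G powr (1 / pc1)" unfolding \<Psi>1_def using C(2)[OF g] by linarith
  assume G': "G' \<in> LpM pc1 M"
  note g' = grad_functional_dual[OF G' z2]
  show "\<Psi>1 (%x. G x + G' x) = \<Psi>1 G + \<Psi>1 G'" unfolding \<Psi>1_def
   by (rule pl[OF grad_functional_dual[OF LpM_add(1)[OF q1(1) G G'] z2] g g' dadd[OF g g']]) (rule add1[OF G G'])
 qed
 have L2: "Lp_functional pc2 M (LpM pc2 M) \<Psi>2"
  unfolding Lp_functional_def
 proof (intro conjI ballI allI exI[of _ C])
  fix G G' :: "'a => 'a" and c assume G: "G \<in> LpM pc2 M"
  note g = grad_functional_dual[OF z1 G]
  show "\<Psi>2 (%x. c *R G x) = c * \<Psi>2 G" unfolding \<Psi>2_def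
   by (rule sc[OF grad_functional_dual[OF z1 LpM_scale(1)[OF G]] g]) (auto simp: grad_functional_def)
  have "dual_norm X N (grad_functional (%_. 0) G) <= Ip pc2 M G powr (1 / pc2)"
   using grad_functional_bound[OF z1 G] by (intro dual_norm_le) auto
  then have "C * dual_norm X N (grad_functional (%_. 0) G) <= C * Ip pc2 M G powr (1 / pc2)" using C(1) by (intro mult_left_mono)
  then show "\<bar>\<Psi>2 G\<bar> <= C * Ip pc2 M G powr (1 / pc2)" unfolding \<Psi>2_def using C(2)[OF g] by linarith
  assume G': "G' \<in> LpM pc2 M"
  note g' = grad_functional_dual[OF z1 G']
  show "\<Psi>2 (%x. G x + G' x) = \<Psi>2 G + \<Psi>2 G'" unfolding \<Psi>2_def
   by (rule pl[OF grad_functional_dual[OF z1 LpM_add(1)[OF q1(2) G G']] g g' dadd[OF g g']]) (rule add2[OF G G'])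
 qed
 obtain u where u: "u \<in> W10 p1 \<Omega>" "\<And>G. G \<in> LpM pc1 M ==> \<Psi>1 G = (LINT x|M. G x \<bullet> wg u x)"
 proof -
  have "\<exists>u\<in>W10 p1 \<Omega>. \<forall>G\<in>LpM pc1 M. \<Psi>1 G = (LINT x|M. G x \<bullet> wg u x)"
  proof (rule D1.Lq_functional_repr_gradient[OF L1])
   fix G assume G: "G \<in> LpM pc1 M" and z: "\<And>u. u \<in> W10 p1 \<Omega> ==> (LINT x|M. G x \<bullet> wg u x) = 0"
   show "\<Psi>1 G = 0" unfolding \<Psi>1_def
    by (rule \<Phi>0[OF grad_functional_dual[OF G z2]]) (use z in \<open>auto simp: grad_functional_def X_iff\<close>)
  qed
  then show ?thesis using that by blast
 qed
 obtain v where v: "v \<in> W10 p2 \<Omega>" "\<And>G. G \<in> LpM pc2 M ==> \<Psi>2 G = (LINT x|M. G x \<bullet> wg v x)"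
 proof -
  have "\<exists>u\<in>W10 p2 \<Omega>. \<forall>G\<in>LpM pc2 M. \<Psi>2 G = (LINT x|M. G x \<bullet> wg u x)"
  proof (rule D2.Lq_functional_repr_gradient[OF L2])
   fix G assume G: "G \<in> LpM pc2 M" and z: "\<And>u. u \<in> W10 p2 \<Omega> ==> (LINT x|M. G x \<bullet> wg u x) = 0"
   show "\<Psi>2 G = 0" unfolding \<Psi>2_def
    by (rule \<Phi>0[OF grad_functional_dual[OF z1 G]]) (use z in \<open>auto simp: grad_functional_def X_iff\<close>)
  qed
  then show ?thesis using that by blast
 qed
 show ?thesis
 proof (rule that[of "(u, v)"])
  show "(u, v) \<in> X" using u v by (simp add: X_iff)
  fix F assume F: "F \<in> dual_space X N"
  obtain G1 G2 where G: "G1 \<in> LpM pc1 M" "G2 \<in> LpM pc2 M" "\<And>x. x \<in> X ==> F x = grad_functional G1 G2 x"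
   using F by (rule dual_space_X_repr) (rule that)
  have "\<Phi> F = \<Phi> (grad_functional G1 (%_. 0)) + \<Phi> (grad_functional (%_. 0) G2)"
   by (rule pl[OF F grad_functional_dual[OF G(1) z2] grad_functional_dual[OF z1 G(2)] dadd[OF grad_functional_dual[OF G(1) z2] grad_functional_dual[OF z1 G(2)]]])
    (use G(3) in \<open>auto simp: grad_functional_def\<close>)
  also have "\<dots> = F (u, v)"
   using u(2)[OF G(1)] v(2)[OF G(2)] G(3)[of "(u, v)"] u v by (simp add: \<Psi>1_def \<Psi>2_def grad_functional_def X_iff)
  finally show "\<Phi> F = F (u, v)" .
 qed
qed

lemma weakly_converges_dual_0:
 assumes "\<And>n::nat. A n \<in> dual_space X N" "\<And>h. h \<in> X ==> (%n. A n h) ----> 0"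
 shows "weakly_converges (dual_space X N) (dual_norm X N) A 0"
 unfolding weakly_converges_def
proof (intro conjI allI ballI assms(1))
 show z: "0 \<in> dual_space X N" unfolding dual_space_def by (auto intro!: exI[of _ 0])
 fix \<Phi> assume "\<Phi> \<in> dual_space (dual_space X N) (dual_norm X N)"
 then obtain h where h: "h \<in> X" "\<And>F. F \<in> dual_space X N ==> \<Phi> F = F h" by (rule bidual_evaluation) (rule that)
 show "(%n. \<Phi> (A n)) ----> \<Phi> 0" using assms(2)[OF h(1)] h(2)[OF assms(1)] h(2)[OF z] by simp
qed

end

section \<open>The principal part\<close>

lemma LpM_norm: "f \<in> LpM p M ==> (%x. norm (f x)) \<in> LpM p M" by (auto simp: LpM_def)

lemma Ip_norm: "Ip p M (%x. norm (f x)) = Ip p M f" by (simp add: Ip_def)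

lemma LpM_bounded_by:
 fixes f :: "'a => 'b::euclidean_space" and g :: "'a => 'c::euclidean_space"
 assumes "0 <= p" "f \<in> borel_measurable M" "g \<in> LpM p M" "AE x in M. norm (f x) <= norm (g x)"
 shows "f \<in> LpM p M" "Ip p M f <= Ip p M g"
proof -
 have ae: "AE x in M. norm (f x) powr p <= norm (g x) powr p"
  using assms(4) by eventually_elim (use assms(1) in \<open>simp add: powr_mono2\<close>)
 show f: "f \<in> LpM p M" by (rule LpM_dominated[OF assms(2) LpM_integrable[OF assms(3)] ae])
 show "Ip p M f <= Ip p M g" unfolding Ip_def
  by (rule integral_mono_AE[OF LpM_integrable[OF f] LpM_integrable[OF assms(3)] ae])
qed

lemma flux_eq: "flux p q \<mu> \<xi> = duality p \<xi> - \<mu> *R duality q \<xi>"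
 by (simp add: flux_def duality_def)

lemma continuous_flux:
 assumes "1 < p" "1 < q"
 shows "continuous_on UNIV (flux p q \<mu> :: 'b::euclidean_space => 'b)"
proof -
 have "continuous_on UNIV (%\<xi>::'b. duality p \<xi> - \<mu> *R duality q \<xi>)"
  using continuous_duality[OF assms(1)] continuous_duality[OF assms(2)]
  by (intro continuous_on_diff continuous_on_scaleR continuous_on_const)
 then show ?thesis by (simp add: flux_eq[abs_def])
qed

lemma norm_flux_le:
 assumes "1 < q" "q < p"
 shows "norm (flux p q \<mu> \<xi>) <= (1 + \<bar>\<mu>\<bar>) * norm \<xi> powr (p - 1) + \<bar>\<mu>\<bar>"
proof -
 have "norm \<xi> powr (q - 1) <= 1 + norm \<xi> powr (p - 1)"
 proof (cases "norm \<xi> <= 1")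
  case True
  then have "norm \<xi> powr (q - 1) <= 1" using assms by (intro powr_le1) auto
  then show ?thesis using powr_ge_zero[of "norm \<xi>" "p - 1"] by linarith
 next
  case False
  then have "norm \<xi> powr (q - 1) <= norm \<xi> powr (p - 1)" using assms by (intro powr_mono) auto
  then show ?thesis by simp
 qed
 then have "\<bar>\<mu>\<bar> * norm \<xi> powr (q - 1) <= \<bar>\<mu>\<bar> * (1 + norm \<xi> powr (p - 1))" by (intro mult_left_mono) auto
 moreover have "norm (flux p q \<mu> \<xi>) <= norm \<xi> powr (p - 1) + \<bar>\<mu>\<bar> * norm \<xi> powr (q - 1)"
  unfolding flux_eq using norm_triangle_ineq4[of "duality p \<xi>" "\<mu> *R duality q \<xi>"] assms by (simp add: norm_duality)
 ultimately show ?thesis by (simp add: distrib_left distrib_right)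
qed

lemma flux_inner_self: "1 < p ==> 1 < q ==> flux p q \<mu> \<xi> \<bullet> \<xi> = norm \<xi> powr p - \<mu> * norm \<xi> powr q"
 by (simp add: flux_eq inner_diff_left duality_inner_self)

text \<open>
 The lower power \<open>q\<close> is absorbed by the power \<open>p\<close>, for either sign of \<open>\<mu>\<close>.
\<close>

lemma flux_coercive:
 assumes "1 < q" "q < p" "0 < e"
 obtains K where "0 <= K" "\<And>\<xi>::'b::euclidean_space. (1 - e) * norm \<xi> powr p - K <= flux p q \<mu> \<xi> \<bullet> \<xi>"
proof -
 obtain K where K: "0 <= K" "\<And>t. 0 <= t ==> \<bar>\<mu>\<bar> * t <= e * t powr (p / q) + K"
  using linear_le_epsilon_powr[of "p / q" e "\<bar>\<mu>\<bar>"] assms by auto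
 have "(1 - e) * norm \<xi> powr p - K <= flux p q \<mu> \<xi> \<bullet> \<xi>" for \<xi> :: 'b
 proof -
  have "\<mu> * norm \<xi> powr q <= \<bar>\<mu>\<bar> * norm \<xi> powr q" by (intro mult_right_mono) auto
  also have "\<dots> <= e * (norm \<xi> powr q) powr (p / q) + K" by (rule K(2)) simp
  also have "(norm \<xi> powr q) powr (p / q) = norm \<xi> powr p" using assms by (simp add: powr_powr)
  finally show ?thesis using assms by (simp add: flux_inner_self left_diff_distrib)
 qed
 with K(1) show ?thesis by (rule that)
qed

context sobolev_domain begin

lemma flux_LpM:
 fixes g :: "'a => 'a"
 assumes q: "1 < q" "q < p" and g: "g \<in> LpM p M"
 shows "(%x. flux p q \<mu> (g x)) \<in> LpM (p / (p - 1)) M"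
  and "Ip (p / (p - 1)) M (%x. flux p q \<mu> (g x)) \<le>
   2 powr (p / (p - 1)) * ((1 + \<bar>\<mu>\<bar>) powr (p / (p - 1)) * Ip p M g + Ip (p / (p - 1)) M (%x. \<bar>\<mu>\<bar>))"
proof -
 define p' where "p' = p / (p - 1)"
 have p': "0 <= p'" using p1 by (simp add: p'_def)
 define a where "a = (%x. (1 + \<bar>\<mu>\<bar>) *R norm (duality p (g x)))"
 note d = duality_Lq[OF p1 p'_def g]
 have a: "a \<in> LpM p' M" unfolding a_def by (intro LpM_scale LpM_norm d)
 have Ia: "Ip p' M a = (1 + \<bar>\<mu>\<bar>) powr p' * Ip p M g"
  unfolding a_def Ip_scale[OF LpM_norm[OF d(1)]] Ip_norm d(2) by simp
 have c: "(%x. \<bar>\<mu>\<bar>) \<in> LpM p' M" using finite_M by (simp add: LpM_def finite_measure.integrable_const)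
 have m: "(%x. flux p q \<mu> (g x)) \<in> borel_measurable M"
  using borel_measurable_continuous_onI[OF continuous_flux[OF p1 q(1)]] LpM_measurable[OF g] by measurable
 have ae: "AE x in M. norm (flux p q \<mu> (g x)) <= norm (a x + \<bar>\<mu>\<bar>)"
  using norm_flux_le[OF q, of \<mu>] p1 by (auto simp: a_def norm_duality)
 note * = LpM_bounded_by[OF p' m LpM_add(1)[OF p' a c] ae]
 show "(%x. flux p q \<mu> (g x)) \<in> LpM (p / (p - 1)) M" using *(1) by (simp add: p'_def)
 from order_trans[OF *(2) Ip_add_le[OF p' a c]]
 show "Ip (p / (p - 1)) M (%x. flux p q \<mu> (g x)) \<le>
   2 powr (p / (p - 1)) * ((1 + \<bar>\<mu>\<bar>) powr (p / (p - 1)) * Ip p M g + Ip (p / (p - 1)) M (%x. \<bar>\<mu>\<bar>))"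
  unfolding Ia by (simp add: p'_def)
qed

lemma flux_tendsto:
 fixes g :: "nat => 'a => 'a"
 assumes q: "1 < q" "q < p" and g: "\<And>n. g n \<in> LpM p M" "g0 \<in> LpM p M" and B: "\<And>n. Ip p M (g n) <= B"
  and lim: "AE x in M. (%n. g n x) ----> g0 x" and h: "h \<in> LpM p M"
 shows "(%n. LINT x|M. flux p q \<mu> (g n x) \<bullet> h x) ----> (LINT x|M. flux p q \<mu> (g0 x) \<bullet> h x)"
proof -
 define p' where "p' = p / (p - 1)"
 have p': "1 < p'" "p = p' / (p' - 1)" unfolding p'_def using p1 by (simp_all add: field_simps)
 define a where "a k = (%x. (1 + \<bar>\<mu>\<bar>) *R norm (duality p (k x)))" for k :: "'a => 'a"
 have a: "a k \<in> LpM p' M" "Ip p' M (a k) = (1 + \<bar>\<mu>\<bar>) powr p' * Ip p M k" if "k \<in> LpM p M" for k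
 proof -
  note d = duality_Lq[OF p1 p'_def that]
  show "a k \<in> LpM p' M" unfolding a_def by (intro LpM_scale LpM_norm d)
  show "Ip p' M (a k) = (1 + \<bar>\<mu>\<bar>) powr p' * Ip p M k"
   unfolding a_def Ip_scale[OF LpM_norm[OF d(1)]] Ip_norm d(2) by simp
 qed
 have ae: "AE x in M. norm (flux p q \<mu> (k x)) <= \<bar>a k x\<bar> + \<bar>\<mu>\<bar>" for k :: "'a => 'a"
  using norm_flux_le[OF q, of \<mu>] p1 by (auto simp: a_def norm_duality)
 have m: "(%x. flux p q \<mu> (k x)) \<in> borel_measurable M" if "k \<in> LpM p M" for k :: "'a => 'a"
  by (rule LpM_measurable[OF flux_LpM(1)[OF q that]])
 show ?thesis
 proof (rule tendsto_integral_bounded_AE[OF p' m[OF g(1)] m[OF g(2)] a(1)[OF g(1)] a(1)[OF g(2)] _ h _ ae ae])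
  show "Ip p' M (a (g n)) <= (1 + \<bar>\<mu>\<bar>) powr p' * B" for n
   unfolding a(2)[OF g(1)] using B by (intro mult_left_mono) auto
  show "integrable M (%x. \<bar>\<mu>\<bar> * norm (h x))"
   using LpM_imp_integrable[OF finite_M p0(3) h] by simp
  show "AE x in M. (%n. flux p q \<mu> (g n x)) ----> flux p q \<mu> (g0 x)"
   using lim
  proof eventually_elim
   case (elim x)
   show ?case using continuous_on_tendsto_compose[OF continuous_flux[OF p1 q(1)] elim] by simp
  qed
 qed simp
qed

end

section \<open>The lower order terms\<close>

text \<open>
 Simple functions take finitely many values, so substituting them preserves measurability; continuity in the
 remaining arguments carries this to limits outside a null set.
\<close>

lemma caratheodory_measurable:
 fixes f :: "'a::euclidean_space nonlinearity"
 assumes \<Omega>: "\<Omega> \<in> sets lebesgue" and f: "caratheodory \<Omega> f"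
  and [measurable]: "u \<in> borel_measurable (lebesgue_on \<Omega>)" "v \<in> borel_measurable (lebesgue_on \<Omega>)"
   "g \<in> borel_measurable (lebesgue_on \<Omega>)" "h \<in> borel_measurable (lebesgue_on \<Omega>)"
 shows "(%x. f x (u x) (v x) (g x) (h x)) \<in> borel_measurable (lebesgue_on \<Omega>)"
proof -
 let ?M = "lebesgue_on \<Omega>"
 define F where "F y x = (case y of (s, t, \<xi>, \<nu>) => f x s t \<xi> \<nu>)" for y x
 define U where "U x = (u x, v x, g x, h x)" for x
 have "U \<in> borel_measurable ?M" unfolding U_def by measurable
 from borel_measurable_implies_sequence_metric[OF this, of "(0, 0, 0, 0)"]
 obtain S where S: "\<And>i. simple_function ?M (S i)" and lim: "\<And>x. x \<in> space ?M ==> (%i. S i x) ----> U x"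
  by blast
 have SF: "(%x. F (S i x) x) \<in> borel_measurable ?M" for i
 proof (rule measurable_compose_countable'[where I = "S i ` space ?M"])
  have fin: "finite (S i ` space ?M)" using S by (rule simple_functionD)
  show "S i \<in> ?M \<rightarrow>\<^sub>M count_space (S i ` space ?M)"
   using S[of i] unfolding measurable_count_space_eq2[OF fin] simple_function_def by auto
  show "countable (S i ` space ?M)" using fin by (rule countable_finite)
  show "(%x. F y x) \<in> borel_measurable ?M" for y
   using f unfolding F_def caratheodory_def by (cases y) simp
 qed
 have "AE x in ?M. continuous_on UNIV (%y. F y x)" using f unfolding caratheodory_def F_def by blast
 then obtain Z where Z: "\<And>x. x \<in> space ?M - Z ==> continuous_on UNIV (%y. F y x)" "Z \<in> null_sets ?M"
  by (rule AE_E3) (rule that)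
 define k where "k x = indicator (- Z) x * F (U x) x" for x
 have Zs: "Z \<in> sets ?M" using Z(2) by auto
 have ind: "(%x. indicator (- Z) x :: real) \<in> borel_measurable ?M"
 proof -
  have "(%x. 1 - indicator Z x :: real) \<in> borel_measurable ?M" using Zs by measurable
  then show ?thesis by (simp add: indicator_compl)
 qed
 have "k \<in> borel_measurable ?M"
 proof (rule borel_measurable_LIMSEQ_real)
  show "(%x. indicator (- Z) x * F (S i x) x) \<in> borel_measurable ?M" for i
   using ind SF by (intro borel_measurable_times)
  show "(%i. indicator (- Z) x * F (S i x) x) ----> k x" if x: "x \<in> space ?M" for x
  proof (cases "x \<in> Z")
   case False
   have "(%i. F (S i x) x) ----> F (U x) x"
    using continuous_on_tendsto_compose[OF Z(1) lim[OF x]] x False by simp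
   then show ?thesis unfolding k_def by (intro tendsto_mult tendsto_const)
  qed (simp add: k_def)
 qed
 moreover have "AE x in ?M. k x = f x (u x) (v x) (g x) (h x)"
  using AE_not_in[OF Z(2)] by eventually_elim (simp add: k_def F_def U_def)
 ultimately show ?thesis by (rule lebesgue_on_measurable_AE[OF \<Omega>])
qed

context sobolev_pair begin

text \<open>
 Bounded subsets of \<open>X\<close>, described by the integrals of the gradients instead of the norm.
\<close>

definition XB :: "real => (('a => real) \<times> ('a => real)) set" where
 "XB B = {w \<in> X. Ip p1 M (wg (fst w)) <= B \<and> Ip p2 M (wg (snd w)) <= B}"

lemma X_components: "w \<in> X ==> fst w \<in> W10 p1 \<Omega>" "w \<in> X ==> snd w \<in> W10 p2 \<Omega>"
 by (auto simp: X_space_def)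

end

text \<open>
 One right-hand side \<open>f\<close> with its growth condition. The exponent \<open>p\<close> is that of the test functions, and will be
 \<open>p1\<close> for the first equation and \<open>p2\<close> for the second.
\<close>

locale growth = sobolev_pair \<Omega> p1 p2 + T: sobolev_domain \<Omega> p
 for \<Omega> :: "'a::euclidean_space set" and p1 p2 p :: real +
 fixes f :: "'a nonlinearity" and r s \<kappa> :: real and \<sigma> :: "'a => real"
 assumes f: "caratheodory \<Omega> f"
  and r: "1 < r" "r < sobolev_exp DIM('a) p" and s: "1 < s" "s < sobolev_exp DIM('a) p"
  and \<kappa>: "0 < \<kappa>" and \<sigma>: "\<sigma> \<in> Lp_space (conj_exp s) \<Omega>"
  and f_growth: "AE x in lebesgue_on \<Omega>. \<forall>a b \<xi> \<nu>. \<bar>f x a b \<xi> \<nu>\<bar> \<le>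
      \<kappa> * (\<bar>a\<bar> powr (sobolev_exp DIM('a) p1 / conj_exp r) +
         \<bar>b\<bar> powr (sobolev_exp DIM('a) p2 / conj_exp r) +
         norm \<xi> powr (p1 / conj_exp r) + norm \<nu> powr (p2 / conj_exp r)) + \<sigma> x"
begin

definition nemytskii :: "('a => real) \<times> ('a => real) => 'a => real" where
 "nemytskii w x = f x (fst w x) (snd w x) (wg (fst w) x) (wg (snd w) x)"

definition energy_density :: "('a => real) \<times> ('a => real) => 'a => real" where
 "energy_density w x = \<bar>fst w x\<bar> powr D1.ps + \<bar>snd w x\<bar> powr D2.ps +
   norm (wg (fst w) x) powr p1 + norm (wg (snd w) x) powr p2"

definition majorant :: "('a => real) \<times> ('a => real) => 'a => real" where
 "majorant w x = 4 * \<kappa> * energy_density w x powr (1 / conj_exp r)"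

lemma r': "1 < conj_exp r" "r = conj_exp r / (conj_exp r - 1)"
 using r by (simp_all add: conj_exp_def field_simps)

lemma s': "1 < conj_exp s" "s = conj_exp s / (conj_exp s - 1)"
 using s by (simp_all add: conj_exp_def field_simps)

lemma energy_density_nonneg: "0 <= energy_density w x" by (simp add: energy_density_def)

lemma nemytskii_measurable:
 assumes "w \<in> X" shows "nemytskii w \<in> borel_measurable M"
proof -
 note w = X_components[OF assms]
 show ?thesis unfolding nemytskii_def[abs_def]
  by (rule caratheodory_measurable[OF D1.\<Omega>_lebesgue f LpM_measurable[OF D1.W10_LpM[OF w(1)]]
   LpM_measurable[OF D2.W10_LpM[OF w(2)]] LpM_measurable[OF D1.wg_LpM[OF w(1)]] LpM_measurable[OF D2.wg_LpM[OF w(2)]]])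
qed

text \<open>
 Each of the four powers in the growth condition is at most the same power \<open>1 / conj_exp r\<close> of the energy
 density, hence the factor 4 in the majorant.
\<close>

lemma nemytskii_le: "AE x in M. norm (nemytskii w x) <= \<bar>majorant w x\<bar> + \<sigma> x"
 using f_growth
proof eventually_elim
 case (elim x)
 define E where "E = energy_density w x"
 have c: "0 <= 1 / conj_exp r" using r'(1) by simp
 have part: "a powr (t / conj_exp r) <= E powr (1 / conj_exp r)" if "a powr t <= E" for a t :: real
 proof -
  have "a powr (t / conj_exp r) = (a powr t) powr (1 / conj_exp r)" by (simp add: powr_powr)
  also have "\<dots> <= E powr (1 / conj_exp r)" using that c by (intro powr_mono2) auto
  finally show ?thesis .
 qed
 have "\<bar>fst w x\<bar> powr (D1.ps / conj_exp r) + \<bar>snd w x\<bar> powr (D2.ps / conj_exp r) +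
   norm (wg (fst w) x) powr (p1 / conj_exp r) + norm (wg (snd w) x) powr (p2 / conj_exp r)
   <= E powr (1 / conj_exp r) + E powr (1 / conj_exp r) + E powr (1 / conj_exp r) + E powr (1 / conj_exp r)"
  by (intro add_mono part) (simp_all add: E_def energy_density_def)
 then have 1: "\<kappa> * (\<bar>fst w x\<bar> powr (D1.ps / conj_exp r) + \<bar>snd w x\<bar> powr (D2.ps / conj_exp r) +
   norm (wg (fst w) x) powr (p1 / conj_exp r) + norm (wg (snd w) x) powr (p2 / conj_exp r)) <= \<kappa> * (4 * E powr (1 / conj_exp r))"
  using \<kappa> by (intro mult_left_mono) auto
 have 2: "\<bar>majorant w x\<bar> = \<kappa> * (4 * E powr (1 / conj_exp r))" using \<kappa> by (simp add: majorant_def E_def abs_mult)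
 show ?case
  unfolding 2 unfolding nemytskii_def real_norm_def
  by (rule order_trans[OF elim[rule_format] add_right_mono[OF 1[unfolded D1.ps_def D2.ps_def]]])
qed

lemma \<sigma>_nonneg: "AE x in M. 0 <= \<sigma> x"
 using f_growth
proof eventually_elim
 case (elim x)
 have "\<bar>f x 0 0 0 0\<bar> <= \<sigma> x" using elim[rule_format, of 0 0 0 0] by simp
 then show ?case by linarith
qed

lemma energy_integrable:
 assumes "w \<in> X"
 shows "integrable M (energy_density w)"
  and "(LINT x|M. energy_density w x) = Ip D1.ps M (fst w) + Ip D2.ps M (snd w) + Ip p1 M (wg (fst w)) + Ip p2 M (wg (snd w))"
proof -
 note w = X_components[OF assms]
 note i = LpM_integrable[OF D1.Sobolev_inequality(1)[OF D1.W10_pair_wg[OF w(1)]], unfolded real_norm_def]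
  LpM_integrable[OF D2.Sobolev_inequality(1)[OF D2.W10_pair_wg[OF w(2)]], unfolded real_norm_def]
  LpM_integrable[OF D1.wg_LpM[OF w(1)]] LpM_integrable[OF D2.wg_LpM[OF w(2)]]
 show "integrable M (energy_density w)" unfolding energy_density_def
  by (intro Bochner_Integration.integrable_add i)
 show "(LINT x|M. energy_density w x) = Ip D1.ps M (fst w) + Ip D2.ps M (snd w) + Ip p1 M (wg (fst w)) + Ip p2 M (wg (snd w))"
  unfolding energy_density_def Ip_def real_norm_def
  by (simp add: i Bochner_Integration.integral_add Bochner_Integration.integrable_add)
qed

lemma majorant_LpM:
 assumes "w \<in> X"
 shows "majorant w \<in> LpM (conj_exp r) M"
  and "Ip (conj_exp r) M (majorant w) = (4 * \<kappa>) powr conj_exp r * (LINT x|M. energy_density w x)"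
proof -
 have pw: "norm (majorant w x) powr conj_exp r = (4 * \<kappa>) powr conj_exp r * energy_density w x" for x
  using \<kappa> r'(1) energy_density_nonneg[of w x] by (simp add: majorant_def abs_mult powr_mult powr_powr)
 have "energy_density w \<in> borel_measurable M" using energy_integrable(1)[OF assms] by auto
 then have "majorant w \<in> borel_measurable M" unfolding majorant_def[abs_def] by measurable
 then show "majorant w \<in> LpM (conj_exp r) M" unfolding LpM_def mem_Collect_eq pw
  using energy_integrable(1)[OF assms] by simp
 show "Ip (conj_exp r) M (majorant w) = (4 * \<kappa>) powr conj_exp r * (LINT x|M. energy_density w x)"
  unfolding Ip_def pw by simp
qed

lemma energy_bounded:
 obtains C where "\<And>w. w \<in> XB B ==> (LINT x|M. energy_density w x) <= C"
proof -
 have S: "Ip (sobolev_exp DIM('a) t) M u <= (2 * sobolev_domain.sobolev_const TYPE('a) t * B powr (1 / t)) powr sobolev_exp DIM('a) t"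
  if t: "sobolev_domain \<Omega> t" and u: "u \<in> W10 t \<Omega>" "Ip t M (wg u) <= B" for u t
 proof -
  interpret t: sobolev_domain \<Omega> t by fact
  have "Ip t.ps M u powr (1 / t.ps) <= 2 * t.sobolev_const * Ip t M (wg u) powr (1 / t)"
   by (rule t.Sobolev_inequality_sharp[OF t.W10_pair_wg[OF u(1)]])
  also have "\<dots> <= 2 * t.sobolev_const * B powr (1 / t)"
   using u(2) t.sobolev_const_nonneg t.p0 by (intro mult_left_mono powr_mono2) auto
  finally have "(Ip t.ps M u powr (1 / t.ps)) powr t.ps <= (2 * t.sobolev_const * B powr (1 / t)) powr t.ps"
   using t.ps_gt by (intro powr_mono2) auto
  then show ?thesis using t.ps_gt by (simp add: powr_powr t.ps_def)
 qed
 show ?thesis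
 proof (rule that)
  fix w assume "w \<in> XB B"
  then have w: "w \<in> X" "Ip p1 M (wg (fst w)) <= B" "Ip p2 M (wg (snd w)) <= B" by (auto simp: XB_def)
  note c = X_components[OF w(1)]
  show "(LINT x|M. energy_density w x) \<le>
    (2 * D1.sobolev_const * B powr (1 / p1)) powr sobolev_exp DIM('a) p1 + (2 * D2.sobolev_const * B powr (1 / p2)) powr sobolev_exp DIM('a) p2 + B + B"
   unfolding energy_integrable(2)[OF w(1)] D1.ps_def D2.ps_def
   by (intro add_mono S D1.sobolev_domain_axioms D2.sobolev_domain_axioms c w)
 qed
qed

lemma test_LpM_rs:
 assumes "\<phi> \<in> W10 p \<Omega>" shows "\<phi> \<in> LpM r M" "\<phi> \<in> LpM s M"
proof -
 have P: "T.W10_pair \<phi> (wg \<phi>)" by (rule T.W10_pair_wg[OF assms])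
 have "0 < r" "r < T.ps" "0 < s" "s < T.ps" using r s by (auto simp: T.ps_def)
 note rs = this
 show "\<phi> \<in> LpM r M" by (rule T.Sobolev_subcritical[OF rs(1,2)]) (use P in blast)
 show "\<phi> \<in> LpM s M" by (rule T.Sobolev_subcritical[OF rs(3,4)]) (use P in blast)
qed

lemma nemytskii_pairing:
 assumes w: "w \<in> X" and \<phi>: "\<phi> \<in> LpM r M" "\<phi> \<in> LpM s M"
 shows "integrable M (%x. nemytskii w x * \<phi> x)"
  and "\<bar>LINT x|M. nemytskii w x * \<phi> x\<bar> <= Ip (conj_exp r) M (majorant w) powr (1 / conj_exp r) * Ip r M \<phi> powr (1 / r) +
   Ip (conj_exp s) M \<sigma> powr (1 / conj_exp s) * Ip s M \<phi> powr (1 / s)"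
proof -
 have \<sigma>': "\<sigma> \<in> LpM (conj_exp s) M" using \<sigma> by (simp add: Lp_space_eq)
 note H1 = Holder[OF r' majorant_LpM(1)[OF w] \<phi>(1)]
 note H2 = Holder[OF s' \<sigma>' \<phi>(2)]
 have i: "integrable M (%x. norm (majorant w x) * norm (\<phi> x) + norm (\<sigma> x) * norm (\<phi> x))"
  by (intro Bochner_Integration.integrable_add H1(1) H2(1))
 have ae: "AE x in M. norm (nemytskii w x * \<phi> x) <= norm (majorant w x) * norm (\<phi> x) + norm (\<sigma> x) * norm (\<phi> x)"
  using nemytskii_le[of w]
 proof eventually_elim
  case (elim x)
  have "norm (nemytskii w x) <= norm (majorant w x) + norm (\<sigma> x)" using elim by simp
  then have "norm (nemytskii w x) * norm (\<phi> x) <= (norm (majorant w x) + norm (\<sigma> x)) * norm (\<phi> x)" by (intro mult_right_mono) auto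
  then show ?case by (simp add: norm_mult distrib_right abs_mult)
 qed
 have m: "(%x. nemytskii w x * \<phi> x) \<in> borel_measurable M"
  using nemytskii_measurable[OF w] LpM_measurable[OF \<phi>(1)] by simp
 show int: "integrable M (%x. nemytskii w x * \<phi> x)"
  by (rule Bochner_Integration.integrable_bound[OF i m]) (use ae in \<open>eventually_elim, auto\<close>)
 have "\<bar>LINT x|M. nemytskii w x * \<phi> x\<bar> <= (LINT x|M. norm (nemytskii w x * \<phi> x))"
  using integral_norm_bound[of M "%x. nemytskii w x * \<phi> x"] by simp
 also have "\<dots> <= (LINT x|M. norm (majorant w x) * norm (\<phi> x) + norm (\<sigma> x) * norm (\<phi> x))"
  by (rule integral_mono_AE[OF integrable_norm[OF int] i ae])
 also have "\<dots> = (LINT x|M. norm (majorant w x) * norm (\<phi> x)) + (LINT x|M. norm (\<sigma> x) * norm (\<phi> x))"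
  by (rule Bochner_Integration.integral_add[OF H1(1) H2(1)])
 also have "\<dots> <= Ip (conj_exp r) M (majorant w) powr (1 / conj_exp r) * Ip r M \<phi> powr (1 / r) +
   Ip (conj_exp s) M \<sigma> powr (1 / conj_exp s) * Ip s M \<phi> powr (1 / s)"
  by (rule add_mono[OF H1(2) H2(2)])
 finally show "\<bar>LINT x|M. nemytskii w x * \<phi> x\<bar> <= Ip (conj_exp r) M (majorant w) powr (1 / conj_exp r) * Ip r M \<phi> powr (1 / r) +
   Ip (conj_exp s) M \<sigma> powr (1 / conj_exp s) * Ip s M \<phi> powr (1 / s)" .
qed

lemma nemytskii_bounded:
 obtains C where "0 <= C" "\<And>w \<phi>. w \<in> XB B ==> \<phi> \<in> LpM r M ==> \<phi> \<in> LpM s M ==>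
  \<bar>LINT x|M. nemytskii w x * \<phi> x\<bar> <= C * (Ip r M \<phi> powr (1 / r) + Ip s M \<phi> powr (1 / s))"
proof -
 obtain K where K: "\<And>w. w \<in> XB B ==> (LINT x|M. energy_density w x) <= K" by (rule energy_bounded) (rule that)
 define C1 where "C1 = ((4 * \<kappa>) powr conj_exp r * K) powr (1 / conj_exp r)"
 define C2 where "C2 = Ip (conj_exp s) M \<sigma> powr (1 / conj_exp s)"
 have C0: "0 <= C1" "0 <= C2" by (auto simp: C1_def C2_def)
 show ?thesis
 proof (rule that[of "C1 + C2"])
  fix w and \<phi> :: "'a => real" assume w: "w \<in> XB B" and \<phi>: "\<phi> \<in> LpM r M" "\<phi> \<in> LpM s M"
  have wX: "w \<in> X" using w by (simp add: XB_def)
  have "Ip (conj_exp r) M (majorant w) powr (1 / conj_exp r) <= C1" unfolding majorant_LpM(2)[OF wX] C1_def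
  proof (intro powr_mono2 mult_left_mono K[OF w] mult_nonneg_nonneg)
   show "0 <= (LINT x|M. energy_density w x)" using energy_density_nonneg by (intro Bochner_Integration.integral_nonneg) simp
  qed (use r'(1) in auto)
  then have "Ip (conj_exp r) M (majorant w) powr (1 / conj_exp r) * Ip r M \<phi> powr (1 / r) <= C1 * Ip r M \<phi> powr (1 / r)"
   by (intro mult_right_mono) auto
  moreover have "0 <= C2 * Ip r M \<phi> powr (1 / r)" "0 <= C1 * Ip s M \<phi> powr (1 / s)" using C0 by auto
  ultimately show "\<bar>LINT x|M. nemytskii w x * \<phi> x\<bar> <= (C1 + C2) * (Ip r M \<phi> powr (1 / r) + Ip s M \<phi> powr (1 / s))"
   using nemytskii_pairing(2)[OF wX \<phi>] unfolding C2_def[symmetric] distrib_left distrib_right by linarith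
 qed (use C0 in simp)
qed

lemma nemytskii_bounded_W10:
 obtains C where "0 <= C" "\<And>w \<phi>. w \<in> XB B ==> \<phi> \<in> W10 p \<Omega> ==>
  \<bar>LINT x|M. nemytskii w x * \<phi> x\<bar> <= C * W10_norm p \<Omega> \<phi>"
proof -
 obtain C where C: "0 <= C" "\<And>w \<phi>. w \<in> XB B ==> \<phi> \<in> LpM r M ==> \<phi> \<in> LpM s M ==>
  \<bar>LINT x|M. nemytskii w x * \<phi> x\<bar> <= C * (Ip r M \<phi> powr (1 / r) + Ip s M \<phi> powr (1 / s))"
  by (rule nemytskii_bounded) (rule that)
 have rs: "0 < r" "r < T.ps" "0 < s" "s < T.ps" using r s by (auto simp: T.ps_def)
 obtain A where A: "0 < A" "\<And>u G. T.W10_pair u G ==> Ip r M u powr (1 / r) <= A * Ip p M G powr (1 / p)"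
  by (rule T.Sobolev_subcritical[OF rs(1,2)]) (rule that)
 obtain A' where A': "0 < A'" "\<And>u G. T.W10_pair u G ==> Ip s M u powr (1 / s) <= A' * Ip p M G powr (1 / p)"
  by (rule T.Sobolev_subcritical[OF rs(3,4)]) (rule that)
 show ?thesis
 proof (rule that[of "C * (A + A')"])
  fix w \<phi> assume w: "w \<in> XB B" and \<phi>: "\<phi> \<in> W10 p \<Omega>"
  note P = T.W10_pair_wg[OF \<phi>]
  have "\<bar>LINT x|M. nemytskii w x * \<phi> x\<bar> <= C * (Ip r M \<phi> powr (1 / r) + Ip s M \<phi> powr (1 / s))"
   by (rule C(2)[OF w test_LpM_rs[OF \<phi>]])
  also have "\<dots> <= C * (A * W10_norm p \<Omega> \<phi> + A' * W10_norm p \<Omega> \<phi>)"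
   unfolding T.W10_norm_eq by (intro mult_left_mono add_mono A A' P C)
  finally show "\<bar>LINT x|M. nemytskii w x * \<phi> x\<bar> <= C * (A + A') * W10_norm p \<Omega> \<phi>" by (simp add: distrib_left distrib_right mult.assoc)
 qed (use C A A' in simp)
qed

lemma nemytskii_tendsto:
 assumes w: "\<And>n::nat. w n \<in> XB B" "z \<in> X" and \<phi>: "\<phi> \<in> W10 p \<Omega>"
  and l: "AE x in M. (%n. fst (w n) x) ----> fst z x" "AE x in M. (%n. snd (w n) x) ----> snd z x"
   "AE x in M. (%n. wg (fst (w n)) x) ----> wg (fst z) x" "AE x in M. (%n. wg (snd (w n)) x) ----> wg (snd z) x"
 shows "(%n. LINT x|M. nemytskii (w n) x * \<phi> x) ----> (LINT x|M. nemytskii z x * \<phi> x)"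
proof -
 have wX: "w n \<in> X" for n using w(1)[of n] by (simp add: XB_def)
 obtain K where K: "\<And>w. w \<in> XB B ==> (LINT x|M. energy_density w x) <= K" by (rule energy_bounded) (rule that)
 have \<sigma>': "\<sigma> \<in> LpM (conj_exp s) M" using \<sigma> by (simp add: Lp_space_eq)
 have "(%n. LINT x|M. nemytskii (w n) x \<bullet> \<phi> x) ----> (LINT x|M. nemytskii z x \<bullet> \<phi> x)"
 proof (rule tendsto_integral_bounded_AE[OF r' nemytskii_measurable[OF wX] nemytskii_measurable[OF w(2)]
    majorant_LpM(1)[OF wX] majorant_LpM(1)[OF w(2)] _ test_LpM_rs(1)[OF \<phi>] _ nemytskii_le nemytskii_le \<sigma>_nonneg])
  show "Ip (conj_exp r) M (majorant (w n)) <= (4 * \<kappa>) powr conj_exp r * K" for n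
   unfolding majorant_LpM(2)[OF wX] by (intro mult_left_mono K w) simp
  show "integrable M (%x. \<sigma> x * norm (\<phi> x))"
  proof (rule integrable_cong_AE_imp[OF Holder(1)[OF s' \<sigma>' test_LpM_rs(2)[OF \<phi>]]])
   show "(%x. \<sigma> x * norm (\<phi> x)) \<in> borel_measurable M"
    using LpM_measurable[OF \<sigma>'] LpM_measurable[OF test_LpM_rs(2)[OF \<phi>]] by simp
   show "AE x in M. norm (\<sigma> x) * norm (\<phi> x) = \<sigma> x * norm (\<phi> x)" using \<sigma>_nonneg by eventually_elim simp
  qed
  have "AE x in M. continuous_on UNIV (%(s, t, \<xi>, \<nu>). f x s t \<xi> \<nu>)" using f by (simp add: caratheodory_def)
  then show "AE x in M. (%n. nemytskii (w n) x) ----> nemytskii z x"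
   using l
  proof eventually_elim
   case (elim x)
   have "(%n. (fst (w n) x, snd (w n) x, wg (fst (w n)) x, wg (snd (w n)) x)) ---->
     (fst z x, snd z x, wg (fst z) x, wg (snd z) x)"
    using elim by (intro tendsto_Pair)
   from continuous_on_tendsto_compose[OF elim(1) this] show ?case by (simp add: nemytskii_def)
  qed
 qed
 then show ?thesis by simp
qed

end

context sobolev_domain begin

lemma W10_sum:
 assumes "\<And>i. i < (m::nat) ==> u i \<in> W10 p \<Omega>"
 shows "(\<Sum>i<m. c i *R u i) \<in> W10 p \<Omega>"
  and "AE x in M. wg (\<Sum>i<m. c i *R u i) x = (\<Sum>i<m. c i *R wg (u i) x)"
  and "W10_norm p \<Omega> (\<Sum>i<m. c i *R u i) <= 4 ^ m * (\<Sum>i<m. \<bar>c i\<bar> * W10_norm p \<Omega> (u i))"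
proof -
 have "(\<Sum>i<m. c i *R u i) \<in> W10 p \<Omega> \<and> (AE x in M. wg (\<Sum>i<m. c i *R u i) x = (\<Sum>i<m. c i *R wg (u i) x)) \<and>
  W10_norm p \<Omega> (\<Sum>i<m. c i *R u i) <= 4 ^ m * (\<Sum>i<m. \<bar>c i\<bar> * W10_norm p \<Omega> (u i))"
  using assms
 proof (induction m)
  case 0
  show ?case using W10_zero W10_norm_zero by (simp add: zero_fun_def)
 next
  case (Suc m)
  define S where "S = (\<Sum>i<m. c i *R u i)"
  define B where "B = (\<Sum>i<m. \<bar>c i\<bar> * W10_norm p \<Omega> (u i))"
  have S: "S \<in> W10 p \<Omega>" "AE x in M. wg S x = (\<Sum>i<m. c i *R wg (u i) x)" "W10_norm p \<Omega> S <= 4 ^ m * B"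
   unfolding S_def B_def using Suc by auto
  have um: "u m \<in> W10 p \<Omega>" using Suc.prems by simp
  note cu = W10_scale[OF um, of "c m"]
  note a = W10_add[OF S(1) cu(1)]
  have "W10_norm p \<Omega> (S + c m *R u m) <= 4 * (W10_norm p \<Omega> S + W10_norm p \<Omega> (c m *R u m))"
   by (rule W10_norm_add[OF S(1) cu(1)])
  also have "\<dots> <= 4 * (4 ^ m * B + 4 ^ m * (\<bar>c m\<bar> * W10_norm p \<Omega> (u m)))"
  proof (intro mult_left_mono add_mono S)
   have "1 * (\<bar>c m\<bar> * W10_norm p \<Omega> (u m)) <= 4 ^ m * (\<bar>c m\<bar> * W10_norm p \<Omega> (u m))"
    using W10_norm_nonneg by (intro mult_right_mono) auto
   then show "W10_norm p \<Omega> (c m *R u m) <= 4 ^ m * (\<bar>c m\<bar> * W10_norm p \<Omega> (u m))"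
    by (simp add: W10_norm_scale[OF um])
  qed simp
  finally have "W10_norm p \<Omega> (S + c m *R u m) <= 4 ^ Suc m * (B + \<bar>c m\<bar> * W10_norm p \<Omega> (u m))"
   by (simp add: distrib_left)
  moreover have "AE x in M. wg (S + c m *R u m) x = (\<Sum>i<Suc m. c i *R wg (u i) x)"
   using a(2) cu(2) S(2) by eventually_elim simp
  ultimately show ?case using a(1) unfolding S_def B_def sum.lessThan_Suc by (intro conjI)
 qed
 then show "(\<Sum>i<m. c i *R u i) \<in> W10 p \<Omega>"
  and "AE x in M. wg (\<Sum>i<m. c i *R u i) x = (\<Sum>i<m. c i *R wg (u i) x)"
  and "W10_norm p \<Omega> (\<Sum>i<m. c i *R u i) <= 4 ^ m * (\<Sum>i<m. \<bar>c i\<bar> * W10_norm p \<Omega> (u i))" by auto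
qed

end

lemma fun_sum_apply: "(\<Sum>i<m. c i *R u i) x = (\<Sum>i<(m::nat). c i *R u i x)"
 for u :: "nat => 'b => 'c::real_vector"
 by (induction m) (simp_all add: scaleR_fun_def)

lemma (in growth) nemytskii_vanishing:
 assumes w: "\<And>n::nat. w n \<in> XB B" and \<phi>: "\<And>n. \<phi> n \<in> LpM r M" "\<And>n. \<phi> n \<in> LpM s M"
  and l: "(%n. Ip r M (\<phi> n)) ----> 0" "(%n. Ip s M (\<phi> n)) ----> 0"
 shows "(%n. LINT x|M. nemytskii (w n) x * \<phi> n x) ----> 0"
proof -
 obtain C where C: "0 <= C" "\<And>w \<phi>. w \<in> XB B ==> \<phi> \<in> LpM r M ==> \<phi> \<in> LpM s M ==>
  \<bar>LINT x|M. nemytskii w x * \<phi> x\<bar> <= C * (Ip r M \<phi> powr (1 / r) + Ip s M \<phi> powr (1 / s))"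
  by (rule nemytskii_bounded) (rule that)
 have p: "(%n. Ip t M (\<phi> n) powr (1 / t)) ----> 0" if t: "1 < t" "(%n. Ip t M (\<phi> n)) ----> 0" for t
 proof -
  have "(%n. Ip t M (\<phi> n) powr (1 / t)) ----> 0 powr (1 / t)" using t by (intro tendsto_powr') auto
  then show ?thesis by simp
 qed
 have "(%n. C * (Ip r M (\<phi> n) powr (1 / r) + Ip s M (\<phi> n) powr (1 / s))) ----> C * (0 + 0)"
  by (intro tendsto_intros p r s l)
 then have L: "(%n. C * (Ip r M (\<phi> n) powr (1 / r) + Ip s M (\<phi> n) powr (1 / s))) ----> 0" by simp
 show ?thesis
  by (rule tendsto_if_diff_le[OF _ L]) (use C(2)[OF w \<phi>] in simp)
qed

section \<open>The system\<close>

locale elliptic_system = sobolev_pair \<Omega> p1 p2 +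
 N1: growth \<Omega> p1 p2 p1 f1 r1 s1 \<kappa>1 \<sigma>1 + N2: growth \<Omega> p1 p2 p2 f2 r2 s2 \<kappa>2 \<sigma>2
 for \<Omega> :: "'a::euclidean_space set" and p1 p2 f1 r1 s1 \<kappa>1 \<sigma>1 f2 r2 s2 \<kappa>2 \<sigma>2 +
 fixes q1 q2 \<mu>1 \<mu>2 c1 c2 d1 d2 :: real and \<gamma>1 \<gamma>2 :: "'a => real"
 assumes q1: "1 < q1" "q1 < p1" and q2: "1 < q2" "q2 < p2" and \<Omega>_nonempty: "\<Omega> \<noteq> {}"
  and d_pos: "0 < d1" "0 < d2"
  and small: "c1 + c2 + (d1 + d2) * (1 / min (first_eigenvalue p1 \<Omega>) (first_eigenvalue p2 \<Omega>)) < 1"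
  and \<gamma>1: "\<gamma>1 \<in> Lp_space 1 \<Omega>" and \<gamma>2: "\<gamma>2 \<in> Lp_space 1 \<Omega>"
  and sign1: "AE x in lebesgue_on \<Omega>. \<forall>s t \<xi> \<nu>. f1 x s t \<xi> \<nu> * s \<le>
      c1 * (norm \<xi> powr p1 + norm \<nu> powr p2) + d1 * (\<bar>s\<bar> powr p1 + \<bar>t\<bar> powr p2) + \<gamma>1 x"
  and sign2: "AE x in lebesgue_on \<Omega>. \<forall>s t \<xi> \<nu>. f2 x s t \<xi> \<nu> * t \<le>
      c2 * (norm \<xi> powr p1 + norm \<nu> powr p2) + d2 * (\<bar>s\<bar> powr p1 + \<bar>t\<bar> powr p2) + \<gamma>2 x"
begin

abbreviation "A \<equiv> A_op \<Omega> p1 p2 q1 q2 \<mu>1 \<mu>2"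
abbreviation "S \<equiv> system_op \<Omega> p1 p2 q1 q2 \<mu>1 \<mu>2 f1 f2"
abbreviation "flux1 w x \<equiv> flux p1 q1 \<mu>1 (wg (fst w) x)"
abbreviation "flux2 w x \<equiv> flux p2 q2 \<mu>2 (wg (snd w) x)"

lemma A_eq: "A w = grad_functional (flux1 w) (flux2 w)"
 by (cases w) (simp add: A_op_def grad_functional_def fun_eq_iff)

lemma S_eq: "S w h = A w h - (LINT x|M. N1.nemytskii w x * fst h x) - (LINT x|M. N2.nemytskii w x * snd h x)"
 by (cases w; cases h) (simp add: system_op_def N1.nemytskii_def N2.nemytskii_def)

lemma flux1_LpM: "w \<in> X ==> flux1 w \<in> LpM pc1 M"
 by (rule D1.flux_LpM(1)[OF q1 D1.wg_LpM[OF X_components(1)]])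

lemma flux2_LpM: "w \<in> X ==> flux2 w \<in> LpM pc2 M"
 by (rule D2.flux_LpM(1)[OF q2 D2.wg_LpM[OF X_components(2)]])

lemma A_dual: "w \<in> X ==> A w \<in> dual_space X N"
 unfolding A_eq by (intro grad_functional_dual flux1_LpM flux2_LpM)

lemma N_components: "W10_norm p1 \<Omega> (fst h) <= N h" "W10_norm p2 \<Omega> (snd h) <= N h"
 using D1.W10_norm_nonneg[of "fst h"] D2.W10_norm_nonneg[of "snd h"] N_eq[of "fst h" "snd h"] by auto

lemma N_nonneg: "0 <= N h"
 using order_trans[OF D1.W10_norm_nonneg N_components(1)] .

lemma S_bounded:
 obtains C where "0 <= C" "\<And>w h. w \<in> XB B ==> h \<in> X ==> \<bar>S w h\<bar> <= C * N h"
proof -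
 obtain C1 where C1: "0 <= C1" "\<And>w \<phi>. w \<in> XB B ==> \<phi> \<in> W10 p1 \<Omega> ==> \<bar>LINT x|M. N1.nemytskii w x * \<phi> x\<bar> <= C1 * W10_norm p1 \<Omega> \<phi>"
  by (rule N1.nemytskii_bounded_W10) (rule that)
 obtain C2 where C2: "0 <= C2" "\<And>w \<phi>. w \<in> XB B ==> \<phi> \<in> W10 p2 \<Omega> ==> \<bar>LINT x|M. N2.nemytskii w x * \<phi> x\<bar> <= C2 * W10_norm p2 \<Omega> \<phi>"
  by (rule N2.nemytskii_bounded_W10) (rule that)
 define K1 where "K1 = (2 powr pc1 * ((1 + \<bar>\<mu>1\<bar>) powr pc1 * B + Ip pc1 M (%x. \<bar>\<mu>1\<bar>))) powr (1 / pc1)"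
 define K2 where "K2 = (2 powr pc2 * ((1 + \<bar>\<mu>2\<bar>) powr pc2 * B + Ip pc2 M (%x. \<bar>\<mu>2\<bar>))) powr (1 / pc2)"
 have K0: "0 <= K1" "0 <= K2" by (auto simp: K1_def K2_def)
 show ?thesis
 proof (rule that[of "K1 + K2 + C1 + C2"])
  fix w h assume w: "w \<in> XB B" and h: "h \<in> X"
  have wX: "w \<in> X" and wB: "Ip p1 M (wg (fst w)) <= B" "Ip p2 M (wg (snd w)) <= B" using w by (auto simp: XB_def)
  have "Ip pc1 M (flux1 w) <= 2 powr pc1 * ((1 + \<bar>\<mu>1\<bar>) powr pc1 * B + Ip pc1 M (%x. \<bar>\<mu>1\<bar>))"
   by (rule order_trans[OF D1.flux_LpM(2)[OF q1 D1.wg_LpM[OF X_components(1)[OF wX]]]])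
    (intro mult_left_mono add_mono wB order_refl powr_ge_zero)
  then have 1: "Ip pc1 M (flux1 w) powr (1 / pc1) <= K1" unfolding K1_def using D1.p1 by (intro powr_mono2) auto
  have "Ip pc2 M (flux2 w) <= 2 powr pc2 * ((1 + \<bar>\<mu>2\<bar>) powr pc2 * B + Ip pc2 M (%x. \<bar>\<mu>2\<bar>))"
   by (rule order_trans[OF D2.flux_LpM(2)[OF q2 D2.wg_LpM[OF X_components(2)[OF wX]]]])
    (intro mult_left_mono add_mono wB order_refl powr_ge_zero)
  then have 2: "Ip pc2 M (flux2 w) powr (1 / pc2) <= K2" unfolding K2_def using D2.p1 by (intro powr_mono2) auto
  have "\<bar>A w h\<bar> <= (K1 + K2) * N h"
   unfolding A_eq
   by (rule order_trans[OF grad_functional_bound[OF flux1_LpM[OF wX] flux2_LpM[OF wX] h] mult_right_mono[OF add_mono[OF 1 2] N_nonneg]])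
  moreover have "\<bar>LINT x|M. N1.nemytskii w x * fst h x\<bar> <= C1 * N h"
   by (rule order_trans[OF C1(2)[OF w X_components(1)[OF h]] mult_left_mono[OF N_components(1) C1(1)]])
  moreover have "\<bar>LINT x|M. N2.nemytskii w x * snd h x\<bar> <= C2 * N h"
   by (rule order_trans[OF C2(2)[OF w X_components(2)[OF h]] mult_left_mono[OF N_components(2) C2(1)]])
  ultimately show "\<bar>S w h\<bar> <= (K1 + K2 + C1 + C2) * N h" unfolding S_eq distrib_right by linarith
 qed (use K0 C1 C2 in simp)
qed

lemma S_dual:
 assumes w: "w \<in> X" shows "S w \<in> dual_space X N"
proof -
 have wB: "w \<in> XB (max (Ip p1 M (wg (fst w))) (Ip p2 M (wg (snd w))))" using w by (simp add: XB_def)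
 obtain C where C: "\<And>h. h \<in> X ==> \<bar>S w h\<bar> <= C * N h" by (rule S_bounded) (use wB in blast)
 note i1 = N1.nemytskii_pairing(1)[OF w N1.test_LpM_rs[OF X_components(1)]]
 note i2 = N2.nemytskii_pairing(1)[OF w N2.test_LpM_rs[OF X_components(2)]]
 show ?thesis unfolding dual_space_def
 proof (intro CollectI conjI ballI allI exI[of _ C] C)
  fix x y c assume x: "x \<in> X"
  show "S w (c *R x) = c * S w x"
   unfolding S_eq dual_spaceD(2)[OF A_dual[OF w] x] by (simp add: scaleR_fun_def mult.left_commute right_diff_distrib)
  assume y: "y \<in> X"
  show "S w (x + y) = S w x + S w y"
   unfolding S_eq dual_spaceD(1)[OF A_dual[OF w] x y]
   using i1[OF x x] i1[OF y y] i2[OF x x] i2[OF y y] by (simp add: distrib_left Bochner_Integration.integral_add)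
 qed
qed

text \<open>
 The sign condition bounds the lower order terms by the gradient integrals and the integrals of
 \<open>abs u powr p1\<close> and \<open>abs v powr p2\<close>; the first eigenvalues turn the latter into gradient integrals. The
 total factor is below 1, and half of the remaining gap absorbs the terms with exponents \<open>q1\<close> and \<open>q2\<close>.
\<close>

lemma S_coercive:
 obtains c K where "0 < c" "0 <= K"
  "\<And>w. w \<in> X ==> c * (Ip p1 M (wg (fst w)) + Ip p2 M (wg (snd w))) - K <= S w w"
proof -
 define l where "l = min (first_eigenvalue p1 \<Omega>) (first_eigenvalue p2 \<Omega>)"
 have l: "0 < l" using D1.first_eigenvalue_pos_le(1) D2.first_eigenvalue_pos_le(1) \<Omega>_nonempty by (simp add: l_def)
 define e where "e = (1 - (c1 + c2 + (d1 + d2) * (1 / l))) / 2"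
 have e: "0 < e" using small by (simp add: e_def l_def)
 obtain K1 where K1: "0 <= K1" "\<And>\<xi>::'a. (1 - e) * norm \<xi> powr p1 - K1 <= flux p1 q1 \<mu>1 \<xi> \<bullet> \<xi>"
  by (rule flux_coercive[OF q1 e]) (rule that)
 obtain K2 where K2: "0 <= K2" "\<And>\<xi>::'a. (1 - e) * norm \<xi> powr p2 - K2 <= flux p2 q2 \<mu>2 \<xi> \<bullet> \<xi>"
  by (rule flux_coercive[OF q2 e]) (rule that)
 define m where "m = measure M (space M)"
 note const = finite_measure.integrable_const[OF D1.finite_M]
 define g where "g = (LINT x|M. \<gamma>1 x) + (LINT x|M. \<gamma>2 x)"
 have \<gamma>i: "integrable M \<gamma>1" "integrable M \<gamma>2"
  using LpM_imp_integrable[OF D1.finite_M, of 1] \<gamma>1 \<gamma>2 by (auto simp: Lp_space_eq)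
 define K where "K = K1 * m + K2 * m + \<bar>g\<bar>"
 have "e * (Ip p1 M (wg (fst w)) + Ip p2 M (wg (snd w))) - K <= S w w" if w: "w \<in> X" for w
 proof -
  note c = X_components[OF w]
  define I1 where "I1 = Ip p1 M (wg (fst w))"
  define I2 where "I2 = Ip p2 M (wg (snd w))"
  define J1 where "J1 = Ip p1 M (fst w)"
  define J2 where "J2 = Ip p2 M (snd w)"
  note ii = LpM_integrable[OF D1.wg_LpM[OF c(1)]] LpM_integrable[OF D2.wg_LpM[OF c(2)]]
   LpM_integrable[OF D1.W10_LpM[OF c(1)], unfolded real_norm_def] LpM_integrable[OF D2.W10_LpM[OF c(2)], unfolded real_norm_def]
  have "(LINT x|M. (1 - e) * norm (wg (fst w) x) powr p1 - K1) <= (LINT x|M. flux1 w x \<bullet> wg (fst w) x)"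
   by (rule integral_mono[OF _ Holder_inner(1)[OF D1.p1 refl D1.wg_LpM[OF c(1)] flux1_LpM[OF w]] K1(2)])
    (intro Bochner_Integration.integrable_diff integrable_mult_right ii const)
  then have a1: "(1 - e) * I1 - K1 * m <= (LINT x|M. flux1 w x \<bullet> wg (fst w) x)"
   using ii(1) by (simp add: I1_def Ip_def m_def mult.commute)
  have "(LINT x|M. (1 - e) * norm (wg (snd w) x) powr p2 - K2) <= (LINT x|M. flux2 w x \<bullet> wg (snd w) x)"
   by (rule integral_mono[OF _ Holder_inner(1)[OF D2.p1 refl D2.wg_LpM[OF c(2)] flux2_LpM[OF w]] K2(2)])
    (intro Bochner_Integration.integrable_diff integrable_mult_right ii const)
  then have a2: "(1 - e) * I2 - K2 * m <= (LINT x|M. flux2 w x \<bullet> wg (snd w) x)"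
   using ii(2) by (simp add: I2_def Ip_def m_def mult.commute)
  have up: "(LINT x|M. k x) <= c' * (I1 + I2) + d' * (J1 + J2) + (LINT x|M. \<gamma> x)"
   if k: "integrable M k" and \<gamma>: "integrable M \<gamma>"
    and le: "AE x in M. k x <= c' * (norm (wg (fst w) x) powr p1 + norm (wg (snd w) x) powr p2) +
     d' * (\<bar>fst w x\<bar> powr p1 + \<bar>snd w x\<bar> powr p2) + \<gamma> x" for k \<gamma> c' d'
  proof -
   have "(LINT x|M. k x) <= (LINT x|M. c' * (norm (wg (fst w) x) powr p1 + norm (wg (snd w) x) powr p2) +
     d' * (\<bar>fst w x\<bar> powr p1 + \<bar>snd w x\<bar> powr p2) + \<gamma> x)"
    by (rule integral_mono_AE[OF k _ le])
     (intro Bochner_Integration.integrable_add integrable_mult_right ii \<gamma>)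
   also have "\<dots> = c' * (I1 + I2) + d' * (J1 + J2) + (LINT x|M. \<gamma> x)"
    using ii \<gamma> by (simp add: I1_def I2_def J1_def J2_def Ip_def)
   finally show ?thesis .
  qed
  have b1: "(LINT x|M. N1.nemytskii w x * fst w x) <= c1 * (I1 + I2) + d1 * (J1 + J2) + (LINT x|M. \<gamma>1 x)"
   by (rule up[OF N1.nemytskii_pairing(1)[OF w N1.test_LpM_rs[OF c(1)]] \<gamma>i(1)])
    (use sign1 in \<open>eventually_elim, simp add: N1.nemytskii_def\<close>)
  have b2: "(LINT x|M. N2.nemytskii w x * snd w x) <= c2 * (I1 + I2) + d2 * (J1 + J2) + (LINT x|M. \<gamma>2 x)"
   by (rule up[OF N2.nemytskii_pairing(1)[OF w N2.test_LpM_rs[OF c(2)]] \<gamma>i(2)])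
    (use sign2 in \<open>eventually_elim, simp add: N2.nemytskii_def\<close>)
  have "l * J1 <= first_eigenvalue p1 \<Omega> * J1" by (intro mult_right_mono) (auto simp: l_def J1_def)
  then have j1: "l * J1 <= I1" using D1.first_eigenvalue_pos_le(2)[OF \<Omega>_nonempty c(1)] by (simp add: I1_def J1_def)
  have "l * J2 <= first_eigenvalue p2 \<Omega> * J2" by (intro mult_right_mono) (auto simp: l_def J2_def)
  then have j2: "l * J2 <= I2" using D2.first_eigenvalue_pos_le(2)[OF \<Omega>_nonempty c(2)] by (simp add: I2_def J2_def)
  have "J1 + J2 <= (1 / l) * (I1 + I2)" using j1 j2 l by (simp add: field_simps)
  then have "(d1 + d2) * (J1 + J2) <= (d1 + d2) * ((1 / l) * (I1 + I2))" using d_pos by (intro mult_left_mono) auto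
  then have dj: "d1 * (J1 + J2) + d2 * (J1 + J2) <= (d1 + d2) * (1 / l) * (I1 + I2)" by (simp only: distrib_right mult.assoc)
  have ee: "(1 - e) * (I1 + I2) - c1 * (I1 + I2) - c2 * (I1 + I2) - (d1 + d2) * (1 / l) * (I1 + I2) = e * (I1 + I2)"
  proof -
   have "(1 - e) - c1 - c2 - (d1 + d2) * (1 / l) = e" by (simp add: e_def field_simps)
   then show ?thesis by (metis left_diff_distrib)
  qed
  have "S w w = (LINT x|M. flux1 w x \<bullet> wg (fst w) x) + (LINT x|M. flux2 w x \<bullet> wg (snd w) x)
    - (LINT x|M. N1.nemytskii w x * fst w x) - (LINT x|M. N2.nemytskii w x * snd w x)"
   unfolding S_eq A_eq by (simp add: grad_functional_def case_prod_beta)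
  then show ?thesis using a1 a2 b1 b2 dj ee abs_ge_self[of g] unfolding K_def g_def I1_def[symmetric] I2_def[symmetric]
   by (simp add: distrib_left)
 qed
 moreover have "0 <= K" using K1 K2 by (simp add: K_def m_def)
 ultimately show ?thesis using e that by blast
qed

lemma S_tendsto:
 assumes w: "\<And>n::nat. w n \<in> XB B" "z \<in> X" and h: "h \<in> X"
  and l: "AE x in M. (%n. fst (w n) x) ----> fst z x" "AE x in M. (%n. snd (w n) x) ----> snd z x"
   "AE x in M. (%n. wg (fst (w n)) x) ----> wg (fst z) x" "AE x in M. (%n. wg (snd (w n)) x) ----> wg (snd z) x"
 shows "(%n. S (w n) h) ----> S z h"
proof -
 have wX: "w n \<in> X" and wB: "Ip p1 M (wg (fst (w n))) <= B" "Ip p2 M (wg (snd (w n))) <= B" for n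
  using w(1)[of n] by (auto simp: XB_def)
 note h' = X_components[OF h]
 have 1: "(%n. LINT x|M. flux1 (w n) x \<bullet> wg (fst h) x) ----> (LINT x|M. flux1 z x \<bullet> wg (fst h) x)"
  by (rule D1.flux_tendsto[OF q1 D1.wg_LpM[OF X_components(1)[OF wX]] D1.wg_LpM[OF X_components(1)[OF w(2)]] wB(1) l(3) D1.wg_LpM[OF h'(1)]])
 have 2: "(%n. LINT x|M. flux2 (w n) x \<bullet> wg (snd h) x) ----> (LINT x|M. flux2 z x \<bullet> wg (snd h) x)"
  by (rule D2.flux_tendsto[OF q2 D2.wg_LpM[OF X_components(2)[OF wX]] D2.wg_LpM[OF X_components(2)[OF w(2)]] wB(2) l(4) D2.wg_LpM[OF h'(2)]])
 show ?thesis
  unfolding S_eq A_eq grad_functional_def case_prod_beta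
  by (intro tendsto_diff tendsto_add 1 2 N1.nemytskii_tendsto[OF w h'(1) l] N2.nemytskii_tendsto[OF w h'(2) l])
qed

section \<open>Galerkin approximation\<close>

text \<open>
 On coefficient vectors, the operator is a continuous field, and it points outwards on large spheres by
 coercivity. At a zero of the field, \<open>S w\<close> annihilates all \<open>e i\<close> and therefore \<open>w\<close> itself.
\<close>

lemma galerkin_step:
 assumes K: "0 < c0" "0 <= K" "\<And>w. w \<in> X ==> c0 * (Ip p1 M (wg (fst w)) + Ip p2 M (wg (snd w))) - K <= S w w"
  and e: "\<And>i. i < (m::nat) ==> e i \<in> X" and B: "\<And>c i. i < m ==> \<bar>c i\<bar> <= B * N (\<Sum>i<m. c i *R e i)"
 obtains w where "w \<in> XB (K / c0)" "S w w = 0" "\<And>i. i < m ==> S w (e i) = 0"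
proof -
 define W where "W c = (\<Sum>i<m. c i *R e i)" for c
 have WX: "W c \<in> X" for c unfolding W_def using e by (intro subspace_sum[OF subspace_X] subspace_mul[OF subspace_X]) auto
 have pair: "S w (W c) = (\<Sum>i<m. c i * S w (e i))" if "w \<in> X" for w c
  unfolding W_def by (rule dual_space_sum(2)[OF subspace_X S_dual[OF that] e])
 have e1: "fst (e i) \<in> W10 p1 \<Omega>" and e2: "snd (e i) \<in> W10 p2 \<Omega>" if "i < m" for i using X_components[OF e[OF that]] .
 have W1: "fst (W c) = (\<Sum>i<m. c i *R fst (e i))" and W2: "snd (W c) = (\<Sum>i<m. c i *R snd (e i))" for c
  by (simp_all add: W_def fst_sum snd_sum)
 define F where "F i c = S (W c) (e i)" for i c
 define T where "T = K / c0"
 define Nm where "Nm = T powr (1 / p1) + T powr (1 / p2)"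
 \<comment> \<open>larger than the length of any \<open>c\<close> with \<open>S (W c) (W c) <= 0\<close>, since \<open>N (W c) <= Nm\<close> for those\<close>
 define R where "R = sqrt (1 + real m * (\<bar>B\<bar> * Nm)\<^sup>2)"
 have small: "w \<in> XB T" if w: "w \<in> X" "S w w <= 0" for w
 proof -
  have "c0 * (Ip p1 M (wg (fst w)) + Ip p2 M (wg (snd w))) <= K" using K(3)[OF w(1)] w(2) by linarith
  then have "Ip p1 M (wg (fst w)) + Ip p2 M (wg (snd w)) <= T" using K(1) by (simp add: T_def field_simps)
  then have "Ip p1 M (wg (fst w)) <= T" "Ip p2 M (wg (snd w)) <= T"
   using Ip_nonneg[of p1 M "wg (fst w)"] Ip_nonneg[of p2 M "wg (snd w)"] by linarith+
  then show ?thesis using w(1) by (simp add: XB_def)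
 qed
 have "\<exists>c. (\<forall>j\<ge>m. c j = 0) \<and> (\<forall>i<m. F i c = 0)"
 proof (rule outward_field_has_zero)
  have R2: "R\<^sup>2 = 1 + real m * (\<bar>B\<bar> * Nm)\<^sup>2" unfolding R_def by (intro real_sqrt_pow2 add_nonneg_nonneg mult_nonneg_nonneg) auto
  show "0 < R" unfolding R_def by (simp add: add_pos_nonneg)
  fix c assume c: "(\<Sum>j<m. (c j)\<^sup>2) = R\<^sup>2"
  have sum: "(\<Sum>j<m. F j c * c j) = S (W c) (W c)" unfolding pair[OF WX] F_def by (simp add: mult.commute)
  show "0 < (\<Sum>j<m. F j c * c j)"
  proof (rule ccontr)
   assume "\<not> ?thesis"
   then have "W c \<in> XB T" using small[OF WX] sum by simp
   then have "W10_norm p1 \<Omega> (fst (W c)) <= T powr (1 / p1)" "W10_norm p2 \<Omega> (snd (W c)) <= T powr (1 / p2)"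
    unfolding D1.W10_norm_eq D2.W10_norm_eq XB_def using D1.p0 D2.p0 by (auto intro!: powr_mono2)
   then have NW: "N (W c) <= Nm" using N_eq[of "fst (W c)" "snd (W c)"] by (simp add: Nm_def)
   have "(c i)\<^sup>2 <= (\<bar>B\<bar> * Nm)\<^sup>2" if i: "i < m" for i
   proof -
    have "\<bar>c i\<bar> <= B * N (W c)" using B[OF i, of c] by (simp add: W_def)
    also have "\<dots> <= \<bar>B\<bar> * N (W c)" by (intro mult_right_mono N_nonneg) simp
    also have "\<dots> <= \<bar>B\<bar> * Nm" using NW by (intro mult_left_mono) auto
    finally show ?thesis by (metis abs_ge_zero power2_abs power_mono)
   qed
   then have "(\<Sum>j<m. (c j)\<^sup>2) <= (\<Sum>j<m. (\<bar>B\<bar> * Nm)\<^sup>2)" by (intro sum_mono) simp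
   then show False using c R2 by simp
  qed
 next
  fix i assume i: "i < m"
  show "continuous_on {c. \<forall>j\<ge>m. c j = 0} (F i)"
  proof (rule continuous_on_sequentiallyI)
   fix c :: "nat => nat => real" and a assume lim: "c ----> a"
   have ci: "(%n. c n j) ----> a j" for j
    using continuous_on_tendsto_compose[OF continuous_on_product_coordinates lim] by simp
   have bd: "\<exists>b. \<forall>n. 4 ^ m * (\<Sum>i<m. \<bar>c n i\<bar> * t i) <= b" for t :: "nat => real"
   proof -
    have "(%n. 4 ^ m * (\<Sum>i<m. \<bar>c n i\<bar> * t i)) ----> 4 ^ m * (\<Sum>i<m. \<bar>a i\<bar> * t i)"
     by (intro tendsto_intros ci)
    then have "Bseq (%n. 4 ^ m * (\<Sum>i<m. \<bar>c n i\<bar> * t i))" by (intro convergent_imp_Bseq convergentI)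
    then obtain b where "\<And>n. norm (4 ^ m * (\<Sum>i<m. \<bar>c n i\<bar> * t i)) <= b" by (rule BseqE) blast
    then have "4 ^ m * (\<Sum>i<m. \<bar>c n i\<bar> * t i) <= b" for n using abs_ge_self order_trans by (metis real_norm_def)
    then show ?thesis by blast
   qed
   obtain b1 where b1: "\<And>n. 4 ^ m * (\<Sum>i<m. \<bar>c n i\<bar> * W10_norm p1 \<Omega> (fst (e i))) <= b1" using bd[of "%i. W10_norm p1 \<Omega> (fst (e i))"] by blast
   obtain b2 where b2: "\<And>n. 4 ^ m * (\<Sum>i<m. \<bar>c n i\<bar> * W10_norm p2 \<Omega> (snd (e i))) <= b2" using bd[of "%i. W10_norm p2 \<Omega> (snd (e i))"] by blast
   have "W (c n) \<in> XB (max (b1 powr p1) (b2 powr p2))" for n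
   proof -
    have "W10_norm p1 \<Omega> (fst (W (c n))) <= b1" unfolding W1 by (rule order_trans[OF D1.W10_sum(3)[OF e1] b1])
    then have 1: "Ip p1 M (wg (fst (W (c n)))) <= b1 powr p1"
     unfolding D1.W10_norm_powr[symmetric] using D1.p0 D1.W10_norm_nonneg by (intro powr_mono2) auto
    have "W10_norm p2 \<Omega> (snd (W (c n))) <= b2" unfolding W2 by (rule order_trans[OF D2.W10_sum(3)[OF e2] b2])
    then have 2: "Ip p2 M (wg (snd (W (c n)))) <= b2 powr p2"
     unfolding D2.W10_norm_powr[symmetric] using D2.p0 D2.W10_norm_nonneg by (intro powr_mono2) auto
    show ?thesis using 1 2 WX by (simp add: XB_def le_max_iff_disj)
   qed
   then show "(%n. F i (c n)) ----> F i a"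
    unfolding F_def
   proof (rule S_tendsto[OF _ WX e[OF i]])
    have "(%n. fst (W (c n)) x) ----> fst (W a) x" "(%n. snd (W (c n)) x) ----> snd (W a) x" for x
     unfolding W1 W2 fun_sum_apply by (intro tendsto_intros ci)+
    then show "AE x in M. (%n. fst (W (c n)) x) ----> fst (W a) x" "AE x in M. (%n. snd (W (c n)) x) ----> snd (W a) x"
     by simp_all
    have "AE x in M. \<forall>n. wg (fst (W (c n))) x = (\<Sum>i<m. c n i *R wg (fst (e i)) x)"
     unfolding AE_all_countable W1 by (intro allI D1.W10_sum(2) e1)
    moreover have "AE x in M. wg (fst (W a)) x = (\<Sum>i<m. a i *R wg (fst (e i)) x)"
     unfolding W1 by (rule D1.W10_sum(2)[OF e1])
    ultimately show "AE x in M. (%n. wg (fst (W (c n))) x) ----> wg (fst (W a)) x"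
    proof eventually_elim
     case (elim x)
     then show ?case by (simp only: elim) (intro tendsto_intros ci)
    qed
    have "AE x in M. \<forall>n. wg (snd (W (c n))) x = (\<Sum>i<m. c n i *R wg (snd (e i)) x)"
     unfolding AE_all_countable W2 by (intro allI D2.W10_sum(2) e2)
    moreover have "AE x in M. wg (snd (W a)) x = (\<Sum>i<m. a i *R wg (snd (e i)) x)"
     unfolding W2 by (rule D2.W10_sum(2)[OF e2])
    ultimately show "AE x in M. (%n. wg (snd (W (c n))) x) ----> wg (snd (W a)) x"
    proof eventually_elim
     case (elim x)
     then show ?case by (simp only: elim) (intro tendsto_intros ci)
    qed
   qed
  qed
 qed
 then obtain c where c: "\<And>i. i < m ==> F i c = 0" by blast
 have 0: "S (W c) (e i) = 0" if "i < m" for i using c[OF that] by (simp add: F_def)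
 then have S0: "S (W c) (W c) = 0" unfolding pair[OF WX] by simp
 then have "W c \<in> XB (K / c0)" using small[OF WX] by (simp add: T_def)
 then show ?thesis using S0 0 by (rule that)
qed

lemma galerkin:
 assumes d: "\<And>k::nat. d k \<in> X"
 obtains w B where "\<And>n. w n \<in> XB B" "\<And>n::nat. S (w n) (w n) = 0" "\<And>n k. k < n ==> S (w n) (d k) = 0"
proof -
 obtain c0 K where K: "0 < c0" "0 <= K" "\<And>w. w \<in> X ==> c0 * (Ip p1 M (wg (fst w)) + Ip p2 M (wg (snd w))) - K <= S w w"
  by (rule S_coercive) (rule that)
 have "\<exists>w. w \<in> XB (K / c0) \<and> S w w = 0 \<and> (\<forall>k<n. S w (d k) = 0)" for n
 proof -
  obtain m :: nat and e B where e: "\<And>i. i < m ==> e i \<in> X" and B: "\<And>c i. i < m ==> \<bar>c i\<bar> <= B * N (\<Sum>i<m. c i *R e i)"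
   and ann: "\<And>k F. k < n ==> F \<in> dual_space X N ==> (\<forall>i<m. F (e i) = 0) ==> F (d k) = 0"
   using independent_family_exists[where d = d and n = n, OF quasi_seminorm_X d] by blast
  obtain w where w: "w \<in> XB (K / c0)" "S w w = 0" "\<And>i. i < m ==> S w (e i) = 0"
   by (rule galerkin_step[OF K e B]) (assumption | rule that)+
  have "w \<in> X" using w(1) by (simp add: XB_def)
  then have "\<forall>k<n. S w (d k) = 0" using ann S_dual w(3) by blast
  then show ?thesis using w by blast
 qed
 then obtain w where "\<And>n. w n \<in> XB (K / c0) \<and> S (w n) (w n) = 0 \<and> (\<forall>k<n. S (w n) (d k) = 0)" by metis
 then show ?thesis using that by blast
qed

end

section \<open>Passing to the limit\<close>

text \<open>
 The term with exponent \<open>q\<close> contributes \<open>- \<mu>\<close> times a nonnegative quantity.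
\<close>

lemma flux_monotone:
 fixes \<xi> \<eta> :: "'b::euclidean_space"
 assumes "1 < q" "\<mu> <= 0"
 shows "(duality p \<xi> - duality p \<eta>) \<bullet> (\<xi> - \<eta>) <= (flux p q \<mu> \<xi> - flux p q \<mu> \<eta>) \<bullet> (\<xi> - \<eta>)"
proof -
 have "(flux p q \<mu> \<xi> - flux p q \<mu> \<eta>) \<bullet> (\<xi> - \<eta>) =
   (duality p \<xi> - duality p \<eta>) \<bullet> (\<xi> - \<eta>) + (- \<mu>) * ((duality q \<xi> - duality q \<eta>) \<bullet> (\<xi> - \<eta>))"
  by (simp add: flux_eq inner_diff_left inner_diff_right algebra_simps)
 moreover have "0 <= (- \<mu>) * ((duality q \<xi> - duality q \<eta>) \<bullet> (\<xi> - \<eta>))"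
  using assms duality_monotone by (intro mult_nonneg_nonneg) auto
 ultimately show ?thesis by linarith
qed

context elliptic_system begin

lemma A_diff_eq:
 assumes w: "w \<in> X" and z: "z \<in> X"
 shows "integrable M (%x. (flux1 w x - flux1 z x) \<bullet> (wg (fst w) x - wg (fst z) x))"
  and "integrable M (%x. (flux2 w x - flux2 z x) \<bullet> (wg (snd w) x - wg (snd z) x))"
  and "A w (w - z) - A z (w - z) = (LINT x|M. (flux1 w x - flux1 z x) \<bullet> (wg (fst w) x - wg (fst z) x)) +
   (LINT x|M. (flux2 w x - flux2 z x) \<bullet> (wg (snd w) x - wg (snd z) x))"
proof -
 have key: "integrable M (%x. (F x - G x) \<bullet> (wg u x - wg v x))"
  "(LINT x|M. F x \<bullet> wg (u - v) x) - (LINT x|M. G x \<bullet> wg (u - v) x) = (LINT x|M. (F x - G x) \<bullet> (wg u x - wg v x))"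
  if D: "sobolev_domain \<Omega> p" and uv: "u \<in> W10 p \<Omega>" "v \<in> W10 p \<Omega>" and FG: "F \<in> LpM (p / (p - 1)) M" "G \<in> LpM (p / (p - 1)) M"
  for p u v F G
 proof -
  interpret D: sobolev_domain \<Omega> p by fact
  note d = D.W10_diff[OF uv]
  note L = D.wg_LpM[OF uv(1)] D.wg_LpM[OF uv(2)] D.wg_LpM[OF d(1)]
  have pc: "0 <= p / (p - 1)" using D.p1 by simp
  note FG' = LpM_diff(1)[OF pc FG]
  show i: "integrable M (%x. (F x - G x) \<bullet> (wg u x - wg v x))"
   by (rule Holder_inner(1)[OF D.p1 refl LpM_diff(1)[OF D.p0(1) L(1,2)] FG'])
  have "(LINT x|M. F x \<bullet> wg (u - v) x) - (LINT x|M. G x \<bullet> wg (u - v) x) = (LINT x|M. F x \<bullet> wg (u - v) x - G x \<bullet> wg (u - v) x)"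
   by (intro Bochner_Integration.integral_diff[symmetric] Holder_inner(1)[OF D.p1 refl L(3)] FG)
  also have "\<dots> = (LINT x|M. (F x - G x) \<bullet> (wg u x - wg v x))"
  proof (rule integral_cong_AE)
   show "(%x. F x \<bullet> wg (u - v) x - G x \<bullet> wg (u - v) x) \<in> borel_measurable M"
    using LpM_measurable[OF FG(1)] LpM_measurable[OF FG(2)] LpM_measurable[OF L(3)] by auto
   show "AE x in M. F x \<bullet> wg (u - v) x - G x \<bullet> wg (u - v) x = (F x - G x) \<bullet> (wg u x - wg v x)"
    using d(2) by eventually_elim (simp add: inner_diff_left)
  qed (use i in auto)
  finally show "(LINT x|M. F x \<bullet> wg (u - v) x) - (LINT x|M. G x \<bullet> wg (u - v) x) = (LINT x|M. (F x - G x) \<bullet> (wg u x - wg v x))" .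
 qed
 note k1 = key[OF D1.sobolev_domain_axioms X_components(1)[OF w] X_components(1)[OF z] flux1_LpM[OF w] flux1_LpM[OF z]]
 note k2 = key[OF D2.sobolev_domain_axioms X_components(2)[OF w] X_components(2)[OF z] flux2_LpM[OF w] flux2_LpM[OF z]]
 show "integrable M (%x. (flux1 w x - flux1 z x) \<bullet> (wg (fst w) x - wg (fst z) x))" by (rule k1(1))
 show "integrable M (%x. (flux2 w x - flux2 z x) \<bullet> (wg (snd w) x - wg (snd z) x))" by (rule k2(1))
 show "A w (w - z) - A z (w - z) = (LINT x|M. (flux1 w x - flux1 z x) \<bullet> (wg (fst w) x - wg (fst z) x)) +
   (LINT x|M. (flux2 w x - flux2 z x) \<bullet> (wg (snd w) x - wg (snd z) x))"
  unfolding k1(2)[symmetric] k2(2)[symmetric] A_eq by (simp add: grad_functional_def case_prod_beta)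
qed

text \<open>
 Two successive subsequences of the Galerkin solutions make both components converge weakly. As \<open>S (w n)\<close> is
 uniformly bounded on \<open>X\<close>, its convergence to 0 on a dense sequence extends to \<open>X\<close>. The last pairing tends to
 0 since \<open>S (w n) (w n - z) = - S (w n) z\<close>, while the lower order terms vanish by Rellich's theorem.
\<close>

lemma approximate_solutions:
 obtains w z B where "\<And>n::nat. w n \<in> XB B" "z \<in> X" "weakly_converges X N w z"
  "\<And>h. h \<in> X ==> (%n. S (w n) h) ----> 0" "(%n. A (w n) (w n - z)) ----> 0"
  "(%n. LINT x|M. \<bar>fst (w n) x - fst z x\<bar>) ----> 0" "(%n. LINT x|M. \<bar>snd (w n) x - snd z x\<bar>) ----> 0"
proof -
 obtain a where a: "\<And>k::nat. a k \<in> W10 p1 \<Omega>" "\<And>u e. u \<in> W10 p1 \<Omega> ==> 0 < e ==> \<exists>k. W10_norm p1 \<Omega> (u - a k) < e"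
  by (rule D1.W10_separable) (rule that)
 obtain b where b: "\<And>k::nat. b k \<in> W10 p2 \<Omega>" "\<And>u e. u \<in> W10 p2 \<Omega> ==> 0 < e ==> \<exists>k. W10_norm p2 \<Omega> (u - b k) < e"
  by (rule D2.W10_separable) (rule that)
 define d where "d k = (a (fst (prod_decode k)), b (snd (prod_decode k)))" for k
 have dX: "d k \<in> X" for k using a b by (simp add: d_def X_iff)
 have dense: "\<exists>k. N (h - d k) < e" if h: "h \<in> X" and e: "0 < e" for h e
 proof -
  obtain i where i: "W10_norm p1 \<Omega> (fst h - a i) < e / 2" using a(2)[OF X_components(1)[OF h], of "e / 2"] e by auto
  obtain j where j: "W10_norm p2 \<Omega> (snd h - b j) < e / 2" using b(2)[OF X_components(2)[OF h], of "e / 2"] e by auto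
  have hd: "h - d (prod_encode (i, j)) = (fst h - a i, snd h - b j)" by (simp add: d_def minus_prod_def)
  have "N (h - d (prod_encode (i, j))) < e / 2 + e / 2" unfolding hd N_eq by (rule add_strict_mono[OF i j])
  then show ?thesis by (auto simp only: field_sum_of_halves)
 qed
 obtain w0 B where w0: "\<And>n. w0 n \<in> XB B" "\<And>n::nat. S (w0 n) (w0 n) = 0" "\<And>n k. k < n ==> S (w0 n) (d k) = 0"
  by (rule galerkin[OF dX]) (rule that)
 have w0X: "w0 n \<in> X" and w0B: "Ip p1 M (wg (fst (w0 n))) <= B" "Ip p2 M (wg (snd (w0 n))) <= B" for n
  using w0(1)[of n] by (auto simp: XB_def)
 obtain \<rho> u where \<rho>: "strict_mono (\<rho> :: nat => nat)" and u: "u \<in> W10 p1 \<Omega>"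
  and wu: "\<And>G. G \<in> LpM pc1 M ==> (%n. LINT x|M. G x \<bullet> wg (fst (w0 (\<rho> n))) x) ----> (LINT x|M. G x \<bullet> wg u x)"
  by (rule D1.W10_weak_compact[of "%n. fst (w0 n)", OF X_components(1)[OF w0X] w0B(1)]) (rule that)
 obtain \<tau> v where \<tau>: "strict_mono (\<tau> :: nat => nat)" and v: "v \<in> W10 p2 \<Omega>"
  and wv: "\<And>G. G \<in> LpM pc2 M ==> (%n. LINT x|M. G x \<bullet> wg (snd (w0 (\<rho> (\<tau> n)))) x) ----> (LINT x|M. G x \<bullet> wg v x)"
  by (rule D2.W10_weak_compact[of "%n. snd (w0 (\<rho> n))", OF X_components(2)[OF w0X] w0B(2)]) (rule that)
 define w where "w n = w0 (\<rho> (\<tau> n))" for n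
 define z where "z = (u, v)"
 have zX: "z \<in> X" using u v by (simp add: z_def X_iff)
 have wB: "w n \<in> XB B" for n unfolding w_def by (rule w0)
 have wX: "w n \<in> X" for n unfolding w_def by (rule w0X)
 have l1: "(%n. LINT x|M. G x \<bullet> wg (fst (w n)) x) ----> (LINT x|M. G x \<bullet> wg u x)" if "G \<in> LpM pc1 M" for G
  using LIMSEQ_subseq_LIMSEQ[OF wu[OF that] \<tau>] by (simp add: comp_def w_def)
 have l2: "(%n. LINT x|M. G x \<bullet> wg (snd (w n)) x) ----> (LINT x|M. G x \<bullet> wg v x)" if "G \<in> LpM pc2 M" for G
  using wv[OF that] by (simp add: w_def)
 have weak: "weakly_converges X N w z"
  using weakly_converges_X[of "%n. fst (w n)" "%n. snd (w n)" u v] wX zX l1 l2 by (simp add: z_def)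
 obtain C where C: "0 <= C" "\<And>w h. w \<in> XB B ==> h \<in> X ==> \<bar>S w h\<bar> <= C * N h" by (rule S_bounded) (rule that)
 have S0: "(%n. S (w n) h) ----> 0" if h: "h \<in> X" for h
 proof (rule LIMSEQ_I)
  fix e :: real assume e: "0 < e"
  obtain k where k: "N (h - d k) < e / (C + 1)" using dense[OF h, of "e / (C + 1)"] e C(1) by auto
  have hd: "h - d k \<in> X" by (rule subspace_diff[OF subspace_X h dX])
  have "norm (S (w n) h - 0) < e" if n: "Suc k <= n" for n
  proof -
   have "k < \<rho> (\<tau> n)" using n seq_suble[OF \<rho>, of "\<tau> n"] seq_suble[OF \<tau>, of n] by linarith
   then have "S (w n) (d k) = 0" unfolding w_def by (rule w0)
   moreover have "S (w n) h = S (w n) (h - d k) + S (w n) (d k)"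
    using dual_spaceD(1)[OF S_dual[OF wX[of n]] hd dX[of k]] by simp
   ultimately have "\<bar>S (w n) h\<bar> <= C * N (h - d k)" using C(2)[OF wB hd] by simp
   also have "\<dots> <= C * (e / (C + 1))" using k C(1) by (intro mult_left_mono) auto
   also have "\<dots> < e" using e C(1) by (simp add: field_simps)
   finally show ?thesis by simp
  qed
  then show "\<exists>n0. \<forall>n\<ge>n0. norm (S (w n) h - 0) < e" by blast
 qed
 have IB: "Ip p1 M (wg (fst (w n))) <= B" "Ip p2 M (wg (snd (w n))) <= B" for n using wB[of n] by (auto simp: XB_def)
 note R1 = D1.W10_Rellich[of "%n. fst (w n)", OF X_components(1)[OF wX] u IB(1) l1]
 note R2 = D2.W10_Rellich[of "%n. snd (w n)", OF X_components(2)[OF wX] v IB(2) l2]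
 have wz: "w n - z \<in> X" for n by (rule subspace_diff[OF subspace_X wX zX])
 have f1: "fst (w n - z) = (%x. fst (w n) x - u x)" and f2: "snd (w n - z) = (%x. snd (w n) x - v x)" for n
  by (simp_all add: z_def fun_eq_iff)
 have n1: "(%n. LINT x|M. N1.nemytskii (w n) x * fst (w n - z) x) ----> 0"
  by (rule N1.nemytskii_vanishing[OF wB N1.test_LpM_rs(1)[OF X_components(1)[OF wz]] N1.test_LpM_rs(2)[OF X_components(1)[OF wz]]])
   (unfold f1, (rule R1(2), use N1.r N1.s in \<open>simp_all add: D1.ps_def\<close>)+)
 have n2: "(%n. LINT x|M. N2.nemytskii (w n) x * snd (w n - z) x) ----> 0"
  by (rule N2.nemytskii_vanishing[OF wB N2.test_LpM_rs(1)[OF X_components(2)[OF wz]] N2.test_LpM_rs(2)[OF X_components(2)[OF wz]]])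
   (unfold f2, (rule R2(2), use N2.r N2.s in \<open>simp_all add: D2.ps_def\<close>)+)
 have Aw: "A (w n) (w n - z) = (LINT x|M. N1.nemytskii (w n) x * fst (w n - z) x) + (LINT x|M. N2.nemytskii (w n) x * snd (w n - z) x) - S (w n) z" for n
 proof -
  have "S (w n) (w n) = S (w n) (w n - z) + S (w n) z" using dual_spaceD(1)[OF S_dual[OF wX] wz zX] by simp
  moreover have "S (w n) (w n) = 0" unfolding w_def by (rule w0)
  ultimately show ?thesis unfolding S_eq[of "w n" "w n - z"] by linarith
 qed
 have "(%n. A (w n) (w n - z)) ----> 0 + 0 - 0" unfolding Aw by (intro tendsto_intros n1 n2 S0 zX)
 then have A0: "(%n. A (w n) (w n - z)) ----> 0" by simp
 show ?thesis using that[OF wB zX weak S0 A0] R1(1) R2(1) by (simp add: z_def)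
qed

text \<open>
 The integrands \<open>P\<close> and \<open>Q\<close> of the monotone principal part are nonnegative with integrals tending to 0, so
 a subsequence tends to 0 almost everywhere, and by strict monotonicity the gradients converge there. The sum
 \<open>T\<close> makes one subsequence serve both gradients and both functions.
\<close>

lemma weak_solution_limit:
 assumes \<mu>: "\<mu>1 <= 0" "\<mu>2 <= 0"
  and w: "\<And>n::nat. w n \<in> XB B" and z: "z \<in> X" and weak: "weakly_converges X N w z"
  and S0: "\<And>h. h \<in> X ==> (%n. S (w n) h) ----> 0" and A0: "(%n. A (w n) (w n - z)) ----> 0"
  and L: "(%n. LINT x|M. \<bar>fst (w n) x - fst z x\<bar>) ----> 0" "(%n. LINT x|M. \<bar>snd (w n) x - snd z x\<bar>) ----> 0"
  and h: "h \<in> X"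
 shows "S z h = 0"
proof -
 have wX: "w n \<in> X" for n using w[of n] by (simp add: XB_def)
 define P where "P n x = (flux1 (w n) x - flux1 z x) \<bullet> (wg (fst (w n)) x - wg (fst z) x)" for n x
 define Q where "Q n x = (flux2 (w n) x - flux2 z x) \<bullet> (wg (snd (w n)) x - wg (snd z) x)" for n x
 note d = A_diff_eq[OF wX z, folded P_def Q_def]
 have P: "(duality p1 (wg (fst (w n)) x) - duality p1 (wg (fst z) x)) \<bullet> (wg (fst (w n)) x - wg (fst z) x) <= P n x" for n x
  unfolding P_def by (rule flux_monotone[OF q1(1) \<mu>(1)])
 have Q: "(duality p2 (wg (snd (w n)) x) - duality p2 (wg (snd z) x)) \<bullet> (wg (snd (w n)) x - wg (snd z) x) <= Q n x" for n x
  unfolding Q_def by (rule flux_monotone[OF q2(1) \<mu>(2)])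
 have P0: "0 <= P n x" for n x by (rule order_trans[OF duality_monotone[OF D1.p1] P])
 have Q0: "0 <= Q n x" for n x by (rule order_trans[OF duality_monotone[OF D2.p1] Q])
 define T where "T n x = P n x + Q n x + \<bar>fst (w n) x - fst z x\<bar> + \<bar>snd (w n) x - snd z x\<bar>" for n x
 have T0: "0 <= T n x" for n x using P0[of n x] Q0[of n x] by (simp add: T_def)
 have iu: "integrable M (%x. \<bar>fst (w n) x - fst z x\<bar>)" "integrable M (%x. \<bar>snd (w n) x - snd z x\<bar>)" for n
  using LpM_imp_integrable[OF D1.finite_M D1.p0(3) D1.W10_LpM[OF X_components(1)]]
   LpM_imp_integrable[OF D2.finite_M D2.p0(3) D2.W10_LpM[OF X_components(2)]] wX[of n] z
  by (auto intro!: integrable_abs Bochner_Integration.integrable_diff)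
 have Ti: "integrable M (T n)" for n unfolding T_def by (intro Bochner_Integration.integrable_add d iu)
 have TI: "(LINT x|M. T n x) = (A (w n) (w n - z) - A z (w n - z)) + (LINT x|M. \<bar>fst (w n) x - fst z x\<bar>) + (LINT x|M. \<bar>snd (w n) x - snd z x\<bar>)" for n
  unfolding d(3) T_def using d(1,2)[of n] iu[of n] by (simp add: Bochner_Integration.integral_add)
 have Az: "(%n. A z (w n - z)) ----> 0"
 proof -
  have "A z (w n) = A z (w n - z) + A z z" for n
   using dual_spaceD(1)[OF A_dual[OF z] subspace_diff[OF subspace_X wX z] z] by simp
  then have e: "A z (w n - z) = A z (w n) - A z z" for n by simp
  have "(%n. A z (w n)) ----> A z z" using weak A_dual[OF z] by (simp add: weakly_converges_def)
  then show ?thesis unfolding e by (rule LIM_zero)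
 qed
 have "(%n. LINT x|M. T n x) ----> (0 - 0) + 0 + 0" unfolding TI by (intro tendsto_intros A0 Az L)
 then have "(%n. LINT x|M. norm (T n x)) ----> 0" using T0 by simp
 then obtain \<rho> where \<rho>: "strict_mono (\<rho> :: nat => nat)" "AE x in M. (%n. T (\<rho> n) x) ----> 0"
  using tendsto_L1_AE_subseq[of M T] Ti by blast
 have "(%n. S (w (\<rho> n)) h) ----> S z h"
 proof (rule S_tendsto[OF w z h])
  show "AE x in M. (%n. fst (w (\<rho> n)) x) ----> fst z x"
   using \<rho>(2)
  proof eventually_elim
   case (elim x)
   show ?case by (rule tendsto_if_diff_le[OF _ elim]) (use P0 Q0 in \<open>simp add: T_def add_nonneg_nonneg\<close>)
  qed
  show "AE x in M. (%n. snd (w (\<rho> n)) x) ----> snd z x"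
   using \<rho>(2)
  proof eventually_elim
   case (elim x)
   show ?case by (rule tendsto_if_diff_le[OF _ elim]) (use P0 Q0 in \<open>simp add: T_def add_nonneg_nonneg\<close>)
  qed
  show "AE x in M. (%n. wg (fst (w (\<rho> n))) x) ----> wg (fst z) x"
   using \<rho>(2)
  proof eventually_elim
   case (elim x)
   show ?case
   proof (rule duality_monotone_tendsto[OF D1.p1 tendsto_if_diff_le[OF _ elim]])
    fix n
    show "norm ((duality p1 (wg (fst (w (\<rho> n))) x) - duality p1 (wg (fst z) x)) \<bullet> (wg (fst (w (\<rho> n))) x - wg (fst z) x) - 0) <= T (\<rho> n) x"
     using P[of "\<rho> n" x] Q0[of "\<rho> n" x] duality_monotone[OF D1.p1, of "wg (fst (w (\<rho> n))) x" "wg (fst z) x"] by (simp add: T_def)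
   qed
  qed
  show "AE x in M. (%n. wg (snd (w (\<rho> n))) x) ----> wg (snd z) x"
   using \<rho>(2)
  proof eventually_elim
   case (elim x)
   show ?case
   proof (rule duality_monotone_tendsto[OF D2.p1 tendsto_if_diff_le[OF _ elim]])
    fix n
    show "norm ((duality p2 (wg (snd (w (\<rho> n))) x) - duality p2 (wg (snd z) x)) \<bullet> (wg (snd (w (\<rho> n))) x - wg (snd z) x) - 0) <= T (\<rho> n) x"
     using Q[of "\<rho> n" x] P0[of "\<rho> n" x] duality_monotone[OF D2.p1, of "wg (snd (w (\<rho> n))) x" "wg (snd z) x"] by (simp add: T_def)
   qed
  qed
 qed
 moreover have "(%n. S (w (\<rho> n)) h) ----> 0" using LIMSEQ_subseq_LIMSEQ[OF S0[OF h] \<rho>(1)] by (simp add: comp_def)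
 ultimately show ?thesis by (rule LIMSEQ_unique)
qed

theorem solution_exists:
 "\<exists>u v. strong_generalized_solution \<Omega> p1 p2 q1 q2 \<mu>1 \<mu>2 f1 f2 (u, v) \<and>
   (max \<mu>1 \<mu>2 < 0 \<longrightarrow> weak_solution \<Omega> p1 p2 q1 q2 \<mu>1 \<mu>2 f1 f2 (u, v))"
proof -
 obtain w z B where w: "\<And>n::nat. w n \<in> XB B" "z \<in> X" "weakly_converges X N w z"
  "\<And>h. h \<in> X ==> (%n. S (w n) h) ----> 0" "(%n. A (w n) (w n - z)) ----> 0"
  "(%n. LINT x|M. \<bar>fst (w n) x - fst z x\<bar>) ----> 0" "(%n. LINT x|M. \<bar>snd (w n) x - snd z x\<bar>) ----> 0"
  by (rule approximate_solutions) (rule that)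
 have wX: "w n \<in> X" for n using w(1)[of n] by (simp add: XB_def)
 have "strong_generalized_solution \<Omega> p1 p2 q1 q2 \<mu>1 \<mu>2 f1 f2 z"
  unfolding strong_generalized_solution_def using w(2,3,5) wX weakly_converges_dual_0[OF S_dual[OF wX] w(4)] by blast
 moreover have "weak_solution \<Omega> p1 p2 q1 q2 \<mu>1 \<mu>2 f1 f2 z" if "max \<mu>1 \<mu>2 < 0"
  unfolding weak_solution_def using w(2) weak_solution_limit[OF _ _ w] that by auto
 ultimately show ?thesis by (cases z) blast
qed

end

theorem theorem4p2:
  fixes \<Omega> :: "(real ^ 'n) set"
    and f1 f2 :: "real ^ 'n \<Rightarrow> real \<Rightarrow> real \<Rightarrow> real ^ 'n \<Rightarrow> real ^ 'n \<Rightarrow> real"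
    and \<sigma>1 \<sigma>2 \<gamma>1 \<gamma>2 :: "real ^ 'n \<Rightarrow> real"
    and p1 p2 q1 q2 r1 r2 s1 s2 D1 D2 c1 c2 d1 d2 \<mu>1 \<mu>2 :: real
  assumes "2 \<le> CARD('n)" and "bounded_lipschitz_domain \<Omega>"
    and "1 < q1" "q1 < p1" "p1 < real CARD('n)"
    and "1 < q2" "q2 < p2" "p2 < real CARD('n)"
    and "caratheodory \<Omega> f1" "caratheodory \<Omega> f2"
    and "r1 \<in> {1<..<sobolev_exp CARD('n) p1}" "s1 \<in> {1<..<sobolev_exp CARD('n) p1}"
    and "r2 \<in> {1<..<sobolev_exp CARD('n) p2}" "s2 \<in> {1<..<sobolev_exp CARD('n) p2}"
    and "0 < D1" "0 < D2"
    and "\<sigma>1 \<in> Lp_space (conj_exp s1) \<Omega>" "\<sigma>2 \<in> Lp_space (conj_exp s2) \<Omega>"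
    and "AE x in lebesgue_on \<Omega>. \<forall>s t \<xi> \<nu>. \<bar>f1 x s t \<xi> \<nu>\<bar> \<le>
           D1 * (\<bar>s\<bar> powr (sobolev_exp CARD('n) p1 / conj_exp r1) +
                 \<bar>t\<bar> powr (sobolev_exp CARD('n) p2 / conj_exp r1) +
                 norm \<xi> powr (p1 / conj_exp r1) + norm \<nu> powr (p2 / conj_exp r1)) + \<sigma>1 x"
    and "AE x in lebesgue_on \<Omega>. \<forall>s t \<xi> \<nu>. \<bar>f2 x s t \<xi> \<nu>\<bar> \<le>
           D2 * (\<bar>s\<bar> powr (sobolev_exp CARD('n) p1 / conj_exp r2) +
                 \<bar>t\<bar> powr (sobolev_exp CARD('n) p2 / conj_exp r2) +
                 norm \<xi> powr (p1 / conj_exp r2) + norm \<nu> powr (p2 / conj_exp r2)) + \<sigma>2 x"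
    and "0 < c1" "0 < c2" "0 < d1" "0 < d2"
    and "c1 + c2 + (d1 + d2) * (1 / min (first_eigenvalue p1 \<Omega>) (first_eigenvalue p2 \<Omega>)) < 1"
    and "\<gamma>1 \<in> Lp_space 1 \<Omega>" "\<gamma>2 \<in> Lp_space 1 \<Omega>"
    and "AE x in lebesgue_on \<Omega>. \<forall>s t \<xi> \<nu>. f1 x s t \<xi> \<nu> * s \<le>
           c1 * (norm \<xi> powr p1 + norm \<nu> powr p2) + d1 * (\<bar>s\<bar> powr p1 + \<bar>t\<bar> powr p2) + \<gamma>1 x"
    and "AE x in lebesgue_on \<Omega>. \<forall>s t \<xi> \<nu>. f2 x s t \<xi> \<nu> * t \<le>
           c2 * (norm \<xi> powr p1 + norm \<nu> powr p2) + d2 * (\<bar>s\<bar> powr p1 + \<bar>t\<bar> powr p2) + \<gamma>2 x"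
  shows "\<exists>u v. strong_generalized_solution \<Omega> p1 p2 q1 q2 \<mu>1 \<mu>2 f1 f2 (u, v) \<and>
           (max \<mu>1 \<mu>2 < 0 \<longrightarrow> weak_solution \<Omega> p1 p2 q1 q2 \<mu>1 \<mu>2 f1 f2 (u, v))"
proof -
 note lip = assms(2)[unfolded bounded_lipschitz_domain_def]
 have 1: "sobolev_domain \<Omega> p1" and 2: "sobolev_domain \<Omega> p2"
  using assms(1,3-8) lip by (auto intro!: sobolev_domain.intro)
 interpret sobolev_pair \<Omega> p1 p2 by (intro sobolev_pair.intro 1 2)
 interpret N1: growth \<Omega> p1 p2 p1 f1 r1 s1 D1 \<sigma>1
  by (intro growth.intro growth_axioms.intro sobolev_pair_axioms 1) (use assms in simp_all)
 interpret N2: growth \<Omega> p1 p2 p2 f2 r2 s2 D2 \<sigma>2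
  by (intro growth.intro growth_axioms.intro sobolev_pair_axioms 2) (use assms in simp_all)
 interpret elliptic_system \<Omega> p1 p2 f1 r1 s1 D1 \<sigma>1 f2 r2 s2 D2 \<sigma>2 q1 q2 \<mu>1 \<mu>2 c1 c2 d1 d2 \<gamma>1 \<gamma>2
  by (intro elliptic_system.intro elliptic_system_axioms.intro sobolev_pair_axioms N1.growth_axioms N2.growth_axioms)
   (use assms lip in simp_all)
 show ?thesis by (rule solution_exists)
qed

end
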